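(* There is an algorithm (a refinement of Algorithm 1 below, obtained by choosing a specific order of the recursive calls together with prescribed first and last ideals for each call, followed by deamortization) that enumerates all ideals of a finite poset $P$ on $n$ elements with constant worst-case delay, such that any two consecutively visited ideals differ in at most three elements (their symmetric difference has size at most $3$). It requires $O(n(n+q))$ space and $O(n(n+q))$ time for initialization, where $q$ is the number of incomparable pairs of $P$.
   Context: An ideal is a downward-closed subset of a poset; an incomparable pair is a 2-element antichain. Algorithm 1 (basic version): input poset given by its comparability matrix, relabeled so that $u\preceq v$ implies $u\le v$. The recursive procedure Enumerate$(P,I)$ does: if $P=\emptyset$, visit $I$; otherwise compute a longest chain $C=\{c_1\prec\cdots\prec c_k\}$ of $P$ and, for each $i\in\{0,\dots,k\}$, call Enumerate$(P_i, I\cup D_i)$, where (with virtual $c_0\prec$ everything $\prec c_{k+1}$) $P_i=\{u\in P: u\not\preceq c_i,\ u\not\succeq c_{i+1}\}$ and $D_i=\{u: u\preceq c_i\}$. Worst-case delay means the maximum time between two consecutive outputs (and before the first output after initialization); outputs are given by a pointer to a data structure modified between outputs, on a RAM. *)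

theory Defs
  imports Main
begin

section \<open>Posets and ideals\<close>

text \<open>A poset on \<open>n\<close> elements has ground set \<open>{0, ..., n - 1}\<close>, labelled along a linear
  extension; this is the labelling that the input of the algorithm is required to have.\<close>

definition labelled_poset :: "nat \<Rightarrow> (nat \<times> nat) set \<Rightarrow> bool" where
  "labelled_poset n r \<longleftrightarrow> partial_order_on {..<n} r \<and> (\<forall>(u, v) \<in> r. u \<le> v)"

definition ideals :: "nat \<Rightarrow> (nat \<times> nat) set \<Rightarrow> nat set set" where
  "ideals n r = {I. I \<subseteq> {..<n} \<and> (\<forall>u v. (u, v) \<in> r \<longrightarrow> v \<in> I \<longrightarrow> u \<in> I)}"

definition incomparable_pairs :: "nat \<Rightarrow> (nat \<times> nat) set \<Rightarrow> nat set set" where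
  "incomparable_pairs n r =
     {{u, v} | u v. u < n \<and> v < n \<and> (u, v) \<notin> r \<and> (v, u) \<notin> r}"


section \<open>The recursive procedure\<close>

definition chain_in :: "(nat \<times> nat) set \<Rightarrow> nat set \<Rightarrow> nat list \<Rightarrow> bool" where
  "chain_in r P cs \<longleftrightarrow> set cs \<subseteq> P \<and> sorted_wrt (\<lambda>u v. (u, v) \<in> r \<and> u \<noteq> v) cs"

definition longest_chain_in :: "(nat \<times> nat) set \<Rightarrow> nat set \<Rightarrow> nat list \<Rightarrow> bool" where
  "longest_chain_in r P cs \<longleftrightarrow>
     chain_in r P cs \<and> (\<forall>ds. chain_in r P ds \<longrightarrow> length ds \<le> length cs)"

text \<open>Lists are indexed from 0, so \<open>c\<^sub>i\<close> is \<open>cs ! (i - 1)\<close> and \<open>c\<^sub>i\<^sub>+\<^sub>1\<close> is \<open>cs ! i\<close>.  The guards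
  on \<open>i\<close> render the virtual elements below and above everything.\<close>

definition sub_poset :: "(nat \<times> nat) set \<Rightarrow> nat set \<Rightarrow> nat list \<Rightarrow> nat \<Rightarrow> nat set" where
  "sub_poset r P cs i =
     {u \<in> P. (0 < i \<longrightarrow> (u, cs ! (i - 1)) \<notin> r) \<and> (i < length cs \<longrightarrow> (cs ! i, u) \<notin> r)}"

definition down_part :: "(nat \<times> nat) set \<Rightarrow> nat list \<Rightarrow> nat \<Rightarrow> nat set" where
  "down_part r cs i = {u. 0 < i \<and> (u, cs ! (i - 1)) \<in> r}"

text \<open>\<open>enumerate_visits r P I Is\<close>: the procedure called on \<open>P\<close> and \<open>I\<close> visits the list
  \<open>Is\<close>, for some choice of the longest chain and some order \<open>js\<close> of the recursive calls
  at every node of the recursion tree.\<close>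

inductive enumerate_visits ::
  "(nat \<times> nat) set \<Rightarrow> nat set \<Rightarrow> nat set \<Rightarrow> nat set list \<Rightarrow> bool" for r where
  visit: "enumerate_visits r {} I [I]"
| recurse: "\<lbrakk>P \<noteq> {}; longest_chain_in r P cs; distinct js; set js = {0..length cs};
     \<forall>i \<in> {0..length cs}.
       enumerate_visits r (sub_poset r P cs i) (I \<union> down_part r cs i) (out i)\<rbrakk>
   \<Longrightarrow> enumerate_visits r P I (concat (map out js))"


section \<open>Random access machines\<close>

text \<open>A unit-cost RAM.  Register names and jump targets are constants of the program, so a
  program uses a constant number of registers; \<open>Load\<close> and \<open>Store\<close> address the memory
  indirectly.  Subtraction is truncated.\<close>

datatype instr =
    Set_Const nat nat
  | Copy nat nat
  | Add nat nat nat
  | Sub nat nat nat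
  | Mult nat nat nat
  | Load nat nat
  | Store nat nat
  | Jump nat
  | Jump_Zero nat nat
  | Jump_Less nat nat nat
  | Output nat
  | Halt

record config =
  pc :: nat
  reg :: "nat \<Rightarrow> nat"
  mem :: "nat \<Rightarrow> nat"

definition current :: "instr list \<Rightarrow> config \<Rightarrow> instr" where
  "current prog s = (if pc s < length prog then prog ! pc s else Halt)"

definition set_reg :: "nat \<Rightarrow> nat \<Rightarrow> config \<Rightarrow> config" where
  "set_reg a x s = s\<lparr>pc := pc s + 1, reg := (reg s)(a := x)\<rparr>"

fun exec :: "instr \<Rightarrow> config \<Rightarrow> config" where
  "exec (Set_Const a k) s = set_reg a k s"
| "exec (Copy a b) s = set_reg a (reg s b) s"
| "exec (Add a b c) s = set_reg a (reg s b + reg s c) s"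
| "exec (Sub a b c) s = set_reg a (reg s b - reg s c) s"
| "exec (Mult a b c) s = set_reg a (reg s b * reg s c) s"
| "exec (Load a b) s = set_reg a (mem s (reg s b)) s"
| "exec (Store a b) s = s\<lparr>pc := pc s + 1, mem := (mem s)(reg s a := reg s b)\<rparr>"
| "exec (Jump l) s = s\<lparr>pc := l\<rparr>"
| "exec (Jump_Zero a l) s = s\<lparr>pc := (if reg s a = 0 then l else pc s + 1)\<rparr>"
| "exec (Jump_Less a b l) s = s\<lparr>pc := (if reg s a < reg s b then l else pc s + 1)\<rparr>"
| "exec (Output a) s = s\<lparr>pc := pc s + 1\<rparr>"
| "exec Halt s = s"

text \<open>The input: register 0 holds \<open>n\<close>, and the first \<open>n * n\<close> memory cells hold the
  comparability matrix row by row.  All other registers and cells are 0.\<close>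

definition initial :: "nat \<Rightarrow> (nat \<times> nat) set \<Rightarrow> config" where
  "initial n r =
     \<lparr>pc = 0,
      reg = (\<lambda>a. if a = 0 then n else 0),
      mem = (\<lambda>a. if a < n * n \<and> (a div n, a mod n) \<in> r then 1 else 0)\<rparr>"

definition config_at :: "instr list \<Rightarrow> nat \<Rightarrow> (nat \<times> nat) set \<Rightarrow> nat \<Rightarrow> config" where
  "config_at prog n r t = ((\<lambda>s. exec (current prog s) s) ^^ t) (initial n r)"

definition halts :: "instr list \<Rightarrow> nat \<Rightarrow> (nat \<times> nat) set \<Rightarrow> bool" where
  "halts prog n r \<longleftrightarrow> (\<exists>t. current prog (config_at prog n r t) = Halt)"

definition output_times :: "instr list \<Rightarrow> nat \<Rightarrow> (nat \<times> nat) set \<Rightarrow> nat set" where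
  "output_times prog n r = {t. \<exists>a. current prog (config_at prog n r t) = Output a}"

text \<open>An output is a pointer to a bit vector of length \<open>n\<close> in memory, the characteristic
  vector of the set that is output.\<close>

definition outputs_set :: "instr list \<Rightarrow> nat \<Rightarrow> config \<Rightarrow> nat set \<Rightarrow> bool" where
  "outputs_set prog n s I \<longleftrightarrow>
     I \<subseteq> {..<n} \<and>
     (\<exists>a. current prog s = Output a \<and>
          (\<forall>u < n. mem s (reg s a + u) = (if u \<in> I then 1 else 0)))"

text \<open>The memory cells accessed by an instruction; an output gives access to the whole
  vector pointed to.\<close>

fun accessed :: "nat \<Rightarrow> instr \<Rightarrow> config \<Rightarrow> nat set" where
  "accessed n (Load a b) s = {reg s b}"
| "accessed n (Store a b) s = {reg s a}"
| "accessed n (Output a) s = {reg s a ..< reg s a + n}"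
| "accessed n _ s = {}"

text \<open>Space is measured by the size of the initial segment of the memory that the
  computation stays within.\<close>

definition space_within :: "instr list \<Rightarrow> nat \<Rightarrow> (nat \<times> nat) set \<Rightarrow> nat \<Rightarrow> bool" where
  "space_within prog n r b \<longleftrightarrow>
     {..<n * n} \<subseteq> {..<b} \<and>
     (\<forall>t. let s = config_at prog n r t in accessed n (current prog s) s \<subseteq> {..<b})"

text \<open>Every register and memory cell always holds a number below \<open>(n + 2) ^ d\<close>, that is,
  a word of \<open>O(log n)\<close> bits.  This is what makes unit cost per instruction legitimate.\<close>

definition words_within :: "instr list \<Rightarrow> nat \<Rightarrow> (nat \<times> nat) set \<Rightarrow> nat \<Rightarrow> bool" where
  "words_within prog n r d \<longleftrightarrow>
     (\<forall>t a. reg (config_at prog n r t) a < (n + 2) ^ d \<and>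
            mem (config_at prog n r t) a < (n + 2) ^ d)"

end

theory Submission
  imports Defs Complex_Main
begin

text \<open>A call is traversed as a walk that toggles single elements, starting from the empty ideal and ending at a
  prescribed one.  Consecutive blocks \<open>P\<^sub>i\<close> differ by one or two chain elements, and each is traversed either upwards
  from its bottom or downwards from its top with the last ideal chosen such that only chain elements have to be toggled
  on the way to the next block; at most three toggles then separate two visits.
  The number of visits pays for the work: weigh an antichain \<open>A\<close> by \<open>5 - |A|\<close> (truncated).  The weight of \<open>P\<close> plus the
  number of antichains with at most five elements that meet the chain is at most the total weight
  of the blocks, and this number dominates \<open>|P|\<close> plus the number of incomparable pairs in \<open>P\<close>, which bounds the time
  a call needs for its longest chain and its blocks.  Hence the time of the traversal stays within a constant per visit,
  up to \<open>O(n(n + q))\<close> on every segment, and a queue of toggles and visits of that capacity turns the amortised bound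
  into a worst-case one.\<close>

section \<open>Splitting a poset along a longest chain\<close>

text \<open>The size five comes from the incomparable pairs that share no incomparable chain
  element. They lie in products of two sets \<open>U i\<close> and \<open>V (Suc i)\<close>, so the
  squares of the sizes of these sets have to be charged to antichains through the chain. When
  \<open>U i\<close> is sorted into antichain levels of sizes s(t), an element of level t is
  incomparable to at least t chain elements, and two applications of Cauchy-Schwarz bound the square
  of the sum of all s(t) by three times the sum of t * s(t)^4. Four elements of a level and one
  chain element make an antichain of at most five elements.

  Three toggles suffice because pending toggles are rationed by direction: a block traversed upwards
  tolerates three on entry and may leave one, a block traversed downwards tolerates two and leaves
  none. Between upward blocks at most two chain elements are toggled, between downward blocks two,
  and at the turn only one.

  A prescribed last ideal cannot be stored for every call. It is always cut out of the block by one
  element of an ancestor's chain, so an element and a bit describe it.\<close>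

lemma partial_orderD:
  assumes "partial_order_on E rho"
  shows "u \<in> E \<Longrightarrow> (u, u) \<in> rho"
    and "(u, v) \<in> rho \<Longrightarrow> (v, w) \<in> rho \<Longrightarrow> (u, w) \<in> rho"
    and "(u, v) \<in> rho \<Longrightarrow> (v, u) \<in> rho \<Longrightarrow> u = v"
  using assms by (auto simp: partial_order_on_def preorder_on_def refl_on_def antisym_def elim: transE)

lemma chain_in_rev: "chain_in (rho\<inverse>) P (rev cs) = chain_in rho P cs"
proof -
  have "(\<lambda>u v. (u, v) \<in> rho \<and> v \<noteq> u) = (\<lambda>u v. (u, v) \<in> rho \<and> u \<noteq> v)" by auto
  then show ?thesis by (simp add: chain_in_def sorted_wrt_rev)
qed

lemma longest_chain_in_rev:
  assumes "longest_chain_in rho P cs"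
  shows "longest_chain_in (rho\<inverse>) P (rev cs)"
  unfolding longest_chain_in_def
proof (intro conjI allI impI)
  show "chain_in (rho\<inverse>) P (rev cs)"
    using assms by (simp add: chain_in_rev longest_chain_in_def)
  fix ds assume "chain_in (rho\<inverse>) P ds"
  then have "chain_in rho P (rev ds)"
    using chain_in_rev[of rho P "rev ds"] by simp
  then show "length ds \<le> length (rev cs)"
    using assms by (fastforce simp: longest_chain_in_def)
qed

locale chain_split =
  fixes rho :: "(nat \<times> nat) set" and E P :: "nat set" and cs :: "nat list"
  assumes po: "partial_order_on E rho"
    and sub: "P \<subseteq> E"
    and fin: "finite P"
    and ne: "P \<noteq> {}"
    and longest: "longest_chain_in rho P cs"
begin

abbreviation k where "k \<equiv> length cs"
abbreviation c where "c i \<equiv> cs ! (i - Suc 0)"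
abbreviation C where "C \<equiv> set cs"
abbreviation B where "B i \<equiv> sub_poset rho P cs i"
abbreviation D where "D i \<equiv> P \<inter> down_part rho cs i"

lemmas refl = partial_orderD(1)[OF po subsetD[OF sub]]
lemmas trans = partial_orderD(2)[OF po]
lemmas antisym = partial_orderD(3)[OF po]

lemma chain: "chain_in rho P cs"
  using longest by (simp add: longest_chain_in_def)

lemma k_pos: "1 \<le> k"
proof -
  obtain u where "u \<in> P" using ne by auto
  then have "chain_in rho P [u]" by (simp add: chain_in_def)
  then show ?thesis using longest by (fastforce simp: longest_chain_in_def)
qed

lemma c_in: "1 \<le> i \<Longrightarrow> i \<le> k \<Longrightarrow> c i \<in> P"
  using chain by (auto simp: chain_in_def)

lemma C_sub: "C \<subseteq> P"
  using chain by (auto simp: chain_in_def)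

lemma C_index: "u \<in> C \<Longrightarrow> \<exists>i. 1 \<le> i \<and> i \<le> k \<and> u = c i"
  by (metis One_nat_def Suc_leI diff_Suc_1 in_set_conv_nth le_add1 plus_1_eq_Suc)

lemma c_mem: "1 \<le> i \<Longrightarrow> i \<le> k \<Longrightarrow> c i \<in> C"
  by simp

lemma c_less: "1 \<le> i \<Longrightarrow> i < j \<Longrightarrow> j \<le> k \<Longrightarrow> (c i, c j) \<in> rho \<and> c i \<noteq> c j"
  using chain by (auto simp: chain_in_def sorted_wrt_iff_nth_less)

lemma c_le_iff: "1 \<le> i \<Longrightarrow> i \<le> k \<Longrightarrow> 1 \<le> j \<Longrightarrow> j \<le> k \<Longrightarrow> (c i, c j) \<in> rho \<longleftrightarrow> i \<le> j"
  by (metis antisym c_in c_less leI le_neq_implies_less refl)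

lemma c_inj: "1 \<le> i \<Longrightarrow> i \<le> k \<Longrightarrow> 1 \<le> j \<Longrightarrow> j \<le> k \<Longrightarrow> c i = c j \<longleftrightarrow> i = j"
  by (metis c_less linorder_neqE_nat)

lemma distinct_cs: "distinct cs"
proof -
  have "cs ! i \<noteq> cs ! j" if "i < k" "j < k" "i \<noteq> j" for i j
    using c_inj[of "Suc i" "Suc j"] that by simp
  then show ?thesis by (simp add: distinct_conv_nth)
qed

text \<open>In a longest chain, the segment \<open>c (a + 1)\<close>, ..., \<open>c i\<close> may be
  exchanged for any chain \<open>xs\<close> that fits strictly between \<open>c a\<close> and
  \<open>c (Suc i)\<close>. Maximality then bounds \<open>length xs\<close> by \<open>i - a\<close>.
  The guards drop the virtual end points.\<close>

lemma chain_swap: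
  assumes xs: "chain_in rho P xs" and ai: "a \<le> i" "i \<le> k"
    and lo: "\<And>x. x \<in> set xs \<Longrightarrow> 1 \<le> a \<Longrightarrow> (c a, x) \<in> rho \<and> c a \<noteq> x"
    and hi: "\<And>x. x \<in> set xs \<Longrightarrow> i < k \<Longrightarrow> (x, c (Suc i)) \<in> rho \<and> x \<noteq> c (Suc i)"
  shows "a + length xs \<le> i"
proof -
  have take_idx: "\<exists>j. j < a \<and> j < k \<and> y = cs ! j" if "y \<in> set (take a cs)" for y
    using that by (fastforce simp: in_set_conv_nth)
  have drop_idx: "\<exists>j. i \<le> j \<and> j < k \<and> y = cs ! j" if y: "y \<in> set (drop i cs)" for y
  proof -
    obtain j where "j < k - i" "drop i cs ! j = y"
      using y unfolding in_set_conv_nth length_drop by blast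
    then show ?thesis using ai by (intro exI[of _ "i + j"]) auto
  qed
  have lower: "(y, x) \<in> rho \<and> y \<noteq> x" if y: "y \<in> set (take a cs)" and x: "x \<in> set xs" for x y
  proof -
    obtain j where j: "j < a" "j < k" "y = cs ! j"
      using take_idx[OF y] by blast
    then have "(y, c a) \<in> rho" using c_le_iff[of "Suc j" a] ai by auto
    moreover have "(c a, x) \<in> rho \<and> c a \<noteq> x" using lo[OF x] j by auto
    ultimately show ?thesis using trans antisym by blast
  qed
  have upper: "(x, y) \<in> rho \<and> x \<noteq> y" if y: "y \<in> set (drop i cs)" and x: "x \<in> set xs" for x y
  proof -
    obtain j where j: "i \<le> j" "j < k" "y = cs ! j"
      using drop_idx[OF y] by blast
    then have "(c (Suc i), y) \<in> rho" using c_le_iff[of "Suc i" "Suc j"] ai by auto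
    moreover have "(x, c (Suc i)) \<in> rho \<and> x \<noteq> c (Suc i)" using hi[OF x] j by auto
    ultimately show ?thesis using trans antisym by blast
  qed
  have outer: "(y, z) \<in> rho \<and> y \<noteq> z" if y: "y \<in> set (take a cs)" and z: "z \<in> set (drop i cs)" for y z
  proof -
    obtain j where j: "j < a" "j < k" "y = cs ! j"
      using take_idx[OF y] by blast
    obtain j' where j': "i \<le> j'" "j' < k" "z = cs ! j'"
      using drop_idx[OF z] by blast
    show ?thesis using c_less[of "Suc j" "Suc j'"] j j' ai by auto
  qed
  have "chain_in rho P (take a cs @ xs @ drop i cs)"
    unfolding chain_in_def sorted_wrt_append set_append
    using chain xs lower upper outer set_take_subset[of a cs] set_drop_subset[of i cs]
    by (simp add: chain_in_def sorted_wrt_take sorted_wrt_drop) blast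
  then have "length (take a cs @ xs @ drop i cs) \<le> k"
    using longest unfolding longest_chain_in_def by blast
  then show ?thesis using ai by simp
qed

text \<open>The exchange for the empty segment \<open>a = i\<close>: nothing can be inserted into a
  longest chain.\<close>

lemma between_absurd:
  assumes "u \<in> P" "i \<le> k" "1 \<le> i \<Longrightarrow> (c i, u) \<in> rho \<and> c i \<noteq> u"
    "i < k \<Longrightarrow> (u, c (Suc i)) \<in> rho \<and> u \<noteq> c (Suc i)"
  shows False
  using chain_swap[of "[u]" i i] assms by (auto simp: chain_in_def)

lemma between:
  assumes "1 \<le> i" "i < k" "(c i, u) \<in> rho" "(u, c (Suc i)) \<in> rho" "u \<in> P"
  shows "u = c i \<or> u = c (Suc i)"
  using between_absurd[of u i] assms by auto

lemma below_first: "u \<in> P \<Longrightarrow> (u, c 1) \<in> rho \<Longrightarrow> u = c 1"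
  using between_absurd[of u 0] k_pos by auto

lemma above_last: "u \<in> P \<Longrightarrow> (c k, u) \<in> rho \<Longrightarrow> u = c k"
  using between_absurd[of u k] k_pos by auto

text \<open>\<open>b\<close> is the last index with \<open>c b\<close> in \<open>T\<close>, or 0.
  Since \<open>T\<close> is arbitrary, it can be an ideal, the set of elements below a given one, or
  the set of elements not above it.\<close>

lemma cut:
  obtains b where "b \<le> k" "1 \<le> b \<Longrightarrow> c b \<in> T" "b < k \<Longrightarrow> c (Suc b) \<notin> T"
    "\<And>j. b < j \<Longrightarrow> j \<le> k \<Longrightarrow> c j \<notin> T"
proof -
  let ?S = "insert 0 {j. 1 \<le> j \<and> j \<le> k \<and> c j \<in> T}"
  have fin: "finite ?S" by simp
  define b where "b = Max ?S"
  have b: "b \<in> ?S" unfolding b_def using fin by (intro Max_in) auto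
  have ge: "j \<le> b" if "j \<in> ?S" for j unfolding b_def using that fin by (intro Max_ge) auto
  show ?thesis
  proof (rule that[of b])
    show "b \<le> k" "1 \<le> b \<Longrightarrow> c b \<in> T" using b by auto
    show "c (Suc b) \<notin> T" if "b < k" using ge[of "Suc b"] that by auto
    show "c j \<notin> T" if "b < j" "j \<le> k" for j using ge[of j] that by auto
  qed
qed

lemma incomparable_chain_element:
  assumes "u \<in> P" "u \<notin> C"
  shows "\<exists>v\<in>C. (u, v) \<notin> rho \<and> (v, u) \<notin> rho"
proof (rule ccontr)
  assume a: "\<not> ?thesis"
  obtain b where b: "b \<le> k" "1 \<le> b \<Longrightarrow> c b \<in> {v. (v, u) \<in> rho}"
    "b < k \<Longrightarrow> c (Suc b) \<notin> {v. (v, u) \<in> rho}" using cut[of "{v. (v, u) \<in> rho}"] by metis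
  show False
  proof (rule between_absurd[OF assms(1) b(1)])
    show "1 \<le> b \<Longrightarrow> (c b, u) \<in> rho \<and> c b \<noteq> u" using b(1,2) assms c_mem by blast
    assume "b < k"
    then have "c (Suc b) \<in> C" "(c (Suc b), u) \<notin> rho" using b(3) by auto
    then show "(u, c (Suc b)) \<in> rho \<and> u \<noteq> c (Suc b)" using a assms(2) by blast
  qed
qed

lemma in_B: "i \<le> k \<Longrightarrow> u \<in> B i \<longleftrightarrow>
    u \<in> P \<and> (1 \<le> i \<longrightarrow> (u, c i) \<notin> rho) \<and> (i < k \<longrightarrow> (c (Suc i), u) \<notin> rho)"
  by (auto simp: sub_poset_def)

lemma in_down: "u \<in> down_part rho cs i \<longleftrightarrow> 1 \<le> i \<and> (u, c i) \<in> rho"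
  by (auto simp: down_part_def)

lemma B_sub: "B i \<subseteq> P"
  by (auto simp: sub_poset_def)

lemma B_C: "i \<le> k \<Longrightarrow> B i \<inter> C = {}"
proof -
  assume i: "i \<le> k"
  have "c j \<notin> B i" if j: "1 \<le> j" "j \<le> k" for j
    using c_le_iff[of j i] c_le_iff[of "Suc i" j] j i by (cases "j \<le> i") (auto simp: in_B)
  then show ?thesis using C_index by blast
qed

lemma B_psub: "i \<le> k \<Longrightarrow> B i \<subset> P"
  using B_sub B_C c_in[of 1] c_mem[of 1] k_pos by blast

lemma D_B: "i \<le> k \<Longrightarrow> D i \<inter> B i = {}"
  by (auto simp: in_B in_down)

text \<open>This is the full set of block \<open>i\<close>, the largest one visited there. The
  right-hand side does not mention \<open>c i\<close>, which makes it the complement of a down part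
  of the reversed chain.\<close>

lemma D_un_B: "i \<le> k \<Longrightarrow> D i \<union> B i = {u \<in> P. i < k \<longrightarrow> (c (Suc i), u) \<notin> rho}"
proof (intro set_eqI iffI)
  fix u assume a: "i \<le> k" "u \<in> D i \<union> B i"
  have "(c (Suc i), u) \<notin> rho" if "i < k"
  proof
    assume l: "(c (Suc i), u) \<in> rho"
    then have "1 \<le> i" "(u, c i) \<in> rho" using a that by (auto simp: in_B in_down)
    then have "(c (Suc i), c i) \<in> rho" using l trans by blast
    then show False using c_le_iff[of "Suc i" i] that \<open>1 \<le> i\<close> by simp
  qed
  then show "u \<in> {u \<in> P. i < k \<longrightarrow> (c (Suc i), u) \<notin> rho}" using a B_sub by auto
next
  fix u assume a: "i \<le> k" "u \<in> {u \<in> P. i < k \<longrightarrow> (c (Suc i), u) \<notin> rho}"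
  then show "u \<in> D i \<union> B i" by (simp add: in_B[OF a(1)] in_down)
qed

end

section \<open>Ideals and the lists that visit them\<close>

definition order_ideals :: "(nat \<times> nat) set \<Rightarrow> nat set \<Rightarrow> nat set set" where
  "order_ideals rho P = {T. T \<subseteq> P \<and> (\<forall>u v. u \<in> P \<longrightarrow> v \<in> T \<longrightarrow> (u, v) \<in> rho \<longrightarrow> u \<in> T)}"

text \<open>As \<open>enumerate_visits\<close>, but a call visits subsets of its own poset only: the part \<open>I\<close> of the
  ideal that is fixed by the calls above is left out.  This makes the relation self-dual.\<close>

inductive visits :: "(nat \<times> nat) set \<Rightarrow> nat set \<Rightarrow> nat set list \<Rightarrow> bool" for rho where
  visits_empty: "visits rho {} [{}]"
| visits_node: "\<lbrakk>P \<noteq> {}; longest_chain_in rho P cs; distinct js; set js = {0..length cs};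
     \<forall>i \<in> {0..length cs}. visits rho (sub_poset rho P cs i) (out i)\<rbrakk>
   \<Longrightarrow> visits rho P (concat (map (\<lambda>i. map ((\<union>) (P \<inter> down_part rho cs i)) (out i)) js))"

text \<open>An ideal \<open>T\<close> belongs to the block of the last chain element it contains and
  to no other. There it is the fixed part \<open>D b\<close> together with the ideal
  \<open>T \<inter> B b\<close> of the block, so the blocks partition the ideals and induction
  applies to each.\<close>

lemma visits_ideals:
  assumes "visits rho P Ts" "partial_order_on E rho" "P \<subseteq> E" "finite P"
  shows "distinct Ts \<and> set Ts = order_ideals rho P"
  using assms
proof (induction rule: visits.induct)
  case visits_empty
  then show ?case by (auto simp: order_ideals_def)
next
  case (visits_node P cs js out)
  interpret chain_split rho E P cs
    using visits_node.prems visits_node.hyps(1,2) by (simp add: chain_split_def)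
  have sub_id: "distinct (out i)" "set (out i) = order_ideals rho (B i)" if "i \<le> k" for i
  proof -
    have "B i \<subseteq> E" "finite (B i)" using B_sub[of i] sub fin finite_subset by auto
    then have "distinct (out i) \<and> set (out i) = order_ideals rho (B i)"
      using visits_node.IH po that by simp
    then show "distinct (out i)" "set (out i) = order_ideals rho (B i)" by auto
  qed
  have block: "T \<inter> (D i \<union> B i) = T" "D i \<union> T \<subseteq> D i \<union> B i" if "T \<in> order_ideals rho (B i)" for i T
    using that by (auto simp: order_ideals_def)
  have ideal: "D i \<union> T \<in> order_ideals rho P" if i: "i \<le> k" and T: "T \<in> order_ideals rho (B i)" for i T
  proof -
    have "u \<in> D i \<union> T" if "u \<in> P" "v \<in> D i \<union> T" "(u, v) \<in> rho" for u v
    proof (cases "v \<in> D i")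
      case True then show ?thesis using that i trans by (auto simp: down_part_def)
    next
      case False
      then have v: "v \<in> T" "v \<in> B i" using that T by (auto simp: order_ideals_def)
      show ?thesis
      proof (cases "u \<in> B i")
        case True then show ?thesis using T v that unfolding order_ideals_def by blast
      next
        case False
        moreover have "i < k \<longrightarrow> (c (Suc i), u) \<notin> rho"
          using v that trans by (auto simp: sub_poset_def)
        ultimately show ?thesis using that i by (auto simp: in_B in_down)
      qed
    qed
    moreover have "T \<subseteq> P" using T B_sub[of i] by (auto simp: order_ideals_def)
    ultimately show ?thesis by (auto simp: order_ideals_def)
  qed
  have which: "i = j" if "i \<le> k" "j \<le> k" "D i \<union> T = D j \<union> T'" "T \<in> order_ideals rho (B i)"
    "T' \<in> order_ideals rho (B j)" for i j T T'
  proof -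
    have key: "\<not> i < j" if a: "i \<le> k" "j \<le> k" "D i \<union> T = D j \<union> T'"
      "T \<in> order_ideals rho (B i)" "T' \<in> order_ideals rho (B j)" for i j T T'
    proof
      assume l: "i < j"
      \<comment> \<open>\<open>c (Suc i)\<close> separates block \<open>i\<close> from every later
        block: it belongs to all sets visited there and to none of block \<open>i\<close>.\<close>
      then have "c (Suc i) \<in> D j" using a c_le_iff[of "Suc i" j] c_in[of "Suc i"] by (auto simp: in_down)
      then have "c (Suc i) \<in> D i \<union> B i" using a block(2)[of T i] by auto
      then show False using D_un_B[OF a(1)] l a(2) c_in[of "Suc i"] refl by auto
    qed
    show ?thesis using key[of i j T T'] key[of j i T' T] that by auto
  qed
  have inj: "inj_on ((\<union>) (D i)) (set (out i))" if i: "i \<le> k" for i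
  proof (rule inj_onI)
    fix T T' assume a: "T \<in> set (out i)" "T' \<in> set (out i)" "D i \<union> T = D i \<union> T'"
    then have "T \<subseteq> B i" "T' \<subseteq> B i" using sub_id(2)[OF i] by (auto simp: order_ideals_def)
    then show "T = T'" using a D_B[OF i] by blast
  qed
  have dist: "distinct (concat (map (\<lambda>i. map ((\<union>) (D i)) (out i)) js))"
  proof (rule distinct_concat)
    have "i = j" if "i \<le> k" "j \<le> k" "map ((\<union>) (D i)) (out i) = map ((\<union>) (D j)) (out j)" for i j
    proof -
      have "{} \<in> set (out i)" using sub_id that by (auto simp: order_ideals_def)
      then have "D i \<union> {} \<in> set (map ((\<union>) (D i)) (out i))" by auto
      then have "D i \<union> {} \<in> set (map ((\<union>) (D j)) (out j))" using that by metis
      then obtain T' where "D i \<union> {} = D j \<union> T'" "T' \<in> set (out j)" by auto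
      then show ?thesis using which[of i j "{}" T'] that sub_id[of j] by (auto simp: order_ideals_def)
    qed
    then show "distinct (map (\<lambda>i. map ((\<union>) (D i)) (out i)) js)"
      using visits_node.hyps(3,4) by (subst distinct_map) (auto intro!: inj_onI)
    show "distinct ys" if "ys \<in> set (map (\<lambda>i. map ((\<union>) (D i)) (out i)) js)" for ys
      using that visits_node.hyps(4) sub_id inj by (auto simp: distinct_map)
    fix ys zs
    assume y: "ys \<in> set (map (\<lambda>i. map ((\<union>) (D i)) (out i)) js)"
      and z: "zs \<in> set (map (\<lambda>i. map ((\<union>) (D i)) (out i)) js)" and neq: "ys \<noteq> zs"
    obtain i where i: "i \<le> k" "ys = map ((\<union>) (D i)) (out i)" using y visits_node.hyps(4) by auto
    obtain j where j: "j \<le> k" "zs = map ((\<union>) (D j)) (out j)" using z visits_node.hyps(4) by auto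
    have "i = j" if "X \<in> set ys" "X \<in> set zs" for X
    proof -
      obtain T T' where "X = D i \<union> T" "X = D j \<union> T'" "T \<in> set (out i)" "T' \<in> set (out j)"
        using \<open>X \<in> set ys\<close> \<open>X \<in> set zs\<close> i j by auto
      then show ?thesis using which[of i j T T'] sub_id i j by auto
    qed
    then show "set ys \<inter> set zs = {}" using neq i j by blast
  qed
  have "T \<in> set (concat (map (\<lambda>i. map ((\<union>) (D i)) (out i)) js))" if T: "T \<in> order_ideals rho P" for T
  proof -
    obtain b where b: "b \<le> k" "1 \<le> b \<Longrightarrow> c b \<in> T" "b < k \<Longrightarrow> c (Suc b) \<notin> T"
      using cut[of T] by metis
    have T': "T \<subseteq> P" "\<And>u v. u \<in> P \<Longrightarrow> v \<in> T \<Longrightarrow> (u, v) \<in> rho \<Longrightarrow> u \<in> T"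
      using T by (auto simp: order_ideals_def)
    have "D b \<subseteq> T" using b T' by (auto simp: in_down)
    moreover have "T \<subseteq> D b \<union> B b"
      unfolding D_un_B[OF b(1)] using b T' c_in[of "Suc b"] by auto
    ultimately have "T = D b \<union> (T \<inter> B b)" by auto
    moreover have "T \<inter> B b \<in> order_ideals rho (B b)"
      unfolding order_ideals_def using T'(2) subsetD[OF B_sub[of b]] by blast
    ultimately have "T \<in> (\<union>) (D b) ` set (out b)" using sub_id(2)[OF b(1)] by (metis image_eqI)
    then show ?thesis using visits_node.hyps(4) b(1) by auto
  qed
  then have "set (concat (map (\<lambda>i. map ((\<union>) (D i)) (out i)) js)) = order_ideals rho P"
    using ideal sub_id visits_node.hyps(4) by auto
  then show ?case using dist by simp
qed

text \<open>The third assumption says that everything below \<open>P\<close> is in \<open>P\<close>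
  or already in \<open>I\<close>. Hence the down part of the whole order may be intersected with
  \<open>P\<close> without changing its union with \<open>I\<close>.\<close>

lemma visits_enumerate:
  assumes "visits rho P Ts" "trans rho" "\<And>u v. (u, v) \<in> rho \<Longrightarrow> v \<in> P \<Longrightarrow> u \<in> P \<union> I"
  shows "enumerate_visits rho P I (map ((\<union>) I) Ts)"
  using assms
proof (induction arbitrary: I rule: visits.induct)
  case visits_empty
  then show ?case by (simp add: enumerate_visits.visit)
next
  case (visits_node P cs js out)
  have csP: "set cs \<subseteq> P" using visits_node.hyps by (auto simp: longest_chain_in_def chain_in_def)
  let ?D = "\<lambda>i. down_part rho cs i"
  have I: "I \<union> ?D i = I \<union> (P \<inter> ?D i)" if "i \<le> length cs" for i
    using visits_node.prems(2) that csP nth_mem[of "i - 1" cs] by (fastforce simp: down_part_def)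
  have "enumerate_visits rho (sub_poset rho P cs i) (I \<union> ?D i) (map ((\<union>) (I \<union> ?D i)) (out i))"
    if i: "i \<in> {0..length cs}" for i
  proof -
    have "u \<in> sub_poset rho P cs i \<union> (I \<union> ?D i)" if "(u, v) \<in> rho" "v \<in> sub_poset rho P cs i" for u v
      using that visits_node.prems(2)[of u v] transD[OF visits_node.prems(1), of "cs ! i" u v]
      by (auto simp: sub_poset_def down_part_def)
    with bspec[OF visits_node.IH i] visits_node.prems(1) show ?thesis by simp
  qed
  then have "enumerate_visits rho P I (concat (map (\<lambda>i. map ((\<union>) (I \<union> ?D i)) (out i)) js))"
    by (intro enumerate_visits.recurse[OF visits_node.hyps(1-4)] ballI)
  moreover have "map (\<lambda>i. map ((\<union>) (I \<union> ?D i)) (out i)) js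
      = map (\<lambda>i. map ((\<union>) I) (map ((\<union>) (P \<inter> ?D i)) (out i))) js"
  proof (rule map_cong[OF HOL.refl])
    fix i assume "i \<in> set js"
    then have "i \<le> length cs" using visits_node.hyps(4) by auto
    then show "map ((\<union>) (I \<union> ?D i)) (out i) = map ((\<union>) I) (map ((\<union>) (P \<inter> ?D i)) (out i))"
      using I by (auto simp: Un_assoc)
  qed
  ultimately show ?case by (simp add: map_concat comp_def)
qed

lemma visits_sub: "visits rho P Ts \<Longrightarrow> T \<in> set Ts \<Longrightarrow> T \<subseteq> P"
proof (induction arbitrary: T rule: visits.induct)
  case (visits_node P cs js out)
  then show ?case by (fastforce simp: sub_poset_def)
qed auto

lemma sub_poset_rev:
  assumes "i \<le> length cs"
  shows "sub_poset (rho\<inverse>) P (rev cs) i = sub_poset rho P cs (length cs - i)"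
proof -
  have "0 < i \<Longrightarrow> rev cs ! (i - 1) = cs ! (length cs - i)" using assms by (simp add: rev_nth)
  moreover have "i < length cs \<Longrightarrow> rev cs ! i = cs ! (length cs - i - 1)"
    using assms by (simp add: rev_nth)
  ultimately show ?thesis using assms by (auto simp: sub_poset_def)
qed

text \<open>Reversing the order reverses the chain, exchanges block \<open>i\<close> with block
  \<open>k - i\<close> and turns ideals into their complements. It is what allows a block to be
  traversed downwards by the same procedure, run in the dual order.\<close>

lemma visits_dual:
  assumes "visits (rho\<inverse>) P Ts" "partial_order_on E rho" "P \<subseteq> E" "finite P"
  shows "visits rho P (map (\<lambda>T. P - T) Ts)"
  using assms
proof (induction rule: visits.induct)
  case visits_empty
  then show ?case by (simp add: visits.visits_empty)
next
  case (visits_node P ds js out)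
  define cs where "cs = rev ds"
  have l: "longest_chain_in rho P cs"
    using longest_chain_in_rev[OF visits_node.hyps(2)] by (simp add: cs_def)
  interpret chain_split rho E P cs
    using visits_node.prems visits_node.hyps(1) l by (simp add: chain_split_def)
  have kd: "k = length ds" by (simp add: cs_def)
  have dsc: "ds = rev cs" by (simp add: cs_def)
  let ?out = "\<lambda>i. map (\<lambda>T. B i - T) (out (k - i))"
  have ch: "visits rho (B i) (?out i) \<and> (\<forall>T\<in>set (out (k - i)). T \<subseteq> B i)" if "i \<le> k" for i
  proof -
    have "sub_poset (rho\<inverse>) P ds (k - i) = B i"
      using sub_poset_rev[of "k - i" cs rho P] that by (simp add: dsc)
    moreover have "B i \<subseteq> E" "finite (B i)" using B_sub[of i] sub fin finite_subset by auto
    moreover have "k - i \<in> {0..length ds}" using kd by simp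
    ultimately have "visits (rho\<inverse>) (B i) (out (k - i))" "visits rho (B i) (?out i)"
      using visits_node.IH po by metis+
    then show ?thesis using visits_sub by blast
  qed
  have js: "set (map ((-) k) js) = {0..k}"
  proof -
    have "x \<in> (-) k ` {0..k}" if "x \<le> k" for x
      using that by (intro image_eqI[of _ _ "k - x"]) auto
    then have "(-) k ` {0..k} = {0..k}" by auto
    then show ?thesis using visits_node.hyps(4) kd by simp
  qed
  have "distinct (map ((-) k) js)"
    using visits_node.hyps(3,4) kd by (auto simp: distinct_map intro!: inj_onI)
  from visits.visits_node[OF ne l this js, of ?out] ch
  have v: "visits rho P (concat (map (\<lambda>i. map ((\<union>) (D i)) (?out i)) (map ((-) k) js)))" by auto
  have eq: "map ((\<union>) (D (k - j))) (?out (k - j))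
      = map (\<lambda>T. P - T) (map ((\<union>) (P \<inter> down_part (rho\<inverse>) ds j)) (out j))" if j: "j \<le> k" for j
  proof -
    have D': "P - (P \<inter> down_part (rho\<inverse>) ds j) = D (k - j) \<union> B (k - j)"
    proof -
      have "0 < j \<Longrightarrow> ds ! (j - 1) = cs ! (k - j)" using j by (simp add: dsc rev_nth)
      then have "u \<in> down_part (rho\<inverse>) ds j \<longleftrightarrow> k - j < k \<and> (c (Suc (k - j)), u) \<in> rho" for u
        using j k_pos by (cases "j = 0") (auto simp: down_part_def)
      then show ?thesis unfolding D_un_B[of "k - j", simplified] by auto
    qed
    have "D (k - j) \<union> (B (k - j) - T) = P - ((P \<inter> down_part (rho\<inverse>) ds j) \<union> T)"
      if "T \<in> set (out j)" for T
      using that ch[of "k - j"] j D' D_B[of "k - j"] by auto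
    then show ?thesis using j by simp
  qed
  have mm: "map f (map ((-) k) js) = map (\<lambda>j. f (k - j)) js" for f :: "nat \<Rightarrow> nat set list"
    by simp
  have mm2: "map (\<lambda>i. map ((\<union>) (D i)) (?out i)) (map ((-) k) js)
    = map (\<lambda>i. map (\<lambda>T. P - T) (map ((\<union>) (P \<inter> down_part (rho\<inverse>) ds i)) (out i))) js"
    unfolding mm by (intro map_cong[OF HOL.refl] eq) (use visits_node.hyps(4) kd in auto)
  show ?case using v[unfolded mm2] by (simp add: map_concat comp_def)
qed

section \<open>Amortised analysis\<close>

text \<open>Cauchy-Schwarz in Sedrakyan's form. The nonnegative sum at the start is the weighted
  variance of the quotients \<open>a i / w i\<close> about their mean \<open>S / W\<close>.\<close>

lemma weighted_sum_square_le:
  fixes a w :: "'a \<Rightarrow> real"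
  assumes fin: "finite A" and w: "\<And>i. i \<in> A \<Longrightarrow> 0 < w i"
  shows "(\<Sum>i\<in>A. a i)\<^sup>2 \<le> (\<Sum>i\<in>A. w i) * (\<Sum>i\<in>A. (a i)\<^sup>2 / w i)"
proof (cases "A = {}")
  case False
  define W where "W = (\<Sum>i\<in>A. w i)"
  define S where "S = (\<Sum>i\<in>A. a i)"
  define Q where "Q = (\<Sum>i\<in>A. (a i)\<^sup>2 / w i)"
  have W: "0 < W" unfolding W_def using fin w False by (intro sum_pos) auto
  have "0 \<le> (\<Sum>i\<in>A. w i * (a i / w i - S / W)\<^sup>2)"
    using w by (intro sum_nonneg mult_nonneg_nonneg) (auto intro: less_imp_le)
  also have "\<dots> = (\<Sum>i\<in>A. (a i)\<^sup>2 / w i - 2 * (S / W) * a i + (S / W)\<^sup>2 * w i)"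
  proof (rule sum.cong)
    fix i assume "i \<in> A"
    then have "w i \<noteq> 0" using w by force
    then have "w i * (a i / w i - q)\<^sup>2 = (a i)\<^sup>2 / w i - 2 * q * a i + q\<^sup>2 * w i" for q
      by (simp add: power2_eq_square field_simps)
    then show "w i * (a i / w i - S / W)\<^sup>2 = (a i)\<^sup>2 / w i - 2 * (S / W) * a i + (S / W)\<^sup>2 * w i" .
  qed simp
  also have "\<dots> = Q - 2 * (S / W) * S + (S / W)\<^sup>2 * W"
    unfolding Q_def W_def S_def by (simp add: sum.distrib sum_subtractf sum_distrib_left)
  also have "\<dots> = Q - S\<^sup>2 / W" using W by (simp add: power2_eq_square field_simps)
  finally have "S\<^sup>2 / W \<le> Q" by simp
  then have "S\<^sup>2 \<le> W * Q" using W by (simp add: pos_divide_le_eq mult.commute)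
  then show ?thesis by (simp add: W_def Q_def S_def)
qed simp

text \<open>Each summand is at most twice the increment of the square root, so the sum
  telescopes.\<close>

lemma sum_inverse_sqrt_le: "(\<Sum>t=1..N. 1 / sqrt (real t)) \<le> 2 * sqrt (real N)"
proof (induction N)
  case (Suc N)
  let ?x = "sqrt (real N)" and ?y = "sqrt (real (Suc N))"
  have y: "0 < ?y" "0 \<le> ?x" "?x \<le> ?y" by auto
  have "(?y - ?x) * (?y + ?x) = 1" by (simp add: algebra_simps flip: power2_eq_square)
  moreover have "(?y - ?x) * (?y + ?x) \<le> (?y - ?x) * (2 * ?y)"
    using y by (intro mult_left_mono) auto
  ultimately have "1 \<le> d * (2 * ?y)" if "d = ?y - ?x" for d using that by simp
  then have "1 / ?y \<le> 2 * d" if "d = ?y - ?x" for d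
    unfolding pos_divide_le_eq[OF y(1)] using that by (simp only: ac_simps)
  then have "1 / ?y \<le> 2 * (?y - ?x)" by blast
  then show ?case using Suc by simp
qed simp

text \<open>With \<open>R\<close> as the intermediate sum, Cauchy-Schwarz gives
  \<open>S\<^sup>2 \<le> 2 * sqrt N * R\<close> and \<open>R\<^sup>2 \<le> N * G\<close>. The lower
  bound 1 on the levels gives \<open>N * N \<le> 2 * G\<close>, which removes the number of levels:
  the fourth power of \<open>S\<close> is at most 8 times the square of \<open>G\<close>, and 8 is
  rounded up to 9 to extract the root.\<close>

lemma levels_square_le:
  fixes s :: "nat \<Rightarrow> real"
  assumes s: "\<And>t. 1 \<le> t \<Longrightarrow> t \<le> N \<Longrightarrow> 1 \<le> s t"
  shows "(\<Sum>t=1..N. s t)\<^sup>2 \<le> 3 * (\<Sum>t=1..N. real t * s t ^ 4)"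
proof -
  define S where "S = (\<Sum>t=1..N. s t)"
  define G where "G = (\<Sum>t=1..N. real t * s t ^ 4)"
  define R where "R = (\<Sum>t=1..N. sqrt (real t) * (s t)\<^sup>2)"
  have Rnn: "0 \<le> R" unfolding R_def by (intro sum_nonneg) auto
  have Gnn: "0 \<le> G" unfolding G_def by (intro sum_nonneg) auto
  have "(\<Sum>t=1..N. s t)\<^sup>2 \<le> (\<Sum>t=1..N. 1 / sqrt (real t)) * (\<Sum>t=1..N. (s t)\<^sup>2 / (1 / sqrt (real t)))"
    by (rule weighted_sum_square_le) auto
  also have "(\<Sum>t=1..N. (s t)\<^sup>2 / (1 / sqrt (real t))) = R" unfolding R_def
    by (intro sum.cong) (auto simp: mult.commute)
  also have "(\<Sum>t=1..N. 1 / sqrt (real t)) * R \<le> 2 * sqrt (real N) * R"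
    using Rnn by (intro mult_right_mono sum_inverse_sqrt_le)
  finally have 1: "S\<^sup>2 \<le> 2 * sqrt (real N) * R" by (simp add: S_def)
  have "R\<^sup>2 \<le> (\<Sum>t=1..N. 1) * (\<Sum>t=1..N. (sqrt (real t) * (s t)\<^sup>2)\<^sup>2 / 1)"
    unfolding R_def by (rule weighted_sum_square_le) auto
  also have "\<dots> = real N * G" unfolding G_def by (simp add: power_mult_distrib flip: power_mult)
  finally have 2: "R\<^sup>2 \<le> real N * G" .
  have "real (N * N) \<le> 2 * (\<Sum>t=1..N. real t)"
    using double_gauss_sum_from_Suc_0[of N, where 'a = real] by (simp add: algebra_simps)
  also have "(\<Sum>t=1..N. real t) \<le> G" unfolding G_def
  proof (rule sum_mono)
    fix t assume "t \<in> {1..N}"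
    then have "1 \<le> s t ^ 4" using s[of t] by (intro one_le_power) auto
    then show "real t \<le> real t * s t ^ 4" by (metis mult.right_neutral mult_left_mono of_nat_0_le_iff)
  qed
  finally have 3: "real N * real N \<le> 2 * G" by simp
  have "(S\<^sup>2)\<^sup>2 \<le> (2 * sqrt (real N) * R)\<^sup>2" using 1 by (intro power_mono) auto
  also have "\<dots> = 4 * real N * R\<^sup>2" by (simp add: power_mult_distrib)
  also have "\<dots> \<le> 4 * real N * (real N * G)" using 2 by (intro mult_left_mono) auto
  also have "\<dots> = 4 * G * (real N * real N)" by simp
  also have "\<dots> \<le> 4 * G * (2 * G)" using 3 Gnn by (intro mult_left_mono) auto
  also have "\<dots> \<le> (3 * G)\<^sup>2" by (simp add: power2_eq_square)
  finally have "S\<^sup>2 \<le> 3 * G" using Gnn by (intro power2_le_imp_le[of "S\<^sup>2"]) auto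
  then show ?thesis by (simp add: S_def G_def)
qed

lemma card_le_fibers:
  assumes "finite X" "finite Y" "\<And>x. x \<in> X \<Longrightarrow> f x \<in> Y"
    and "\<And>y. y \<in> Y \<Longrightarrow> card {x \<in> X. f x = y} \<le> m"
  shows "card X \<le> m * card Y"
proof -
  have "X = (\<Union>y\<in>Y. {x \<in> X. f x = y})" using assms(3) by auto
  then have "card X \<le> (\<Sum>y\<in>Y. card {x \<in> X. f x = y})"
    using card_UN_le[OF assms(2), of "\<lambda>y. {x \<in> X. f x = y}"] by simp
  also have "\<dots> \<le> (\<Sum>y\<in>Y. m)" by (intro sum_mono assms(4))
  finally show ?thesis by (simp add: mult.commute)
qed

section \<open>Antichains as a potential\<close>

definition antichains :: "(nat \<times> nat) set \<Rightarrow> nat set \<Rightarrow> nat set set" where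
  "antichains rho P = {A. A \<subseteq> P \<and> (\<forall>u\<in>A. \<forall>v\<in>A. (u, v) \<in> rho \<longrightarrow> u = v)}"

text \<open>The potential of the amortised analysis.\<close>

definition weight :: "(nat \<times> nat) set \<Rightarrow> nat set \<Rightarrow> nat" where
  "weight rho P = (\<Sum>A\<in>antichains rho P. 5 - card A)"

definition incomparable :: "(nat \<times> nat) set \<Rightarrow> nat set \<Rightarrow> (nat \<times> nat) set" where
  "incomparable rho P = {(u, v). u \<in> P \<and> v \<in> P \<and> (u, v) \<notin> rho \<and> (v, u) \<notin> rho}"

lemma finite_antichains: "finite P \<Longrightarrow> finite (antichains rho P)"
  by (rule finite_subset[of _ "Pow P"]) (auto simp: antichains_def)

lemma antichains_dual: "antichains (rho\<inverse>) P = antichains rho P"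
  by (auto simp: antichains_def)

lemma weight_dual: "weight (rho\<inverse>) P = weight rho P"
  by (simp add: weight_def antichains_dual)

lemma weight_empty: "weight rho {} = 5"
proof -
  have "antichains rho {} = {{}}" by (auto simp: antichains_def)
  then show ?thesis by (simp add: weight_def)
qed

text \<open>These are the antichains whose truncated weight rises when their chain element is
  dropped. Size five is included because the weight then rises from 0 to 1.\<close>

definition chain_antichains :: "(nat \<times> nat) set \<Rightarrow> nat set \<Rightarrow> nat set \<Rightarrow> nat set set" where
  "chain_antichains rho P C = {A \<in> antichains rho P. A \<inter> C \<noteq> {} \<and> card A \<le> 5}"

context chain_split
begin

abbreviation "G \<equiv> chain_antichains rho P C"

lemma finite_G: "finite G"
  using finite_antichains[OF fin] by (simp add: chain_antichains_def)

lemma antichain_C: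
  assumes "A \<in> antichains rho P" "c j \<in> A" "1 \<le> j" "j \<le> k"
  shows "A \<inter> C = {c j}"
proof -
  have "u = c j" if "u \<in> A" "u \<in> C" for u
  proof -
    obtain i where i: "1 \<le> i" "i \<le> k" "u = c i" using C_index[OF \<open>u \<in> C\<close>] by blast
    then have "(u, c j) \<in> rho \<or> (c j, u) \<in> rho"
      using c_le_iff[of i j] c_le_iff[of j i] assms(3,4) by auto
    then show ?thesis using assms(1,2) \<open>u \<in> A\<close> by (auto simp: antichains_def)
  qed
  then show ?thesis using assms(2) c_mem[OF assms(3,4)] by blast
qed

text \<open>Antichains of \<open>P\<close> are sent injectively to pairs of an index and an
  antichain of that block. One through \<open>c j\<close> drops \<open>c j\<close> and goes to block
  \<open>j\<close>. One that misses the chain is kept and goes to the block of the last chain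
  element below some member. Only the first kind changes its weight, and it gains one unit for each
  member of \<open>G\<close>.\<close>

lemma weight_split: "weight rho P + card G \<le> (\<Sum>i\<le>k. weight rho (B i))"
proof -
  define low where "low A = (SOME b. b \<le> k \<and> (1 \<le> b \<longrightarrow> (\<exists>u\<in>A. (c b, u) \<in> rho)) \<and>
    (b < k \<longrightarrow> \<not> (\<exists>u\<in>A. (c (Suc b), u) \<in> rho)))" for A
  have low: "low A \<le> k \<and> (1 \<le> low A \<longrightarrow> (\<exists>u\<in>A. (c (low A), u) \<in> rho)) \<and>
    (low A < k \<longrightarrow> \<not> (\<exists>u\<in>A. (c (Suc (low A)), u) \<in> rho))" for A
    unfolding low_def
  proof (rule someI_ex)
    show "\<exists>b. b \<le> k \<and> (1 \<le> b \<longrightarrow> (\<exists>u\<in>A. (c b, u) \<in> rho)) \<and>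
      (b < k \<longrightarrow> \<not> (\<exists>u\<in>A. (c (Suc b), u) \<in> rho))"
      by (rule cut[of "{v. \<exists>u\<in>A. (v, u) \<in> rho}", unfolded mem_Collect_eq]) blast
  qed
  define idx where "idx A = (SOME j. 1 \<le> j \<and> j \<le> k \<and> c j \<in> A)" for A
  have idx: "1 \<le> idx A \<and> idx A \<le> k \<and> c (idx A) \<in> A" if "A \<inter> C \<noteq> {}" for A
    unfolding idx_def
  proof (rule someI_ex)
    obtain u where "u \<in> A" "u \<in> C" using \<open>A \<inter> C \<noteq> {}\<close> by blast
    then show "\<exists>j. 1 \<le> j \<and> j \<le> k \<and> c j \<in> A" using C_index[of u] by blast
  qed
  let ?h = "\<lambda>A. if A \<inter> C = {} then (low A, A) else (idx A, A - C)"
  let ?A = "antichains rho P"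
  let ?S = "Sigma {..k} (\<lambda>i. antichains rho (B i))"
  have fS: "finite ?S" using finite_subset[OF B_sub fin] by (auto intro!: finite_antichains)
  have hin: "?h A \<in> ?S" if A: "A \<in> ?A" for A
  proof (cases "A \<inter> C = {}")
    case True
    have "u \<in> B (low A)" if u: "u \<in> A" for u
    proof -
      have "(u, c (low A)) \<notin> rho" if one: "1 \<le> low A"
      proof
        assume l: "(u, c (low A)) \<in> rho"
        obtain u' where u': "u' \<in> A" "(c (low A), u') \<in> rho" using low[of A] one by auto
        then have "u = u'" using A u trans[OF l u'(2)] by (auto simp: antichains_def)
        then have "u = c (low A)" using antisym[OF l] u' by simp
        then show False using True u c_mem[of "low A"] low[of A] one by auto
      qed
      then show ?thesis using low[of A] u A in_B[of "low A" u] by (auto simp: antichains_def)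
    qed
    then show ?thesis using True low[of A] A by (auto simp: antichains_def)
  next
    case False
    note i = idx[OF False]
    have "u \<in> B (idx A)" if u: "u \<in> A - C" for u
    proof -
      have "u \<in> P" "u \<noteq> c (idx A)" using A u c_mem[of "idx A"] i by (auto simp: antichains_def)
      moreover have "(u, c (idx A)) \<notin> rho" "(c (idx A), u) \<notin> rho"
        using A u i calculation by (auto simp: antichains_def)
      moreover have "idx A < k \<Longrightarrow> (c (idx A), c (Suc (idx A))) \<in> rho"
        using c_le_iff[of "idx A" "Suc (idx A)"] i by simp
      ultimately show ?thesis using i trans by (auto simp: in_B)
    qed
    then show ?thesis using False i A by (auto simp: antichains_def)
  qed
  \<comment> \<open>The two kinds do not collide: if the last chain element below some member of
    \<open>A\<close> is \<open>c j\<close>, then \<open>A\<close> together with \<open>c j\<close>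
    is no antichain.\<close>
  have mixed: False if A: "A \<in> ?A" "A \<inter> C = {}" and A': "A' \<in> ?A" "A' \<inter> C \<noteq> {}"
    and e: "low A = idx A'" "A = A' - C" for A A'
  proof -
    note i = idx[OF A'(2)]
    obtain u where u: "u \<in> A" "(c (idx A'), u) \<in> rho" using low[of A] e i by auto
    then have "u = c (idx A')" using A'(1) i e(2) by (auto simp: antichains_def)
    then show False using u e(2) i c_mem[of "idx A'"] by auto
  qed
  have inj: "inj_on ?h ?A"
  proof (rule inj_onI)
    fix A A' assume a: "A \<in> ?A" "A' \<in> ?A" "?h A = ?h A'"
    show "A = A'"
    proof (cases "A \<inter> C = {}")
      case t1: True
      show ?thesis
      proof (cases "A' \<inter> C = {}")
        case True then show ?thesis using a t1 by simp
      next
        case False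
        then have "low A = idx A'" "A = A' - C" using a(3) t1 by auto
        then show ?thesis using mixed[OF a(1) t1 a(2) False] by blast
      qed
    next
      case f1: False
      show ?thesis
      proof (cases "A' \<inter> C = {}")
        case True
        then have "low A' = idx A" "A' = A - C" using a(3) f1 by auto
        then show ?thesis using mixed[OF a(2) True a(1) f1] by blast
      next
        case False
        then have "idx A = idx A'" "A - C = A' - C" using a f1 by auto
        moreover have "A \<inter> C = {c (idx A)}" "A' \<inter> C = {c (idx A')}"
          using antichain_C a idx[OF f1] idx[OF False] by auto
        ultimately show ?thesis by (metis Un_Diff_Int)
      qed
    qed
  qed
  have wt: "5 - card A + (if A \<in> G then 1 else 0) \<le> 5 - card (snd (?h A))" if A: "A \<in> ?A" for A
  proof (cases "A \<inter> C = {}")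
    case False
    have "finite A" using A fin finite_subset by (auto simp: antichains_def)
    moreover have "A - C = A - {c (idx A)}"
      using antichain_C[OF A, of "idx A"] idx[OF False] by auto
    ultimately have "card (A - C) = card A - 1" "0 < card A" using idx[OF False] by (auto simp: card_gt_0_iff)
    then show ?thesis using False by (auto simp: chain_antichains_def)
  qed (auto simp: chain_antichains_def)
  have "weight rho P + card G = (\<Sum>A\<in>?A. 5 - card A + (if A \<in> G then 1 else 0))"
  proof -
    have "card G = (\<Sum>A\<in>?A. if A \<in> G then 1 else 0)"
      using finite_antichains[OF fin] by (simp add: sum.If_cases chain_antichains_def Collect_conj_eq)
    then show ?thesis by (simp add: weight_def sum.distrib)
  qed
  also have "\<dots> \<le> (\<Sum>A\<in>?A. 5 - card (snd (?h A)))" by (intro sum_mono wt)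
  also have "\<dots> = (\<Sum>x\<in>?h ` ?A. 5 - card (snd x))"
    using sum.reindex[OF inj, of "\<lambda>x. 5 - card (snd x)"] unfolding comp_def by (rule sym)
  also have "\<dots> \<le> (\<Sum>x\<in>?S. 5 - card (snd x))" by (rule sum_mono2[OF fS image_subsetI[OF hin]]) auto
  also have "\<dots> = (\<Sum>i\<le>k. weight rho (B i))" unfolding weight_def
    using finite_antichains[OF finite_subset[OF B_sub fin]] by (subst sum.Sigma) (auto simp: case_prod_beta)
  finally show ?thesis .
qed

text \<open>The elements whose largest incomparable chain element is \<open>c\<^sub>i\<close>.\<close>

definition U :: "nat \<Rightarrow> nat set" where
  "U i = {u \<in> P - C. (u, c i) \<notin> rho \<and> (c i, u) \<notin> rho \<and> (i < k \<longrightarrow> (u, c (Suc i)) \<in> rho)}"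

text \<open>Levels count from the top of \<open>U i\<close>: the maximum is over chains that start
  at \<open>u\<close> and ascend. Elements of equal level therefore form an antichain.\<close>

definition level :: "nat \<Rightarrow> nat \<Rightarrow> nat" where
  "level i u = Max (length ` {xs. chain_in rho (U i) xs \<and> xs \<noteq> [] \<and> hd xs = u})"

section \<open>Levels and the antichains built from them\<close>

lemma U_sub: "U i \<subseteq> P"
  by (auto simp: U_def)

lemma chain_in_mono: "chain_in rho X xs \<Longrightarrow> X \<subseteq> Y \<Longrightarrow> chain_in rho Y xs"
  by (auto simp: chain_in_def)

text \<open>If \<open>c a\<close> is the last chain element below \<open>hd xs\<close>, then
  \<open>xs\<close> could replace \<open>c (a + 1)\<close>, ..., \<open>c i\<close>, whence
  \<open>a + length xs \<le> i\<close>. So \<open>hd xs\<close> is incomparable to the last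
  \<open>length xs\<close> elements among \<open>c 1\<close>, ..., \<open>c i\<close>, and the level
  of an element is a lower bound for the number of chain elements incomparable to it.\<close>

lemma U_chain:
  assumes i: "1 \<le> i" "i \<le> k" and xs: "chain_in rho (U i) xs" "xs \<noteq> []"
  shows "length xs \<le> i"
    and "i - length xs < j \<Longrightarrow> j \<le> i \<Longrightarrow> (c j, hd xs) \<notin> rho \<and> (hd xs, c j) \<notin> rho"
proof -
  let ?u = "hd xs"
  have u: "?u \<in> U i" using xs by (auto simp: chain_in_def)
  obtain a where a: "a \<le> k" "1 \<le> a \<Longrightarrow> c a \<in> {v. (v, ?u) \<in> rho}"
    "\<And>j. a < j \<Longrightarrow> j \<le> k \<Longrightarrow> c j \<notin> {v. (v, ?u) \<in> rho}"
    using cut[of "{v. (v, ?u) \<in> rho}"] by metis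
  have ai: "a \<le> i"
  proof (rule ccontr)
    assume "\<not> a \<le> i"
    then have "(c i, c a) \<in> rho" "(c a, ?u) \<in> rho" using a i c_le_iff[of i a] by auto
    then show False using u trans by (auto simp: U_def)
  qed
  have ge: "(?u, x) \<in> rho" if x: "x \<in> set xs" for x
  proof -
    have "?u \<in> P" using u U_sub by auto
    then show ?thesis using xs x refl by (cases xs) (auto simp: chain_in_def)
  qed
  have mem: "x \<in> U i" if "x \<in> set xs" for x using xs that by (auto simp: chain_in_def)
  have len: "a + length xs \<le> i"
  proof (rule chain_swap[OF chain_in_mono[OF xs(1) U_sub] ai i(2)])
    fix x assume x: "x \<in> set xs"
    show "(c a, x) \<in> rho \<and> c a \<noteq> x" if one: "1 \<le> a"
    proof
      show "(c a, x) \<in> rho" using a(2)[OF one] ge[OF x] trans by blast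
      show "c a \<noteq> x" using mem[OF x] c_mem[OF one a(1)] by (auto simp: U_def)
    qed
    show "(x, c (Suc i)) \<in> rho \<and> x \<noteq> c (Suc i)" if "i < k"
      using mem[OF x] c_mem[of "Suc i"] that by (auto simp: U_def)
  qed
  then show "length xs \<le> i" by simp
  assume j: "i - length xs < j" "j \<le> i"
  have "(c j, ?u) \<notin> rho" using a(3)[of j] j len i by auto
  moreover have "(?u, c j) \<notin> rho"
  proof
    assume "(?u, c j) \<in> rho"
    moreover have "(c j, c i) \<in> rho" using c_le_iff[of j i] j i by auto
    ultimately show False using u trans by (auto simp: U_def)
  qed
  ultimately show "(c j, ?u) \<notin> rho \<and> (?u, c j) \<notin> rho" by simp
qed

lemma level_chain:
  assumes i: "1 \<le> i" "i \<le> k" and u: "u \<in> U i"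
  obtains xs where "chain_in rho (U i) xs" "xs \<noteq> []" "hd xs = u" "length xs = level i u"
proof -
  let ?L = "{xs. chain_in rho (U i) xs \<and> xs \<noteq> [] \<and> hd xs = u}"
  have "length ` ?L \<subseteq> {..i}" using U_chain(1)[OF i] by auto
  then have "finite (length ` ?L)" by (rule finite_subset) simp
  moreover have "[u] \<in> ?L" using u by (simp add: chain_in_def)
  ultimately have "level i u \<in> length ` ?L" unfolding level_def by (intro Max_in) blast+
  then show ?thesis using that by auto
qed

lemma level_ge:
  assumes i: "1 \<le> i" "i \<le> k" and xs: "chain_in rho (U i) xs" "xs \<noteq> []"
  shows "length xs \<le> level i (hd xs)"
proof -
  let ?L = "{ys. chain_in rho (U i) ys \<and> ys \<noteq> [] \<and> hd ys = hd xs}"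
  have "length ` ?L \<subseteq> {..i}" using U_chain(1)[OF i] by auto
  then have "finite (length ` ?L)" by (rule finite_subset) simp
  then show ?thesis unfolding level_def using xs by (intro Max_ge) auto
qed

lemma level_less:
  assumes i: "1 \<le> i" "i \<le> k" and u: "u \<in> U i" "v \<in> U i" "(u, v) \<in> rho" "u \<noteq> v"
  shows "level i v < level i u"
proof -
  obtain xs where xs: "chain_in rho (U i) xs" "xs \<noteq> []" "hd xs = v" "length xs = level i v"
    using level_chain[OF i u(2)] .
  have "(u, x) \<in> rho \<and> u \<noteq> x" if x: "x \<in> set xs" for x
  proof (cases "x = v")
    case False
    then have "(v, x) \<in> rho" using xs x by (cases xs) (auto simp: chain_in_def)
    then show ?thesis using trans[OF u(3)] antisym u(3) False by blast
  qed (use u in auto)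
  then have "chain_in rho (U i) (u # xs)" using xs u by (auto simp: chain_in_def)
  from level_ge[OF i this] show ?thesis using xs by simp
qed

lemma level_down:
  assumes i: "1 \<le> i" "i \<le> k" and u: "u \<in> U i" "level i u = Suc t" "1 \<le> t"
  shows "\<exists>v \<in> U i. level i v = t"
proof -
  obtain xs where xs: "chain_in rho (U i) xs" "xs \<noteq> []" "hd xs = u" "length xs = level i u"
    using level_chain[OF i u(1)] .
  define ys where "ys = tl xs"
  have x: "xs = u # ys" using xs by (cases xs) (auto simp: ys_def)
  have ys: "chain_in rho (U i) ys" "ys \<noteq> []" "length ys = t"
    using xs u x by (auto simp: chain_in_def)
  have "t \<le> level i (hd ys)" using level_ge[OF i ys(1,2)] ys(3) by simp
  moreover have "hd ys \<in> U i" "(u, hd ys) \<in> rho \<and> u \<noteq> hd ys"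
    using xs x ys by (cases ys; auto simp: chain_in_def)+
  moreover have "level i (hd ys) < level i u" using level_less[OF i u(1)] calculation by auto
  ultimately show ?thesis using u by (intro bexI[of _ "hd ys"]) auto
qed

definition H :: "nat \<Rightarrow> nat set set" where
  "H i = {A \<in> G. A - C \<noteq> {} \<and> A - C \<subseteq> U i}"

text \<open>Four elements of level \<open>t\<close>, repetitions allowed, and one of the
  \<open>t\<close> chain elements that are incomparable to all of that level form an antichain of at
  most five elements. \<open>W\<close> is the set of these choices; its size is the sum that
  \<open>levels_square_le\<close> compares with the square. The constant is 3 from that inequality
  times \<open>5 ^ 4\<close> from the fibres.\<close>

lemma U_square:
  assumes i: "1 \<le> i" "i \<le> k"
  shows "(card (U i))\<^sup>2 \<le> 1875 * card (H i)"
proof -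
  define L where "L t = {u \<in> U i. level i u = t}" for t
  have finU: "finite (U i)" using finite_subset[OF U_sub fin] .
  have finL: "finite (L t)" for t using finU by (simp add: L_def)
  define N where "N = Max (insert 0 (level i ` U i))"
  have lN: "level i u \<le> N" if "u \<in> U i" for u unfolding N_def using finU that by (intro Max_ge) auto
  have l1: "1 \<le> level i u" if "u \<in> U i" for u
    using level_ge[OF i, of "[u]"] that by (auto simp: chain_in_def)
  have li: "level i u \<le> i" if "u \<in> U i" for u
    using level_chain[OF i that] U_chain(1)[OF i] by metis
  \<comment> \<open>No level up to \<open>N\<close> is empty, as \<open>levels_square_le\<close>
    requires each summand to be at least 1.\<close>
  have Lne: "L t \<noteq> {}" if "1 \<le> t" "t \<le> N" for t
  proof -
    have "N \<in> insert 0 (level i ` U i)" unfolding N_def using finU by (intro Max_in) auto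
    then have "L N \<noteq> {}" using that by (auto simp: L_def)
    with that(2) show ?thesis using that(1)
    proof (induction rule: inc_induct)
      case (step m)
      then obtain u where "u \<in> U i" "level i u = Suc m" by (auto simp: L_def)
      then show ?case using level_down[OF i, of u m] step by (auto simp: L_def)
    qed
  qed
  have U: "U i = (\<Union>t\<in>{1..N}. L t)" using lN l1 by (auto simp: L_def)
  have cU: "card (U i) = (\<Sum>t=1..N. card (L t))"
    unfolding U by (rule card_UN_disjoint) (use finL in \<open>auto simp: L_def\<close>)
  define W where "W = Sigma {1..N} (\<lambda>t. {xs. set xs \<subseteq> L t \<and> length xs = 4} \<times> {i - t<..i})"
  have finW: "finite W" unfolding W_def using finL
    by (intro finite_SigmaI finite_cartesian_product finite_lists_length_eq) auto
  have cW: "card W = (\<Sum>t=1..N. card (L t) ^ 4 * t)"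
  proof -
    have "card W = (\<Sum>t=1..N. card ({xs. set xs \<subseteq> L t \<and> length xs = 4} \<times> {i - t<..i}))"
      unfolding W_def using finL finite_lists_length_eq by (intro card_SigmaI) auto
    also have "\<dots> = (\<Sum>t=1..N. card (L t) ^ 4 * t)"
    proof (rule sum.cong)
      fix t assume t: "t \<in> {1..N}"
      then obtain u where "u \<in> U i" "level i u = t" using Lne[of t] by (auto simp: L_def)
      then have "t \<le> i" using li by auto
      then show "card ({xs. set xs \<subseteq> L t \<and> length xs = 4} \<times> {i - t<..i}) = card (L t) ^ 4 * t"
        using finL by (simp add: card_cartesian_product card_lists_length_eq)
    qed simp
    finally show ?thesis .
  qed
  let ?f = "\<lambda>(t, xs, j). insert (c j) (set xs)"
  have "card W \<le> 625 * card (H i)"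
  proof (rule card_le_fibers[where f = ?f])
    show "finite W" by (rule finW)
    show "finite (H i)" using finite_G by (simp add: H_def)
    fix x assume "x \<in> W"
    then obtain t xs j where x: "x = (t, xs, j)" "set xs \<subseteq> L t" "length xs = 4" "i - t < j" "j \<le> i"
      by (auto simp: W_def)
    have j: "1 \<le> j" "j \<le> k" using x i by auto
    have xU: "set xs \<subseteq> U i" using x by (auto simp: L_def)
    have inc: "(c j, u) \<notin> rho \<and> (u, c j) \<notin> rho" if "u \<in> set xs" for u
    proof -
      have u: "u \<in> U i" "level i u = t" using x that by (auto simp: L_def)
      obtain ys where "chain_in rho (U i) ys" "ys \<noteq> []" "hd ys = u" "length ys = level i u"
        using level_chain[OF i u(1)] .
      then show ?thesis using U_chain(2)[OF i, of ys j] x u by auto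
    qed
    have "u = v" if "u \<in> set xs" "v \<in> set xs" "(u, v) \<in> rho" for u v
    proof -
      have "u \<in> L t" "v \<in> L t" using that x(2) by auto
      then show ?thesis using level_less[OF i, of u v] that(3) by (auto simp: L_def)
    qed
    then have "insert (c j) (set xs) \<in> antichains rho P"
      using inc subset_trans[OF xU U_sub] c_in[OF j] by (auto simp: antichains_def)
    moreover have "card (insert (c j) (set xs)) \<le> 5"
      using card_insert_le_m1[of 5 "set xs" "c j"] card_length[of xs] x by simp
    moreover have "insert (c j) (set xs) - C = set xs" using xU c_mem[OF j] by (auto simp: U_def)
    moreover have "\<not> set xs \<subseteq> C" using x(3) xU by (cases xs) (auto simp: U_def)
    ultimately show "?f x \<in> H i" using x(1) xU c_mem[OF j]
      by (auto simp: H_def chain_antichains_def)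
  next
    fix A assume A: "A \<in> H i"
    have finA: "finite A" "card A \<le> 5" using A fin finite_subset
      by (auto simp: H_def chain_antichains_def antichains_def)
    have "A \<in> antichains rho P" using A by (simp add: H_def chain_antichains_def)
    let ?F = "{x \<in> W. ?f x = A}"
    \<comment> \<open>The antichain fixes \<open>j\<close>, because it meets the chain in one
      element, and \<open>xs\<close> fixes its own level \<open>t\<close>. Only the list of four
      members of \<open>A\<close> is free.\<close>
    have "inj_on (\<lambda>(t, xs, j). xs) ?F"
    proof (rule inj_onI)
      fix x y assume xy: "x \<in> ?F" "y \<in> ?F" "(\<lambda>(t, xs, j). xs) x = (\<lambda>(t, xs, j). xs) y"
      obtain t xs j where x: "x = (t, xs, j)" by (metis prod_cases3)
      obtain t' ys j' where y: "y = (t', ys, j')" by (metis prod_cases3)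
      have w: "(t, xs, j) \<in> W" "(t', xs, j') \<in> W" "ys = xs" and A1: "A = insert (c j) (set xs)"
        and A2: "insert (c j') (set xs) = insert (c j) (set xs)" using xy x y by auto
      have jk: "1 \<le> j" "j \<le> k" "1 \<le> j'" "j' \<le> k" using w i by (auto simp: W_def)
      have "A \<inter> C = {c j}" "A \<inter> C = {c j'}"
        using antichain_C[OF \<open>A \<in> antichains rho P\<close>] A1 A2 jk by auto
      then have "j = j'" using c_inj jk by simp
      moreover have "xs \<noteq> []" "hd xs \<in> set xs" using w by (cases xs; auto simp: W_def)+
      then have "hd xs \<in> L t" "hd xs \<in> L t'" using w by (auto simp: W_def)
      then have "t = t'" by (simp add: L_def)
      ultimately show "x = y" using x y w(3) by simp
    qed
    moreover have "(\<lambda>(t, xs, j). xs) ` ?F \<subseteq> {xs. set xs \<subseteq> A \<and> length xs = 4}"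
      by (auto simp: W_def)
    ultimately have "card ?F \<le> card {xs. set xs \<subseteq> A \<and> length xs = 4}"
      using finite_lists_length_eq[OF finA(1)] by (intro card_inj_on_le) auto
    also have "\<dots> = card A ^ 4" using finA by (simp add: card_lists_length_eq)
    also have "\<dots> \<le> 5 ^ 4" using finA by (intro power_mono) auto
    finally show "card ?F \<le> 625" by simp
  qed
  moreover have "real ((card (U i))\<^sup>2) \<le> 3 * real (card W)"
  proof -
    have "(\<Sum>t=1..N. real (card (L t)))\<^sup>2 \<le> 3 * (\<Sum>t=1..N. real t * real (card (L t)) ^ 4)"
    proof (rule levels_square_le)
      fix t assume "1 \<le> t" "t \<le> N"
      then have "0 < card (L t)" using Lne finL by (simp add: card_gt_0_iff)
      then show "1 \<le> real (card (L t))" by simp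
    qed
    then show ?thesis by (simp add: cU cW mult.commute)
  qed
  then have "(card (U i))\<^sup>2 \<le> 3 * card W" by linarith
  ultimately show ?thesis by linarith
qed

lemma U_disjoint: "1 \<le> i \<Longrightarrow> i < j \<Longrightarrow> j \<le> k \<Longrightarrow> U i \<inter> U j = {}"
proof -
  assume a: "1 \<le> i" "i < j" "j \<le> k"
  then have "(c (Suc i), c j) \<in> rho" using c_le_iff[of "Suc i" j] by auto
  then show ?thesis using a trans by (auto simp: U_def)
qed

lemma sum_U_square: "(\<Sum>i=1..k. (card (U i))\<^sup>2) \<le> 1875 * card G"
proof -
  have "H i \<inter> H j = {}" if a: "i \<in> {1..k}" "j \<in> {1..k}" "i \<noteq> j" for i j
  proof -
    have "U i \<inter> U j = {}" using a U_disjoint[of i j] U_disjoint[of j i] by (cases "i < j") auto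
    then show ?thesis by (auto simp: H_def)
  qed
  then have "(\<Sum>i=1..k. card (H i)) = card (\<Union>i\<in>{1..k}. H i)"
    using finite_G by (subst card_UN_disjoint) (auto simp: H_def)
  also have "\<dots> \<le> card G" using finite_G by (intro card_mono) (auto simp: H_def)
  finally have "(\<Sum>i=1..k. card (H i)) \<le> card G" .
  moreover have "(\<Sum>i=1..k. (card (U i))\<^sup>2) \<le> (\<Sum>i=1..k. 1875 * card (H i))"
    by (intro sum_mono U_square) auto
  ultimately show ?thesis by (simp add: sum_distrib_left[symmetric])
qed

section \<open>Charging elements and incomparable pairs to antichains\<close>

lemma chain_split_dual: "chain_split (rho\<inverse>) E P (rev cs)"
  using po sub fin ne longest_chain_in_rev[OF longest] by (simp add: chain_split_def)

text \<open>A chain element is represented by its singleton, any other element by the pair with an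
  incomparable chain element \<open>p u\<close>.\<close>

lemma card_le_G: "card P \<le> card G"
proof -
  have "\<exists>v. u \<notin> C \<longrightarrow> v \<in> C \<and> (u, v) \<notin> rho \<and> (v, u) \<notin> rho" if "u \<in> P" for u
    using incomparable_chain_element[OF that] by blast
  then obtain p where p: "\<And>u. u \<in> P \<Longrightarrow> u \<notin> C \<Longrightarrow> p u \<in> C \<and> (u, p u) \<notin> rho \<and> (p u, u) \<notin> rho"
    by metis
  let ?f = "\<lambda>u. if u \<in> C then {u} else {u, p u}"
  have "inj_on ?f P"
  proof (rule inj_onI)
    fix u v assume a: "u \<in> P" "v \<in> P" "?f u = ?f v"
    show "u = v"
    proof (cases "u \<in> C \<or> v \<in> C")
      case False
      then have "?f u - C = {u}" "?f v - C = {v}" using p a(1,2) by auto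
      then show ?thesis using a(3) by simp
    qed (use a p in \<open>auto split: if_splits simp: doubleton_eq_iff\<close>)
  qed
  moreover have "?f u \<in> G" if u: "u \<in> P" for u
  proof (cases "u \<in> C")
    case True
    then show ?thesis using u by (auto simp: chain_antichains_def antichains_def)
  next
    case False
    have "card {u, p u} \<le> 5" by (simp add: card_insert_if)
    then show ?thesis using False p[OF u False] C_sub u
      by (auto simp: chain_antichains_def antichains_def)
  qed
  then have "?f ` P \<subseteq> G" by blast
  ultimately show ?thesis using finite_G by (rule card_inj_on_le)
qed

definition V :: "nat \<Rightarrow> nat set" where
  "V i = {u \<in> P - C. (u, c i) \<notin> rho \<and> (c i, u) \<notin> rho \<and> (1 < i \<longrightarrow> (c (i - 1), u) \<in> rho)}"

text \<open>\<open>V i\<close> is the set \<open>U (k + 1 - i)\<close> of the reversed chain in the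
  dual order, and \<open>G\<close> is the same set of antichains in both orders.\<close>

lemma sum_V_square: "(\<Sum>i=1..k. (card (V i))\<^sup>2) \<le> 1875 * card G"
proof -
  interpret dual: chain_split "rho\<inverse>" E P "rev cs" by (rule chain_split_dual)
  have V: "V i = dual.U (k + 1 - i)" if "i \<in> {1..k}" for i
  proof -
    have "k - Suc (k - i) = i - Suc 0" "k - i < k" using that by auto
    then have "rev cs ! (k + 1 - i - Suc 0) = c i" by (simp add: rev_nth)
    moreover have "1 < i \<Longrightarrow> rev cs ! (Suc (k + 1 - i) - Suc 0) = c (i - 1)"
    proof -
      assume "1 < i"
      then obtain m where m: "i = Suc (Suc m)" by (metis One_nat_def less_imp_Suc_add add.left_neutral plus_nat.add_Suc)
      then have "k - Suc (k - Suc m) = m" "Suc k - Suc (Suc m) = k - Suc m" "k - Suc m < k" using that by auto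
      then show ?thesis using m by (simp add: rev_nth)
    qed
    moreover have "k + 1 - i < length (rev cs) \<longleftrightarrow> 1 < i" using that by auto
    ultimately show ?thesis by (auto simp: V_def dual.U_def)
  qed
  have "(\<Sum>i=1..k. (card (V i))\<^sup>2) = (\<Sum>i=1..k. (card (dual.U (k + 1 - i)))\<^sup>2)"
    using V by (intro sum.cong) auto
  also have "\<dots> = (\<Sum>i=1..k. (card (dual.U i))\<^sup>2)"
    by (rule sum.reindex_bij_witness[of _ "\<lambda>i. k + 1 - i" "\<lambda>i. k + 1 - i"]) auto
  also have "\<dots> \<le> 1875 * card dual.G" using dual.sum_U_square by simp
  also have "dual.G = G" by (simp add: chain_antichains_def antichains_dual)
  finally show ?thesis .
qed

text \<open>The chain elements incomparable to an element outside the chain occupy a nonempty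
  interval \<open>{a<..b}\<close> of indices. Those of \<open>u\<close> and \<open>v\<close> are
  disjoint by assumption. A gap between them would put a chain element between \<open>u\<close> and
  \<open>v\<close> and make these comparable, so the two intervals are adjacent, which is what
  \<open>U i\<close> and \<open>V (Suc i)\<close> express.\<close>

lemma bad_pair:
  assumes "u \<in> P - C" "v \<in> P - C" "(u, v) \<notin> rho" "(v, u) \<notin> rho"
    and none: "\<And>w. w \<in> C \<Longrightarrow> (u, w) \<in> rho \<or> (w, u) \<in> rho \<or> (v, w) \<in> rho \<or> (w, v) \<in> rho"
  shows "\<exists>i. 1 \<le> i \<and> i < k \<and> ((u \<in> U i \<and> v \<in> V (Suc i)) \<or> (v \<in> U i \<and> u \<in> V (Suc i)))"
proof -
  have ends: "\<exists>a b. a < b \<and> b \<le> k \<and> (\<forall>j. 1 \<le> j \<longrightarrow> j \<le> k \<longrightarrow> ((c j, x) \<in> rho \<longleftrightarrow> j \<le> a) \<and> ((x, c j) \<notin> rho \<longleftrightarrow> j \<le> b))"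
    if x: "x \<in> P - C" for x
  proof -
    obtain a where a: "a \<le> k" "1 \<le> a \<Longrightarrow> (c a, x) \<in> rho" "\<And>j. a < j \<Longrightarrow> j \<le> k \<Longrightarrow> (c j, x) \<notin> rho"
      by (rule cut[of "{v. (v, x) \<in> rho}", unfolded mem_Collect_eq]) blast
    obtain b where b: "b \<le> k" "1 \<le> b \<Longrightarrow> (x, c b) \<notin> rho" "\<And>j. b < j \<Longrightarrow> j \<le> k \<Longrightarrow> \<not> (x, c j) \<notin> rho"
      by (rule cut[of "{v. (x, v) \<notin> rho}", unfolded mem_Collect_eq]) blast
    have A: "(c j, x) \<in> rho \<longleftrightarrow> j \<le> a" if "1 \<le> j" "j \<le> k" for j
    proof
      assume "j \<le> a"
      then show "(c j, x) \<in> rho" using a(1,2) that c_le_iff[of j a] trans by auto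
    qed (use a(3)[of j] that in \<open>auto simp: not_le[symmetric]\<close>)
    have B: "(x, c j) \<notin> rho \<longleftrightarrow> j \<le> b" if "1 \<le> j" "j \<le> k" for j
    proof
      assume "j \<le> b"
      then show "(x, c j) \<notin> rho" using b(1,2) that c_le_iff[of j b] trans by auto
    qed (use b(3)[of j] that in \<open>auto simp: not_le[symmetric]\<close>)
    obtain j where j: "1 \<le> j" "j \<le> k" "(x, c j) \<notin> rho" "(c j, x) \<notin> rho"
      using incomparable_chain_element[of x] x C_index by blast
    then have "a < b" using A[of j] B[of j] by auto
    then show ?thesis using A B b(1) by blast
  qed
  obtain a b where ab: "a < b" "b \<le> k"
    "\<And>j. 1 \<le> j \<Longrightarrow> j \<le> k \<Longrightarrow> ((c j, u) \<in> rho \<longleftrightarrow> j \<le> a) \<and> ((u, c j) \<notin> rho \<longleftrightarrow> j \<le> b)"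
    using ends[OF assms(1)] by blast
  obtain a' b' where ab': "a' < b'" "b' \<le> k"
    "\<And>j. 1 \<le> j \<Longrightarrow> j \<le> k \<Longrightarrow> ((c j, v) \<in> rho \<longleftrightarrow> j \<le> a') \<and> ((v, c j) \<notin> rho \<longleftrightarrow> j \<le> b')"
    using ends[OF assms(2)] by blast
  have "b \<le> a' \<or> b' \<le> a"
  proof (rule ccontr)
    assume n: "\<not> ?thesis"
    let ?j = "Suc (max a a')"
    have j: "1 \<le> ?j" "?j \<le> k" "?j \<le> b" "?j \<le> b'" using n ab ab' by auto
    then show False using none[OF c_mem[OF j(1,2)]] ab(3)[OF j(1,2)] ab'(3)[OF j(1,2)] by auto
  qed
  moreover have "\<not> b < a'"
  proof
    assume l: "b < a'"
    then have "(u, c (Suc b)) \<in> rho" "(c (Suc b), v) \<in> rho" using ab(3)[of "Suc b"] ab'(3)[of "Suc b"] ab' by auto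
    then show False using trans assms by blast
  qed
  moreover have "\<not> b' < a"
  proof
    assume l: "b' < a"
    then have "(v, c (Suc b')) \<in> rho" "(c (Suc b'), u) \<in> rho" using ab(3)[of "Suc b'"] ab'(3)[of "Suc b'"] ab by auto
    then show False using trans assms by blast
  qed
  ultimately have "b = a' \<or> b' = a" by auto
  then show ?thesis
  proof
    assume e: "b = a'"
    then have "u \<in> U b" using ab(1,2) ab(3)[of b] ab(3)[of "Suc b"] assms(1) by (auto simp: U_def)
    moreover have "v \<in> V (Suc b)"
      using e ab(1) ab'(1,2) ab'(3)[of b] ab'(3)[of "Suc b"] assms(2) by (auto simp: V_def)
    ultimately show ?thesis using e ab ab' by (intro exI[of _ b]) auto
  next
    assume e: "b' = a"
    then have "v \<in> U b'" using ab'(1,2) ab'(3)[of b'] ab'(3)[of "Suc b'"] assms(2) by (auto simp: U_def)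
    moreover have "u \<in> V (Suc b')"
      using e ab'(1) ab(1,2) ab(3)[of b'] ab(3)[of "Suc b'"] assms(1) by (auto simp: V_def)
    ultimately show ?thesis using e ab ab' by (intro exI[of _ b']) auto
  qed
qed

text \<open>A pair outside \<open>bad\<close> is contained in an antichain of \<open>G\<close>,
  which contains at most \<open>5 * 5\<close> pairs. By \<open>bad_pair\<close> the others lie in
  products of \<open>U i\<close> and \<open>V (Suc i)\<close>, so that twice 1875 bounds their
  number per antichain. With one unit each for \<open>card P\<close> and for 1 the total is 3777,
  rounded up.\<close>

lemma node_bound: "1 + card P + card (incomparable rho P) \<le> 4000 * card G"
proof -
  define I where "I = incomparable rho P"
  define bad where "bad = {(u, v) \<in> I. u \<notin> C \<and> v \<notin> C \<and>
    (\<forall>w\<in>C. (u, w) \<in> rho \<or> (w, u) \<in> rho \<or> (v, w) \<in> rho \<or> (w, v) \<in> rho)}"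
  have I: "(u, v) \<in> I \<longleftrightarrow> u \<in> P \<and> v \<in> P \<and> (u, v) \<notin> rho \<and> (v, u) \<notin> rho" for u v
    by (simp add: I_def incomparable_def)
  have "I \<subseteq> P \<times> P" by (auto simp: I_def incomparable_def)
  then have finI: "finite I" using fin finite_subset by blast
  have "\<exists>A. A \<in> G \<and> fst x \<in> A \<and> snd x \<in> A" if x: "x \<in> I - bad" for x
  proof (cases x)
    case (Pair u v)
    then have uv: "u \<in> P" "v \<in> P" "(u, v) \<notin> rho" "(v, u) \<notin> rho" using x I by auto
    show ?thesis
    proof (cases "u \<in> C \<or> v \<in> C")
      case True
      have "card {u, v} \<le> 5" by (simp add: card_insert_if)
      then have "{u, v} \<in> G" using True uv by (auto simp: chain_antichains_def antichains_def)
      then show ?thesis using Pair by auto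
    next
      case False
      then obtain w where w: "w \<in> C" "(u, w) \<notin> rho" "(w, u) \<notin> rho" "(v, w) \<notin> rho" "(w, v) \<notin> rho"
        using x Pair by (auto simp: bad_def)
      have "card {u, v, w} \<le> 5" by (simp add: card_insert_if)
      then have "{u, v, w} \<in> G" using w uv C_sub by (auto simp: chain_antichains_def antichains_def)
      then show ?thesis using Pair by auto
    qed
  qed
  then obtain f where f: "\<And>x. x \<in> I - bad \<Longrightarrow> f x \<in> G \<and> fst x \<in> f x \<and> snd x \<in> f x" by metis
  have "card (I - bad) \<le> 25 * card G"
  proof (rule card_le_fibers[where f = f])
    fix A assume A: "A \<in> G"
    then have "finite A" "card A \<le> 5" using fin finite_subset
      by (auto simp: chain_antichains_def antichains_def)
    then have c: "card (A \<times> A) \<le> 5 * 5" "finite (A \<times> A)"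
      unfolding card_cartesian_product using mult_le_mono[of "card A" 5 "card A" 5] by auto
    have "{x \<in> I - bad. f x = A} \<subseteq> A \<times> A" using f by (auto simp: mem_Times_iff)
    then have "card {x \<in> I - bad. f x = A} \<le> card (A \<times> A)" using c(2) by (rule card_mono[rotated])
    then show "card {x \<in> I - bad. f x = A} \<le> 25" using c by simp
  qed (use finI finite_G f in auto)
  moreover have "card bad \<le> 3750 * card G"
  proof -
    let ?X = "\<lambda>i. U i \<times> V (Suc i) \<union> V (Suc i) \<times> U i"
    have finU: "finite (U i)" and finV: "finite (V i)" for i
      using fin by (auto simp: U_def V_def)
    have "x \<in> (\<Union>i\<in>{1..<k}. ?X i)" if "x \<in> bad" for x
    proof (cases x)
      case (Pair u v)
      have "\<exists>i. 1 \<le> i \<and> i < k \<and> ((u \<in> U i \<and> v \<in> V (Suc i)) \<or> (v \<in> U i \<and> u \<in> V (Suc i)))"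
        using that Pair I by (intro bad_pair) (auto simp: bad_def)
      then show ?thesis using Pair by auto
    qed
    then have "card bad \<le> card (\<Union>i\<in>{1..<k}. ?X i)"
      using finU finV by (intro card_mono) auto
    also have "\<dots> \<le> (\<Sum>i\<in>{1..<k}. card (?X i))" by (intro card_UN_le) simp
    also have "\<dots> \<le> (\<Sum>i\<in>{1..<k}. (card (U i))\<^sup>2 + (card (V (Suc i)))\<^sup>2)"
    proof (rule sum_mono)
      fix i
      have "card (?X i) \<le> 2 * card (U i) * card (V (Suc i))"
        using card_Un_le[of "U i \<times> V (Suc i)" "V (Suc i) \<times> U i"]
        by (simp add: card_cartesian_product algebra_simps)
      also have "\<dots> \<le> (card (U i))\<^sup>2 + (card (V (Suc i)))\<^sup>2"
      proof -
        have "2 * x * y \<le> x\<^sup>2 + y\<^sup>2" for x y :: nat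
        proof -
          have "real (2 * x * y) \<le> real (x\<^sup>2 + y\<^sup>2)"
            using sum_squares_bound[of "real x" "real y"] by simp
          then show ?thesis by (simp only: of_nat_le_iff)
        qed
        then show ?thesis .
      qed
      finally show "card (?X i) \<le> (card (U i))\<^sup>2 + (card (V (Suc i)))\<^sup>2" .
    qed
    also have "\<dots> = (\<Sum>i\<in>{1..<k}. (card (U i))\<^sup>2) + (\<Sum>i\<in>{1..<k}. (card (V (Suc i)))\<^sup>2)"
      by (rule sum.distrib)
    also have "(\<Sum>i\<in>{1..<k}. (card (U i))\<^sup>2) \<le> (\<Sum>i=1..k. (card (U i))\<^sup>2)"
      by (intro sum_mono2) auto
    also have "(\<Sum>i\<in>{1..<k}. (card (V (Suc i)))\<^sup>2) = (\<Sum>i\<in>{Suc 1..<Suc k}. (card (V i))\<^sup>2)"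
      by (rule sum.shift_bounds_Suc_ivl[symmetric])
    also have "\<dots> \<le> (\<Sum>i=1..k. (card (V i))\<^sup>2)" by (intro sum_mono2) auto
    finally show ?thesis using sum_U_square sum_V_square by linarith
  qed
  moreover have "card I \<le> card (I - bad) + card bad"
  proof -
    have "bad \<subseteq> I" by (auto simp: bad_def)
    then have "(I - bad) \<union> bad = I" by blast
    then show ?thesis using card_Un_le[of "I - bad" "bad"] by simp
  qed
  moreover have "1 \<le> card P" using ne fin by (simp add: Suc_le_eq card_gt_0_iff)
  ultimately show ?thesis using card_le_G unfolding I_def by linarith
qed

end

section \<open>Traces\<close>

text \<open>A trace is a list of unit time steps.  The emitted number 0 visits the current set,
  \<open>Suc u\<close> toggles the element \<open>u\<close>.\<close>

datatype event = Tick | Emit nat | Out "nat \<Rightarrow> nat"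

fun emits :: "event list \<Rightarrow> nat list" where
  "emits [] = []"
| "emits (Emit x # w) = x # emits w"
| "emits (_ # w) = emits w"

definition vis :: "event list \<Rightarrow> nat" where
  "vis w = length (filter ((=) 0) (emits w))"

lemma emits_append [simp]: "emits (v @ w) = emits v @ emits w"
  by (induction v rule: emits.induct) auto

lemma vis_append [simp]: "vis (v @ w) = vis v + vis w"
  by (simp add: vis_def)

section \<open>Walks by single toggles\<close>

definition xor :: "nat set \<Rightarrow> nat set \<Rightarrow> nat set" where
  "xor S T = {u. (u \<in> S) \<noteq> (u \<in> T)}"

fun walk :: "nat set \<Rightarrow> nat list \<Rightarrow> nat set list" where
  "walk S [] = []"
| "walk S (0 # w) = S # walk S w"
| "walk S (Suc u # w) = walk (xor S {u}) w"

fun final :: "nat set \<Rightarrow> nat list \<Rightarrow> nat set" where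
  "final S [] = S"
| "final S (0 # w) = final S w"
| "final S (Suc u # w) = final (xor S {u}) w"

text \<open>\<open>gray i w j\<close>: at most three toggles separate two visits, where \<open>i\<close> toggles precede
  \<open>w\<close> since the last visit and \<open>j\<close> toggles follow the last visit.\<close>

fun gray :: "nat \<Rightarrow> nat list \<Rightarrow> nat \<Rightarrow> bool" where
  "gray i [] j \<longleftrightarrow> i = j"
| "gray i (0 # w) j \<longleftrightarrow> i \<le> 3 \<and> gray 0 w j"
| "gray i (Suc u # w) j \<longleftrightarrow> gray (Suc i) w j"

lemma walk_append: "walk S (v @ w) = walk S v @ walk (final S v) w"
  by (induction S v rule: walk.induct) auto

lemma final_append: "final S (v @ w) = final (final S v) w"
  by (induction S v rule: final.induct) auto

lemma gray_append: "gray i (v @ w) j \<longleftrightarrow> (\<exists>m. gray i v m \<and> gray m w j)"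
  by (induction i v j rule: gray.induct) auto

lemma xor_assoc: "xor (xor S T) X = xor S (xor T X)"
  by (auto simp: xor_def)

lemma xor_commute: "xor S T = xor T S"
  by (auto simp: xor_def)

lemma xor_empty [simp]: "xor S {} = S" "xor {} S = S"
  by (auto simp: xor_def)

text \<open>Walks are translation invariant. A call can thus be analysed as starting from the empty
  set and replayed from whatever set is current when it is made.\<close>

lemma walk_xor: "walk (xor S X) w = map (\<lambda>T. xor T X) (walk S w)"
proof (induction S w rule: walk.induct)
  case (3 S u w)
  then show ?case by (simp add: xor_assoc xor_commute[of X])
qed auto

lemma final_xor: "final (xor S X) w = xor (final S w) X"
proof (induction S w rule: final.induct)
  case (3 S u w)
  then show ?case by (simp add: xor_assoc xor_commute[of X])
qed auto

lemma walk_from: "walk S w = map (\<lambda>T. xor T S) (walk {} w)"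
  using walk_xor[of "{}" S w] by simp

lemma final_from: "final S w = xor (final {} w) S"
  using final_xor[of "{}" S w] by simp

lemma walk_toggles [simp]: "walk S (map Suc us) = []"
  by (induction us arbitrary: S) auto

lemma final_toggles: "distinct us \<Longrightarrow> final S (map Suc us) = xor S (set us)"
proof (induction us arbitrary: S)
  case (Cons u us)
  have "xor (xor S {u}) (set us) = xor S (insert u (set us))"
    using Cons.prems by (auto simp: xor_def)
  then show ?case using Cons by simp
qed simp

lemma gray_toggles: "gray i (map Suc us) j \<longleftrightarrow> j = i + length us"
  by (induction us arbitrary: i) auto

text \<open>\<open>V\<close> is the set visited last before the walk and \<open>i\<close> bounds its
  distance from the current set \<open>S\<close>. Prepending \<open>V\<close> to the list is what
  makes the induction go through.\<close>

lemma gray_differ: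
  assumes "gray i w j" "finite (xor V S)" "card (xor V S) \<le> i" "Suc n < length (V # walk S w)"
  shows "finite (xor ((V # walk S w) ! n) ((V # walk S w) ! Suc n)) \<and>
    card (xor ((V # walk S w) ! n) ((V # walk S w) ! Suc n)) \<le> 3"
  using assms
proof (induction S w arbitrary: V i n rule: walk.induct)
  case (2 S w)
  show ?case
  proof (cases n)
    case (Suc m)
    have "xor S S = {}" by (auto simp: xor_def)
    then show ?thesis using 2(1)[of 0 S m] 2(2-) Suc by simp
  qed (use 2 in simp)
next
  case (3 S u w)
  have sub: "xor V (xor S {u}) \<subseteq> insert u (xor V S)" by (auto simp: xor_def)
  then have "finite (xor V (xor S {u}))" using 3 finite_subset by blast
  moreover have "card (xor V (xor S {u})) \<le> Suc i"
    using card_mono[OF _ sub] card_insert_le_m1[of "Suc i" "xor V S" u] 3(3,4) by simp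
  ultimately show ?case using 3(1)[of "Suc i" V n] 3(2,5) by simp
qed simp

text \<open>How much a trace exceeds \<open>C\<close> steps per visit, in total (\<open>s\<close>), on prefixes and suffixes (\<open>a\<close>) and
  on factors (\<open>f\<close>); only the total adds up when traces are concatenated.\<close>

definition lag :: "nat \<Rightarrow> nat \<Rightarrow> nat \<Rightarrow> nat \<Rightarrow> event list \<Rightarrow> bool" where
  "lag C s a f w \<longleftrightarrow> length w \<le> C * vis w + s \<and>
    (\<forall>u v. w = u @ v \<longrightarrow> length u \<le> C * vis u + s + a \<and> length v \<le> C * vis v + s + a) \<and>
    (\<forall>u v z. w = u @ v @ z \<longrightarrow> length v \<le> C * vis v + s + f)"

text \<open>A factor across the seam is a suffix of \<open>x\<close> followed by a prefix of
  \<open>y\<close>, hence the condition \<open>2 * a \<le> f\<close>. Allowances \<open>s\<close>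
  add up, whereas \<open>a\<close> and \<open>f\<close> do not grow.\<close>

lemma lag_append:
  assumes x: "lag C s a f x" and y: "lag C s' a f y" and f: "2 * a \<le> f"
  shows "lag C (s + s') a f (x @ y)"
proof -
  have X1: "length x \<le> C * vis x + s" using x unfolding lag_def by blast
  have Xp: "\<And>u v. x = u @ v \<Longrightarrow> length u \<le> C * vis u + s + a" using x unfolding lag_def by blast
  have Xs: "\<And>u v. x = u @ v \<Longrightarrow> length v \<le> C * vis v + s + a" using x unfolding lag_def by blast
  have Xf: "\<And>u v z. x = u @ v @ z \<Longrightarrow> length v \<le> C * vis v + s + f" using x unfolding lag_def by blast
  have Y1: "length y \<le> C * vis y + s'" using y unfolding lag_def by blast
  have Yp: "\<And>u v. y = u @ v \<Longrightarrow> length u \<le> C * vis u + s' + a" using y unfolding lag_def by blast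
  have Ys: "\<And>u v. y = u @ v \<Longrightarrow> length v \<le> C * vis v + s' + a" using y unfolding lag_def by blast
  have Yf: "\<And>u v z. y = u @ v @ z \<Longrightarrow> length v \<le> C * vis v + s' + f" using y unfolding lag_def by blast
  have "length u \<le> C * vis u + (s + s') + a \<and> length v \<le> C * vis v + (s + s') + a"
    if "x @ y = u @ v" for u v
  proof -
    from that obtain us where "x = u @ us \<and> us @ y = v \<or> x @ us = u \<and> y = us @ v"
      by (auto simp: append_eq_append_conv2)
    then show ?thesis
    proof
      assume h: "x = u @ us \<and> us @ y = v"
      then have v: "v = us @ y" by simp
      show ?thesis using Xp[of u us] Xs[of u us] Y1 conjunct1[OF h] unfolding v by (simp add: algebra_simps)
    next
      assume h: "x @ us = u \<and> y = us @ v"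
      then have u: "u = x @ us" by simp
      show ?thesis using Yp[of us v] Ys[of us v] X1 conjunct2[OF h] unfolding u by (simp add: algebra_simps)
    qed
  qed
  moreover have "length v \<le> C * vis v + (s + s') + f" if "x @ y = u @ v @ z" for u v z
  proof -
    from that obtain us where "x = u @ us \<and> us @ y = v @ z \<or> x @ us = u \<and> y = us @ v @ z"
      by (auto simp: append_eq_append_conv2)
    then show ?thesis
    proof
      assume h: "x = u @ us \<and> us @ y = v @ z"
      then obtain vs where "us = v @ vs \<and> vs @ y = z \<or> us @ vs = v \<and> y = vs @ z"
        by (auto simp: append_eq_append_conv2)
      then show ?thesis
      proof
        assume "us = v @ vs \<and> vs @ y = z"
        then show ?thesis using Xf[of u v vs] h by simp
      next
        assume g: "us @ vs = v \<and> y = vs @ z"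
        then have v: "v = us @ vs" by simp
        show ?thesis using Xs[of u us] Yp[of vs z] conjunct1[OF h] conjunct2[OF g] f unfolding v
          by (simp add: algebra_simps)
      qed
    next
      assume "x @ us = u \<and> y = us @ v @ z"
      then show ?thesis using Yf[of us v z] by simp
    qed
  qed
  ultimately show ?thesis using X1 Y1 unfolding lag_def by (simp add: algebra_simps)
qed

lemma lag_short: "length w \<le> s \<Longrightarrow> lag C s a f w"
  by (auto simp: lag_def)

lemma lag_mono: "lag C s a f w \<Longrightarrow> s \<le> s' \<Longrightarrow> a \<le> a' \<Longrightarrow> f \<le> f' \<Longrightarrow> lag C s' a' f' w"
proof -
  assume l: "lag C s a f w" and m: "s \<le> s'" "a \<le> a'" "f \<le> f'"
  have t: "length w \<le> C * vis w + s" using l unfolding lag_def by blast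
  have p: "length u \<le> C * vis u + s + a \<and> length v \<le> C * vis v + s + a" if "w = u @ v" for u v
    using l that unfolding lag_def by blast
  have q: "length v \<le> C * vis v + s + f" if "w = u @ v @ z" for u v z
    using l that unfolding lag_def by blast
  have "length u \<le> C * vis u + s' + a' \<and> length v \<le> C * vis v + s' + a'" if "w = u @ v" for u v
    using p[OF that] m by linarith
  moreover have "length v \<le> C * vis v + s' + f'" if "w = u @ v @ z" for u v z
    using q[OF that] m by linarith
  moreover have "length w \<le> C * vis w + s'" using t m by linarith
  ultimately show ?thesis unfolding lag_def by blast
qed

text \<open>Once the visits pay for the whole trace, its allowance \<open>s\<close> can be moved
  into the bounds for prefixes, suffixes and factors. This happens once per node, so these bounds
  grow linearly with the depth of the recursion only. The factor 2 preserves the relation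
  \<open>2 * a \<le> f\<close> that concatenation needs.\<close>

lemma lag_close:
  "lag C s a f w \<Longrightarrow> length w \<le> C * vis w \<Longrightarrow> s \<le> Y \<Longrightarrow> lag C 0 (a + Y) (f + 2 * Y) w"
proof -
  assume l: "lag C s a f w" and w: "length w \<le> C * vis w" and Y: "s \<le> Y"
  have p: "length u \<le> C * vis u + s + a \<and> length v \<le> C * vis v + s + a" if "w = u @ v" for u v
    using l that unfolding lag_def by blast
  have q: "length v \<le> C * vis v + s + f" if "w = u @ v @ z" for u v z
    using l that unfolding lag_def by blast
  have "length u \<le> C * vis u + 0 + (a + Y) \<and> length v \<le> C * vis v + 0 + (a + Y)" if "w = u @ v" for u v
    using p[OF that] Y by linarith
  moreover have "length v \<le> C * vis v + 0 + (f + 2 * Y)" if "w = u @ v @ z" for u v z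
    using q[OF that] Y by linarith
  ultimately show ?thesis using w unfolding lag_def by simp
qed

section \<open>The traversal of a node of the recursion tree\<close>

text \<open>\<open>K\<close> is a time unit and \<open>Y\<close> bounds the own work of a node. The
  factor \<open>card P + 1\<close> bounds the nesting depth because blocks are proper subsets. A
  node spends at most three units for each unit of \<open>node_bound\<close>, whence
  \<open>12000 = 3 * 4000\<close>. At a leaf one visit has to pay for the weight 5 and one time
  unit, whence \<open>60001 = 5 * 12000 + 1\<close>.\<close>

definition good :: "nat \<Rightarrow> nat \<Rightarrow> (nat \<times> nat) set \<Rightarrow> nat set \<Rightarrow> nat set \<Rightarrow> bool \<Rightarrow> event list \<Rightarrow> bool" where
  "good K Y rho P J m w \<longleftrightarrow>
    visits rho P (walk {} (emits w)) \<and> final {} (emits w) = J \<and>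
    (\<forall>i \<le> (if m then 2 else 3). \<exists>j \<le> (if m then 0 else 1). gray i (emits w) j) \<and>
    length w + 12000 * K * weight rho P \<le> 60001 * K * vis w \<and>
    lag (60001 * K) 0 ((card P + 1) * Y) (2 * (card P + 1) * Y) w"

lemma good_leaf:
  assumes "emits w = [0]" "length w \<le> K" "K \<le> Y"
  shows "good K Y rho {} {} m w"
proof -
  have "lag (60001 * K) 0 ((card ({} :: nat set) + 1) * Y) (2 * (card ({} :: nat set) + 1) * Y) w"
    using assms(2,3) by (auto simp: lag_def vis_def assms(1))
  then show ?thesis using assms visits_empty by (auto simp: good_def weight_empty vis_def)
qed

text \<open>Position \<open>p\<close> stands for block \<open>p - 1\<close>, position 0 for the start of the tour.  The blocks below \<open>b\<close> are
  traversed upwards one after the other, then every second block on the way up to the top and the remaining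
  ones on the way down, so that the tour ends in block \<open>b\<close>.  The flag says whether a block is traversed
  downwards, that is, in the dual order and starting from the full block.\<close>

fun nxt :: "nat \<Rightarrow> nat \<Rightarrow> nat \<times> bool \<Rightarrow> nat \<times> bool" where
  "nxt b k (p, False) = (if p < b then (p + 1, False) else if p < k then (p + 2, False)
     else (2 * k + 1 - p, True))"
| "nxt b k (p, True) = (p - 2, True)"

text \<open>The current set ends as \<open>J\<close>, but the last set visited is \<open>Jst\<close>: unless \<open>m\<close> holds, one more toggle may
  be pending when the call returns.  In exchange such a call may be entered with three pending toggles
  instead of two.\<close>

locale tour = chain_split +
  fixes J Jst :: "nat set" and b :: nat and m :: bool and K Y :: nat
  assumes J: "J \<in> order_ideals rho P"
    and Jst: "Jst = (if m then J else insert (c 1) J)"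
    and b_le: "b \<le> k"
    and b_iff: "\<And>j. 1 \<le> j \<Longrightarrow> j \<le> k \<Longrightarrow> c j \<in> Jst \<longleftrightarrow> j \<le> b"
begin

text \<open>The chain elements with indices from \<open>min p p2\<close> to
  \<open>max p p2 - 1\<close>, which lie between the two blocks. Index 0 is virtual and
  skipped.\<close>

definition togs :: "nat \<Rightarrow> nat \<Rightarrow> nat list" where
  "togs p p2 = (if min p p2 = 0 then [] else [c (min p p2)]) @
    (if min p p2 + 2 = max p p2 then [c (min p p2 + 1)] else [])"

definition start :: "nat \<Rightarrow> bool \<Rightarrow> nat set" where
  "start p d = (if d then D (p - 1) \<union> B (p - 1) else D (p - 1))"

text \<open>The last ideal prescribed to the block is chosen to agree with the starting set of the
  next block outside the chain: on the way up it consists of the elements below the last toggled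
  chain element, on the way down of those not above the least one. Only the final block inherits its
  last ideal from \<open>Jst\<close>.\<close>

definition exit :: "nat \<Rightarrow> bool \<Rightarrow> nat set" where
  "exit p d = (if d \<and> p = b + 1 then B (p - 1) \<inter> Jst
     else if snd (nxt b k (p, d)) then {u \<in> B (p - 1). (c (min p (fst (nxt b k (p, d)))), u) \<notin> rho}
     else {u \<in> B (p - 1). (u, c (fst (nxt b k (p, d)) - 1)) \<in> rho})"

definition X :: "nat \<Rightarrow> bool \<Rightarrow> nat set" where
  "X p d = (if p = 0 then {} else D (p - 1) \<union> exit p d)"

text \<open>Beyond \<open>b\<close> the parity of \<open>p + b\<close> records the direction: even
  positions are taken on the way up, odd ones on the way down. The tour therefore ends at
  \<open>b + 1\<close>.\<close>

definition valid :: "nat \<Rightarrow> bool \<Rightarrow> bool" where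
  "valid p d \<longleftrightarrow> p \<le> k + 1 \<and> (if d then b < p \<and> odd (p + b) else p \<le> b \<or> even (p + b))"

definition todo :: "nat \<Rightarrow> bool \<Rightarrow> nat set" where
  "todo p d = {j. 1 \<le> j \<and> j \<le> k + 1 \<and>
     (if d then b < j \<and> j < p \<and> odd (j + b) else p < j \<or> b < j \<and> odd (j + b))}"

lemma valid_nxt:
  assumes "valid p d" "\<not> (d \<and> p = b + 1)" "nxt b k (p, d) = (p2, d2)"
  shows "valid p2 d2" "1 \<le> p2" "p2 \<le> k + 1" "p2 \<in> todo p d" "todo p2 d2 = todo p d - {p2}"
proof -
  note unf = valid_def todo_def set_eq_iff Diff_iff mem_Collect_eq singleton_iff
  have "valid p2 d2 \<and> 1 \<le> p2 \<and> p2 \<le> k + 1 \<and> p2 \<in> todo p d \<and> todo p2 d2 = todo p d - {p2}"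
  proof (cases d)
    case True
    then have v: "b < p" "odd (p + b)" "p \<noteq> b + 1" "p \<le> k + 1" using assms(1,2) by (auto simp: valid_def)
    have e: "d = True" "d2 = True" "p2 = p - 2" using assms(3) True by auto
    show ?thesis unfolding unf e using v by (simp only: if_True if_False) presburger
  next
    case False
    then have v: "p \<le> k + 1" "p \<le> b \<or> even (p + b)" using assms(1) by (auto simp: valid_def)
    consider "p < b" | "b \<le> p" "p < k" | "b \<le> p" "k \<le> p" by linarith
    then show ?thesis
    proof cases
      case 1
      then have e: "d = False" "d2 = False" "p2 = p + 1" using assms(3) False by auto
      show ?thesis unfolding unf e using v(1) 1 b_le by auto
    next
      case 2
      then have e: "d = False" "d2 = False" "p2 = p + 2" using assms(3) False by auto
      have "even (p + b)" using v(2) 2 by auto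
      then show ?thesis unfolding unf e if_False using v(1) 2
        by (intro conjI allI; (presburger | simp))
    next
      case 3
      then have e: "d = False" "d2 = True" "p2 = 2 * k + 1 - p" using assms(3) False by auto
      have "even (p + b)" using v(2) 3 by auto
      moreover have "p = k \<or> p = k + 1" using v(1) 3 by auto
      ultimately show ?thesis
      proof (elim disjE)
        assume p: "p = k" and o: "even (p + b)"
        have e: "d = False" "d2 = True" "p2 = k + 1" using e p by auto
        show ?thesis unfolding unf e p if_True if_False using o[unfolded p] b_le k_pos
          by (intro conjI allI; presburger)
      next
        assume p: "p = k + 1" and o: "even (p + b)"
        have e: "d = False" "d2 = True" "p2 = k" using e p by auto
        show ?thesis unfolding unf e p if_True if_False using o[unfolded p] b_le k_pos
          by (intro conjI allI; presburger)
      qed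
    qed
  qed
  then show "valid p2 d2" "1 \<le> p2" "p2 \<le> k + 1" "p2 \<in> todo p d" "todo p2 d2 = todo p d - {p2}"
    by auto
qed

text \<open>By the choice of \<open>exit\<close>, the set on leaving a block and the starting set of
  the next one differ in chain elements only. Maximality of the chain enters through
  \<open>between\<close>, \<open>below_first\<close> and \<open>above_last\<close>: no further
  element lies between the two blocks, below \<open>c 1\<close> or above \<open>c k\<close>. The
  cases are the first move, two upward moves in one, the two ways to turn at the top, and the
  downward move.\<close>

lemma start_step:
  assumes v: "valid p d" and nd: "\<not> (d \<and> p = b + 1)" and n: "nxt b k (p, d) = (p2, d2)"
  shows "xor (X p d) (set (togs p p2)) = start p2 d2"
proof -
  have ex: "exit p d = (if d2 then {u \<in> B (p - 1). (c (min p p2), u) \<notin> rho}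
     else {u \<in> B (p - 1). (u, c (p2 - 1)) \<in> rho})"
    using nd n by (auto simp: exit_def)
  consider (first) "p = 0" "\<not> d" | (asc) "1 \<le> p" "\<not> d" "\<not> d2" "p2 = p + 1 \<or> p2 = p + 2" "p2 \<le> k + 1"
    | (up) "\<not> d" "d2" "p = k" "p2 = k + 1" | (down) "\<not> d" "d2" "p = k + 1" "p2 = k"
    | (desc) "d" "d2" "3 \<le> p" "p \<le> k + 1" "p2 = p - 2"
  proof (cases d)
    case True
    then have "b < p" "odd (p + b)" "p \<noteq> b + 1" using v nd by (auto simp: valid_def)
    then have "3 \<le> p" by presburger
    then show ?thesis using that(5) n v True by (auto simp: valid_def)
  next
    case False
    consider "p = 0" | "1 \<le> p" "p < b" | "1 \<le> p" "\<not> p < b" "p < k" | "\<not> p < b" "\<not> p < k" "1 \<le> p"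
      by linarith
    then show ?thesis
    proof cases
      case 1 then show ?thesis using that(1) False by simp
    next
      case 2 then show ?thesis using that(2) n False b_le by simp
    next
      case 3 then show ?thesis using that(2) n False by simp
    next
      case 4
      then have "p = k \<or> p = k + 1" using v by (auto simp: valid_def)
      then show ?thesis using that(3,4) n False 4 by auto
    qed
  qed
  then show ?thesis
  proof cases
    case first
    have "D 0 = {}" by (auto simp: down_part_def)
    moreover have "D 1 = {c 1}" using below_first c_in[of 1] k_pos refl by (auto simp: in_down)
    moreover have "0 < k" using k_pos by auto
    moreover have "p2 = (if b = 0 then 2 else 1)" "\<not> d2"
      using first n \<open>0 < k\<close> by (auto split: if_splits)
    ultimately show ?thesis using first by (simp add: X_def togs_def start_def)
  next
    case asc
    then have mm: "min p p2 = p" "max p p2 = p2" by auto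
    have img: "{u. \<exists>j. p \<le> j \<and> j < p2 \<and> u = c j} = c ` {p..<p2}" by auto
    have t: "set (togs p p2) = {u. \<exists>j. p \<le> j \<and> j < p2 \<and> u = c j}"
    proof (cases "p2 = p + 1")
      case True
      then have "{p..<p2} = {p}" by auto
      then show ?thesis unfolding img using asc(1) mm True by (simp add: togs_def)
    next
      case False
      then have p2: "p2 = p + 2" using asc by simp
      then have "{p..<p2} = {p, p + 1}" by auto
      then show ?thesis unfolding img using asc(1) mm p2 by (auto simp: togs_def)
    qed
    have p1: "p - 1 \<le> k" "p \<le> k" using asc by auto
    have "u \<in> xor (X p d) (set (togs p p2)) \<longleftrightarrow> u \<in> start p2 d2" for u
    proof (cases "u \<in> set (togs p p2)")
      case True
      then obtain j where j: "p \<le> j" "j < p2" "u = c j" using t by auto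
      have jk: "1 \<le> j" "j \<le> k" "1 \<le> p2 - 1" "p2 - 1 \<le> k" "j \<le> p2 - 1" using j asc by auto
      have "u \<notin> D (p - 1)" using j jk p1 c_le_iff[of j "p - 1"] by (auto simp: in_down)
      moreover have "u \<notin> B (p - 1)" using B_C[OF p1(1)] c_mem[OF jk(1,2)] j by auto
      moreover have "u \<in> D (p2 - 1)" using j jk c_le_iff[of j "p2 - 1"] c_in[of j] by (auto simp: in_down)
      ultimately show ?thesis using True asc ex by (auto simp: xor_def X_def start_def)
    next
      case False
      have "u \<in> D (p - 1) \<or> u \<in> B (p - 1) \<and> (u, c (p2 - 1)) \<in> rho \<longleftrightarrow> u \<in> D (p2 - 1)"
      proof
        assume l: "u \<in> D (p - 1) \<or> u \<in> B (p - 1) \<and> (u, c (p2 - 1)) \<in> rho"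
        moreover have "1 \<le> p - 1 \<Longrightarrow> (c (p - 1), c (p2 - 1)) \<in> rho"
          using c_le_iff[of "p - 1" "p2 - 1"] asc by auto
        ultimately show "u \<in> D (p2 - 1)" using trans B_sub[of "p - 1"] asc
          by (auto simp: in_down)
      next
        assume r: "u \<in> D (p2 - 1)"
        then have r': "u \<in> P" "(u, c (p2 - 1)) \<in> rho" by (auto simp: in_down)
        have "(c p, u) \<notin> rho"
        proof
          assume "(c p, u) \<in> rho"
          then have "u = c p \<or> p2 = p + 2 \<and> u = c (p + 1)"
            using asc r' antisym[of u "c p"] between[of p u] by auto
          moreover have "c p \<in> c ` {p..<p2}" "p2 = p + 2 \<Longrightarrow> c (p + 1) \<in> c ` {p..<p2}"
            using asc(4) by (intro imageI; simp; linarith)+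
          ultimately show False using False t img by metis
        qed
        then show "u \<in> D (p - 1) \<or> u \<in> B (p - 1) \<and> (u, c (p2 - 1)) \<in> rho"
          using r' asc p1 by (auto simp: in_B in_down)
      qed
      then show ?thesis using False asc ex by (auto simp: xor_def X_def start_def)
    qed
    then show ?thesis by (rule set_eqI)
  next
    case up
    have t: "set (togs p p2) = {c k}" using up k_pos by (auto simp: togs_def)
    have k1: "k - 1 \<le> k" "Suc (k - 1) = k" using k_pos by auto
    have "X p d = D (k - 1) \<union> B (k - 1)" using up k_pos ex in_B[OF k1(1)] k1 by (auto simp: X_def)
    also have "\<dots> = {u \<in> P. (c k, u) \<notin> rho}" using D_un_B[OF k1(1)] k1(2) k_pos by auto
    finally have "xor (X p d) (set (togs p p2)) = P"
      using t above_last c_in[of k] k_pos refl by (auto simp: xor_def)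
    also have "\<dots> = start p2 d2" using up D_un_B[of k] by (auto simp: start_def)
    finally show ?thesis .
  next
    case down
    have t: "set (togs p p2) = {c k}" using down k_pos by (auto simp: togs_def)
    have k1: "k - 1 \<le> k" "Suc (k - 1) = k" using k_pos by auto
    have s: "start p2 d2 = {u \<in> P. (c k, u) \<notin> rho}"
      using down D_un_B[OF k1(1)] k1(2) k_pos by (auto simp: start_def)
    have x: "X p d = D k \<union> {u \<in> B k. (c k, u) \<notin> rho}" using down ex by (auto simp: X_def)
    have ck: "c k \<in> P" using c_in[of k] k_pos by simp
    have "u \<in> xor (X p d) {c k} \<longleftrightarrow> u \<in> start p2 d2" for u
    proof (cases "u = c k")
      case True
      then have "u \<in> X p d" "u \<notin> start p2 d2" using x s ck refl[OF ck] k_pos by (auto simp: in_down)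
      then show ?thesis using True by (simp add: xor_def)
    next
      case False
      have "u \<in> X p d \<longleftrightarrow> u \<in> P \<and> (c k, u) \<notin> rho"
        unfolding x using antisym[of u "c k"] False k_pos in_B[of k u] by (simp add: in_down) blast
      then show ?thesis using False s by (simp add: xor_def)
    qed
    then show ?thesis unfolding t by (rule set_eqI)
  next
    case desc
    obtain q where q: "p = q + 3" using desc(3) by (metis add.commute le_Suc_ex)
    then have qk: "q + 2 \<le> k" "p2 = q + 1" using desc by auto
    have t: "set (togs p p2) = {c (q + 1), c (q + 2)}" using q qk by (auto simp: togs_def)
    have s: "start p2 d2 = {u \<in> P. (c (q + 1), u) \<notin> rho}"
      using D_un_B[of q] qk by (simp add: start_def desc(2))
    have x: "X p d = D (q + 2) \<union> {u \<in> B (q + 2). (c (q + 1), u) \<notin> rho}"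
    proof -
      have "min p p2 = q + 1" "p - 1 = q + 2" "p \<noteq> 0" using q qk by auto
      then show ?thesis using desc(2) by (simp add: X_def ex)
    qed
    have cc: "c (q + 1) \<in> P" "c (q + 2) \<in> P" "(c (q + 1), c (q + 2)) \<in> rho"
      "q + 2 < k \<Longrightarrow> (c (q + 1), c (Suc (q + 2))) \<in> rho"
      using c_in[of "q + 1"] c_in[of "q + 2"] c_le_iff[of "q + 1" "q + 2"]
        c_le_iff[of "q + 1" "Suc (q + 2)"] qk by auto
    have "u \<in> xor (X p d) {c (q + 1), c (q + 2)} \<longleftrightarrow> u \<in> start p2 d2" for u
    proof (cases "u \<in> {c (q + 1), c (q + 2)}")
      case True
      then have "u \<in> X p d" "u \<notin> start p2 d2" using x s cc refl by (auto simp: in_down)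
      then show ?thesis using True by (auto simp: xor_def)
    next
      case False
      have "u \<in> X p d \<longleftrightarrow> u \<in> start p2 d2"
      proof
        assume "u \<in> X p d"
        then show "u \<in> start p2 d2"
          using x s B_sub[of "q + 2"] between[of "q + 1" u] False qk by (auto simp: in_down)
      next
        assume "u \<in> start p2 d2"
        then have u: "u \<in> P" "(c (q + 1), u) \<notin> rho" using s by auto
        then have "q + 2 < k \<longrightarrow> (c (Suc (q + 2)), u) \<notin> rho" using cc(4) trans by blast
        then show "u \<in> X p d" using u x in_B[of "q + 2" u] qk by (auto simp: in_down)
      qed
      then show ?thesis using False by (auto simp: xor_def)
    qed
    then show ?thesis unfolding t by (rule set_eqI)
  qed
qed

lemma Jst_ideal: "Jst \<in> order_ideals rho P"
proof -
  have sub: "J \<subseteq> P" and down: "\<And>u v. u \<in> P \<Longrightarrow> v \<in> J \<Longrightarrow> (u, v) \<in> rho \<Longrightarrow> u \<in> J"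
    using J unfolding order_ideals_def by blast+
  have "insert (c 1) J \<subseteq> P" using sub c_in[of 1] k_pos by simp
  moreover have "u \<in> insert (c 1) J" if "u \<in> P" "v \<in> insert (c 1) J" "(u, v) \<in> rho" for u v
    using down[of u v] below_first[of u] that by blast
  ultimately have "insert (c 1) J \<in> order_ideals rho P" unfolding order_ideals_def by blast
  then show ?thesis using J unfolding Jst by simp
qed

lemma exit_sub: "exit p d \<subseteq> B (p - 1)"
  by (auto simp: exit_def)

lemma X_done: "X (b + 1) True = Jst"
proof -
  have J': "Jst \<subseteq> P" "\<And>u v. u \<in> P \<Longrightarrow> v \<in> Jst \<Longrightarrow> (u, v) \<in> rho \<Longrightarrow> u \<in> Jst"
    using Jst_ideal by (simp_all add: order_ideals_def)
  have "D b \<subseteq> Jst" using J'(2) b_iff[of b] b_le by (auto simp: in_down)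
  moreover have "Jst \<subseteq> D b \<union> B b"
    unfolding D_un_B[OF b_le] using J' b_iff[of "Suc b"] c_in[of "Suc b"] by auto
  ultimately show ?thesis by (auto simp: X_def exit_def)
qed

text \<open>The number of toggles that may be pending when the tour stands at \<open>p\<close>. At
  the start it is 3 only if the first move toggles nothing, that is, if block 0 comes first; for
  \<open>b = 0\<close> the tour begins with block 1 and toggles \<open>c 1\<close>.\<close>

definition slack :: "nat \<Rightarrow> bool \<Rightarrow> nat" where
  "slack p d = (if d then 0 else if 1 \<le> p then 1 else if b = 0 then 2 else 3)"

definition tgood :: "nat \<Rightarrow> bool \<Rightarrow> event list \<Rightarrow> bool" where
  "tgood p d w \<longleftrightarrow> (\<exists>js out. distinct js \<and> set js = todo p d \<and>
    (\<forall>j\<in>todo p d. visits rho (B (j - 1)) (out j)) \<and>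
    walk (X p d) (emits w) = concat (map (\<lambda>j. map ((\<union>) (D (j - 1))) (out j)) js) \<and>
    final (X p d) (emits w) = Jst \<and>
    (\<forall>i \<le> slack p d. gray i (emits w) 0) \<and>
    length w + 12000 * K * (\<Sum>j\<in>todo p d. weight rho (B (j - 1)))
      \<le> 60001 * K * vis w + K * card (todo p d) \<and>
    lag (60001 * K) (K * card (todo p d)) (card P * Y) (2 * card P * Y) w)"

lemma finite_todo: "finite (todo p d)"
  by (rule finite_subset[of _ "{..k + 1}"]) (auto simp: todo_def)

lemma tgood_done: "tgood (b + 1) True []"
proof -
  have "todo (b + 1) True = {}" by (auto simp: todo_def)
  then show ?thesis using X_done by (simp add: tgood_def slack_def vis_def lag_short)
qed

text \<open>The critical moves are those of two positions: on the way up one toggle may already be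
  pending, on the way down none. At the turn a pending toggle meets a single new one.\<close>

lemma togs_slack:
  assumes "valid p d" "\<not> (d \<and> p = b + 1)" "nxt b k (p, d) = (p2, d2)"
  shows "slack p d + length (togs p p2) \<le> (if d2 then 2 else 3)" "distinct (togs p p2)"
proof -
  show "slack p d + length (togs p p2) \<le> (if d2 then 2 else 3)"
    using assms k_pos b_le
    by (cases d) (auto simp: slack_def togs_def valid_def split: if_splits)
  have "min p p2 + 2 = max p p2 \<Longrightarrow> min p p2 \<noteq> 0 \<Longrightarrow> c (min p p2) \<noteq> c (min p p2 + 1)"
    using c_less[of "min p p2" "min p p2 + 1"] valid_nxt(3)[OF assms] assms(1)
    by (auto simp: valid_def max_def split: if_splits)
  then show "distinct (togs p p2)" by (auto simp: togs_def)
qed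

text \<open>The trace of the child, recorded from the empty set in its own order, is replayed from
  \<open>start p2 d2\<close>. For a downward block that set is full, so toggling removes elements
  and the visited sets become complements within the block, as in
  \<open>visits_dual\<close>.\<close>

lemma tgood_step:
  assumes v: "valid p d" "\<not> (d \<and> p = b + 1)" "nxt b k (p, d) = (p2, d2)"
    and seg: "emits seg = map Suc (togs p p2)" "length seg \<le> K"
    and wc: "good K Y (if d2 then rho\<inverse> else rho) (B (p2 - 1))
      (if d2 then B (p2 - 1) - exit p2 d2 else exit p2 d2) d2 wc"
    and w: "tgood p2 d2 w"
  shows "tgood p d (seg @ wc @ w)"
proof -
  let ?S = "start p2 d2" and ?Q = "B (p2 - 1)" and ?D = "D (p2 - 1)"
  note n = valid_nxt[OF v]
  have pk: "p2 - 1 \<le> k" using n by auto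
  have finQ: "finite ?Q" "?Q \<subseteq> E" using finite_subset[OF B_sub fin] B_sub sub by auto
  define Ts where "Ts = walk {} (emits wc)"
  have wc': "visits (if d2 then rho\<inverse> else rho) ?Q Ts"
    "final {} (emits wc) = (if d2 then ?Q - exit p2 d2 else exit p2 d2)"
    "\<And>i. i \<le> (if d2 then 2 else 3) \<Longrightarrow> \<exists>j \<le> (if d2 then 0 else 1). gray i (emits wc) j"
    "length wc + 12000 * K * weight rho ?Q \<le> 60001 * K * vis wc"
    "lag (60001 * K) 0 ((card ?Q + 1) * Y) (2 * (card ?Q + 1) * Y) wc"
    using wc weight_dual by (auto simp: good_def Ts_def split: if_splits)
  obtain js out where js: "distinct js" "set js = todo p2 d2"
    "\<And>j. j\<in>todo p2 d2 \<Longrightarrow> visits rho (B (j - 1)) (out j)"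
    "walk (X p2 d2) (emits w) = concat (map (\<lambda>j. map ((\<union>) (D (j - 1))) (out j)) js)"
    "final (X p2 d2) (emits w) = Jst"
    "\<And>i. i \<le> slack p2 d2 \<Longrightarrow> gray i (emits w) 0"
    "length w + 12000 * K * (\<Sum>j\<in>todo p2 d2. weight rho (B (j - 1)))
      \<le> 60001 * K * vis w + K * card (todo p2 d2)"
    "lag (60001 * K) (K * card (todo p2 d2)) (card P * Y) (2 * card P * Y) w"
    using w unfolding tgood_def by blast
  have todo: "todo p d = insert p2 (todo p2 d2)" "p2 \<notin> todo p2 d2" using n by auto
  define Ts' where "Ts' = (if d2 then map (\<lambda>T. ?Q - T) Ts else Ts)"
  have Tsub: "T \<subseteq> ?Q" if "T \<in> set Ts" for T using visits_sub[OF wc'(1)] that by auto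
  have vT: "visits rho ?Q Ts'" using wc'(1) visits_dual[OF _ po finQ(2,1)] by (auto simp: Ts'_def)
  have DB: "?D \<inter> ?Q = {}" using D_B[OF pk] .
  have walk1: "walk (X p d) (emits seg @ emits wc @ emits w) =
      map ((\<union>) ?D) Ts' @ walk (X p2 d2) (emits w)"
    and fin1: "final (X p d) (emits seg @ emits wc @ emits w) = final (X p2 d2) (emits w)"
  proof -
    have f1: "final (X p d) (emits seg) = ?S"
      using start_step[OF v] final_toggles[OF togs_slack(2)[OF v]] by (simp add: seg)
    have "X p2 d2 = ?D \<union> exit p2 d2" using n by (auto simp: X_def)
    then have f2: "final ?S (emits wc) = X p2 d2"
      unfolding final_from[of ?S] wc'(2) using exit_sub[of p2 d2] DB by (auto simp: start_def xor_def)
    have "walk ?S (emits wc) = map ((\<union>) ?D) Ts'"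
    proof (cases d2)
      case True
      have "xor T ?S = ?D \<union> (?Q - T)" if "T \<in> set Ts" for T
        using Tsub[OF that] DB True by (auto simp: xor_def start_def)
      then show ?thesis unfolding walk_from[of ?S] using True by (simp add: Ts'_def flip: Ts_def)
    next
      case False
      have "xor T ?S = ?D \<union> T" if "T \<in> set Ts" for T
        using Tsub[OF that] DB False by (auto simp: xor_def start_def)
      then show ?thesis unfolding walk_from[of ?S] using False by (simp add: Ts'_def flip: Ts_def)
    qed
    then show "walk (X p d) (emits seg @ emits wc @ emits w) =
      map ((\<union>) ?D) Ts' @ walk (X p2 d2) (emits w)" by (simp add: walk_append f1 f2) (simp add: seg)
    show "final (X p d) (emits seg @ emits wc @ emits w) = final (X p2 d2) (emits w)"
      by (simp add: final_append f1 f2)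
  qed
  have grayt: "gray i (emits seg @ emits wc @ emits w) 0" if i: "i \<le> slack p d" for i
  proof -
    obtain j where j: "j \<le> (if d2 then 0 else 1)" "gray (i + length (togs p p2)) (emits wc) j"
      using wc'(3)[of "i + length (togs p p2)"] togs_slack(1)[OF v] i by fastforce
    have "gray j (emits w) 0" using js(6)[of j] j(1) n by (auto simp: slack_def split: if_splits)
    then show ?thesis using j(2) by (auto simp: gray_append seg gray_toggles)
  qed
  have cardt: "card (todo p d) = card (todo p2 d2) + 1" using todo finite_todo by simp
  have amort: "length (seg @ wc @ w) + 12000 * K * (\<Sum>j\<in>todo p d. weight rho (B (j - 1)))
      \<le> 60001 * K * vis (seg @ wc @ w) + K * card (todo p d)"
  proof -
    have "(\<Sum>j\<in>todo p d. weight rho (B (j - 1))) = weight rho ?Q + (\<Sum>j\<in>todo p2 d2. weight rho (B (j - 1)))"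
      using todo finite_todo by simp
    then have "12000 * K * (\<Sum>j\<in>todo p d. weight rho (B (j - 1)))
      = 12000 * K * weight rho ?Q + 12000 * K * (\<Sum>j\<in>todo p2 d2. weight rho (B (j - 1)))"
      by (simp only: add_mult_distrib2)
    moreover have "60001 * K * vis (seg @ wc @ w)
      = 60001 * K * vis seg + 60001 * K * vis wc + 60001 * K * vis w"
      by (simp only: vis_append add_mult_distrib2 add.assoc)
    moreover have "K * card (todo p d) = K * card (todo p2 d2) + K" using cardt by simp
    ultimately show ?thesis using seg(2) wc'(4) js(7) by simp
  qed
  have lagt: "lag (60001 * K) (K * card (todo p d)) (card P * Y) (2 * card P * Y) (seg @ wc @ w)"
  proof -
    \<comment> \<open>A block is a proper subset, so the bound \<open>card ?Q + 1\<close> of the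
      child fits under the \<open>card P\<close> of the tour, and one further \<open>Y\<close>
      remains for the node itself.\<close>
    have "card ?Q < card P" using B_psub[OF pk] fin by (rule psubset_card_mono[rotated])
    then have "(card ?Q + 1) * Y \<le> card P * Y" "2 * (card ?Q + 1) * Y \<le> 2 * card P * Y"
      by (intro mult_le_mono1, simp)+
    from lag_mono[OF wc'(5) order_refl this]
    have "lag (60001 * K) 0 (card P * Y) (2 * card P * Y) wc" .
    from lag_append[OF lag_short[OF seg(2)] lag_append[OF this js(8)]]
    show ?thesis using cardt by (simp add: algebra_simps)
  qed
  have outs: "map (\<lambda>j. map ((\<union>) (D (j - 1))) ((out(p2 := Ts')) j)) (p2 # js)
    = map ((\<union>) ?D) Ts' # map (\<lambda>j. map ((\<union>) (D (j - 1))) (out j)) js"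
  proof -
    have "p2 \<notin> set js" using js todo by auto
    then show ?thesis by (auto intro!: map_cong)
  qed
  show ?thesis unfolding tgood_def
  proof (intro exI[of _ "p2 # js"] exI[of _ "out(p2 := Ts')"] conjI)
    show "distinct (p2 # js)" "set (p2 # js) = todo p d" using js todo by auto
    show "\<forall>j\<in>todo p d. visits rho (B (j - 1)) ((out(p2 := Ts')) j)" using js vT todo by auto
    show "walk (X p d) (emits (seg @ wc @ w)) =
      concat (map (\<lambda>j. map ((\<union>) (D (j - 1))) ((out(p2 := Ts')) j)) (p2 # js))"
      unfolding outs using walk1 js(4) by simp
    show "final (X p d) (emits (seg @ wc @ w)) = Jst" using fin1 js(5) by simp
    show "\<forall>i\<le>slack p d. gray i (emits (seg @ wc @ w)) 0" using grayt by simp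
  qed (fact amort lagt)+
qed

text \<open>\<open>pre\<close> is the time for chain and blocks, \<open>post\<close> the toggle that
  takes \<open>Jst\<close> back to \<open>J\<close>. The surplus of weight in the blocks,
  \<open>card G\<close> by \<open>weight_split\<close>, pays for both and for the moves of the
  tour.\<close>

lemma tgood_root:
  assumes w: "tgood 0 False w"
    and pre: "emits pre = []" "length pre \<le> K * (1 + card P + card (incomparable rho P))"
    and post: "emits post = (if m \<or> c 1 \<in> J then [] else [Suc (c 1)])" "length post \<le> K"
    and Y: "3 * K * (1 + card P + card (incomparable rho P)) \<le> Y"
  shows "good K Y rho P J m (pre @ w @ post)"
proof -
  have todo: "todo 0 False = {1..k + 1}" by (auto simp: todo_def)
  have X0: "X 0 False = {}" by (simp add: X_def)
  obtain js out where js: "distinct js" "set js = {1..k + 1}"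
    "\<And>j. j\<in>{1..k + 1} \<Longrightarrow> visits rho (B (j - 1)) (out j)"
    "walk {} (emits w) = concat (map (\<lambda>j. map ((\<union>) (D (j - 1))) (out j)) js)"
    "final {} (emits w) = Jst"
    "\<And>i. i \<le> slack 0 False \<Longrightarrow> gray i (emits w) 0"
    "length w + 12000 * K * (\<Sum>j\<in>{1..k + 1}. weight rho (B (j - 1)))
      \<le> 60001 * K * vis w + K * card {1..k + 1}"
    "lag (60001 * K) (K * card {1..k + 1}) (card P * Y) (2 * card P * Y) w"
    using w unfolding tgood_def todo X0 by blast
  let ?js = "map (\<lambda>j. j - 1) js"
  have "distinct ?js" using js(1,2) by (auto simp: distinct_map intro!: inj_onI)
  moreover have "set ?js = {0..k}"
  proof -
    have "i \<in> (\<lambda>j. j - 1) ` {1..k + 1}" if "i \<le> k" for i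
      using that by (intro image_eqI[of _ _ "i + 1"]) auto
    then show ?thesis using js(2) by auto
  qed
  moreover have "\<forall>i\<in>{0..k}. visits rho (B i) (out (i + 1))" using js(3)[of "_ + 1"] by auto
  ultimately have vv: "visits rho P (concat (map (\<lambda>i. map ((\<union>) (D i)) (out (i + 1))) ?js))"
    by (intro visits_node[OF ne longest])
  have me: "map (\<lambda>i. map ((\<union>) (D i)) (out (i + 1))) ?js
    = map (\<lambda>j. map ((\<union>) (D (j - 1))) (out j)) js"
    using js(2) by (auto simp: comp_def)
  have v: "visits rho P (walk {} (emits w))" using vv[unfolded me] js(4) by simp
  have ctr: "c 1 \<in> J \<Longrightarrow> insert (c 1) J = J" by auto
  have f: "final {} (emits w @ emits post) = J"
    by (auto simp: final_append js(5) Jst post ctr xor_def)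
  \<comment> \<open>Without \<open>m\<close>, \<open>c 1\<close> is counted into \<open>Jst\<close>;
    the tour then starts with block 0 and tolerates the third pending toggle.\<close>
  have b1: "\<not> m \<Longrightarrow> 1 \<le> b" using b_iff[of 1] k_pos by (auto simp: Jst)
  have g: "\<exists>j \<le> (if m then 0 else 1). gray i (emits w @ emits post) j"
    if i: "i \<le> (if m then 2 else 3)" for i
  proof -
    have "gray i (emits w) 0" using js(6)[of i] i b1 by (auto simp: slack_def split: if_splits)
    then show ?thesis by (auto simp: gray_append post split: if_splits)
  qed
  have kP: "k \<le> card P" using distinct_card[OF distinct_cs] card_mono[OF fin C_sub] by simp
  have P1: "1 \<le> card P" using ne fin by (simp add: Suc_le_eq card_gt_0_iff)
  let ?Z = "1 + card P + card (incomparable rho P)"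
  have tot: "length pre + K * card {1..k + 1} + length post \<le> 3 * K * ?Z"
  proof -
    have "K * (k + 2) \<le> K * (2 * ?Z)" using kP P1 by (intro mult_le_mono2) auto
    then show ?thesis using pre(2) post(2) by (simp add: algebra_simps)
  qed
  have sumw: "(\<Sum>j\<in>{1..k + 1}. weight rho (B (j - 1))) = (\<Sum>i\<le>k. weight rho (B i))"
    by (rule sum.reindex_bij_witness[of _ "\<lambda>i. i + 1" "\<lambda>j. j - 1"]) auto
  have v0: "vis pre = 0" "vis post = 0" using pre post by (auto simp: vis_def)
  have amort: "length (pre @ w @ post) + 12000 * K * weight rho P \<le> 60001 * K * vis (pre @ w @ post)"
  proof -
    \<comment> \<open>The own time of the node is converted into antichains through the
      chain.\<close>
    have "3 * K * ?Z \<le> 3 * K * (4000 * card G)" using node_bound by (intro mult_le_mono2) auto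
    then have "3 * K * ?Z \<le> 12000 * K * card G" by simp
    moreover have "12000 * K * (weight rho P + card G) \<le> 12000 * K * (\<Sum>i\<le>k. weight rho (B i))"
      by (intro mult_le_mono2 weight_split)
    then have "12000 * K * weight rho P + 12000 * K * card G \<le> 12000 * K * (\<Sum>i\<le>k. weight rho (B i))"
      by (simp only: add_mult_distrib2)
    ultimately show ?thesis using js(7) tot v0 unfolding sumw by simp
  qed
  have l: "lag (60001 * K) (length pre + (K * card {1..k + 1} + length post)) (card P * Y) (2 * card P * Y)
    (pre @ w @ post)"
    by (intro lag_append lag_short js(8)) auto
  have "length (pre @ w @ post) \<le> 60001 * K * vis (pre @ w @ post)" using amort by simp
  moreover have "length pre + (K * card {1..k + 1} + length post) \<le> Y" using tot Y by simp
  ultimately have "lag (60001 * K) 0 (card P * Y + Y) (2 * card P * Y + 2 * Y) (pre @ w @ post)"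
    by (rule lag_close[OF l])
  then have "lag (60001 * K) 0 ((card P + 1) * Y) (2 * (card P + 1) * Y) (pre @ w @ post)"
    by (simp add: algebra_simps)
  moreover have "walk {} (emits (pre @ w @ post)) = walk {} (emits w)"
    by (simp add: walk_append pre(1) post(1))
  moreover have "emits (pre @ w @ post) = emits w @ emits post" by (simp add: pre(1))
  ultimately show ?thesis unfolding good_def using v f g amort by simp
qed

end

section \<open>A structured language for the machine\<close>

text \<open>A state consists of the variables and of the arrays.  Array 0 is the input matrix, array 1
  the output vector.\<close>

type_synonym state = "(nat \<Rightarrow> nat) \<times> (nat \<Rightarrow> nat \<Rightarrow> nat)"

datatype exp = N nat | V nat | Plus exp exp | Minus exp exp | Times exp exp | At nat exp

datatype com = Skip | Assign nat exp | Write nat exp exp | Emt exp | Show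
  | Seq com com (infixr ";;" 60) | Cond exp com com | Loop exp com

fun ev :: "exp \<Rightarrow> state \<Rightarrow> nat" where
  "ev (N k) s = k"
| "ev (V x) s = fst s x"
| "ev (Plus a b) s = ev a s + ev b s"
| "ev (Minus a b) s = ev a s - ev b s"
| "ev (Times a b) s = ev a s * ev b s"
| "ev (At a e) s = snd s a (ev e s)"

fun outs :: "event list \<Rightarrow> (nat \<Rightarrow> nat) list" where
  "outs [] = []"
| "outs (Out f # w) = f # outs w"
| "outs (_ # w) = outs w"

lemma outs_append [simp]: "outs (v @ w) = outs v @ outs w"
  by (induction v rule: outs.induct) auto

text \<open>Starting with a budget of \<open>b\<close> steps, every output comes before the budget is exhausted
  and resets it to \<open>D\<close>; at least \<open>b'\<close> steps are left in the end.\<close>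

fun due :: "nat \<Rightarrow> nat \<Rightarrow> event list \<Rightarrow> nat \<Rightarrow> bool" where
  "due D b [] b' \<longleftrightarrow> b' \<le> b"
| "due D b (Out f # w) b' \<longleftrightarrow> due D D w b'"
| "due D b (Tick # w) b' \<longleftrightarrow> 0 < b \<and> due D (b - 1) w b'"
| "due D b (Emit x # w) b' \<longleftrightarrow> 0 < b \<and> due D (b - 1) w b'"

lemma due_mono: "due D b w b' \<Longrightarrow> b \<le> a \<Longrightarrow> a' \<le> b' \<Longrightarrow> due D a w a'"
proof (induction D b w b' arbitrary: a rule: due.induct)
  case (3 D b w b')
  then show ?case using 3(1)[of "a - 1"] by simp
next
  case (4 D b x w b')
  then show ?case using 4(1)[of "a - 1"] by simp
qed auto

lemma due_append: "due D b v m \<Longrightarrow> due D m w b' \<Longrightarrow> due D b (v @ w) b'"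
proof (induction D b v m rule: due.induct)
  case (1 D b m)
  then show ?case using due_mono by auto
qed auto

locale ram =
  fixes n M W :: nat
  assumes wide: "n * n + n + 30 * M + 100 < W"
begin

definition lim :: "nat \<Rightarrow> nat" where
  "lim a = (if a = 0 then n * n else if a = 1 then n else if a < 30 then M else 0)"

fun eok :: "exp \<Rightarrow> state \<Rightarrow> bool" where
  "eok (N k) s \<longleftrightarrow> k < W"
| "eok (V x) s \<longleftrightarrow> x < 60"
| "eok (Plus a b) s \<longleftrightarrow> eok a s \<and> eok b s \<and> ev a s + ev b s < W"
| "eok (Minus a b) s \<longleftrightarrow> eok a s \<and> eok b s"
| "eok (Times a b) s \<longleftrightarrow> eok a s \<and> eok b s \<and> ev a s * ev b s < W"
| "eok (At a e) s \<longleftrightarrow> eok e s \<and> ev e s < lim a"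

inductive big :: "com \<Rightarrow> state \<Rightarrow> event list \<Rightarrow> state \<Rightarrow> bool" where
  Skip: "big Skip s [] s"
| Assign: "eok e s \<Longrightarrow> x < 60 \<Longrightarrow> big (Assign x e) s [Tick] ((fst s)(x := ev e s), snd s)"
| Write: "eok i s \<Longrightarrow> eok e s \<Longrightarrow> 0 < a \<Longrightarrow> ev i s < lim a \<Longrightarrow>
    big (Write a i e) s [Tick] (fst s, (snd s)(a := (snd s a)(ev i s := ev e s)))"
| Emt: "eok e s \<Longrightarrow> big (Emt e) s [Emit (ev e s)] s"
| Show: "big Show s [Out (snd s 1)] s"
| Seq: "big c1 s w t \<Longrightarrow> big c2 t v u \<Longrightarrow> big (c1 ;; c2) s (w @ v) u"
| CondT: "eok e s \<Longrightarrow> ev e s \<noteq> 0 \<Longrightarrow> big c1 s w t \<Longrightarrow> big (Cond e c1 c2) s (Tick # w @ [Tick]) t"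
| CondF: "eok e s \<Longrightarrow> ev e s = 0 \<Longrightarrow> big c2 s w t \<Longrightarrow> big (Cond e c1 c2) s (Tick # w @ [Tick]) t"
| LoopF: "eok e s \<Longrightarrow> ev e s = 0 \<Longrightarrow> big (Loop e c) s [Tick] s"
| LoopT: "eok e s \<Longrightarrow> ev e s \<noteq> 0 \<Longrightarrow> big c s w t \<Longrightarrow> big (Loop e c) t v u \<Longrightarrow>
    big (Loop e c) s (Tick # w @ Tick # v) u"

end

section \<open>Compilation\<close>

text \<open>Variables are the registers below 60.  Registers 60 and 61 hold \<open>n\<^sup>2\<close> and \<open>n\<^sup>2 + n\<close>,
  registers from 62 on are scratch.  The arrays 2 to 29 are interleaved behind the output vector.\<close>

fun caddr :: "nat \<Rightarrow> nat \<Rightarrow> instr list" where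
  "caddr a t = (if a = 0 then [] else if a = 1 then [Add t t 60]
     else [Set_Const (Suc t) 30, Mult t t (Suc t), Set_Const (Suc t) a, Add t t (Suc t), Add t t 61])"

declare caddr.simps [simp del]

fun cexp :: "exp \<Rightarrow> nat \<Rightarrow> instr list" where
  "cexp (N k) t = [Set_Const t k]"
| "cexp (V x) t = [Copy t x]"
| "cexp (Plus a b) t = cexp a t @ cexp b (Suc t) @ [Add t t (Suc t)]"
| "cexp (Minus a b) t = cexp a t @ cexp b (Suc t) @ [Sub t t (Suc t)]"
| "cexp (Times a b) t = cexp a t @ cexp b (Suc t) @ [Mult t t (Suc t)]"
| "cexp (At a e) t = cexp e t @ caddr a t @ [Load t t]"

fun clen :: "com \<Rightarrow> nat" where
  "clen Skip = 0"
| "clen (Assign x e) = length (cexp e 62) + 1"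
| "clen (Write a i e) = length (cexp i 62) + length (caddr a 62) + length (cexp e 63) + 1"
| "clen (Emt e) = 0"
| "clen Show = 1"
| "clen (c1 ;; c2) = clen c1 + clen c2"
| "clen (Cond e c1 c2) = length (cexp e 62) + 1 + clen c1 + 1 + clen c2"
| "clen (Loop e c) = length (cexp e 62) + 1 + clen c + 1"

fun ccom :: "com \<Rightarrow> nat \<Rightarrow> instr list" where
  "ccom Skip i = []"
| "ccom (Assign x e) i = cexp e 62 @ [Copy x 62]"
| "ccom (Write a j e) i = cexp j 62 @ caddr a 62 @ cexp e 63 @ [Store 62 63]"
| "ccom (Emt e) i = []"
| "ccom Show i = [Output 60]"
| "ccom (c1 ;; c2) i = ccom c1 i @ ccom c2 (i + clen c1)"
| "ccom (Cond e c1 c2) i = cexp e 62 @ [Jump_Zero 62 (i + length (cexp e 62) + 1 + clen c1 + 1)]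
     @ ccom c1 (i + length (cexp e 62) + 1) @ [Jump (i + clen (Cond e c1 c2))]
     @ ccom c2 (i + length (cexp e 62) + 1 + clen c1 + 1)"
| "ccom (Loop e c) i = cexp e 62 @ [Jump_Zero 62 (i + clen (Loop e c))]
     @ ccom c (i + length (cexp e 62) + 1) @ [Jump i]"

lemma length_ccom [simp]: "length (ccom c i) = clen c"
  by (induction c arbitrary: i) auto

fun silent :: "com \<Rightarrow> bool" where
  "silent (Emt e) \<longleftrightarrow> False"
| "silent (c1 ;; c2) \<longleftrightarrow> silent c1 \<and> silent c2"
| "silent (Cond e c1 c2) \<longleftrightarrow> silent c1 \<and> silent c2"
| "silent (Loop e c) \<longleftrightarrow> silent c"
| "silent _ \<longleftrightarrow> True"

definition program :: "com \<Rightarrow> instr list" where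
  "program c = [Mult 60 0 0, Add 61 60 0] @ ccom c 2 @ [Halt]"

definition code_at :: "instr list \<Rightarrow> nat \<Rightarrow> instr list \<Rightarrow> bool" where
  "code_at p i is \<longleftrightarrow> (\<forall>j < length is. i + j < length p \<and> p ! (i + j) = is ! j)"

lemma code_at_append: "code_at p i (xs @ ys) \<longleftrightarrow> code_at p i xs \<and> code_at p (i + length xs) ys"
proof
  assume a: "code_at p i (xs @ ys)"
  have "i + j < length p \<and> p ! (i + j) = xs ! j" if "j < length xs" for j
    using a that unfolding code_at_def by (auto simp: nth_append dest!: spec[of _ j])
  moreover have "i + length xs + j < length p \<and> p ! (i + length xs + j) = ys ! j" if "j < length ys" for j
    using a that unfolding code_at_def by (auto simp: nth_append add.assoc dest!: spec[of _ "length xs + j"])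
  ultimately show "code_at p i xs \<and> code_at p (i + length xs) ys" by (simp add: code_at_def)
next
  assume a: "code_at p i xs \<and> code_at p (i + length xs) ys"
  have "i + j < length p \<and> p ! (i + j) = (xs @ ys) ! j" if j: "j < length (xs @ ys)" for j
  proof (cases "j < length xs")
    case True
    then show ?thesis using a by (simp add: code_at_def nth_append)
  next
    case False
    then have "j - length xs < length ys" "i + length xs + (j - length xs) = i + j" using j by auto
    then show ?thesis using a False unfolding code_at_def by (metis nth_append)
  qed
  then show "code_at p i (xs @ ys)" by (simp add: code_at_def)
qed

lemma code_at_Cons: "code_at p i (x # ys) \<longleftrightarrow> i < length p \<and> p ! i = x \<and> code_at p (Suc i) ys"
  using code_at_append[of p i "[x]" ys] by (auto simp: code_at_def)

lemma code_at_Nil [simp]: "code_at p i []"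
  by (simp add: code_at_def)

section \<open>The machine simulates the structured language\<close>

locale ram_program = ram +
  fixes p :: "instr list" and L :: nat
begin

text \<open>Interleaving with stride 30 keeps the addresses independent of the array size
  \<open>M\<close>, a parameter of the analysis that the program does not contain.\<close>

definition addr :: "nat \<Rightarrow> nat \<Rightarrow> nat" where
  "addr a i = (if a = 0 then i else if a = 1 then n * n + i else n * n + n + i * 30 + a)"

definition space :: nat where "space = n * n + n + 30 * M + 30"

definition rel :: "state \<Rightarrow> config \<Rightarrow> bool" where
  "rel s q \<longleftrightarrow> (\<forall>x<60. reg q x = fst s x) \<and> reg q 60 = n * n \<and> reg q 61 = n * n + n \<and>
     (\<forall>a i. i < lim a \<longrightarrow> mem q (addr a i) = snd s a i)"

definition bounded :: "config \<Rightarrow> bool" where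
  "bounded q \<longleftrightarrow> (\<forall>x. reg q x < W \<and> mem q x < W)"

definition step :: "config \<Rightarrow> config" where
  "step q = exec (current p q) q"

inductive quiet :: "config \<Rightarrow> nat \<Rightarrow> config \<Rightarrow> bool" where
  quiet_0: "quiet q 0 q"
| quiet_Suc: "bounded q \<Longrightarrow> accessed n (current p q) q \<subseteq> {..<space} \<Longrightarrow> (\<And>a. current p q \<noteq> Output a) \<Longrightarrow>
    quiet (step q) m q' \<Longrightarrow> quiet q (Suc m) q'"

lemma quiet_trans: "quiet q m q' \<Longrightarrow> quiet q' m' q'' \<Longrightarrow> quiet q (m + m') q''"
  by (induction rule: quiet.induct) (auto intro: quiet_Suc)

lemma quiet_step:
  assumes "code_at p (pc q) (x # ys)" "bounded q" "accessed n x q \<subseteq> {..<space}" "\<And>a. x \<noteq> Output a"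
    "quiet (exec x q) m q'"
  shows "quiet q (Suc m) q'"
proof -
  have "current p q = x" using assms(1) by (simp add: code_at_Cons current_def)
  then show ?thesis using assms(2-) by (intro quiet_Suc) (auto simp: step_def)
qed

lemma bounded_set_reg: "bounded q \<Longrightarrow> v < W \<Longrightarrow> bounded (set_reg a v q)"
  by (simp add: bounded_def set_reg_def)

lemma set_reg_simps [simp]: "pc (set_reg a v q) = Suc (pc q)" "mem (set_reg a v q) = mem q"
  "reg (set_reg a v q) = (reg q)(a := v)"
  by (simp_all add: set_reg_def)

lemma addr_less: "i < lim a \<Longrightarrow> addr a i < space"
  by (auto simp: addr_def lim_def space_def split: if_splits)

lemma addr_inj:
  assumes "i < lim a" "j < lim b" "addr a i = addr b j"
  shows "a = b \<and> i = j"
proof -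
  have "a = b \<and> i = j" if h: "2 \<le> a" "2 \<le> b" "a < 30" "b < 30" "i * 30 + a = j * 30 + b"
  proof -
    have "(i * 30 + a) mod 30 = (j * 30 + b) mod 30" using h(5) by simp
    then have "a = b" using h(3,4) by simp
    then show ?thesis using h(5) by simp
  qed
  then show ?thesis using assms by (auto simp: addr_def lim_def split: if_splits)
qed

lemma caddr_quiet:
  assumes "code_at p (pc q) (caddr a t)" "62 \<le> t" "reg q t < lim a" "bounded q"
    "reg q 60 = n * n" "reg q 61 = n * n + n"
  shows "\<exists>q'. quiet q (length (caddr a t)) q' \<and> pc q' = pc q + length (caddr a t) \<and>
    reg q' t = addr a (reg q t) \<and> mem q' = mem q \<and> (\<forall>x<t. reg q' x = reg q x) \<and> bounded q'"
proof -
  consider "a = 0" | "a = 1" | "2 \<le> a" by linarith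
  then show ?thesis
  proof cases
    case 1
    then show ?thesis using assms by (intro exI[of _ q]) (auto simp: addr_def quiet_0 caddr.simps)
  next
    case 2
    let ?q = "set_reg t (reg q t + reg q 60) q"
    have b: "reg q t + reg q 60 < W" using assms(3,5) 2 wide by (simp add: lim_def)
    have "quiet q (Suc 0) ?q"
      by (rule quiet_step[where x = "Add t t 60" and ys = "[]"]) (use assms 2 in \<open>auto simp: quiet_0 caddr.simps\<close>)
    then show ?thesis using 2 assms(2,5) bounded_set_reg[OF assms(4) b]
      by (intro exI[of _ ?q]) (auto simp: addr_def caddr.simps)
  next
    case 3
    then have a: "a < 30" "reg q t < M" using assms(3) by (auto simp: lim_def split: if_splits)
    then have r: "reg q t * 30 + 30 \<le> 30 * M" by linarith
    let ?q1 = "set_reg (Suc t) 30 q"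
    let ?q2 = "set_reg t (reg q t * 30) ?q1"
    let ?q3 = "set_reg (Suc t) a ?q2"
    let ?q4 = "set_reg t (reg q t * 30 + a) ?q3"
    let ?q5 = "set_reg t (reg q t * 30 + a + (n * n + n)) ?q4"
    have c: "code_at p (pc q) [Set_Const (Suc t) 30, Mult t t (Suc t), Set_Const (Suc t) a, Add t t (Suc t), Add t t 61]"
      using assms(1) 3 by (simp add: caddr.simps)
    have v: "30 < W" "reg q t * 30 < W" "a < W" "reg q t * 30 + a < W" "reg q t * 30 + a + (n * n + n) < W"
      using wide a r by linarith+
    have b1: "bounded ?q1" by (rule bounded_set_reg[OF assms(4) v(1)])
    have b2: "bounded ?q2" by (rule bounded_set_reg[OF b1 v(2)])
    have b3: "bounded ?q3" by (rule bounded_set_reg[OF b2 v(3)])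
    have b4: "bounded ?q4" by (rule bounded_set_reg[OF b3 v(4)])
    have b5: "bounded ?q5" by (rule bounded_set_reg[OF b4 v(5)])
    have t: "t \<noteq> 61" "t \<noteq> 60" using assms(2) by simp_all
    have s4: "quiet ?q4 (Suc 0) ?q5"
      by (rule quiet_step[where x = "Add t t 61" and ys = "[]"])
        (use c b4 assms(2,6) t in \<open>auto simp: quiet_0 code_at_Cons\<close>)
    have s3: "quiet ?q3 (Suc (Suc 0)) ?q5"
      by (rule quiet_step[where x = "Add t t (Suc t)" and ys = "[]"])
        (use c b3 s4 in \<open>auto simp: code_at_Cons\<close>)
    have s2: "quiet ?q2 (Suc (Suc (Suc 0))) ?q5"
      by (rule quiet_step[where x = "Set_Const (Suc t) a" and ys = "[]"])
        (use c b2 s3 in \<open>auto simp: code_at_Cons\<close>)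
    have s1: "quiet ?q1 (Suc (Suc (Suc (Suc 0)))) ?q5"
      by (rule quiet_step[where x = "Mult t t (Suc t)" and ys = "[]"])
        (use c b1 s2 in \<open>auto simp: code_at_Cons\<close>)
    have "quiet q (Suc (Suc (Suc (Suc (Suc 0))))) ?q5"
      by (rule quiet_step[where x = "Set_Const (Suc t) 30" and ys = "[]"])
        (use c assms(4) s1 in \<open>auto simp: code_at_Cons\<close>)
    then show ?thesis using 3 b5 by (intro exI[of _ ?q5]) (auto simp: addr_def caddr.simps)
  qed
qed

lemma rel_frame: "rel s q \<Longrightarrow> (\<forall>x<62. reg q' x = reg q x) \<Longrightarrow> mem q' = mem q \<Longrightarrow> rel s q'"
  by (simp add: rel_def)

lemma bounded_sub: "bounded q \<Longrightarrow> bounded (set_reg a (reg q x - reg q y) q)"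
  unfolding bounded_def by (auto intro: le_less_trans[OF diff_le_self])

lemma cexp_quiet:
  assumes "code_at p (pc q) (cexp e t)" "62 \<le> t" "eok e s" "rel s q" "bounded q"
  shows "\<exists>q'. quiet q (length (cexp e t)) q' \<and> pc q' = pc q + length (cexp e t) \<and>
    reg q' t = ev e s \<and> mem q' = mem q \<and> (\<forall>x<t. reg q' x = reg q x) \<and> bounded q'"
  using assms
proof (induction e arbitrary: t q)
  case (N k)
  then have "quiet q (Suc 0) (set_reg t k q)"
    by (intro quiet_step[where x = "Set_Const t k" and ys = "[]"]) (auto simp: quiet_0)
  then show ?case using N by (intro exI[of _ "set_reg t k q"]) (auto intro: bounded_set_reg)
next
  case (V x)
  then have "quiet q (Suc 0) (set_reg t (reg q x) q)"
    by (intro quiet_step[where x = "Copy t x" and ys = "[]"]) (auto simp: quiet_0)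
  moreover have "bounded (set_reg t (reg q x) q)" using V by (auto simp: bounded_def)
  ultimately show ?case using V by (intro exI[of _ "set_reg t (reg q x) q"]) (auto simp: rel_def)
next
  case (At a e)
  have c: "code_at p (pc q) (cexp e t)" "code_at p (pc q + length (cexp e t)) (caddr a t)"
    "code_at p (pc q + length (cexp e t) + length (caddr a t)) [Load t t]"
    using At.prems(1) by (simp_all only: cexp.simps code_at_append)
  obtain q1 where q1: "quiet q (length (cexp e t)) q1" "pc q1 = pc q + length (cexp e t)"
    "reg q1 t = ev e s" "mem q1 = mem q" "\<forall>x<t. reg q1 x = reg q x" "bounded q1"
    using At.IH[OF c(1) At.prems(2)] At.prems(3-5) by auto
  have r: "reg q1 60 = n * n" "reg q1 61 = n * n + n" "rel s q1"
    using q1 At.prems(2,4) by (auto simp: rel_def)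
  have l: "reg q1 t < lim a" using At.prems(3) q1 by simp
  obtain q2 where q2: "quiet q1 (length (caddr a t)) q2" "pc q2 = pc q1 + length (caddr a t)"
    "reg q2 t = addr a (reg q1 t)" "mem q2 = mem q1" "\<forall>x<t. reg q2 x = reg q1 x" "bounded q2"
    using caddr_quiet[of q1 a t] c(2) At.prems(2) l q1(2,6) r by auto
  let ?q3 = "set_reg t (mem q2 (reg q2 t)) q2"
  have m: "mem q2 (reg q2 t) = ev (At a e) s" using r(3) l q2(3,4) q1(3) by (auto simp: rel_def)
  have "quiet q2 (Suc 0) ?q3"
    by (rule quiet_step[where x = "Load t t" and ys = "[]"])
      (use c(3) q1(2) q2 addr_less[OF l] in \<open>auto simp: quiet_0\<close>)
  from quiet_trans[OF q1(1) quiet_trans[OF q2(1) this]]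
  have "quiet q (length (cexp (At a e) t)) ?q3" by (simp add: add.assoc)
  moreover have "bounded ?q3" using q2(6) by (auto simp: bounded_def)
  ultimately show ?case using m q1 q2 by (intro exI[of _ ?q3]) auto
next
  case (Plus a b)
  have c: "code_at p (pc q) (cexp a t)" "code_at p (pc q + length (cexp a t)) (cexp b (Suc t))"
    "code_at p (pc q + length (cexp a t) + length (cexp b (Suc t))) [Add t t (Suc t)]"
    using Plus.prems(1) by (simp_all only: cexp.simps code_at_append)
  obtain q1 where q1: "quiet q (length (cexp a t)) q1" "pc q1 = pc q + length (cexp a t)"
    "reg q1 t = ev a s" "mem q1 = mem q" "\<forall>x<t. reg q1 x = reg q x" "bounded q1"
    using Plus.IH(1)[OF c(1) Plus.prems(2)] Plus.prems(3-5) by auto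
  have r: "rel s q1" using rel_frame[OF Plus.prems(4)] q1 Plus.prems(2) by auto
  obtain q2 where q2: "quiet q1 (length (cexp b (Suc t))) q2" "pc q2 = pc q1 + length (cexp b (Suc t))"
    "reg q2 (Suc t) = ev b s" "mem q2 = mem q1" "\<forall>x<Suc t. reg q2 x = reg q1 x" "bounded q2"
    using Plus.IH(2)[of q1 "Suc t"] c(2) Plus.prems(2,3) r q1(2,6) by auto
  let ?q3 = "set_reg t (reg q2 t + reg q2 (Suc t)) q2"
  have "quiet q2 (Suc 0) ?q3"
    by (rule quiet_step[where x = "Add t t (Suc t)" and ys = "[]"])
      (use c(3) q1(2) q2 in \<open>auto simp: quiet_0\<close>)
  from quiet_trans[OF q1(1) quiet_trans[OF q2(1) this]]
  have "quiet q (length (cexp (Plus a b) t)) ?q3" by (simp add: add.assoc)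
  moreover have "bounded ?q3" using q2 q1(3) Plus.prems(3) by (intro bounded_set_reg) auto
  ultimately show ?case using q1 q2 by (intro exI[of _ ?q3]) auto
next
  case (Times a b)
  have c: "code_at p (pc q) (cexp a t)" "code_at p (pc q + length (cexp a t)) (cexp b (Suc t))"
    "code_at p (pc q + length (cexp a t) + length (cexp b (Suc t))) [Mult t t (Suc t)]"
    using Times.prems(1) by (simp_all only: cexp.simps code_at_append)
  obtain q1 where q1: "quiet q (length (cexp a t)) q1" "pc q1 = pc q + length (cexp a t)"
    "reg q1 t = ev a s" "mem q1 = mem q" "\<forall>x<t. reg q1 x = reg q x" "bounded q1"
    using Times.IH(1)[OF c(1) Times.prems(2)] Times.prems(3-5) by auto
  have r: "rel s q1" using rel_frame[OF Times.prems(4)] q1 Times.prems(2) by auto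
  obtain q2 where q2: "quiet q1 (length (cexp b (Suc t))) q2" "pc q2 = pc q1 + length (cexp b (Suc t))"
    "reg q2 (Suc t) = ev b s" "mem q2 = mem q1" "\<forall>x<Suc t. reg q2 x = reg q1 x" "bounded q2"
    using Times.IH(2)[of q1 "Suc t"] c(2) Times.prems(2,3) r q1(2,6) by auto
  let ?q3 = "set_reg t (reg q2 t * reg q2 (Suc t)) q2"
  have "quiet q2 (Suc 0) ?q3"
    by (rule quiet_step[where x = "Mult t t (Suc t)" and ys = "[]"])
      (use c(3) q1(2) q2 in \<open>auto simp: quiet_0\<close>)
  from quiet_trans[OF q1(1) quiet_trans[OF q2(1) this]]
  have "quiet q (length (cexp (Times a b) t)) ?q3" by (simp add: add.assoc)
  moreover have "bounded ?q3" using q2 q1(3) Times.prems(3) by (intro bounded_set_reg) auto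
  ultimately show ?case using q1 q2 by (intro exI[of _ ?q3]) auto
next
  case (Minus a b)
  have c: "code_at p (pc q) (cexp a t)" "code_at p (pc q + length (cexp a t)) (cexp b (Suc t))"
    "code_at p (pc q + length (cexp a t) + length (cexp b (Suc t))) [Sub t t (Suc t)]"
    using Minus.prems(1) by (simp_all only: cexp.simps code_at_append)
  obtain q1 where q1: "quiet q (length (cexp a t)) q1" "pc q1 = pc q + length (cexp a t)"
    "reg q1 t = ev a s" "mem q1 = mem q" "\<forall>x<t. reg q1 x = reg q x" "bounded q1"
    using Minus.IH(1)[OF c(1) Minus.prems(2)] Minus.prems(3-5) by auto
  have r: "rel s q1" using rel_frame[OF Minus.prems(4)] q1 Minus.prems(2) by auto
  obtain q2 where q2: "quiet q1 (length (cexp b (Suc t))) q2" "pc q2 = pc q1 + length (cexp b (Suc t))"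
    "reg q2 (Suc t) = ev b s" "mem q2 = mem q1" "\<forall>x<Suc t. reg q2 x = reg q1 x" "bounded q2"
    using Minus.IH(2)[of q1 "Suc t"] c(2) Minus.prems(2,3) r q1(2,6) by auto
  let ?q3 = "set_reg t (reg q2 t - reg q2 (Suc t)) q2"
  have "quiet q2 (Suc 0) ?q3"
    by (rule quiet_step[where x = "Sub t t (Suc t)" and ys = "[]"])
      (use c(3) q1(2) q2 in \<open>auto simp: quiet_0\<close>)
  from quiet_trans[OF q1(1) quiet_trans[OF q2(1) this]]
  have "quiet q (length (cexp (Minus a b) t)) ?q3" by (simp add: add.assoc)
  moreover have "bounded ?q3" by (rule bounded_sub[OF q2(6)])
  ultimately show ?case using q1 q2 by (intro exI[of _ ?q3]) auto
qed

text \<open>A tick stands for any number of machine steps up to \<open>L\<close>, possibly none, and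
  an output for exactly one. There is no rule for \<open>Emit\<close>, which exists only before
  deamortisation.\<close>

inductive mruns :: "config \<Rightarrow> event list \<Rightarrow> config \<Rightarrow> bool" where
  mruns_Nil: "mruns q [] q"
| mruns_Tick: "quiet q m q1 \<Longrightarrow> m \<le> L \<Longrightarrow> mruns q1 w q2 \<Longrightarrow> mruns q (Tick # w) q2"
| mruns_Out: "bounded q \<Longrightarrow> current p q = Output 60 \<Longrightarrow> reg q 60 = n * n \<Longrightarrow>
    (\<forall>u<n. mem q (n * n + u) = f u) \<Longrightarrow> mruns (step q) w q2 \<Longrightarrow> mruns q (Out f # w) q2"

lemma mruns_append: "mruns q v q1 \<Longrightarrow> mruns q1 w q2 \<Longrightarrow> mruns q (v @ w) q2"
  by (induction rule: mruns.induct) (auto intro: mruns_Tick mruns_Out)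

lemma mruns_tick: "quiet q m q' \<Longrightarrow> m \<le> L \<Longrightarrow> mruns q [Tick] q'"
  using mruns_Tick mruns_Nil by blast

lemma cexp_then:
  assumes c: "code_at p (pc q) (cexp e 62 @ x # ys)" and e: "eok e s" and r: "rel s q" and b: "bounded q"
    and L: "Suc (length (cexp e 62)) \<le> L" and x: "accessed n x = (\<lambda>_. {})" "\<And>a. x \<noteq> Output a"
  obtains q1 where "mruns q [Tick] (exec x q1)" "rel s q1" "bounded q1" "reg q1 62 = ev e s"
    "pc q1 = pc q + length (cexp e 62)"
proof -
  obtain q1 where q1: "quiet q (length (cexp e 62)) q1" "pc q1 = pc q + length (cexp e 62)"
    "reg q1 62 = ev e s" "mem q1 = mem q" "\<forall>x<62. reg q1 x = reg q x" "bounded q1"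
    using cexp_quiet[of q e 62 s] c e r b by (auto simp: code_at_append)
  have "quiet q1 (Suc 0) (exec x q1)"
    using c q1 x by (intro quiet_step[where x = x and ys = ys]) (auto simp: code_at_append quiet_0)
  then have "quiet q (length (cexp e 62) + Suc 0) (exec x q1)" using quiet_trans q1(1) by blast
  then have "mruns q [Tick] (exec x q1)" using L by (intro mruns_tick) auto
  then show ?thesis using that rel_frame[OF r] q1 by auto
qed

lemma jump:
  assumes "code_at p (pc q) [Jump i]" "bounded q" "1 \<le> L"
  shows "mruns q [Tick] (q\<lparr>pc := i\<rparr>)"
proof -
  have "quiet q (Suc 0) (q\<lparr>pc := i\<rparr>)"
    using assms by (intro quiet_step[where x = "Jump i" and ys = "[]"]) (auto simp: quiet_0)
  then show ?thesis using assms(3) by (intro mruns_tick) auto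
qed

lemma rel_pc [simp]: "rel s (q\<lparr>pc := i\<rparr>) = rel s q" "bounded (q\<lparr>pc := i\<rparr>) = bounded q"
  by (simp_all add: rel_def bounded_def)

text \<open>Within one tick only straight-line code is executed, each instruction at most once.
  Hence the length of the code is a sufficient bound \<open>L\<close>.\<close>

lemma compile:
  assumes "big c s w t" "silent c" "code_at p (pc q) (ccom c (pc q))" "rel s q" "bounded q" "clen c \<le> L"
  shows "\<exists>q'. mruns q w q' \<and> rel t q' \<and> bounded q' \<and> pc q' = pc q + clen c"
  using assms
proof (induction arbitrary: q rule: big.induct)
  case (Skip s)
  then show ?case by (intro exI[of _ q]) (auto intro: mruns_Nil)
next
  case (Assign e s x)
  obtain q1 where q1: "mruns q [Tick] (exec (Copy x 62) q1)" "rel s q1" "bounded q1" "reg q1 62 = ev e s"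
    "pc q1 = pc q + length (cexp e 62)"
    by (rule cexp_then[of q e "Copy x 62" "[]" s]) (use Assign in auto)
  have "bounded (set_reg x (reg q1 62) q1)" using q1(3) by (auto simp: bounded_def)
  moreover have "rel ((fst s)(x := ev e s), snd s) (set_reg x (reg q1 62) q1)"
    using q1 Assign(2) by (auto simp: rel_def)
  ultimately show ?case using q1 by (intro exI[of _ "set_reg x (reg q1 62) q1"]) auto
next
  case (Write i s e a)
  have c: "code_at p (pc q) (cexp i 62)" "code_at p (pc q + length (cexp i 62)) (caddr a 62)"
    "code_at p (pc q + length (cexp i 62) + length (caddr a 62)) (cexp e 63)"
    "code_at p (pc q + length (cexp i 62) + length (caddr a 62) + length (cexp e 63)) [Store 62 63]"
    using Write.prems(2) by (simp_all only: ccom.simps code_at_append)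
  obtain q1 where q1: "quiet q (length (cexp i 62)) q1" "pc q1 = pc q + length (cexp i 62)"
    "reg q1 62 = ev i s" "mem q1 = mem q" "\<forall>x<62. reg q1 x = reg q x" "bounded q1"
    using cexp_quiet[of q i 62 s] c(1) Write by auto
  have r1: "rel s q1" "reg q1 60 = n * n" "reg q1 61 = n * n + n"
    using rel_frame[OF Write.prems(3)] q1 Write.prems(3) by (auto simp: rel_def)
  obtain q2 where q2: "quiet q1 (length (caddr a 62)) q2" "pc q2 = pc q1 + length (caddr a 62)"
    "reg q2 62 = addr a (reg q1 62)" "mem q2 = mem q1" "\<forall>x<62. reg q2 x = reg q1 x" "bounded q2"
    using caddr_quiet[of q1 a 62] c(2) q1 r1 Write.hyps(4) by auto
  have r2: "rel s q2" using rel_frame[OF r1(1)] q2 by auto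
  obtain q3 where q3: "quiet q2 (length (cexp e 63)) q3" "pc q3 = pc q2 + length (cexp e 63)"
    "reg q3 63 = ev e s" "mem q3 = mem q2" "\<forall>x<63. reg q3 x = reg q2 x" "bounded q3"
    using cexp_quiet[of q2 e 63 s] c(3) q2 q1(2) r2 Write.hyps(2) by auto
  have r3: "rel s q3" using rel_frame[OF r2] q3 by auto
  let ?q4 = "q3\<lparr>pc := pc q3 + 1, mem := (mem q3)(reg q3 62 := reg q3 63)\<rparr>"
  have a: "reg q3 62 = addr a (ev i s)" using q3 q2 q1 by simp
  have "quiet q3 (Suc 0) ?q4"
    by (rule quiet_step[where x = "Store 62 63" and ys = "[]"])
      (use c(4) q1(2) q2(2) q3 a addr_less[OF Write.hyps(4)] in \<open>auto simp: quiet_0\<close>)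
  from quiet_trans[OF q1(1) quiet_trans[OF q2(1) quiet_trans[OF q3(1) this]]]
  have "quiet q (clen (Write a i e)) ?q4" by (simp add: add.assoc)
  then have "mruns q [Tick] ?q4" using Write.prems(5) by (intro mruns_tick)
  moreover have "bounded ?q4" using q3(6) by (auto simp: bounded_def)
  moreover have "rel (fst s, (snd s)(a := (snd s a)(ev i s := ev e s))) ?q4"
  proof -
    have "mem ?q4 (addr b j) = ((snd s)(a := (snd s a)(ev i s := ev e s))) b j" if "j < lim b" for b j
      using addr_inj[OF that Write.hyps(4)] r3 that a q3(3) by (auto simp: rel_def)
    then show ?thesis using r3 by (simp add: rel_def)
  qed
  ultimately show ?case using q1(2) q2(2) q3(2) by (intro exI[of _ ?q4]) auto
next
  case (Emt e s)
  then show ?case by simp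
next
  case (Show s)
  have cur: "current p q = Output 60" using Show by (simp add: code_at_Cons current_def)
  have "mem q (addr 1 u) = snd s 1 u" if "u < n" for u
    using Show(3) that by (simp add: rel_def lim_def)
  then have m: "\<forall>u<n. mem q (n * n + u) = snd s 1 u" "reg q 60 = n * n"
    using Show(3) by (simp_all add: rel_def addr_def)
  have st: "step q = q\<lparr>pc := pc q + 1\<rparr>" by (simp add: step_def cur)
  have "mruns q [Out (snd s 1)] (step q)" using mruns_Out[OF Show(4) cur m(2,1) mruns_Nil] .
  then show ?case using Show st by (intro exI[of _ "step q"]) auto
next
  case (Seq c1 s w t c2 v u)
  obtain q1 where q1: "mruns q w q1" "rel t q1" "bounded q1" "pc q1 = pc q + clen c1"
    using Seq.IH(1)[of q] Seq.prems by (auto simp: code_at_append)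
  obtain q2 where q2: "mruns q1 v q2" "rel u q2" "bounded q2" "pc q2 = pc q1 + clen c2"
    using Seq.IH(2)[of q1] Seq.prems q1 by (auto simp: code_at_append)
  then show ?case using mruns_append[OF q1(1) q2(1)] q1(4) by (intro exI[of _ q2]) auto
next
  case (CondT e s c1 w t c2)
  let ?l = "length (cexp e 62)"
  have c: "code_at p (pc q + ?l + 1) (ccom c1 (pc q + ?l + 1))"
    "code_at p (pc q + ?l + 1 + clen c1) [Jump (pc q + clen (Cond e c1 c2))]"
    using CondT.prems(2) by (auto simp: code_at_append code_at_Cons)
  obtain q1 where q1: "mruns q [Tick] (exec (Jump_Zero 62 (pc q + ?l + 1 + clen c1 + 1)) q1)"
    "rel s q1" "bounded q1" "reg q1 62 = ev e s" "pc q1 = pc q + ?l"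
    by (rule cexp_then[of q e "Jump_Zero 62 (pc q + ?l + 1 + clen c1 + 1)"
        "ccom c1 (pc q + ?l + 1) @ [Jump (pc q + clen (Cond e c1 c2))] @ ccom c2 (pc q + ?l + 1 + clen c1 + 1)" s])
      (use CondT in auto)
  let ?q1 = "q1\<lparr>pc := pc q + ?l + 1\<rparr>"
  have e1: "exec (Jump_Zero 62 (pc q + ?l + 1 + clen c1 + 1)) q1 = ?q1" using q1 CondT.hyps(2) by simp
  obtain q2 where q2: "mruns ?q1 w q2" "rel t q2" "bounded q2" "pc q2 = pc q + ?l + 1 + clen c1"
    using CondT.IH[of ?q1] CondT.prems c(1) q1 by auto
  have "mruns q2 [Tick] (q2\<lparr>pc := pc q + clen (Cond e c1 c2)\<rparr>)"
    using c(2) q2(3,4) CondT.prems(5) by (intro jump) auto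
  then have "mruns q ([Tick] @ w @ [Tick]) (q2\<lparr>pc := pc q + clen (Cond e c1 c2)\<rparr>)"
    using mruns_append q1(1) e1 q2(1) by metis
  then show ?case using q2 by (intro exI[of _ "q2\<lparr>pc := pc q + clen (Cond e c1 c2)\<rparr>"]) auto
next
  case (CondF e s c2 w t c1)
  let ?l = "length (cexp e 62)"
  let ?i = "pc q + ?l + 1 + clen c1 + 1"
  have c: "code_at p ?i (ccom c2 ?i)"
    using CondF.prems(2) by (auto simp: code_at_append code_at_Cons)
  obtain q1 where q1: "mruns q [Tick] (exec (Jump_Zero 62 ?i) q1)"
    "rel s q1" "bounded q1" "reg q1 62 = ev e s" "pc q1 = pc q + ?l"
    by (rule cexp_then[of q e "Jump_Zero 62 ?i"
        "ccom c1 (pc q + ?l + 1) @ [Jump (pc q + clen (Cond e c1 c2))] @ ccom c2 ?i" s])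
      (use CondF in auto)
  let ?q1 = "q1\<lparr>pc := ?i\<rparr>"
  have e1: "exec (Jump_Zero 62 ?i) q1 = ?q1" using q1 CondF.hyps(2) by simp
  obtain q2 where q2: "mruns ?q1 w q2" "rel t q2" "bounded q2" "pc q2 = ?i + clen c2"
    using CondF.IH[of ?q1] CondF.prems c q1 by auto
  \<comment> \<open>The closing tick of a conditional is the jump over the second branch; after the
    second branch it takes no machine step.\<close>
  have "mruns q2 [Tick] q2" by (rule mruns_tick[OF quiet_0]) simp
  then have "mruns q ([Tick] @ w @ [Tick]) q2"
    using mruns_append q1(1) e1 q2(1) by metis
  then show ?case using q2 by (intro exI[of _ q2]) auto
next
  case (LoopF e s c)
  let ?l = "length (cexp e 62)"
  let ?x = "Jump_Zero 62 (pc q + clen (Loop e c))"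
  obtain q1 where q1: "mruns q [Tick] (exec ?x q1)"
    "rel s q1" "bounded q1" "reg q1 62 = ev e s" "pc q1 = pc q + ?l"
    by (rule cexp_then[of q e ?x "ccom c (pc q + ?l + 1) @ [Jump (pc q)]" s])
      (use LoopF in auto)
  then show ?case using LoopF.hyps(2) by (intro exI[of _ "exec ?x q1"]) auto
next
  case (LoopT e s c w t v u)
  let ?l = "length (cexp e 62)"
  let ?x = "Jump_Zero 62 (pc q + clen (Loop e c))"
  have c: "code_at p (pc q + ?l + 1) (ccom c (pc q + ?l + 1))"
    "code_at p (pc q + ?l + 1 + clen c) [Jump (pc q)]"
    using LoopT.prems(2) by (auto simp: code_at_append code_at_Cons)
  obtain q1 where q1: "mruns q [Tick] (exec ?x q1)"
    "rel s q1" "bounded q1" "reg q1 62 = ev e s" "pc q1 = pc q + ?l"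
    by (rule cexp_then[of q e ?x "ccom c (pc q + ?l + 1) @ [Jump (pc q)]" s])
      (use LoopT in auto)
  let ?q1 = "q1\<lparr>pc := pc q + ?l + 1\<rparr>"
  have e1: "exec ?x q1 = ?q1" using q1 LoopT.hyps(2) by simp
  obtain q2 where q2: "mruns ?q1 w q2" "rel t q2" "bounded q2" "pc q2 = pc q + ?l + 1 + clen c"
    using LoopT.IH(1)[of ?q1] LoopT.prems c(1) q1 by auto
  have j: "mruns q2 [Tick] (q2\<lparr>pc := pc q\<rparr>)"
    using c(2) q2(3,4) LoopT.prems(5) by (intro jump) auto
  obtain q3 where q3: "mruns (q2\<lparr>pc := pc q\<rparr>) v q3" "rel u q3" "bounded q3" "pc q3 = pc q + clen (Loop e c)"
    using LoopT.IH(2)[of "q2\<lparr>pc := pc q\<rparr>"] LoopT.prems q2 by auto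
  have "mruns q ([Tick] @ w @ [Tick] @ v) q3"
    using mruns_append q1(1) e1 q2(1) j q3(1) by metis
  then show ?case using q3 by (intro exI[of _ q3]) auto
qed

section \<open>Times of the outputs\<close>

definition shows_at :: "config \<Rightarrow> (nat \<Rightarrow> nat) \<Rightarrow> bool" where
  "shows_at q f \<longleftrightarrow> current p q = Output 60 \<and> reg q 60 = n * n \<and> (\<forall>u<n. mem q (n * n + u) = f u)"

abbreviation safe_at :: "(nat \<times> nat) set \<Rightarrow> nat \<Rightarrow> bool" where
  "safe_at r t \<equiv> bounded (config_at p n r t) \<and>
    accessed n (current p (config_at p n r t)) (config_at p n r t) \<subseteq> {..<space}"

abbreviation out_at :: "(nat \<times> nat) set \<Rightarrow> nat \<Rightarrow> bool" where
  "out_at r t \<equiv> \<exists>a. current p (config_at p n r t) = Output a"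

lemma config_Suc: "config_at p n r (Suc t) = step (config_at p n r t)"
  by (simp add: config_at_def step_def)

lemma quiet_config:
  assumes "quiet q m q'" "q = config_at p n r t"
  shows "q' = config_at p n r (t + m) \<and> (\<forall>t'\<in>{t..<t + m}. safe_at r t' \<and> \<not> out_at r t')"
  using assms
proof (induction arbitrary: t rule: quiet.induct)
  case (quiet_Suc q m q')
  have IH: "q' = config_at p n r (Suc t + m) \<and> (\<forall>t'\<in>{Suc t..<Suc t + m}. safe_at r t' \<and> \<not> out_at r t')"
    using quiet_Suc.IH[of "Suc t"] quiet_Suc.prems config_Suc by simp
  have "safe_at r t' \<and> \<not> out_at r t'" if "t' \<in> {t..<t + Suc m}" for t'
  proof (cases "t' = t")
    case True then show ?thesis using quiet_Suc by simp
  next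
    case False then show ?thesis using IH that by auto
  qed
  then show ?case using IH by simp
qed simp

text \<open>Budgets in ticks become distances in machine steps by the factor \<open>L\<close>;
  between two outputs the output instruction itself adds one step.\<close>

lemma mruns_times:
  assumes "mruns q w q'" "q = config_at p n r t" "due D b w b'"
  shows "\<exists>ts t'. q' = config_at p n r t' \<and> t \<le> t' \<and> sorted_wrt (<) ts \<and>
    set ts = {t''. t \<le> t'' \<and> t'' < t' \<and> out_at r t''} \<and> length ts = length (outs w) \<and>
    (\<forall>j<length ts. shows_at (config_at p n r (ts ! j)) (outs w ! j)) \<and>
    (\<forall>t''. t \<le> t'' \<longrightarrow> t'' < t' \<longrightarrow> safe_at r t'') \<and>
    (ts \<noteq> [] \<longrightarrow> hd ts \<le> t + L * b) \<and>
    (\<forall>j. Suc j < length ts \<longrightarrow> ts ! Suc j \<le> ts ! j + (L * D + 1))"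
  using assms
proof (induction arbitrary: t b rule: mruns.induct)
  case (mruns_Nil q)
  then show ?case by (intro exI[of _ "[]"] exI[of _ t]) auto
next
  case (mruns_Tick q m q1 w q2)
  note Q = quiet_config[OF mruns_Tick(1) mruns_Tick.prems(1)]
  have d: "0 < b" "due D (b - 1) w b'" using mruns_Tick.prems by auto
  from mruns_Tick.IH[of "t + m" "b - 1"] Q d obtain ts t' where ts: "q2 = config_at p n r t'" "t + m \<le> t'"
    "sorted_wrt (<) ts" "set ts = {t''. t + m \<le> t'' \<and> t'' < t' \<and> out_at r t''}" "length ts = length (outs w)"
    "\<forall>j<length ts. shows_at (config_at p n r (ts ! j)) (outs w ! j)"
    "\<forall>t''. t + m \<le> t'' \<longrightarrow> t'' < t' \<longrightarrow> safe_at r t''"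
    "ts \<noteq> [] \<longrightarrow> hd ts \<le> t + m + L * (b - 1)"
    "\<forall>j. Suc j < length ts \<longrightarrow> ts ! Suc j \<le> ts ! j + (L * D + 1)" by blast
  have q: "safe_at r t'' \<and> \<not> out_at r t''" if "t \<le> t''" "t'' < t + m" for t'' using Q that by simp
  have "m + L * (b - 1) \<le> L * b" using mruns_Tick(2) d(1) by (cases b) auto
  then have "ts \<noteq> [] \<longrightarrow> hd ts \<le> t + L * b" using ts(8) by auto
  moreover have "set ts = {t''. t \<le> t'' \<and> t'' < t' \<and> out_at r t''}"
    unfolding ts(4) using q ts(2) by (intro Collect_cong) (metis le_add1 not_le order_trans)
  moreover have "safe_at r t''" if "t \<le> t''" "t'' < t'" for t''
    using q[OF that(1)] ts(7) that(2) by (cases "t'' < t + m") auto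
  ultimately show ?case using ts(1,2,3,5,6,9) by (intro exI[of _ ts] exI[of _ t']) auto
next
  case (mruns_Out q f w q2)
  have d: "due D D w b'" using mruns_Out.prems by auto
  have st: "step q = config_at p n r (Suc t)" by (simp add: config_Suc mruns_Out.prems(1))
  from mruns_Out.IH[OF st d]
  obtain ts t' where ts: "q2 = config_at p n r t'" "Suc t \<le> t'"
    "sorted_wrt (<) ts" "set ts = {t''. Suc t \<le> t'' \<and> t'' < t' \<and> out_at r t''}" "length ts = length (outs w)"
    "\<forall>j<length ts. shows_at (config_at p n r (ts ! j)) (outs w ! j)"
    "\<forall>t''. Suc t \<le> t'' \<longrightarrow> t'' < t' \<longrightarrow> safe_at r t''"
    "ts \<noteq> [] \<longrightarrow> hd ts \<le> Suc t + L * D"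
    "\<forall>j. Suc j < length ts \<longrightarrow> ts ! Suc j \<le> ts ! j + (L * D + 1)" by blast
  have o: "out_at r t" using mruns_Out by auto
  have "set (t # ts) = {t''. t \<le> t'' \<and> t'' < t' \<and> out_at r t''}"
  proof -
    have "t \<le> t'' \<and> t'' < t' \<and> out_at r t'' \<longleftrightarrow> t'' = t \<or> Suc t \<le> t'' \<and> t'' < t' \<and> out_at r t''" for t''
      using o ts(2) by (cases "t'' = t") auto
    then have "{t''. t \<le> t'' \<and> t'' < t' \<and> out_at r t''}
      = {t''. t'' = t \<or> Suc t \<le> t'' \<and> t'' < t' \<and> out_at r t''}" by (intro Collect_cong)
    then show ?thesis using ts(4) by auto
  qed
  moreover have "sorted_wrt (<) (t # ts)" using ts(3,4) by auto
  moreover have "shows_at (config_at p n r ((t # ts) ! j)) (outs (Out f # w) ! j)" if "j < length (t # ts)" for j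
  proof (cases j)
    case 0
    then show ?thesis using mruns_Out.hyps(2-4) mruns_Out.prems(1) by (simp add: shows_at_def)
  next
    case (Suc i)
    then show ?thesis using ts(6) that by simp
  qed
  moreover have "safe_at r t''" if "t \<le> t''" "t'' < t'" for t''
  proof (cases "t'' = t")
    case True
    have "accessed n (current p q) q \<subseteq> {..<space}" using mruns_Out(2,3) by (auto simp: space_def)
    then show ?thesis using True mruns_Out.hyps(1) mruns_Out.prems(1) by simp
  qed (use ts(7) that in auto)
  moreover have "(t # ts) ! Suc j \<le> (t # ts) ! j + (L * D + 1)" if "Suc j < length (t # ts)" for j
  proof (cases j)
    case 0
    then show ?thesis using ts(8) that by (cases ts) auto
  next
    case (Suc i)
    then show ?thesis using ts(9) that by simp
  qed
  moreover have "length (t # ts) = length (outs (Out f # w))" "t \<le> t'" "t # ts \<noteq> [] \<longrightarrow> hd (t # ts) \<le> t + L * b"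
    using ts(2,5) by simp_all
  ultimately show ?case using ts(1) by blast
qed

definition start_state :: "(nat \<times> nat) set \<Rightarrow> state" where
  "start_state r = (\<lambda>x. if x = 0 then n else 0,
     \<lambda>a i. if a = 0 \<and> i < n * n \<and> (i div n, i mod n) \<in> r then 1 else 0)"

text \<open>The summand 2 is the prologue that fills registers 60 and 61. Since the configuration is
  constant after halting, safety holds at all times and no output is missed.\<close>

theorem program_run:
  assumes big: "big cc (start_state r) w u" and sil: "silent cc" and due: "due D b w b'"
    and p: "p = program cc" and L: "clen cc \<le> L"
  shows "\<exists>ts. sorted_wrt (<) ts \<and> set ts = output_times p n r \<and> length ts = length (outs w) \<and>
    (\<forall>j<length ts. shows_at (config_at p n r (ts ! j)) (outs w ! j)) \<and> halts p n r \<and>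
    (ts \<noteq> [] \<longrightarrow> hd ts \<le> 2 + L * b) \<and>
    (\<forall>j. Suc j < length ts \<longrightarrow> ts ! Suc j \<le> ts ! j + (L * D + 1)) \<and>
    (\<forall>t. safe_at r t)"
proof -
  let ?q0 = "config_at p n r 0"
  let ?q1 = "set_reg 60 (n * n) ?q0"
  let ?q2 = "set_reg 61 (n * n + n) ?q1"
  have code: "code_at p 0 [Mult 60 0 0, Add 61 60 0]" "code_at p 2 (ccom cc 2)" "code_at p (2 + clen cc) [Halt]"
  proof -
    have "code_at p 0 ([Mult 60 0 0, Add 61 60 0] @ ccom cc 2 @ [Halt])"
      by (simp add: p program_def code_at_def)
    then show "code_at p 0 [Mult 60 0 0, Add 61 60 0]" "code_at p 2 (ccom cc 2)" "code_at p (2 + clen cc) [Halt]"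
      by (simp_all add: code_at_append code_at_Cons numeral_2_eq_2)
  qed
  have q0: "pc ?q0 = 0" "reg ?q0 0 = n" "mem ?q0 = mem (initial n r)" "reg ?q0 = reg (initial n r)"
    by (simp_all add: config_at_def initial_def)
  have small: "n < W" "n * n < W" "n * n + n < W" "0 < W" "1 < W" using wide by linarith+
  have b0: "bounded ?q0" using small by (simp add: bounded_def q0 initial_def)
  have b1: "bounded ?q1" by (rule bounded_set_reg[OF b0 small(2)])
  have b2: "bounded ?q2" by (rule bounded_set_reg[OF b1 small(3)])
  have s1: "quiet ?q1 (Suc 0) ?q2"
    by (rule quiet_step[where x = "Add 61 60 0" and ys = "[]"])
      (use code(1) b1 q0 in \<open>auto simp: quiet_0 code_at_Cons\<close>)
  have s0: "quiet ?q0 (Suc (Suc 0)) ?q2"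
    by (rule quiet_step[where x = "Mult 60 0 0" and ys = "[]"])
      (use code(1) b0 q0 s1 in \<open>auto simp: code_at_Cons\<close>)
  note Q = quiet_config[OF s0 HOL.refl]
  have r2: "rel (start_state r) ?q2"
    by (auto simp: rel_def start_state_def q0 initial_def addr_def lim_def split: if_splits)
  obtain q3 where q3: "mruns ?q2 w q3" "rel u q3" "bounded q3" "pc q3 = 2 + clen cc"
    using compile[OF big sil, of ?q2] code(2) r2 b2 L q0 by (auto simp: numeral_2_eq_2)
  have "?q2 = config_at p n r 2" using Q by (simp add: numeral_2_eq_2)
  from mruns_times[OF q3(1) this due] obtain ts t' where ts: "q3 = config_at p n r t'" "2 \<le> t'"
    "sorted_wrt (<) ts" "set ts = {t''. 2 \<le> t'' \<and> t'' < t' \<and> out_at r t''}" "length ts = length (outs w)"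
    "\<forall>j<length ts. shows_at (config_at p n r (ts ! j)) (outs w ! j)"
    "\<forall>t''. 2 \<le> t'' \<longrightarrow> t'' < t' \<longrightarrow> safe_at r t''"
    "ts \<noteq> [] \<longrightarrow> hd ts \<le> 2 + L * b"
    "\<forall>j. Suc j < length ts \<longrightarrow> ts ! Suc j \<le> ts ! j + (L * D + 1)" by blast
  have halt: "current p q3 = Halt" using code(3) q3(4) by (simp add: code_at_Cons current_def)
  have stay: "config_at p n r (t' + j) = q3" for j
  proof (induction j)
    case (Suc j)
    then show ?case using halt config_Suc[of r "t' + j"] by (simp add: step_def)
  qed (simp add: ts(1))
  have late: "config_at p n r t = q3" if "t' \<le> t" for t using stay[of "t - t'"] that by simp
  have early: "safe_at r t \<and> \<not> out_at r t" if "t < 2" for t using Q that by (auto simp: numeral_2_eq_2)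
  have "safe_at r t" for t
  proof -
    consider "t < 2" | "2 \<le> t" "t < t'" | "t' \<le> t" by linarith
    then show ?thesis
    proof cases
      case 3 then show ?thesis using late[of t] halt q3(3) by simp
    qed (use early ts(7) in auto)
  qed
  moreover have "set ts = output_times p n r"
  proof -
    have "\<not> out_at r t" if "t' \<le> t" for t using late[OF that] halt by simp
    then have "out_at r t \<longleftrightarrow> 2 \<le> t \<and> t < t' \<and> out_at r t" for t
      using early[of t] not_le by blast
    then show ?thesis unfolding ts(4) output_times_def by blast
  qed
  moreover have "halts p n r" unfolding halts_def using late[of t'] halt by (intro exI[of _ t']) simp
  ultimately show ?thesis using ts(3,5,6,8,9) by blast
qed

end

section \<open>Deamortisation\<close>

context ram
begin

definition wpw :: "com \<Rightarrow> state \<Rightarrow> (event list \<Rightarrow> state \<Rightarrow> bool) \<Rightarrow> bool" where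
  "wpw c s Q \<longleftrightarrow> (\<exists>w t. big c s w t \<and> Q w t)"

inductive_cases SkipE: "big Skip s w t"
inductive_cases AssignE: "big (Assign x e) s w t"
inductive_cases WriteE: "big (Write a i e) s w t"
inductive_cases EmtE: "big (Emt e) s w t"
inductive_cases ShowE: "big Show s w t"
inductive_cases SeqE: "big (c1 ;; c2) s w t"
inductive_cases CondE: "big (Cond e c1 c2) s w t"
inductive_cases LoopE: "big (Loop e c) s w t"

lemma wpw_mono: "wpw c s Q \<Longrightarrow> (\<And>w t. Q w t \<Longrightarrow> Q' w t) \<Longrightarrow> wpw c s Q'"
  unfolding wpw_def by blast

lemma wpw_Skip [simp]: "wpw Skip s Q \<longleftrightarrow> Q [] s"
  unfolding wpw_def by (blast elim: SkipE intro: big.Skip)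

lemma wpw_Assign [simp]:
  "wpw (Assign x e) s Q \<longleftrightarrow> eok e s \<and> x < 60 \<and> Q [Tick] ((fst s)(x := ev e s), snd s)"
  unfolding wpw_def by (blast elim: AssignE intro: big.Assign)

lemma wpw_Write [simp]:
  "wpw (Write a i e) s Q \<longleftrightarrow> eok i s \<and> eok e s \<and> 0 < a \<and> ev i s < lim a \<and>
    Q [Tick] (fst s, (snd s)(a := (snd s a)(ev i s := ev e s)))"
  unfolding wpw_def by (blast elim: WriteE intro: big.Write)

lemma wpw_Emt [simp]: "wpw (Emt e) s Q \<longleftrightarrow> eok e s \<and> Q [Emit (ev e s)] s"
  unfolding wpw_def by (blast elim: EmtE intro: big.Emt)

lemma wpw_Show [simp]: "wpw Show s Q \<longleftrightarrow> Q [Out (snd s 1)] s"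
  unfolding wpw_def One_nat_def by (metis ShowE big.Show One_nat_def)

lemma wpw_Seq [simp]: "wpw (c1 ;; c2) s Q \<longleftrightarrow> wpw c1 s (\<lambda>w t. wpw c2 t (\<lambda>v. Q (w @ v)))"
proof
  assume "wpw (c1 ;; c2) s Q"
  then show "wpw c1 s (\<lambda>w t. wpw c2 t (\<lambda>v. Q (w @ v)))"
    unfolding wpw_def by (blast elim: SeqE)
next
  assume "wpw c1 s (\<lambda>w t. wpw c2 t (\<lambda>v. Q (w @ v)))"
  then show "wpw (c1 ;; c2) s Q" unfolding wpw_def by (blast intro: Seq)
qed

lemma wpw_Cond [simp]: "wpw (Cond e c1 c2) s Q \<longleftrightarrow> eok e s \<and>
    (if ev e s \<noteq> 0 then wpw c1 s (\<lambda>w. Q (Tick # w @ [Tick])) else wpw c2 s (\<lambda>w. Q (Tick # w @ [Tick])))"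
proof
  assume "wpw (Cond e c1 c2) s Q"
  then show "eok e s \<and> (if ev e s \<noteq> 0 then wpw c1 s (\<lambda>w. Q (Tick # w @ [Tick]))
    else wpw c2 s (\<lambda>w. Q (Tick # w @ [Tick])))"
    unfolding wpw_def by (auto elim!: CondE)
next
  assume "eok e s \<and> (if ev e s \<noteq> 0 then wpw c1 s (\<lambda>w. Q (Tick # w @ [Tick]))
    else wpw c2 s (\<lambda>w. Q (Tick # w @ [Tick])))"
  then show "wpw (Cond e c1 c2) s Q"
    unfolding wpw_def using CondT CondF by (metis (no_types, lifting))
qed

lemma big_Loop: "big (Loop e c) s w u \<longleftrightarrow> eok e s \<and> (if ev e s = 0 then w = [Tick] \<and> u = s
    else \<exists>w1 t v. w = Tick # w1 @ Tick # v \<and> big c s w1 t \<and> big (Loop e c) t v u)"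
proof
  assume "big (Loop e c) s w u"
  then show "eok e s \<and> (if ev e s = 0 then w = [Tick] \<and> u = s
    else \<exists>w1 t v. w = Tick # w1 @ Tick # v \<and> big c s w1 t \<and> big (Loop e c) t v u)"
  proof (rule LoopE, goal_cases)
    case 1 then show ?case by simp
  next
    case (2 w1 t v)
    then have nz: "\<not> ev e s = 0" by simp
    show ?case unfolding if_not_P[OF nz] using 2 by blast
  qed
next
  assume "eok e s \<and> (if ev e s = 0 then w = [Tick] \<and> u = s
    else \<exists>w1 t v. w = Tick # w1 @ Tick # v \<and> big c s w1 t \<and> big (Loop e c) t v u)"
  then show "big (Loop e c) s w u"
  proof (cases "ev e s = 0")
    case False
    assume "eok e s \<and> (if ev e s = 0 then w = [Tick] \<and> u = s
      else \<exists>w1 t v. w = Tick # w1 @ Tick # v \<and> big c s w1 t \<and> big (Loop e c) t v u)"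
    then obtain w1 t v where "eok e s" "w = Tick # w1 @ Tick # v" "big c s w1 t" "big (Loop e c) t v u"
      unfolding if_not_P[OF False] by blast
    then show ?thesis using LoopT[OF _ False, of c w1 t v u] by simp
  qed (auto intro: LoopF)
qed

lemma wpw_Loop: "wpw (Loop e c) s Q \<longleftrightarrow> eok e s \<and> (if ev e s = 0 then Q [Tick] s
    else wpw c s (\<lambda>w t. wpw (Loop e c) t (\<lambda>v. Q (Tick # w @ Tick # v))))"
proof (cases "ev e s = 0")
  case True
  then show ?thesis unfolding wpw_def by (subst big_Loop) simp
next
  case False
  show ?thesis unfolding wpw_def if_not_P[OF False] by (subst big_Loop) (simp only: if_not_P[OF False], blast)
qed

end

text \<open>The queue is a ring buffer in array 22.  Variable 40 is a countdown to the next
  output; 41 to 44 are the head, the tail, the length and the capacity of the queue.\<close>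

definition fetch :: com where
  "fetch = Assign 45 (At 22 (V 41)) ;; Assign 41 (Plus (V 41) (N 1)) ;;
    Cond (Minus (V 44) (V 41)) Skip (Assign 41 (N 0)) ;; Assign 43 (Minus (V 43) (N 1))"

definition flip :: com where
  "flip = Write 1 (Minus (V 45) (N 1)) (Minus (N 1) (At 1 (Minus (V 45) (N 1))))"

definition pop :: com where
  "pop = fetch ;; Loop (V 45) (flip ;; fetch) ;; Show"

definition tick :: "nat \<Rightarrow> com" where
  "tick C = Assign 40 (Minus (V 40) (N 1)) ;; Cond (V 40) Skip (pop ;; Assign 40 (N C))"

definition enqueue :: "exp \<Rightarrow> com" where
  "enqueue e = Write 22 (V 42) e ;; Assign 42 (Plus (V 42) (N 1)) ;;
    Cond (Minus (V 44) (V 42)) Skip (Assign 42 (N 0)) ;; Assign 43 (Plus (V 43) (N 1))"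

text \<open>A full queue is relieved by an output before its time. The countdown restarts as after a
  regular output, so such outputs never delay the next one beyond the normal interval.\<close>

definition push :: "nat \<Rightarrow> exp \<Rightarrow> com" where
  "push C e = Cond (Minus (V 44) (V 43)) Skip (pop ;; Assign 40 (N C)) ;; enqueue e ;; tick C"

text \<open>The ticks are placed to match the original trace event by event: two for a conditional,
  two for an iteration, one for leaving a loop, and one as part of every
  \<open>push\<close>.\<close>

fun deam :: "nat \<Rightarrow> com \<Rightarrow> com" where
  "deam C Skip = Skip"
| "deam C (Assign x e) = Assign x e ;; tick C"
| "deam C (Write a i e) = Write a i e ;; tick C"
| "deam C (Emt e) = push C e"
| "deam C Show = Show"
| "deam C (c1 ;; c2) = deam C c1 ;; deam C c2"
| "deam C (Cond e c1 c2) = tick C ;; Cond e (deam C c1) (deam C c2) ;; tick C"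
| "deam C (Loop e c) = Loop e (tick C ;; deam C c ;; tick C) ;; tick C"

definition drain :: com where
  "drain = Loop (V 43) pop"

fun pure_exp :: "exp \<Rightarrow> bool" where
  "pure_exp (N k) \<longleftrightarrow> True"
| "pure_exp (V x) \<longleftrightarrow> x < 40"
| "pure_exp (Plus a b) \<longleftrightarrow> pure_exp a \<and> pure_exp b"
| "pure_exp (Minus a b) \<longleftrightarrow> pure_exp a \<and> pure_exp b"
| "pure_exp (Times a b) \<longleftrightarrow> pure_exp a \<and> pure_exp b"
| "pure_exp (At a e) \<longleftrightarrow> a \<noteq> 1 \<and> a \<noteq> 22 \<and> pure_exp e"

fun pure :: "com \<Rightarrow> bool" where
  "pure Skip \<longleftrightarrow> True"
| "pure (Assign x e) \<longleftrightarrow> x < 40 \<and> pure_exp e"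
| "pure (Write a i e) \<longleftrightarrow> a \<noteq> 1 \<and> a \<noteq> 22 \<and> pure_exp i \<and> pure_exp e"
| "pure (Emt e) \<longleftrightarrow> pure_exp e"
| "pure Show \<longleftrightarrow> False"
| "pure (c1 ;; c2) \<longleftrightarrow> pure c1 \<and> pure c2"
| "pure (Cond e c1 c2) \<longleftrightarrow> pure_exp e \<and> pure c1 \<and> pure c2"
| "pure (Loop e c) \<longleftrightarrow> pure_exp e \<and> pure c"

lemma silent_deam: "silent (deam C c)"
  by (induction c) (auto simp: tick_def push_def enqueue_def pop_def fetch_def flip_def)

text \<open>The part of the state visible to the producer. Everything else, variables from 40 on and
  arrays 1 and 22, belongs to queue and output, so interleaving leaves the producer's run
  unchanged.\<close>

definition agree :: "state \<Rightarrow> state \<Rightarrow> bool" where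
  "agree s t \<longleftrightarrow> (\<forall>x<40. fst t x = fst s x) \<and> (\<forall>a. a \<noteq> 1 \<longrightarrow> a \<noteq> 22 \<longrightarrow> snd t a = snd s a)"

lemma agree_trans: "agree s t \<Longrightarrow> agree t u \<Longrightarrow> agree s u"
  by (simp add: agree_def)

lemma agree_refl [simp]: "agree s s"
  by (simp add: agree_def)

lemma agree_ev: "agree s t \<Longrightarrow> pure_exp e \<Longrightarrow> ev e t = ev e s"
  by (induction e) (auto simp: agree_def)

lemma (in ram) agree_eok: "agree s t \<Longrightarrow> pure_exp e \<Longrightarrow> eok e s \<Longrightarrow> eok e t"
  by (induction e) (auto simp: agree_ev)

definition zeros :: "nat list \<Rightarrow> nat" where
  "zeros q = length (filter ((=) 0) q)"

lemma zeros_simps [simp]: "zeros [] = 0" "zeros (x # q) = (if x = 0 then 1 else 0) + zeros q"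
  "zeros (q @ r) = zeros q + zeros r" "zeros (map Suc us) = 0"
  by (auto simp: zeros_def comp_def)

text \<open>Each visit accounts for itself and at most three toggles before it. A long queue
  therefore contains many visits.\<close>

lemma gray_length: "gray i q j \<Longrightarrow> i + length q \<le> 4 * zeros q + j"
  by (induction i q j rule: gray.induct) auto

lemma gray_end: "gray i x 0 \<Longrightarrow> i \<le> 3"
  by (induction i x "0 :: nat" rule: gray.induct) auto

lemma gray_first_visit:
  assumes "gray 0 (q @ x) 0" "1 \<le> zeros q"
  obtains us q' where "q = map Suc us @ 0 # q'" "length us \<le> 3" "gray 0 (q' @ x) 0"
proof -
  have "0 \<in> set q" using assms(2) by (induction q) (auto split: if_splits)
  then obtain a q' where q: "q = a @ 0 # q'" "0 \<notin> set a" using split_list_first by metis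
  define us where "us = map (\<lambda>x. x - 1) a"
  have "a = map Suc us" unfolding us_def map_map comp_def using q(2)
    by (intro map_idI[symmetric]) (metis Suc_pred' gr0I diff_Suc_1 One_nat_def)
  then show ?thesis using that[of us q'] assms(1) q(1) by (auto simp: gray_append gray_toggles)
qed

lemma due_silent: "outs w = [] \<Longrightarrow> length w + b' \<le> b \<Longrightarrow> due D b w b'"
  by (induction D b w b' rule: due.induct) auto

lemma due_out: "outs v = [] \<Longrightarrow> outs w = [] \<Longrightarrow> length v \<le> b \<Longrightarrow> length w + b' \<le> D \<Longrightarrow>
    due D b (v @ Out f # w) b'"
  by (rule due_append[of D b v 0]) (auto intro!: due_silent)

section \<open>The queue and its invariant\<close>

locale deamortizer = ram +
  fixes C lag0 :: nat
  assumes C: "2 \<le> C" "C < W"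
begin

definition qrep :: "nat list \<Rightarrow> state \<Rightarrow> bool" where
  "qrep q t \<longleftrightarrow> (let cap = fst t 44 in fst t 41 < cap \<and> fst t 43 = length q \<and> length q \<le> cap \<and>
    cap \<le> M \<and> 4 * lag0 + 8 \<le> cap \<and> fst t 42 = (fst t 41 + length q) mod cap \<and>
    (\<forall>j<length q. snd t 22 ((fst t 41 + j) mod cap) = q ! j))"

definition out_rep :: "nat set \<Rightarrow> state \<Rightarrow> bool" where
  "out_rep S t \<longleftrightarrow> S \<subseteq> {..<n} \<and> (\<forall>u<n. snd t 1 u = (if u \<in> S then 1 else 0))"

text \<open>\<open>z\<close> is the part of the producer's trace that is still to come. The last
  condition grants the producer the current countdown plus \<open>C\<close> events for each visit
  already queued or still to be produced in \<open>u\<close>, so that a visit is in the queue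
  whenever the countdown expires.\<close>

definition core :: "nat list \<Rightarrow> nat set \<Rightarrow> event list \<Rightarrow> state \<Rightarrow> bool" where
  "core q S z t \<longleftrightarrow> qrep q t \<and> out_rep S t \<and> (\<forall>u. Suc u \<in> set (q @ emits z) \<longrightarrow> u < n) \<and>
    gray 0 (q @ emits z) 0 \<and> 1 \<le> fst t 40 \<and> fst t 40 \<le> C + lag0 + 1 \<and>
    (\<forall>u v. z = u @ v \<longrightarrow> length u < C * (zeros q + vis u) + fst t 40)"

definition depicts :: "(nat \<Rightarrow> nat) \<Rightarrow> nat set \<Rightarrow> bool" where
  "depicts f T \<longleftrightarrow> T \<subseteq> {..<n} \<and> (\<forall>u<n. f u = (if u \<in> T then 1 else 0))"

text \<open>Steps of execution granted per unit of the countdown. It exceeds the 40 steps of a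
  \<open>pop\<close> together with the margins for the surrounding code. After an output the budget
  is \<open>C\<close> units for the new countdown, the extra one in
  \<open>E * (fst t 40 + 1)\<close>, and one to finish the current call.\<close>

abbreviation E :: nat where "E \<equiv> 100"
abbreviation budget :: nat where "budget \<equiv> E * (C + 2)"

text \<open>A conservation law: what has been output, followed by what the queue and the rest of the
  trace will show, remains the same.\<close>

definition link :: "nat list \<Rightarrow> nat set \<Rightarrow> nat list \<Rightarrow> event list \<Rightarrow> nat list \<Rightarrow> nat set \<Rightarrow> nat list \<Rightarrow> bool" where
  "link q S x v q' S' x' \<longleftrightarrow> (\<exists>Ts. list_all2 depicts (outs v) Ts \<and> walk S (q @ x) = Ts @ walk S' (q' @ x'))"

lemma link_trans: "link q S x v q' S' x' \<Longrightarrow> link q' S' x' v' q'' S'' x'' \<Longrightarrow> link q S x (v @ v') q'' S'' x''"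
  unfolding link_def outs_append by (metis append.assoc list_all2_appendI)

lemma link_refl: "outs v = [] \<Longrightarrow> q @ x = q' @ x' \<Longrightarrow> link q S x v q' S x'"
  by (simp add: link_def)

lemma fetch_ok:
  assumes q: "qrep (x # q) t"
  shows "wpw fetch t (\<lambda>v t'. outs v = [] \<and> length v \<le> 7 \<and> fst t' 45 = x \<and> qrep q t' \<and> snd t' = snd t \<and>
    (\<forall>y. y \<notin> {41, 43, 45} \<longrightarrow> fst t' y = fst t y))"
proof -
  obtain R A where t: "t = (R, A)" by force
  define cap where "cap = R 44"
  have q': "R 41 < cap" "R 43 = Suc (length q)" "Suc (length q) \<le> cap" "cap \<le> M" "4 * lag0 + 8 \<le> cap"
    "R 42 = (R 41 + Suc (length q)) mod cap"
    and cells: "\<And>j. j < Suc (length q) \<Longrightarrow> A 22 ((R 41 + j) mod cap) = (x # q) ! j"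
    using q by (auto simp: qrep_def t cap_def Let_def)
  have x: "A 22 (R 41) = x" using cells[of 0] q'(1) by simp
  have W: "R 41 + 1 < W" "0 < W" "1 < W" using q' wide by linarith+
  define h where "h = (if cap - (R 41 + 1) = 0 then 0 else R 41 + 1)"
  have h: "h = (R 41 + 1) mod cap" "h < cap" using q'(1) by (auto simp: h_def mod_if)
  have hm: "(h + j) mod cap = Suc (R 41 + j) mod cap" for j
    unfolding h(1) by (simp add: mod_add_left_eq)
  have rep: "qrep q (R(45 := x, 41 := h, 43 := length q), A)"
    using q' cells[of "Suc _"] h(2) by (auto simp: qrep_def Let_def hm simp flip: cap_def)
  have M41: "R 41 < M" using q' by simp
  show ?thesis
    using rep W M41 q' x unfolding fetch_def t
    by (auto simp: lim_def h_def cap_def fun_upd_twist simp flip: One_nat_def)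
qed

lemma flip_ok:
  assumes o: "out_rep S t" and x: "fst t 45 = Suc u" "u < n"
  shows "wpw flip t (\<lambda>v t'. v = [Tick] \<and> fst t' = fst t \<and> out_rep (xor S {u}) t' \<and>
    (\<forall>a. a \<noteq> 1 \<longrightarrow> snd t' a = snd t a))"
proof -
  have W: "1 < W" using wide by simp
  have "out_rep (xor S {u}) (fst t, (snd t)(1 := (snd t 1)(u := 1 - snd t 1 u)))"
    using o x by (auto simp: out_rep_def xor_def)
  then show ?thesis using x W by (simp add: flip_def lim_def)
qed

lemma qrep_cong: "fst t' = fst t \<Longrightarrow> snd t' 22 = snd t 22 \<Longrightarrow> qrep q t' = qrep q t"
  by (simp add: qrep_def Let_def)

lemma out_rep_cong: "snd t' 1 = snd t 1 \<Longrightarrow> out_rep S t' = out_rep S t"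
  by (simp add: out_rep_def)

lemma pop_loop:
  assumes "fst t 45 = hd (map Suc us @ [0])" "qrep (tl (map Suc us @ [0]) @ q) t" "out_rep S t"
    "\<forall>u\<in>set us. u < n"
  shows "wpw (Loop (V 45) (flip ;; fetch)) t (\<lambda>v t'. outs v = [] \<and> length v \<le> 1 + 10 * length us \<and>
    qrep q t' \<and> out_rep (final S (map Suc us)) t' \<and> agree t t' \<and>
    (\<forall>y. y \<notin> {41, 43, 45} \<longrightarrow> fst t' y = fst t y))"
  using assms
proof (induction us arbitrary: t S)
  case Nil
  then show ?case by (subst wpw_Loop) simp
next
  case (Cons u us)
  have q: "qrep (hd (map Suc us @ [0]) # (tl (map Suc us @ [0]) @ q)) t"
    using Cons.prems(2) by (cases us) auto
  have "wpw (flip ;; fetch) t (\<lambda>w t'. outs w = [] \<and> length w \<le> 8 \<and> fst t' 45 = hd (map Suc us @ [0]) \<and>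
    qrep (tl (map Suc us @ [0]) @ q) t' \<and> out_rep (xor S {u}) t' \<and> agree t t' \<and>
    (\<forall>y. y \<notin> {41, 43, 45} \<longrightarrow> fst t' y = fst t y))"
    unfolding wpw_Seq
  proof (rule wpw_mono[OF flip_ok[OF Cons.prems(3), of u]])
    fix w t1 assume 1: "w = [Tick] \<and> fst t1 = fst t \<and> out_rep (xor S {u}) t1 \<and> (\<forall>a. a \<noteq> 1 \<longrightarrow> snd t1 a = snd t a)"
    then have "qrep (hd (map Suc us @ [0]) # (tl (map Suc us @ [0]) @ q)) t1"
      using q qrep_cong[of t1 t] by simp
    show "wpw fetch t1 (\<lambda>v t'. outs (w @ v) = [] \<and> length (w @ v) \<le> 8 \<and> fst t' 45 = hd (map Suc us @ [0]) \<and>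
      qrep (tl (map Suc us @ [0]) @ q) t' \<and> out_rep (xor S {u}) t' \<and> agree t t' \<and>
      (\<forall>y. y \<notin> {41, 43, 45} \<longrightarrow> fst t' y = fst t y))"
    proof (rule wpw_mono[OF fetch_ok[OF \<open>qrep _ t1\<close>]])
      fix v t2
      assume 2: "outs v = [] \<and> length v \<le> 7 \<and> fst t2 45 = hd (map Suc us @ [0]) \<and>
        qrep (tl (map Suc us @ [0]) @ q) t2 \<and> snd t2 = snd t1 \<and> (\<forall>y. y \<notin> {41, 43, 45} \<longrightarrow> fst t2 y = fst t1 y)"
      then have "out_rep (xor S {u}) t2" using 1 out_rep_cong[of t2 t1] by simp
      then show "outs (w @ v) = [] \<and> length (w @ v) \<le> 8 \<and> fst t2 45 = hd (map Suc us @ [0]) \<and>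
        qrep (tl (map Suc us @ [0]) @ q) t2 \<and> out_rep (xor S {u}) t2 \<and> agree t t2 \<and>
        (\<forall>y. y \<notin> {41, 43, 45} \<longrightarrow> fst t2 y = fst t y)" using 1 2 by (simp add: agree_def)
    qed
  qed (use Cons.prems in auto)
  note iter = this
  have "wpw (flip ;; fetch) t (\<lambda>w t'. wpw (Loop (V 45) (flip ;; fetch)) t' (\<lambda>v t'. outs (Tick # w @ Tick # v) = [] \<and>
    length (Tick # w @ Tick # v) \<le> 1 + 10 * length (u # us) \<and>
    qrep q t' \<and> out_rep (final S (map Suc (u # us))) t' \<and> agree t t' \<and>
    (\<forall>y. y \<notin> {41, 43, 45} \<longrightarrow> fst t' y = fst t y)))"
  proof (rule wpw_mono[OF iter])
    fix w t1
    assume 1: "outs w = [] \<and> length w \<le> 8 \<and> fst t1 45 = hd (map Suc us @ [0]) \<and>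
      qrep (tl (map Suc us @ [0]) @ q) t1 \<and> out_rep (xor S {u}) t1 \<and> agree t t1 \<and>
      (\<forall>y. y \<notin> {41, 43, 45} \<longrightarrow> fst t1 y = fst t y)"
    show "wpw (Loop (V 45) (flip ;; fetch)) t1 (\<lambda>v t'. outs (Tick # w @ Tick # v) = [] \<and>
      length (Tick # w @ Tick # v) \<le> 1 + 10 * length (u # us) \<and>
      qrep q t' \<and> out_rep (final S (map Suc (u # us))) t' \<and> agree t t' \<and>
      (\<forall>y. y \<notin> {41, 43, 45} \<longrightarrow> fst t' y = fst t y))"
    proof (rule wpw_mono[OF Cons.IH[of t1 "xor S {u}"]])
      fix v t2
      assume 2: "outs v = [] \<and> length v \<le> 1 + 10 * length us \<and> qrep q t2 \<and>
        out_rep (final (xor S {u}) (map Suc us)) t2 \<and> agree t1 t2 \<and>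
        (\<forall>y. y \<notin> {41, 43, 45} \<longrightarrow> fst t2 y = fst t1 y)"
      have "agree t t2" using 1 2 agree_trans by blast
      then show "outs (Tick # w @ Tick # v) = [] \<and>
        length (Tick # w @ Tick # v) \<le> 1 + 10 * length (u # us) \<and>
        qrep q t2 \<and> out_rep (final S (map Suc (u # us))) t2 \<and> agree t t2 \<and>
        (\<forall>y. y \<notin> {41, 43, 45} \<longrightarrow> fst t2 y = fst t y)" using 1 2 by simp
    qed (use 1 Cons.prems(4) in auto)
  qed
  then show ?case using Cons.prems(1) by (subst wpw_Loop) (simp del: wpw_Seq)
qed

lemma pop_ok:
  assumes q: "qrep (map Suc us @ 0 # q) t" and o: "out_rep S t" and us: "\<forall>u\<in>set us. u < n" "length us \<le> 3"
  shows "wpw pop t (\<lambda>v t'. \<exists>v' f. v = v' @ [Out f] \<and> outs v' = [] \<and> length v' \<le> 40 \<and>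
    qrep q t' \<and> out_rep (final S (map Suc us)) t' \<and> depicts f (final S (map Suc us)) \<and> agree t t' \<and>
    (\<forall>y. y \<notin> {41, 43, 45} \<longrightarrow> fst t' y = fst t y))"
proof -
  have q': "qrep (hd (map Suc us @ [0]) # (tl (map Suc us @ [0]) @ q)) t" using q by (cases us) auto
  show ?thesis unfolding pop_def wpw_Seq
  proof (rule wpw_mono[OF fetch_ok[OF q']], goal_cases)
    case (1 w t1)
    have p: "fst t1 45 = hd (map Suc us @ [0])" "qrep (tl (map Suc us @ [0]) @ q) t1" "out_rep S t1"
      using 1 o out_rep_cong[of t1 t] by auto
    show ?case
    proof (rule wpw_mono[OF pop_loop[OF p us(1)]], goal_cases)
      case (1 w' t2)
      then have "depicts (snd t2 1) (final S (map Suc us))" by (auto simp: depicts_def out_rep_def)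
      then show ?case using 1 \<open>outs w = [] \<and> _\<close> us(2) unfolding wpw_Show
        by (intro exI[of _ "w @ w'"] exI[of _ "snd t2 1"]) (auto simp: agree_def)
    qed
  qed
qed

definition res :: "nat list \<Rightarrow> nat set \<Rightarrow> event list \<Rightarrow> nat \<Rightarrow> event list \<Rightarrow> nat list \<Rightarrow> nat set \<Rightarrow> event list \<Rightarrow> state \<Rightarrow> bool" where
  "res q S z b v q' S' z' t' \<longleftrightarrow> core q' S' z' t' \<and> link q S (emits z) v q' S' (emits z') \<and>
    due budget b v (E * (fst t' 40 + 1))"

text \<open>Popping restores the invariant when some visit is queued: the budget \<open>C\<close> granted to the
  producer is what that visit was worth.\<close>

lemma pop_reset:
  assumes core: "core q S z' t0" and z: "emits z' = emits z" and t: "fst t = (fst t0)(40 := r)" "snd t = snd t0"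
    and zq: "1 \<le> zeros q"
    and lag: "\<And>u v. z = u @ v \<Longrightarrow> length u < C * (zeros q + vis u)"
  shows "wpw (pop ;; Assign 40 (N C)) t (\<lambda>v t'. \<exists>q' S' v' f. core q' S' z t' \<and>
    link q S (emits z) v q' S' (emits z) \<and> v = v' @ [Out f, Tick] \<and> outs v' = [] \<and> length v' \<le> 40 \<and>
    fst t' 40 = C \<and> agree t t' \<and> length q' < length q \<and> fst t' 44 = fst t 44)"
proof -
  have g: "gray 0 (q @ emits z) 0" using core z by (simp add: core_def)
  obtain us q' where q: "q = map Suc us @ 0 # q'" "length us \<le> 3" "gray 0 (q' @ emits z) 0"
    using gray_first_visit[OF g zq] .
  have items: "\<forall>u. Suc u \<in> set (q @ emits z) \<longrightarrow> u < n" using core z by (simp add: core_def)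
  have us: "\<forall>u\<in>set us. u < n" using items q by auto
  have rep: "qrep (map Suc us @ 0 # q') t" using core t q by (simp add: core_def qrep_def Let_def)
  have o: "out_rep S t" using core t by (simp add: core_def out_rep_def)
  let ?S = "final S (map Suc us)"
  show ?thesis unfolding wpw_Seq
  proof (rule wpw_mono[OF pop_ok[OF rep o us q(2)]], goal_cases)
    case (1 w t1)
    then obtain v' f where 2: "w = v' @ [Out f]" "outs v' = []" "length v' \<le> 40" "qrep q' t1" "out_rep ?S t1"
      "depicts f ?S" "agree t t1" "\<forall>y. y \<notin> {41, 43, 45} \<longrightarrow> fst t1 y = fst t y" by blast
    let ?t = "((fst t1)(40 := C), snd t1)"
    have "length u < C * (zeros q' + vis u) + C" if "z = u @ v" for u v
      using lag[OF that] by (simp add: q(1))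
    then have "core q' ?S z ?t" using 2 q(3) items q(1) C
      unfolding core_def by (auto simp: qrep_def out_rep_def Let_def)
    moreover have "link q S (emits z) (w @ [Tick]) q' ?S (emits z)"
      unfolding link_def using 2 by (intro exI[of _ "[?S]"]) (simp add: q(1) walk_append)
    ultimately show ?case using 2 C q(1)
      by (simp, intro exI[of _ q'] exI[of _ ?S] conjI exI[of _ v'] exI[of _ f]) (auto simp: agree_def)
  qed
qed

text \<open>The 20 steps missing before and the 20 left over afterwards are margins for the
  instructions of the producer around the tick; \<open>due_pad\<close> spends them.\<close>

lemma tick_ok:
  assumes core: "core q S (Tick # z) t"
  shows "wpw (tick C) t (\<lambda>v t'. agree t t' \<and>
    (\<exists>q' S'. core q' S' z t' \<and> link q S (emits z) v q' S' (emits z) \<and>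
      due budget (E * (fst t 40 + 1) - 20) v (E * (fst t' 40 + 1) + 20)))"
proof -
  have lag: "length u + 1 < C * (zeros q + vis u) + fst t 40" if "z = u @ v" for u v
  proof -
    have "Tick # z = (Tick # u) @ v" using that by simp
    moreover have "\<forall>u v. Tick # z = u @ v \<longrightarrow> length u < C * (zeros q + vis u) + fst t 40"
      using core unfolding core_def by blast
    ultimately have "length (Tick # u) < C * (zeros q + vis (Tick # u)) + fst t 40" by blast
    then show ?thesis by (simp add: vis_def)
  qed
  have c40: "1 \<le> fst t 40" and W: "1 < W" using core wide by (auto simp: core_def)
  let ?t = "((fst t)(40 := fst t 40 - 1), snd t)"
  show ?thesis
  proof (cases "fst t 40 = 1")
    case False
    have "core q S z ?t" unfolding core_def
      using core lag False by (fastforce simp: core_def qrep_def out_rep_def Let_def)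
    moreover have "due budget (E * (fst t 40 + 1) - 20) [Tick, Tick, Tick] (E * (fst t 40 - 1 + 1) + 20)"
      using c40 by (intro due_silent) auto
    moreover have "agree t ?t" by (simp add: agree_def)
    moreover have "wpw (tick C) t (\<lambda>v t'. v = [Tick, Tick, Tick] \<and> t' = ?t)"
      using False c40 W by (simp add: tick_def)
    ultimately show ?thesis
      by (elim wpw_mono) (metis (no_types, lifting) fst_conv fun_upd_same link_refl outs.simps(1,3))
  next
    case True
    \<comment> \<open>The invariant for the prefix consisting of the present tick: with countdown 1
      the queue must hold a visit.\<close>
    have zq: "1 \<le> zeros q" using lag[of "[]" z] True by (cases "zeros q") (auto simp: vis_def)
    have lag': "length u < C * (zeros q + vis u)" if "z = u @ v" for u v using lag[OF that] True by simp
    have wp: "wpw (pop ;; Assign 40 (N C)) ?t (\<lambda>v t'. \<exists>q' S' v' f. core q' S' z t' \<and>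
      link q S (emits z) v q' S' (emits z) \<and> v = v' @ [Out f, Tick] \<and> outs v' = [] \<and> length v' \<le> 40 \<and>
      fst t' 40 = C \<and> agree ?t t' \<and> length q' < length q \<and> fst t' 44 = fst ?t 44)"
      by (rule pop_reset[OF core _ _ _ zq lag', where r = 0]) (use True in auto)
    have t0: "?t = ((fst t)(40 := 0), snd t)" using True by simp
    have red: "wpw (tick C) t Q" if "wpw (pop ;; Assign 40 (N C)) ?t (\<lambda>w. Q (Tick # Tick # w @ [Tick]))" for Q
      using that True W unfolding tick_def t0 by (simp add: wpw_Seq[of "Assign _ _"] del: wpw_Seq)
    show ?thesis
    proof (rule red, rule wpw_mono[OF wp], goal_cases)
      case (1 v t')
      then obtain q' S' v' f where 2: "core q' S' z t'" "link q S (emits z) v q' S' (emits z)"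
        "v = v' @ [Out f, Tick]" "outs v' = []" "length v' \<le> 40" "fst t' 40 = C" "agree ?t t'"
        by (auto simp: True)
      have a: "agree t t'" using 2(7) by (simp add: agree_def)
      have "link q S (emits z) (Tick # Tick # v @ [Tick]) q' S' (emits z)"
        using 2(2) by (simp add: link_def)
      moreover have "due budget (E * 2 - 20) ((Tick # Tick # v') @ Out f # [Tick, Tick]) (E * (C + 1) + 20)"
        using 2 by (intro due_out) auto
      ultimately show ?case using a 2 True by auto
    qed
  qed
qed

lemma push_ok:
  assumes core: "core q S (Emit x # z) t" and e: "eok e t" "ev e t = x" "pure_exp e"
    and fac: "\<And>u v. Emit x # z = u @ v \<Longrightarrow> length u \<le> C * vis u + lag0"
  shows "wpw (push C e) t (\<lambda>v t'. agree t t' \<and>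
    (\<exists>q' S'. core q' S' z t' \<and> link q S (x # emits z) v q' S' (emits z) \<and>
      due budget (E * (fst t 40 + 1)) v (E * (fst t' 40 + 1))))"
proof -
  text \<open>After making room, the item is appended and the event becomes a mere tick.\<close>
  have append: "wpw (enqueue e ;; tick C) t1 (\<lambda>v t'. agree t t' \<and> (\<exists>q' S'. core q' S' z t' \<and> link q1 S1 (x # emits z) v q' S' (emits z) \<and>
      due budget (E * (fst t1 40 + 1) - 10) v (E * (fst t' 40 + 1))))"
    if c1: "core q1 S1 (Emit x # z) t1" and a1: "agree t t1" and room: "length q1 < fst t1 44" for q1 S1 t1
  proof -
    obtain R A where t1: "t1 = (R, A)" by force
    define cap where "cap = R 44"
    have q': "R 41 < cap" "R 43 = length q1" "length q1 < cap" "cap \<le> M" "4 * lag0 + 8 \<le> cap"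
      "R 42 = (R 41 + length q1) mod cap"
      and cells: "\<And>j. j < length q1 \<Longrightarrow> A 22 ((R 41 + j) mod cap) = q1 ! j"
      using c1 room by (auto simp: core_def qrep_def t1 cap_def Let_def)
    have R42: "R 42 < cap" and R42M: "R 42 < M" using q' mod_less_divisor[of cap "R 41 + length q1"] by linarith+
    define h where "h = (if cap - (R 42 + 1) = 0 then 0 else R 42 + 1)"
    have h: "h = (R 42 + 1) mod cap" using R42 by (auto simp: h_def mod_if)
    have h': "h = (R 41 + Suc (length q1)) mod cap"
      unfolding h q'(6) by (simp add: mod_Suc_eq)
    let ?t = "(R(42 := h, 43 := length q1 + 1), A(22 := (A 22)(R 42 := x)))"
    have ne: "(R 41 + j) mod cap \<noteq> R 42" if "j < length q1" for j
    proof
      assume "(R 41 + j) mod cap = R 42"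
      then have "(R 41 + j) mod cap = (R 41 + length q1) mod cap" using q'(6) by simp
      then have "cap dvd (R 41 + length q1) - (R 41 + j)"
        using that by (metis mod_eq_dvd_iff_nat add_left_mono less_imp_le)
      then have "cap \<le> length q1 - j" using that by (intro dvd_imp_le) auto
      then show False using q'(3) by simp
    qed
    have rep: "qrep (q1 @ [x]) ?t"
      using q' h' cells ne R42 by (auto simp: qrep_def Let_def nth_append less_Suc_eq simp flip: cap_def)
    have "length u < C * (zeros (q1 @ [x]) + vis u) + R 40" if zu: "Tick # z = u @ v" for u v
    proof (cases u)
      case Nil
      then show ?thesis using c1 by (auto simp: core_def t1)
    next
      case (Cons y u')
      then have u: "u = Tick # u'" "Emit x # z = (Emit x # u') @ v" using zu by auto
      have "\<forall>u v. Emit x # z = u @ v \<longrightarrow> length u < C * (zeros q1 + vis u) + R 40"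
        using c1 unfolding core_def t1 fst_conv by blast
      then have "length (Emit x # u') < C * (zeros q1 + vis (Emit x # u')) + R 40" using u(2) by blast
      then show ?thesis using u(1) by (simp add: vis_def split: if_splits)
    qed
    then have c2: "core (q1 @ [x]) S1 (Tick # z) ?t"
      using c1 rep unfolding core_def by (auto simp: t1 out_rep_def)
    have a2: "agree t ?t" using a1 by (auto simp: agree_def t1)
    have W: "R 42 + 1 < W" "length q1 + 1 < W" "0 < W" "1 < W" using q' R42 wide by linarith+
    have e1: "ev e (R, A) = x" "eok e (R, A)" using agree_ev[OF a1 e(3)] agree_eok[OF a1 e(3)] e t1 by auto
    have pre: "wpw (enqueue e) (R, A) (\<lambda>v t'. outs v = [] \<and> length v \<le> 10 \<and> t' = ?t)"
      unfolding enqueue_def using W q'(1-5) R42 R42M e1 by (auto simp: lim_def h_def cap_def fun_upd_twist simp flip: One_nat_def)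
    show ?thesis unfolding wpw_Seq t1
    proof (rule wpw_mono[OF pre], goal_cases)
      case (1 w t')
      then have t': "t' = ?t" "outs w = []" "length w \<le> 10" by auto
      show ?case unfolding t'(1)
      proof (rule wpw_mono[OF tick_ok[OF c2]], goal_cases)
        case (1 v t2)
        then obtain q' S' where 3: "agree ?t t2" "core q' S' z t2" "link (q1 @ [x]) S1 (emits z) v q' S' (emits z)"
          "due budget (E * (R 40 + 1) - 20) v (E * (fst t2 40 + 1) + 20)" by auto
        have "link q1 S1 (x # emits z) (w @ v) q' S' (emits z)"
          using 3(3) t'(2) by (simp add: link_def)
        moreover have "due budget (E * (R 40 + 1) - 10) (w @ v) (E * (fst t2 40 + 1))"
        proof (rule due_append)
          show "due budget (E * (R 40 + 1) - 10) w (E * (R 40 + 1) - 20)"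
            using t' by (intro due_silent) auto
          show "due budget (E * (R 40 + 1) - 20) v (E * (fst t2 40 + 1))" using due_mono[OF 3(4)] by simp
        qed
        ultimately show ?case using 3 agree_trans[OF a2] by auto
      qed
    qed
  qed
  have qr: "fst t 43 = length q" "length q \<le> fst t 44" using core by (auto simp: core_def qrep_def Let_def)
  show ?thesis
  proof (cases "length q < fst t 44")
    case True
    have red: "wpw (push C e) t Q" if "wpw (enqueue e ;; tick C) t (\<lambda>w. Q (Tick # Tick # w))" for Q
      using that True qr unfolding push_def by (simp add: wpw_Seq[of "Cond _ _ _"] del: wpw_Seq)
    show ?thesis
    proof (rule red, rule wpw_mono[OF append[OF core agree_refl True]], goal_cases)
      case (1 v t')
      then obtain q' S' where 3: "agree t t'" "core q' S' z t'" "link q S (x # emits z) v q' S' (emits z)"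
        "due budget (E * (fst t 40 + 1) - 10) v (E * (fst t' 40 + 1))" by auto
      have "link q S (x # emits z) (Tick # Tick # v) q' S' (emits z)" using 3(3) by (simp add: link_def)
      moreover have "due budget (E * (fst t 40 + 1)) (Tick # Tick # v) (E * (fst t' 40 + 1))"
        using due_mono[OF 3(4), of "E * (fst t 40 + 1) - 1 - 1"] by simp
      ultimately show ?case using 3 by auto
    qed
  next
    case False
    then have full: "length q = fst t 44" using qr by simp
    \<comment> \<open>A full queue has at least \<open>4 * lag0 + 8\<close> items and at most
      \<open>4 * zeros q + 3\<close>. It holds so many visits that they cover any lag of the
      remaining trace, which makes the early restart of the countdown safe.\<close>
    have zq: "lag0 + 1 < zeros q"
    proof -
      have "gray 0 (q @ (x # emits z)) 0" using core by (simp add: core_def)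
      then obtain j where j: "gray 0 q j" "gray j (x # emits z) 0" by (auto simp: gray_append)
      have "length q \<le> 4 * zeros q + 3" using gray_length[OF j(1)] gray_end[OF j(2)] by simp
      moreover have "4 * lag0 + 8 \<le> length q" using full core by (auto simp: core_def qrep_def Let_def)
      ultimately show ?thesis by simp
    qed
    have lag: "length u < C * (zeros q + vis u)" if "Emit x # z = u @ v" for u v
    proof -
      have "length u \<le> C * vis u + lag0" by (rule fac[OF that])
      moreover have "lag0 < C * zeros q" using zq C(1) by (metis add_lessD1 less_le_trans le_add1
            mult_le_mono1 mult_1 one_le_numeral order_trans less_imp_le)
      ultimately show ?thesis by (simp add: algebra_simps)
    qed
    have wp: "wpw (pop ;; Assign 40 (N C)) t (\<lambda>v t'. \<exists>q' S' v' f. core q' S' (Emit x # z) t' \<and>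
      link q S (emits (Emit x # z)) v q' S' (emits (Emit x # z)) \<and> v = v' @ [Out f, Tick] \<and> outs v' = [] \<and>
      length v' \<le> 40 \<and> fst t' 40 = C \<and> agree t t' \<and> length q' < length q \<and> fst t' 44 = fst t 44)"
      by (rule pop_reset[OF core _ _ _ _ lag, where r = "fst t 40"]) (use zq in auto)
    have red: "wpw (push C e) t Q" if "wpw (pop ;; Assign 40 (N C)) t
      (\<lambda>w t1. wpw (enqueue e ;; tick C) t1 (\<lambda>v. Q (Tick # w @ Tick # v)))" for Q
      using that full qr unfolding push_def by (simp add: wpw_Seq[of "Cond _ _ _"] del: wpw_Seq)
    show ?thesis
    proof (rule red, rule wpw_mono[OF wp], goal_cases)
      case (1 w t1)
      then obtain q1 S1 v' f where 2: "core q1 S1 (Emit x # z) t1"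
        "link q S (x # emits z) w q1 S1 (x # emits z)" "w = v' @ [Out f, Tick]" "outs v' = []"
        "length v' \<le> 40" "fst t1 40 = C" "agree t t1" "length q1 < length q" "fst t1 44 = fst t 44" by auto
      have room: "length q1 < fst t1 44" using 2 full by simp
      show ?case
      proof (rule wpw_mono[OF append[OF 2(1,7) room]], goal_cases)
        case (1 v t')
        then obtain q' S' where 3: "agree t t'" "core q' S' z t'" "link q1 S1 (x # emits z) v q' S' (emits z)"
          "due budget (E * (C + 1) - 10) v (E * (fst t' 40 + 1))" using 2(6) by auto
        have "link q S (x # emits z) (Tick # w @ Tick # v) q' S' (emits z)"
          using link_trans[OF 2(2) 3(3)] by (simp add: link_def)
        moreover have "due budget (E * (fst t 40 + 1)) (((Tick # v') @ Out f # [Tick, Tick]) @ v) (E * (fst t' 40 + 1))"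
        proof (rule due_append[OF _ 3(4)])
          show "due budget (E * (fst t 40 + 1)) ((Tick # v') @ Out f # [Tick, Tick]) (E * (C + 1) - 10)"
            using 2(4,5) by (intro due_out) auto
        qed
        ultimately show ?case using 3 2(3) by auto
      qed
    qed
  qed
qed

section \<open>The interleaved program simulates the producer\<close>

lemma core_cong:
  "core q S z t \<Longrightarrow> (\<forall>y. 40 \<le> y \<longrightarrow> fst t' y = fst t y) \<Longrightarrow> snd t' 1 = snd t 1 \<Longrightarrow> snd t' 22 = snd t 22 \<Longrightarrow>
    core q S z t'"
  by (simp add: core_def qrep_def out_rep_def Let_def)

definition fac :: "event list \<Rightarrow> bool" where
  "fac z \<longleftrightarrow> (\<forall>x u v. z = x @ u @ v \<longrightarrow> length u \<le> C * vis u + lag0)"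

lemma fac_suffix: "fac (x @ z) \<Longrightarrow> fac z"
  unfolding fac_def by (metis append.assoc)

text \<open>The quantification over all continuations \<open>z\<close> is needed because
  \<open>core\<close> speaks about the future: in a sequential composition the trace of the second
  command is part of the continuation of the first.\<close>

definition sim :: "com \<Rightarrow> state \<Rightarrow> event list \<Rightarrow> state \<Rightarrow> bool" where
  "sim c s w s' \<longleftrightarrow> (\<forall>q S z t. agree s t \<longrightarrow> core q S (w @ z) t \<longrightarrow> fac (w @ z) \<longrightarrow>
    (\<exists>v q' S' t'. big (deam C c) t v t' \<and> agree s' t' \<and> core q' S' z t' \<and>
      link q S (emits w @ emits z) v q' S' (emits z) \<and>
      due budget (E * (fst t 40 + 1)) v (E * (fst t' 40 + 1))))"

lemma tick_sim:
  assumes "core q S (Tick # z) t" "agree s t"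
  shows "\<exists>v q' S' t'. big (tick C) t v t' \<and> agree s t' \<and> core q' S' z t' \<and>
    link q S (emits z) v q' S' (emits z) \<and> due budget (E * (fst t 40 + 1) - 20) v (E * (fst t' 40 + 1) + 20)"
  using tick_ok[OF assms(1)] agree_trans[OF assms(2)] unfolding wpw_def by blast

lemma due_pad: "due budget (E * (i + 1) - 20) v (E * (j + 1) + 20) \<Longrightarrow> outs x = [] \<Longrightarrow> length x \<le> 20 \<Longrightarrow>
    outs y = [] \<Longrightarrow> length y \<le> 20 \<Longrightarrow> due budget (E * (i + 1)) (x @ v @ y) (E * (j + 1))"
  by (rule due_append[OF due_silent due_append[OF _ due_silent]]) auto

lemma link_pad: "link q S x v q' S' x' \<Longrightarrow> outs a = [] \<Longrightarrow> outs b = [] \<Longrightarrow> link q S x (a @ v @ b) q' S' x'"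
  by (simp add: link_def)

lemma deam_ok:
  assumes "big c s w s'" "pure c"
  shows "sim c s w s'"
  using assms
proof (induction rule: big.induct)
  case (Skip s)
  show ?case unfolding sim_def
  proof (intro allI impI)
    fix q S z t assume "agree s t" "core q S ([] @ z) t"
    then show "\<exists>v q' S' t'. big (deam C Skip) t v t' \<and> agree s t' \<and> core q' S' z t' \<and>
      link q S (emits [] @ emits z) v q' S' (emits z) \<and> due budget (E * (fst t 40 + 1)) v (E * (fst t' 40 + 1))"
      by (intro exI[of _ "[]"] exI[of _ q] exI[of _ S] exI[of _ t]) (auto simp: link_refl intro: big.Skip)
  qed
next
  case (Assign e s x)
  show ?case unfolding sim_def
  proof (intro allI impI)
    fix q S z t assume a: "agree s t" and c: "core q S ([Tick] @ z) t"
    let ?s = "((fst s)(x := ev e s), snd s)" and ?t = "((fst t)(x := ev e t), snd t)"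
    have p: "x < 40" "pure_exp e" using Assign by auto
    have b: "big (Assign x e) t [Tick] ?t"
      using agree_eok[OF a p(2) Assign(1)] Assign(2) by (rule big.Assign)
    have a': "agree ?s ?t" using a agree_ev[OF a p(2)] by (simp add: agree_def)
    have c': "core q S (Tick # z) ?t" by (rule core_cong[of q S "Tick # z" t]) (use c p(1) in simp_all)
    obtain v q' S' t' where v: "big (tick C) ?t v t'" "agree ?s t'" "core q' S' z t'"
      "link q S (emits z) v q' S' (emits z)" "due budget (E * (fst ?t 40 + 1) - 20) v (E * (fst t' 40 + 1) + 20)"
      using tick_sim[OF c' a'] by blast
    have "fst ?t 40 = fst t 40" using p(1) by simp
    then show "\<exists>v q' S' t'. big (deam C (Assign x e)) t v t' \<and> agree ?s t' \<and> core q' S' z t' \<and>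
      link q S (emits [Tick] @ emits z) v q' S' (emits z) \<and>
      due budget (E * (fst t 40 + 1)) v (E * (fst t' 40 + 1))"
      using Seq[OF b v(1)] v(2,3) link_pad[OF v(4), of "[Tick]" "[]"] due_pad[OF v(5), of "[Tick]" "[]"]
      by (intro exI[of _ "[Tick] @ v"] exI[of _ q'] exI[of _ S'] exI[of _ t']) simp
  qed
next
  case (Write i s e a)
  show ?case unfolding sim_def
  proof (intro allI impI)
    fix q S z t assume ag: "agree s t" and c: "core q S ([Tick] @ z) t"
    let ?s = "(fst s, (snd s)(a := (snd s a)(ev i s := ev e s)))"
    let ?t = "(fst t, (snd t)(a := (snd t a)(ev i t := ev e t)))"
    have p: "a \<noteq> 1" "a \<noteq> 22" "pure_exp i" "pure_exp e" using Write by auto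
    have ee: "ev i t = ev i s" "ev e t = ev e s" using agree_ev[OF ag] p by auto
    have b: "big (Write a i e) t [Tick] ?t"
      using agree_eok[OF ag p(3) Write(1)] agree_eok[OF ag p(4) Write(2)] Write(3) Write(4)[folded ee(1)]
      by (rule big.Write)
    have a': "agree ?s ?t" using ag ee p by (simp add: agree_def)
    have c': "core q S (Tick # z) ?t" by (rule core_cong[of q S "Tick # z" t]) (use c p(1,2) in simp_all)
    obtain v q' S' t' where v: "big (tick C) ?t v t'" "agree ?s t'" "core q' S' z t'"
      "link q S (emits z) v q' S' (emits z)" "due budget (E * (fst ?t 40 + 1) - 20) v (E * (fst t' 40 + 1) + 20)"
      using tick_sim[OF c' a'] by blast
    then show "\<exists>v q' S' t'. big (deam C (Write a i e)) t v t' \<and> agree ?s t' \<and> core q' S' z t' \<and>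
      link q S (emits [Tick] @ emits z) v q' S' (emits z) \<and>
      due budget (E * (fst t 40 + 1)) v (E * (fst t' 40 + 1))"
      using Seq[OF b v(1)] v(2,3) link_pad[OF v(4), of "[Tick]" "[]"] due_pad[OF v(5), of "[Tick]" "[]"]
      by (intro exI[of _ "[Tick] @ v"] exI[of _ q'] exI[of _ S'] exI[of _ t']) simp
  qed
next
  case (Emt e s)
  show ?case unfolding sim_def
  proof (intro allI impI)
    fix q S z t assume a: "agree s t" and c: "core q S ([Emit (ev e s)] @ z) t" and f: "fac ([Emit (ev e s)] @ z)"
    have p: "pure_exp e" using Emt by simp
    have "wpw (push C e) t (\<lambda>v t'. agree t t' \<and>
      (\<exists>q' S'. core q' S' z t' \<and> link q S (ev e s # emits z) v q' S' (emits z) \<and>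
        due budget (E * (fst t 40 + 1)) v (E * (fst t' 40 + 1))))"
    proof (rule push_ok[OF _ agree_eok[OF a p Emt(1)] agree_ev[OF a p] p])
      show "core q S (Emit (ev e s) # z) t" using c by simp
      show "length u \<le> C * vis u + lag0" if "Emit (ev e s) # z = u @ v" for u v
        using f that unfolding fac_def by (metis append_Cons append_Nil)
    qed
    then obtain v t' q' S' where v: "big (push C e) t v t'" "agree t t'" "core q' S' z t'"
      "link q S (ev e s # emits z) v q' S' (emits z)"
      "due budget (E * (fst t 40 + 1)) v (E * (fst t' 40 + 1))" unfolding wpw_def by blast
    show "\<exists>v q' S' t'. big (deam C (Emt e)) t v t' \<and> agree s t' \<and> core q' S' z t' \<and>
      link q S (emits [Emit (ev e s)] @ emits z) v q' S' (emits z) \<and>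
      due budget (E * (fst t 40 + 1)) v (E * (fst t' 40 + 1))"
      using v(1,3-5) agree_trans[OF a v(2)]
      by (intro exI[of _ v] exI[of _ q'] exI[of _ S'] exI[of _ t']) simp
  qed
next
  case (Show s)
  then show ?case by simp
next
  case (Seq c1 s w t c2 v u)
  note s1 = Seq.IH(1)[unfolded sim_def] and s2 = Seq.IH(2)[unfolded sim_def]
  show ?case unfolding sim_def
  proof (intro allI impI)
    fix q S z t0 assume a: "agree s t0" and c: "core q S ((w @ v) @ z) t0" and f: "fac ((w @ v) @ z)"
    obtain x q1 S1 t1 where 1: "big (deam C c1) t0 x t1" "agree t t1" "core q1 S1 (v @ z) t1"
      "link q S (emits w @ emits (v @ z)) x q1 S1 (emits (v @ z))"
      "due budget (E * (fst t0 40 + 1)) x (E * (fst t1 40 + 1))"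
      using s1 a c f Seq.prems by (metis append.assoc pure.simps(6))
    obtain y q2 S2 t2 where 2: "big (deam C c2) t1 y t2" "agree u t2" "core q2 S2 z t2"
      "link q1 S1 (emits v @ emits z) y q2 S2 (emits z)"
      "due budget (E * (fst t1 40 + 1)) y (E * (fst t2 40 + 1))"
      using s2 1(2,3) fac_suffix[of w "v @ z"] f Seq.prems by (metis append.assoc pure.simps(6))
    have "link q S (emits (w @ v) @ emits z) (x @ y) q2 S2 (emits z)"
      using link_trans[OF 1(4)] 2(4) by simp
    then show "\<exists>x q' S' t'. big (deam C (c1 ;; c2)) t0 x t' \<and> agree u t' \<and> core q' S' z t' \<and>
      link q S (emits (w @ v) @ emits z) x q' S' (emits z) \<and>
      due budget (E * (fst t0 40 + 1)) x (E * (fst t' 40 + 1))"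
      using big.Seq[OF 1(1) 2(1)] 2(2,3) due_append[OF 1(5) 2(5)]
      by (intro exI[of _ "x @ y"] exI[of _ q2] exI[of _ S2] exI[of _ t2]) simp
  qed
next
  case (CondT e s c1 w u c2)
  note IH = CondT.IH[unfolded sim_def]
  show ?case unfolding sim_def
  proof (intro allI impI)
    fix q S z t assume a: "agree s t" and c: "core q S ((Tick # w @ [Tick]) @ z) t"
      and f: "fac ((Tick # w @ [Tick]) @ z)"
    have p: "pure_exp e" "pure c1" using CondT by auto
    have c': "core q S (Tick # (w @ Tick # z)) t" using c by simp
    obtain x q1 S1 t1 where 1: "big (tick C) t x t1" "agree s t1" "core q1 S1 (w @ Tick # z) t1"
      "link q S (emits (w @ Tick # z)) x q1 S1 (emits (w @ Tick # z))"
      "due budget (E * (fst t 40 + 1) - 20) x (E * (fst t1 40 + 1) + 20)"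
      using tick_sim[OF c' a] by blast
    have f': "fac (w @ Tick # z)" using f fac_suffix[of "[Tick]" "w @ Tick # z"] by simp
    obtain y q2 S2 t2 where 2: "big (deam C c1) t1 y t2" "agree u t2" "core q2 S2 (Tick # z) t2"
      "link q1 S1 (emits w @ emits (Tick # z)) y q2 S2 (emits (Tick # z))"
      "due budget (E * (fst t1 40 + 1)) y (E * (fst t2 40 + 1))"
      using IH p 1(2,3) f' by blast
    obtain r q3 S3 t3 where 3: "big (tick C) t2 r t3" "agree u t3" "core q3 S3 z t3"
      "link q2 S2 (emits z) r q3 S3 (emits z)"
      "due budget (E * (fst t2 40 + 1) - 20) r (E * (fst t3 40 + 1) + 20)"
      using tick_sim[OF 2(3,2)] by blast
    have b: "big (deam C (Cond e c1 c2)) t (x @ (Tick # y @ [Tick]) @ r) t3"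
      unfolding deam.simps
      using 1(1) big.CondT[OF agree_eok[OF 1(2) p(1) CondT(1)] _ 2(1)] agree_ev[OF 1(2) p(1)] CondT(2) 3(1)
      by (metis big.Seq)
    have l: "link q S (emits (Tick # w @ [Tick]) @ emits z) (x @ (Tick # y @ [Tick]) @ r) q3 S3 (emits z)"
      using link_trans[OF 1(4) link_trans[OF link_pad[of _ _ _ _ _ _ _ "[Tick]" "[Tick]"] 3(4)]] 2(4) by simp
    have "due budget (E * (fst t 40 + 1)) ((x @ [Tick]) @ y @ [Tick] @ r) (E * (fst t3 40 + 1))"
      using due_append[OF due_pad[OF 1(5), of "[]" "[Tick]"] due_append[OF 2(5) due_pad[OF 3(5), of "[Tick]" "[]"]]]
      by simp
    then show "\<exists>v q' S' t'. big (deam C (Cond e c1 c2)) t v t' \<and> agree u t' \<and> core q' S' z t' \<and>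
      link q S (emits (Tick # w @ [Tick]) @ emits z) v q' S' (emits z) \<and>
      due budget (E * (fst t 40 + 1)) v (E * (fst t' 40 + 1))" using b l 3
      by (intro exI[of _ "x @ (Tick # y @ [Tick]) @ r"] exI[of _ q3] exI[of _ S3] exI[of _ t3]) simp
  qed
next
  case (CondF e s c1 w u c2)
  note IH = CondF.IH[unfolded sim_def]
  show ?case unfolding sim_def
  proof (intro allI impI)
    fix q S z t assume a: "agree s t" and c: "core q S ((Tick # w @ [Tick]) @ z) t"
      and f: "fac ((Tick # w @ [Tick]) @ z)"
    have p: "pure_exp e" "pure c1" using CondF by auto
    have c': "core q S (Tick # (w @ Tick # z)) t" using c by simp
    obtain x q1 S1 t1 where 1: "big (tick C) t x t1" "agree s t1" "core q1 S1 (w @ Tick # z) t1"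
      "link q S (emits (w @ Tick # z)) x q1 S1 (emits (w @ Tick # z))"
      "due budget (E * (fst t 40 + 1) - 20) x (E * (fst t1 40 + 1) + 20)"
      using tick_sim[OF c' a] by blast
    have f': "fac (w @ Tick # z)" using f fac_suffix[of "[Tick]" "w @ Tick # z"] by simp
    obtain y q2 S2 t2 where 2: "big (deam C c1) t1 y t2" "agree u t2" "core q2 S2 (Tick # z) t2"
      "link q1 S1 (emits w @ emits (Tick # z)) y q2 S2 (emits (Tick # z))"
      "due budget (E * (fst t1 40 + 1)) y (E * (fst t2 40 + 1))"
      using IH p 1(2,3) f' by blast
    obtain r q3 S3 t3 where 3: "big (tick C) t2 r t3" "agree u t3" "core q3 S3 z t3"
      "link q2 S2 (emits z) r q3 S3 (emits z)"
      "due budget (E * (fst t2 40 + 1) - 20) r (E * (fst t3 40 + 1) + 20)"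
      using tick_sim[OF 2(3,2)] by blast
    have b: "big (deam C (Cond e c2 c1)) t (x @ (Tick # y @ [Tick]) @ r) t3"
      unfolding deam.simps
      using 1(1) big.CondF[OF agree_eok[OF 1(2) p(1) CondF(1)] _ 2(1)] agree_ev[OF 1(2) p(1)] CondF(2) 3(1)
      by (metis big.Seq)
    have l: "link q S (emits (Tick # w @ [Tick]) @ emits z) (x @ (Tick # y @ [Tick]) @ r) q3 S3 (emits z)"
      using link_trans[OF 1(4) link_trans[OF link_pad[of _ _ _ _ _ _ _ "[Tick]" "[Tick]"] 3(4)]] 2(4) by simp
    have "due budget (E * (fst t 40 + 1)) ((x @ [Tick]) @ y @ [Tick] @ r) (E * (fst t3 40 + 1))"
      using due_append[OF due_pad[OF 1(5), of "[]" "[Tick]"] due_append[OF 2(5) due_pad[OF 3(5), of "[Tick]" "[]"]]]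
      by simp
    then show "\<exists>v q' S' t'. big (deam C (Cond e c2 c1)) t v t' \<and> agree u t' \<and> core q' S' z t' \<and>
      link q S (emits (Tick # w @ [Tick]) @ emits z) v q' S' (emits z) \<and>
      due budget (E * (fst t 40 + 1)) v (E * (fst t' 40 + 1))" using b l 3
      by (intro exI[of _ "x @ (Tick # y @ [Tick]) @ r"] exI[of _ q3] exI[of _ S3] exI[of _ t3]) simp
  qed
next
  case (LoopF e s c)
  show ?case unfolding sim_def
  proof (intro allI impI)
    fix q S z t assume a: "agree s t" and c: "core q S ([Tick] @ z) t"
    have p: "pure_exp e" using LoopF by auto
    have c': "core q S (Tick # z) t" using c by simp
    obtain x q1 S1 t1 where 1: "big (tick C) t x t1" "agree s t1" "core q1 S1 z t1"
      "link q S (emits z) x q1 S1 (emits z)"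
      "due budget (E * (fst t 40 + 1) - 20) x (E * (fst t1 40 + 1) + 20)"
      using tick_sim[OF c' a] by blast
    have "big (deam C (Loop e c)) t ([Tick] @ x) t1"
      unfolding deam.simps using big.LoopF[OF agree_eok[OF a p LoopF(1)]] agree_ev[OF a p] LoopF(2) 1(1)
      by (metis big.Seq)
    then show "\<exists>v q' S' t'. big (deam C (Loop e c)) t v t' \<and> agree s t' \<and> core q' S' z t' \<and>
      link q S (emits [Tick] @ emits z) v q' S' (emits z) \<and>
      due budget (E * (fst t 40 + 1)) v (E * (fst t' 40 + 1))"
      using 1(2,3) link_pad[OF 1(4), of "[Tick]" "[]"] due_pad[OF 1(5), of "[Tick]" "[]"]
      by (intro exI[of _ "[Tick] @ x"] exI[of _ q1] exI[of _ S1] exI[of _ t1]) simp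
  qed
next
  case (LoopT e s c w u v u')
  note IH = LoopT.IH(1)[unfolded sim_def] and IH2 = LoopT.IH(2)[unfolded sim_def]
  show ?case unfolding sim_def
  proof (intro allI impI)
    fix q S z t assume a: "agree s t" and c: "core q S ((Tick # w @ Tick # v) @ z) t"
      and f: "fac ((Tick # w @ Tick # v) @ z)"
    have p: "pure_exp e" "pure c" using LoopT by auto
    have c': "core q S (Tick # (w @ Tick # v @ z)) t" using c by simp
    obtain x q1 S1 t1 where 1: "big (tick C) t x t1" "agree s t1" "core q1 S1 (w @ Tick # v @ z) t1"
      "link q S (emits (w @ Tick # v @ z)) x q1 S1 (emits (w @ Tick # v @ z))"
      "due budget (E * (fst t 40 + 1) - 20) x (E * (fst t1 40 + 1) + 20)"
      using tick_sim[OF c' a] by blast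
    have f': "fac (w @ Tick # v @ z)" using f fac_suffix[of "[Tick]" "w @ Tick # v @ z"] by simp
    obtain y q2 S2 t2 where 2: "big (deam C c) t1 y t2" "agree u t2" "core q2 S2 (Tick # v @ z) t2"
      "link q1 S1 (emits w @ emits (Tick # v @ z)) y q2 S2 (emits (Tick # v @ z))"
      "due budget (E * (fst t1 40 + 1)) y (E * (fst t2 40 + 1))"
      using IH p 1(2,3) f' by blast
    obtain r q3 S3 t3 where 3: "big (tick C) t2 r t3" "agree u t3" "core q3 S3 (v @ z) t3"
      "link q2 S2 (emits (v @ z)) r q3 S3 (emits (v @ z))"
      "due budget (E * (fst t2 40 + 1) - 20) r (E * (fst t3 40 + 1) + 20)"
      using tick_sim[OF 2(3,2)] by blast
    have f3: "fac (v @ z)" using f' fac_suffix[of "w @ [Tick]" "v @ z"] by simp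
    obtain y' q4 S4 t4 where 4: "big (Loop e (tick C ;; deam C c ;; tick C) ;; tick C) t3 y' t4" "agree u' t4"
      "core q4 S4 z t4" "link q3 S3 (emits v @ emits z) y' q4 S4 (emits z)"
      "due budget (E * (fst t3 40 + 1)) y' (E * (fst t4 40 + 1))"
      using IH2 LoopT.prems 3(2,3) f3 unfolding deam.simps by blast
    obtain m t5 y'' where 5: "big (Loop e (tick C ;; deam C c ;; tick C)) t3 m t5" "big (tick C) t5 y'' t4"
      "y' = m @ y''" using 4(1) by (blast elim: SeqE)
    let ?v = "[Tick] @ x @ y @ r @ [Tick] @ y'"
    have body: "big (tick C ;; deam C c ;; tick C) t (x @ y @ r) t3" using 1(1) 2(1) 3(1) big.Seq by metis
    have "big (Loop e (tick C ;; deam C c ;; tick C)) t (Tick # (x @ y @ r) @ Tick # m) t5"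
      using big.LoopT[OF agree_eok[OF a p(1) LoopT(1)] _ body 5(1)] agree_ev[OF a p(1)] LoopT(2) by simp
    from big.Seq[OF this 5(2)] have b: "big (deam C (Loop e c)) t ?v t4" by (simp add: 5(3))
    have l: "link q S (emits (Tick # w @ Tick # v) @ emits z) ?v q4 S4 (emits z)"
      using link_pad[OF link_trans[OF 1(4) link_trans[OF _ link_trans[OF link_pad[OF 3(4), of "[]" "[Tick]"]]]],
        of _ _ _ _ _ "[Tick]" "[]"] 2(4) 4(4) by simp
    have "due budget (E * (fst t 40 + 1)) (([Tick] @ x @ []) @ y @ ([] @ r @ [Tick]) @ y') (E * (fst t4 40 + 1))"
      by (intro due_append[OF due_pad[OF 1(5)]] due_append[OF 2(5)] due_append[OF due_pad[OF 3(5)] 4(5)]) auto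
    then show "\<exists>x q' S' t'. big (deam C (Loop e c)) t x t' \<and> agree u' t' \<and> core q' S' z t' \<and>
      link q S (emits (Tick # w @ Tick # v) @ emits z) x q' S' (emits z) \<and>
      due budget (E * (fst t 40 + 1)) x (E * (fst t' 40 + 1))" using b l 4(2,3)
      by (intro exI[of _ ?v] exI[of _ q4] exI[of _ S4] exI[of _ t4]) simp
  qed
qed

text \<open>The remaining items end with a visit, since no toggle is pending after them. So every
  iteration finds a visit, and 100 steps suffice for a test and a \<open>pop\<close>.\<close>

lemma drain_ok:
  assumes "qrep q t" "out_rep S t" "\<forall>u. Suc u \<in> set q \<longrightarrow> u < n" "gray 0 q 0"
  shows "\<exists>v t'. big drain t v t' \<and> list_all2 depicts (outs v) (walk S q) \<and> due budget 100 v 0"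
  using assms
proof (induction "length q" arbitrary: q t S rule: less_induct)
  case less
  have len: "fst t 43 = length q" using less.prems(1) by (simp add: qrep_def Let_def)
  show ?case
  proof (cases "q = []")
    case True
    have "big drain t [Tick] t" unfolding drain_def using len True by (intro LoopF) auto
    then show ?thesis using True by (intro exI[of _ "[Tick]"] exI[of _ t]) auto
  next
    case False
    have "1 \<le> zeros q" using gray_length[OF less.prems(4)] False by (cases "zeros q") auto
    then obtain us q' where q: "q = map Suc us @ 0 # q'" "length us \<le> 3" "gray 0 q' 0"
      using gray_first_visit[of q "[]"] less.prems(4) by (metis append_Nil2)
    have us: "\<forall>u\<in>set us. u < n" using less.prems(3) q by auto
    let ?S = "final S (map Suc us)"
    obtain w t1 v' f where 1: "big pop t w t1" "w = v' @ [Out f]" "outs v' = []" "length v' \<le> 40"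
      "qrep q' t1" "out_rep ?S t1" "depicts f ?S"
      using pop_ok[OF less.prems(1)[unfolded q(1)] less.prems(2) us q(2)] unfolding wpw_def by blast
    obtain v t' where 2: "big drain t1 v t'" "list_all2 depicts (outs v) (walk ?S q')" "due budget 100 v 0"
      using less.hyps[of q' t1 ?S] 1(5,6) less.prems(3) q by auto
    have "big drain t (Tick # w @ Tick # v) t'"
      using LoopT[of "V 43" t pop w t1 v t'] len False 1(1) 2(1) by (simp add: drain_def)
    moreover have "due budget 100 ((Tick # v') @ Out f # Tick # v) 0"
    proof (rule due_append[of budget 100 "Tick # v'" 0])
      show "due budget 100 (Tick # v') 0" using 1(3,4) by (intro due_silent) auto
      show "due budget 0 (Out f # Tick # v) 0" using due_mono[OF 2(3)] C by simp
    qed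
    moreover have "list_all2 depicts (outs (Tick # w @ Tick # v)) (walk S q)"
      using 1(2,3,7) 2(2) by (simp add: q(1) walk_append)
    ultimately show ?thesis using 1(2) by (intro exI[of _ "Tick # w @ Tick # v"] exI[of _ t']) simp
  qed
qed

end

section \<open>The traversal program: heights\<close>

context ram
begin

text \<open>The correctness of the traversal needs only the length and the emitted items of a trace;
  the prefixes and factors reappear when the segments are composed by
  \<open>lag_append\<close>.\<close>

definition wp :: "com \<Rightarrow> state \<Rightarrow> (nat \<Rightarrow> nat list \<Rightarrow> state \<Rightarrow> bool) \<Rightarrow> bool" where
  "wp c s Q \<longleftrightarrow> wpw c s (\<lambda>w. Q (length w) (emits w))"

lemma wp_mono: "wp c s Q \<Longrightarrow> (\<And>l es t. Q l es t \<Longrightarrow> Q' l es t) \<Longrightarrow> wp c s Q'"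
  unfolding wp_def by (erule wpw_mono) blast

lemma wp_simps [simp]:
  "wp Skip s Q \<longleftrightarrow> Q 0 [] s"
  "wp (Assign x e) s Q \<longleftrightarrow> eok e s \<and> x < 60 \<and> Q (Suc 0) [] ((fst s)(x := ev e s), snd s)"
  "wp (Write a i e) s Q \<longleftrightarrow> eok i s \<and> eok e s \<and> 0 < a \<and> ev i s < lim a \<and>
    Q (Suc 0) [] (fst s, (snd s)(a := (snd s a)(ev i s := ev e s)))"
  "wp (Emt e) s Q \<longleftrightarrow> eok e s \<and> Q (Suc 0) [ev e s] s"
  "wp (c1 ;; c2) s Q \<longleftrightarrow> wp c1 s (\<lambda>l es t. wp c2 t (\<lambda>l' es'. Q (l + l') (es @ es')))"
  "wp (Cond e c1 c2) s Q \<longleftrightarrow> eok e s \<and>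
    (if ev e s \<noteq> 0 then wp c1 s (\<lambda>l. Q (Suc (Suc l))) else wp c2 s (\<lambda>l. Q (Suc (Suc l))))"
  unfolding wp_def by simp_all

lemma wp_Assign_Seq: "wp (Assign x e ;; c) s Q \<longleftrightarrow>
    eok e s \<and> x < 60 \<and> wp c ((fst s)(x := ev e s), snd s) (\<lambda>l es. Q (Suc l) es)"
  by simp

lemma wp_Loop: "wp (Loop e c) s Q \<longleftrightarrow> eok e s \<and> (if ev e s = 0 then Q (Suc 0) [] s
    else wp c s (\<lambda>l es t. wp (Loop e c) t (\<lambda>l' es'. Q (Suc (Suc (l + l'))) (es @ es'))))"
  unfolding wp_def by (subst wpw_Loop) simp

lemma wp_Loop_step:
  assumes "eok e s" "ev e s \<noteq> 0" "wp c s (\<lambda>l es t. es = [] \<and> l \<le> k \<and> P t)"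
    "\<And>t. P t \<Longrightarrow> wp (Loop e c) t Q'"
    "\<And>l l' es t. l \<le> k \<Longrightarrow> Q' l' es t \<Longrightarrow> Q (Suc (Suc (l + l'))) es t"
  shows "wp (Loop e c) s Q"
proof -
  have "wp c s (\<lambda>l es t. wp (Loop e c) t (\<lambda>l' es'. Q (Suc (Suc (l + l'))) (es @ es')))"
  proof (rule wp_mono[OF assms(3)])
    fix l and es :: "nat list" and t assume a: "es = [] \<and> l \<le> k \<and> P t"
    show "wp (Loop e c) t (\<lambda>l' es'. Q (Suc (Suc (l + l'))) (es @ es'))"
      by (rule wp_mono[OF assms(4)]) (use a assms(5) in auto)
  qed
  then show ?thesis using assms(1,2) by (subst wp_Loop) simp
qed

lemma wp_Seq_silent:
  assumes "wp c s (\<lambda>l es t. es = [] \<and> l \<le> k \<and> P t)" "\<And>t. P t \<Longrightarrow> wp d t Q'"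
    "\<And>l l' es t. l \<le> k \<Longrightarrow> Q' l' es t \<Longrightarrow> Q (l + l') es t"
  shows "wp (c ;; d) s Q"
proof -
  have "wp c s (\<lambda>l es t. wp d t (\<lambda>l' es'. Q (l + l') (es @ es')))"
  proof (rule wp_mono[OF assms(1)])
    fix l and es :: "nat list" and t assume a: "es = [] \<and> l \<le> k \<and> P t"
    show "wp d t (\<lambda>l' es'. Q (l + l') (es @ es'))"
      by (rule wp_mono[OF assms(2)]) (use a assms(3) in auto)
  qed
  then show ?thesis by simp
qed

end

text \<open>Arrays of the traversal program: 2 and 3 cells of lists of elements (value, next), 4 chains, 5 heads of
  the lists of the blocks, 6 to 13 the frames of the stack; 15 to 19, indexed by height or by element, are
  scratch space of the computation of a longest chain: buckets of elements of equal height (head, next),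
  height, predecessor, reversed list of the elements.
  A stack frame takes the index range \<open>{base..<base + wd}\<close> of arrays 2 to 13 and consists, in arrays 6 to 13, of the
  length of the chain, \<open>b\<close>, the toggle pending at the end, the orientation, the two numbers describing \<open>J\<close>,
  and the position and the direction of the tour.
  Variables: 0 is \<open>n\<close>, 3 the width \<open>wd\<close> of a frame, 10 the base of the current frame; for a new call
  (11) the orientation, \<open>m\<close>, the description of \<open>J\<close> and the list of elements are in 5 to 9.
  Pointers are shifted by one, 0 is the empty list.\<close>

fun ilist :: "(nat \<Rightarrow> nat) \<Rightarrow> nat \<Rightarrow> nat list \<Rightarrow> bool" where
  "ilist nx p [] \<longleftrightarrow> p = 0"
| "ilist nx p (x # xs) \<longleftrightarrow> p = Suc x \<and> ilist nx (nx x) xs"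

text \<open>All cells of the list lie below index \<open>b\<close>, so the list survives the
  allocation of cells and frames from \<open>b\<close> on.\<close>

fun clist :: "(nat \<Rightarrow> nat) \<Rightarrow> (nat \<Rightarrow> nat) \<Rightarrow> nat \<Rightarrow> nat \<Rightarrow> nat list \<Rightarrow> bool" where
  "clist cv cn b p [] \<longleftrightarrow> p = 0"
| "clist cv cn b p (x # xs) \<longleftrightarrow> 0 < p \<and> p \<le> b \<and> cv (p - 1) = x \<and> clist cv cn b (cn (p - 1)) xs"

lemma ilist_upd: "u \<notin> set xs \<Longrightarrow> ilist (nx(u := v)) p xs = ilist nx p xs"
  by (induction xs arbitrary: p) auto

lemma clist_cong: "clist cv cn b p xs \<Longrightarrow> (\<And>i. i < b \<Longrightarrow> cv' i = cv i \<and> cn' i = cn i) \<Longrightarrow> clist cv' cn' b p xs"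
  by (induction xs arbitrary: p) auto

lemma clist_mono: "clist cv cn b p xs \<Longrightarrow> b \<le> b' \<Longrightarrow> clist cv cn b' p xs"
  by (induction xs arbitrary: p) auto

text \<open>The buckets below height \<open>h\<close> in the order in which the scan meets them,
  from high to low.\<close>

definition low :: "(nat \<Rightarrow> nat list) \<Rightarrow> nat \<Rightarrow> nat list" where
  "low bk h = concat (map bk (rev [1..<h]))"

lemma low_simps: "low bk 0 = []" "low bk (Suc 0) = []" "1 \<le> h \<Longrightarrow> low bk (Suc h) = bk h @ low bk h"
  by (simp_all add: low_def)

lemma set_low: "x \<in> set (low bk h) \<longleftrightarrow> (\<exists>j. 1 \<le> j \<and> j < h \<and> x \<in> set (bk j))"
  by (auto simp: low_def)

lemma distinct_low:
  "(\<And>j. 1 \<le> j \<Longrightarrow> j < h \<Longrightarrow> distinct (bk j) \<and> (\<forall>x\<in>set (bk j). ht x = j)) \<Longrightarrow> distinct (low bk h)"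
proof (induction h)
  case (Suc h)
  show ?case
  proof (cases "1 \<le> h")
    case True
    have "set (bk h) \<inter> set (low bk h) = {}" using Suc.prems True unfolding set_low disjoint_iff
      by (metis less_Suc_eq less_irrefl)
    then show ?thesis using Suc True by (simp add: low_simps)
  next
    case False
    then have "h = 0" by simp
    then show ?thesis by (simp add: low_simps)
  qed
qed (simp add: low_simps)

text \<open>One test or one change of bucket: register 17 points into the current bucket, 16 is its
  height, and 19 becomes 0 when an element below the new one is found or height 0 is
  reached.\<close>

definition scan :: com where
  "scan = Cond (V 17)
     (Cond (At 0 (Plus (Times (Minus (V 17) (N 1)) (V 0)) (V 15))) (Assign 19 (N 0))
       (Assign 17 (At 16 (Minus (V 17) (N 1)))))
     (Assign 16 (Minus (V 16) (N 1)) ;; Assign 17 (At 15 (V 16)) ;; Assign 19 (V 16))"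

definition height_pre :: com where
  "height_pre = Assign 15 (At 2 (Minus (V 14) (N 1))) ;; Assign 14 (At 3 (Minus (V 14) (N 1))) ;;
     Write 19 (V 15) (V 21) ;; Assign 21 (Plus (V 15) (N 1)) ;;
     Assign 16 (V 13) ;; Assign 17 (At 15 (V 16)) ;; Assign 19 (V 16)"

definition height_post :: com where
  "height_post = Write 18 (V 15) (V 17) ;; Assign 16 (Plus (V 16) (N 1)) ;; Write 17 (V 15) (V 16) ;;
     Cond (Minus (V 16) (V 13)) (Assign 13 (V 16) ;; Write 15 (V 16) (N 0)) Skip ;;
     Write 16 (V 15) (At 15 (V 16)) ;; Write 15 (V 16) (Plus (V 15) (N 1))"

definition height_step :: com where
  "height_step = height_pre ;; Loop (V 19) scan ;; height_post"

definition heights :: com where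
  "heights = Assign 13 (N 0) ;; Assign 21 (N 0) ;; Assign 14 (V 9) ;; Loop (V 14) height_step"

text \<open>\<open>wd\<close> bounds the number of list cells of a frame: an element occurs in at
  most one block more than it has incomparable elements in the poset. \<open>M\<close> has room for
  the deepest nesting, as the sets shrink strictly and base 0 is reserved for the end of the main
  loop.\<close>

locale producer = ram +
  fixes r :: "(nat \<times> nat) set" and wd :: nat
  assumes poset: "labelled_poset n r"
    and wd: "wd = n + card (incomparable r {..<n}) + 2"
    and M: "(n + 3) * wd \<le> M"
begin

lemma po: "partial_order_on {..<n} r"
  using poset by (simp add: labelled_poset_def)

lemma label: "(u, v) \<in> r \<Longrightarrow> u \<le> v"
  using poset by (auto simp: labelled_poset_def)

lemma sizes: "n < W" "n * n < W" "M < W" "M + 100 < W" "n < M" "2 < W" "wd \<le> M" "n + 1 < wd"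
proof -
  have m: "wd \<le> (n + 3) * wd" by simp
  show "n + 1 < wd" by (simp add: wd)
  then show "n < W" "n * n < W" "M < W" "M + 100 < W" "n < M" "2 < W" "wd \<le> M"
    using wide m M by linarith+
qed

lemma cell: "x < n \<Longrightarrow> u < n \<Longrightarrow> x * n + u < n * n"
proof -
  assume a: "x < n" "u < n"
  then have "Suc x * n \<le> n * n" by (intro mult_le_mono1) simp
  then show ?thesis using a by simp
qed

text \<open>Cell 0 of array 15 is the empty bucket of height 0, in which an unsuccessful scan ends
  with a null pointer as predecessor.\<close>

definition static :: "state \<Rightarrow> bool" where
  "static s \<longleftrightarrow> fst s 0 = n \<and> fst s 3 = wd \<and> snd s 15 0 = 0 \<and>
     (\<forall>x<n. \<forall>u<n. snd s 0 (x * n + u) = (if (x, u) \<in> r then 1 else 0))"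

lemma static_upd:
  "static s \<Longrightarrow> fst t 0 = fst s 0 \<Longrightarrow> fst t 3 = fst s 3 \<Longrightarrow> snd t 0 = snd s 0 \<Longrightarrow> snd t 15 0 = 0 \<Longrightarrow> static t"
  by (simp add: static_def)

text \<open>All buckets are nonempty, so a change of bucket is preceded by a failed test in the
  bucket just left. The time is thus proportional to the number of failed tests; the last summand
  covers a start in an exhausted bucket.\<close>

lemma scan_ok:
  assumes "static s" "fst s 16 = h" "fst s 19 = h" "h \<le> n" "fst s 15 = u" "u < n"
    "ilist (snd s 16) (fst s 17) ys" "h = 0 \<longrightarrow> ys = []" "set ys \<subseteq> {..<n}"
    "\<And>j. 1 \<le> j \<Longrightarrow> j < h \<Longrightarrow> ilist (snd s 16) (snd s 15 j) (bk j) \<and> bk j \<noteq> [] \<and> set (bk j) \<subseteq> {..<n}"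
  shows "wp (Loop (V 19) scan) s (\<lambda>l es t. es = [] \<and> snd t = snd s \<and> (\<forall>y. y \<notin> {16, 17, 19} \<longrightarrow> fst t y = fst s y) \<and>
    l \<le> 10 * (1 + 2 * length (takeWhile (\<lambda>x. (x, u) \<notin> r) (ys @ low bk h)) + (if ys = [] \<and> h \<noteq> 0 then 1 else 0)) \<and>
    (\<exists>h'. fst t 16 = h' \<and> h' \<le> h \<and> (if h' = 0 then fst t 17 = 0 else \<exists>x. fst t 17 = Suc x \<and> (x, u) \<in> r \<and>
       x \<in> set (if h' = h then ys else bk h')) \<and>
     (h' < h \<longrightarrow> (\<forall>y\<in>set ys. (y, u) \<notin> r)) \<and> (\<forall>j. h' < j \<longrightarrow> j < h \<longrightarrow> (\<forall>y\<in>set (bk j). (y, u) \<notin> r))))"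
  using assms
proof (induction "h + length (ys @ low bk h)" arbitrary: s h ys rule: less_induct)
  case less
  obtain R A where s: "s = (R, A)" by force
  note pre = less.prems[unfolded s fst_conv snd_conv]
  have st: "R 0 = n" "A 15 0 = 0" "\<And>x u. x < n \<Longrightarrow> u < n \<Longrightarrow> A 0 (x * n + u) = (if (x, u) \<in> r then 1 else 0)"
    using pre(1) by (auto simp: static_def)
  show ?case
  proof (cases "h = 0")
    case True
    then show ?thesis using pre by (subst wp_Loop) (auto simp: s)
  next
    case h0: False
    show ?thesis
    proof (cases ys)
      case Nil
      then have v0: "R 17 = 0" using pre(7) by simp
      let ?R = "R(16 := h - 1, 17 := A 15 (h - 1), 19 := h - 1)"
      have nx: "ilist (A 16) (A 15 (h - 1)) (if h = 1 then [] else bk (h - 1))"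
        using pre(10)[of "h - 1"] h0 st(2) by auto
      have lowh: "low bk h = (if h = 1 then [] else bk (h - 1)) @ low bk (h - 1)"
        using h0 low_simps(3)[of "h - 1" bk] by (cases "h = 1") (auto simp: low_simps)
      have IH: "wp (Loop (V 19) scan) (?R, A) (\<lambda>l es t. es = [] \<and> snd t = snd (?R, A) \<and>
        (\<forall>y. y \<notin> {16, 17, 19} \<longrightarrow> fst t y = fst (?R, A) y) \<and>
        l \<le> 10 * (1 + 2 * length (takeWhile (\<lambda>x. (x, u) \<notin> r) ((if h = 1 then [] else bk (h - 1)) @ low bk (h - 1)))
          + (if (if h = 1 then [] else bk (h - 1)) = [] \<and> h - 1 \<noteq> 0 then 1 else 0)) \<and>
        (\<exists>h'. fst t 16 = h' \<and> h' \<le> h - 1 \<and> (if h' = 0 then fst t 17 = 0 else \<exists>x. fst t 17 = Suc x \<and> (x, u) \<in> r \<and>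
           x \<in> set (if h' = h - 1 then (if h = 1 then [] else bk (h - 1)) else bk h')) \<and>
         (h' < h - 1 \<longrightarrow> (\<forall>y\<in>set (if h = 1 then [] else bk (h - 1)). (y, u) \<notin> r)) \<and>
         (\<forall>j. h' < j \<longrightarrow> j < h - 1 \<longrightarrow> (\<forall>y\<in>set (bk j). (y, u) \<notin> r))))"
        (is "wp _ _ ?Q")
      proof (rule less.hyps)
        show "h - 1 + length ((if h = 1 then [] else bk (h - 1)) @ low bk (h - 1)) < h + length (ys @ low bk h)"
          using h0 Nil lowh by simp
        show "static (?R, A)" using pre(1) by (simp add: static_def)
      qed (use pre h0 nx in auto)
      have body: "wp scan (R, A) (\<lambda>l es t. es = [] \<and> l \<le> 6 \<and> t = (?R, A))"
        using v0 pre(2,4) sizes h0 by (simp add: scan_def lim_def)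
      show ?thesis unfolding s
      proof (rule wp_Loop_step[OF _ _ body, where Q' = ?Q], goal_cases)
        case (4 l l' es t')
        have ne: "h \<noteq> 1 \<Longrightarrow> bk (h - 1) \<noteq> []" using pre(10)[of "h - 1"] h0 by auto
        note 1 = 4
        obtain h' where h': "fst t' 16 = h'" "h' \<le> h - 1"
          "if h' = 0 then fst t' 17 = 0 else \<exists>x. fst t' 17 = Suc x \<and> (x, u) \<in> r \<and>
           x \<in> set (if h' = h - 1 then (if h = 1 then [] else bk (h - 1)) else bk h')"
          "h' < h - 1 \<longrightarrow> (\<forall>y\<in>set (if h = 1 then [] else bk (h - 1)). (y, u) \<notin> r)"
          "\<forall>j. h' < j \<longrightarrow> j < h - 1 \<longrightarrow> (\<forall>y\<in>set (bk j). (y, u) \<notin> r)" using 1 by auto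
        have "\<forall>j. h' < j \<longrightarrow> j < h \<longrightarrow> (\<forall>y\<in>set (bk j). (y, u) \<notin> r)"
        proof (intro allI impI)
          fix j assume "h' < j" "j < h"
          then show "\<forall>y\<in>set (bk j). (y, u) \<notin> r" using h'(4,5) by (cases "j = h - 1") auto
        qed
        moreover have "if h' = 0 then fst t' 17 = 0 else \<exists>x. fst t' 17 = Suc x \<and> (x, u) \<in> r \<and> x \<in> set (bk h')"
          using h'(2,3) h0 by (auto split: if_splits)
        ultimately show ?case using 1 h'(1,2) h0 Nil ne lowh by (auto split: if_splits)
      qed (use pre(3) h0 IH in auto)
    next
      case (Cons y ys')
      then have v: "R 17 = Suc y" "ilist (A 16) (A 16 y) ys'" "y < n" using pre(7,9) by auto
      have ma: "A 0 (y * n + u) = (if (y, u) \<in> r then 1 else 0)" "y * n + u < n * n" "y * n \<le> y * n + u"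
        using st(3)[OF v(3) pre(6)] cell[OF v(3) pre(6)] by simp_all
      have W: "y * n + u < W" "y * n < W" "1 < W" "y < M" using ma sizes v(3) by linarith+
      show ?thesis
      proof (cases "(y, u) \<in> r")
        case True
        have body: "wp scan (R, A) (\<lambda>l es t. es = [] \<and> l \<le> 6 \<and> t = (R(19 := 0), A))"
          using v st pre(5) ma W True sizes by (simp add: scan_def lim_def)
        show ?thesis unfolding s
        proof (rule wp_Loop_step[OF _ _ body, where Q' = "\<lambda>l es t. es = [] \<and> l = 1 \<and> t = (R(19 := 0), A)"], goal_cases)
          case (3 t)
          then show ?case by (subst wp_Loop) simp
        next
          case (4 l l' es t)
          then show ?case using h0 pre(2) v(1) True Cons by simp
        qed (use pre(3) h0 in auto)
      next
        case False
        let ?R = "R(17 := A 16 y)"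
        have body: "wp scan (R, A) (\<lambda>l es t. es = [] \<and> l \<le> 6 \<and> t = (?R, A))"
          using v st pre(5) ma W False sizes by (simp add: scan_def lim_def)
        have IH: "wp (Loop (V 19) scan) (?R, A) (\<lambda>l es t. es = [] \<and> snd t = snd (?R, A) \<and>
          (\<forall>y. y \<notin> {16, 17, 19} \<longrightarrow> fst t y = fst (?R, A) y) \<and>
          l \<le> 10 * (1 + 2 * length (takeWhile (\<lambda>x. (x, u) \<notin> r) (ys' @ low bk h)) + (if ys' = [] \<and> h \<noteq> 0 then 1 else 0)) \<and>
          (\<exists>h'. fst t 16 = h' \<and> h' \<le> h \<and> (if h' = 0 then fst t 17 = 0 else \<exists>x. fst t 17 = Suc x \<and> (x, u) \<in> r \<and>
             x \<in> set (if h' = h then ys' else bk h')) \<and>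
           (h' < h \<longrightarrow> (\<forall>y\<in>set ys'. (y, u) \<notin> r)) \<and> (\<forall>j. h' < j \<longrightarrow> j < h \<longrightarrow> (\<forall>y\<in>set (bk j). (y, u) \<notin> r))))"
          (is "wp _ _ ?Q")
          by (rule less.hyps) (use pre Cons v h0 in \<open>auto simp: static_def\<close>)
        show ?thesis unfolding s
        proof (rule wp_Loop_step[OF _ _ body, where Q' = ?Q], goal_cases)
          case (4 l l' es t')
          then show ?case using False Cons by (auto split: if_splits)
        qed (use pre(3) h0 IH in auto)
      qed
    qed
  qed
qed

text \<open>Strict monotonicity bounds the length of every chain by \<open>hm\<close>, and the
  predecessor pointers, shifted by one, give a chain that attains the height of its last
  element.\<close>

definition hts :: "(nat \<Rightarrow> nat) \<Rightarrow> (nat \<Rightarrow> nat) \<Rightarrow> nat \<Rightarrow> nat set \<Rightarrow> bool" where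
  "hts ht pr hm X \<longleftrightarrow> (\<forall>x\<in>X. 1 \<le> ht x \<and> ht x \<le> hm \<and> (\<forall>y\<in>X. (y, x) \<in> r \<longrightarrow> y \<noteq> x \<longrightarrow> ht y < ht x) \<and>
     (if ht x = 1 then pr x = 0 else \<exists>y\<in>X. pr x = Suc y \<and> (y, x) \<in> r \<and> y \<noteq> x \<and> ht y = ht x - 1))"

definition hinv :: "state \<Rightarrow> nat list \<Rightarrow> (nat \<Rightarrow> nat list) \<Rightarrow> bool" where
  "hinv s X bk \<longleftrightarrow> fst s 13 \<le> length X \<and>
     (\<forall>h. 1 \<le> h \<longrightarrow> h \<le> fst s 13 \<longrightarrow> ilist (snd s 16) (snd s 15 h) (bk h) \<and> bk h \<noteq> [] \<and> distinct (bk h) \<and>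
       (\<forall>x\<in>set (bk h). snd s 17 x = h)) \<and>
     (\<forall>x. x \<in> set X \<longleftrightarrow> (\<exists>h. 1 \<le> h \<and> h \<le> fst s 13 \<and> x \<in> set (bk h))) \<and>
     hts (snd s 17) (snd s 18) (fst s 13) (set X)"

text \<open>The scan has found the greatest height \<open>h\<close> of an element below
  \<open>u\<close>, so \<open>u\<close> gets \<open>h + 1\<close>. Elements arrive in the order of a
  linear extension, hence heights already assigned remain correct.\<close>

lemma height_post_ok:
  assumes st: "static t" and hv: "hinv t X bk" and X: "\<forall>x\<in>set X. x < u" "length X < n" and u: "fst t 15 = u" "u < n"
    and h: "fst t 16 = h" "h \<le> fst t 13" "if h = 0 then fst t 17 = 0 else \<exists>x. fst t 17 = Suc x \<and> (x, u) \<in> r \<and> x \<in> set (bk h)"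
    and fails: "\<forall>j. h < j \<longrightarrow> j \<le> fst t 13 \<longrightarrow> (\<forall>y\<in>set (bk j). (y, u) \<notin> r)"
  shows "wp height_post t (\<lambda>k es t'. es = [] \<and> k \<le> 12 \<and> static t' \<and> (\<exists>bk'. hinv t' (X @ [u]) bk') \<and>
    (\<forall>a. a \<notin> {15, 16, 17, 18} \<longrightarrow> snd t' a = snd t a) \<and> (\<forall>y. y \<notin> {13, 16} \<longrightarrow> fst t' y = fst t y))"
proof -
  obtain R A where t: "t = (R, A)" by force
  define hm where "hm = R 13"
  note H = hv[unfolded hinv_def t fst_conv snd_conv, folded hm_def]
  have hm: "hm \<le> length X" and bk: "\<And>h. 1 \<le> h \<Longrightarrow> h \<le> hm \<Longrightarrow> ilist (A 16) (A 15 h) (bk h) \<and> bk h \<noteq> [] \<and>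
      distinct (bk h) \<and> (\<forall>x\<in>set (bk h). A 17 x = h)"
    and mem: "\<And>x. x \<in> set X \<longleftrightarrow> (\<exists>h. 1 \<le> h \<and> h \<le> hm \<and> x \<in> set (bk h))"
    and hh: "hts (A 17) (A 18) hm (set X)" using H by blast+
  have Rs: "R 15 = u" "R 16 = h" "h \<le> hm" using u h t hm_def by auto
  define hm' where "hm' = max hm (h + 1)"
  define BK where "BK = (if h + 1 \<le> hm then A 15 else (A 15)(h + 1 := 0))"
  let ?A = "A(18 := (A 18)(u := R 17), 17 := (A 17)(u := h + 1), 16 := (A 16)(u := BK (h + 1)),
    15 := BK(h + 1 := u + 1))"
  let ?R = "R(16 := h + 1, 13 := hm')"
  have small: "h + 1 \<le> n" "h + 1 < W" "u + 1 < W" "u < M" "h + 1 < M" using Rs hm X u sizes by linarith+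
  have run: "wp height_post (R, A) (\<lambda>k es t'. es = [] \<and> k \<le> 12 \<and> t' = (?R, ?A))"
  proof (cases "h + 1 \<le> hm")
    case True
    then have "hm' = hm" "BK = A 15" by (auto simp: hm'_def BK_def)
    then show ?thesis using Rs small True sizes
      by (simp add: height_post_def lim_def hm_def fun_upd_idem fun_upd_twist)
  next
    case False
    then have "hm' = h + 1" "BK = (A 15)(h + 1 := 0)" by (auto simp: hm'_def BK_def)
    then show ?thesis using Rs small False sizes
      by (simp add: height_post_def lim_def hm_def fun_upd_twist)
  qed
  define bk' where "bk' = bk(h + 1 := u # (if h + 1 \<le> hm then bk (h + 1) else []))"
  have uX: "u \<notin> set X" using X by auto
  have ubk: "u \<notin> set (bk j)" if "1 \<le> j" "j \<le> hm" for j using mem uX that by blast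
  have hinv': "hinv (?R, ?A) (X @ [u]) bk'"
    unfolding hinv_def fst_conv snd_conv
  proof (intro conjI allI impI)
    show "?R 13 \<le> length (X @ [u])" using hm Rs by (simp add: hm'_def)
  next
    fix j assume j: "1 \<le> j" "j \<le> ?R 13"
    then have j': "j \<le> hm'" by simp
    show "ilist (?A 16) (?A 15 j) (bk' j)"
    proof (cases "j = h + 1")
      case True
      have "ilist ((A 16)(u := BK (h + 1))) (BK (h + 1)) (if h + 1 \<le> hm then bk (h + 1) else [])"
        using ubk[of "h + 1"] bk[of "h + 1"] by (auto simp: ilist_upd BK_def)
      then show ?thesis using True by (simp add: bk'_def)
    next
      case False
      then have "j \<le> hm" using j' Rs(3) by (auto simp: hm'_def)
      then show ?thesis using False bk[of j] ubk[of j] j by (simp add: ilist_upd bk'_def BK_def)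
    qed
    show "bk' j \<noteq> []" "distinct (bk' j)"
      using bk[of j] ubk[of "h + 1"] bk[of "h + 1"] j j' Rs(3) by (auto simp: bk'_def hm'_def)
    show "\<forall>x\<in>set (bk' j). ?A 17 x = j"
    proof (cases "j = h + 1")
      case True
      then show ?thesis using bk[of "h + 1"] by (auto simp: bk'_def)
    next
      case False
      then have "j \<le> hm" using j' Rs(3) by (auto simp: hm'_def)
      then show ?thesis using False bk[of j] ubk[of j] j by (auto simp: bk'_def)
    qed
  next
    fix x
    show "x \<in> set (X @ [u]) \<longleftrightarrow> (\<exists>j. 1 \<le> j \<and> j \<le> ?R 13 \<and> x \<in> set (bk' j))"
    proof
      assume "x \<in> set (X @ [u])"
      then show "\<exists>j. 1 \<le> j \<and> j \<le> ?R 13 \<and> x \<in> set (bk' j)"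
      proof (cases "x = u")
        case True
        then show ?thesis by (intro exI[of _ "h + 1"]) (simp add: bk'_def hm'_def)
      next
        case False
        then obtain j where "1 \<le> j" "j \<le> hm" "x \<in> set (bk j)" using mem \<open>x \<in> set (X @ [u])\<close> by auto
        then show ?thesis by (intro exI[of _ j]) (auto simp: bk'_def hm'_def)
      qed
    next
      assume "\<exists>j. 1 \<le> j \<and> j \<le> ?R 13 \<and> x \<in> set (bk' j)"
      then obtain j where j: "1 \<le> j" "j \<le> hm'" "x \<in> set (bk' j)" by auto
      show "x \<in> set (X @ [u])"
      proof (cases "x = u")
        case False
        then have "x \<in> set (bk j)" "j \<le> hm" using j Rs(3) by (auto simp: bk'_def hm'_def split: if_splits)
        then show ?thesis using mem j by auto
      qed simp
    qed
  next
    have HX: "A 17 y \<le> h" if y: "y \<in> set X" "(y, u) \<in> r" for y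
    proof (rule ccontr)
      assume gt: "\<not> A 17 y \<le> h"
      obtain j where j: "1 \<le> j" "j \<le> hm" "y \<in> set (bk j)" using mem y by auto
      then have "A 17 y = j" using bk[of j] by blast
      then have "h < j" "j \<le> fst t 13" using gt j by (auto simp: t hm_def)
      then show False using fails j(3) y(2) by blast
    qed
    \<comment> \<open>Labels increase along the order, so the new element is not below an earlier
      one.\<close>
    have nolater: "(u, x) \<notin> r" if "x \<in> set X" for x using X(1) that label[of u x] by fastforce
    show "hts (?A 17) (?A 18) (?R 13) (set (X @ [u]))"
      unfolding hts_def
    proof
      fix x assume x: "x \<in> set (X @ [u])"
      show "1 \<le> ?A 17 x \<and> ?A 17 x \<le> ?R 13 \<and>
        (\<forall>y\<in>set (X @ [u]). (y, x) \<in> r \<longrightarrow> y \<noteq> x \<longrightarrow> ?A 17 y < ?A 17 x) \<and>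
        (if ?A 17 x = 1 then ?A 18 x = 0
         else \<exists>y\<in>set (X @ [u]). ?A 18 x = Suc y \<and> (y, x) \<in> r \<and> y \<noteq> x \<and> ?A 17 y = ?A 17 x - 1)"
      proof (cases "x = u")
        case True
        have pr: "if h = 0 then R 17 = 0 else \<exists>y\<in>set X. R 17 = Suc y \<and> (y, u) \<in> r \<and> y \<noteq> u \<and> A 17 y = h"
        proof (cases "h = 0")
          case False
          then obtain y where y: "R 17 = Suc y" "(y, u) \<in> r" "y \<in> set (bk h)" using h(3) t by auto
          have h1: "1 \<le> h" using False by simp
          then have "y \<in> set X" "A 17 y = h" "y \<noteq> u"
            using mem[of y] bk[OF h1 Rs(3)] ubk[OF h1 Rs(3)] Rs(3) y(3) by blast+
          then show ?thesis using False y by auto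
        qed (use h(3) t in auto)
        then show ?thesis using True HX uX by (auto simp: hm'_def less_Suc_eq_le)
      next
        case False
        then have xX: "x \<in> set X" using x by auto
        have hx: "1 \<le> A 17 x" "A 17 x \<le> hm" "\<forall>y\<in>set X. (y, x) \<in> r \<longrightarrow> y \<noteq> x \<longrightarrow> A 17 y < A 17 x"
          "if A 17 x = 1 then A 18 x = 0 else \<exists>y\<in>set X. A 18 x = Suc y \<and> (y, x) \<in> r \<and> y \<noteq> x \<and> A 17 y = A 17 x - 1"
          using hh xX unfolding hts_def by blast+
        have "\<exists>y\<in>set (X @ [u]). ?A 18 x = Suc y \<and> (y, x) \<in> r \<and> y \<noteq> x \<and> ?A 17 y = ?A 17 x - 1" if ne: "A 17 x \<noteq> 1"
        proof -
          obtain y where y: "y \<in> set X" "A 18 x = Suc y" "(y, x) \<in> r" "y \<noteq> x" "A 17 y = A 17 x - 1"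
            using hx(4) ne by auto
          then have "y \<noteq> u" using uX by auto
          then show ?thesis using y False by (intro bexI[of _ y]) auto
        qed
        then show ?thesis using False hx nolater[OF xX] uX by (auto simp: hm'_def)
      qed
    qed
  qed
  have "static (?R, ?A)" using st by (auto simp: static_def t BK_def)
  then show ?thesis unfolding t
    by (rule_tac wp_mono[OF run]) (use hinv' in \<open>auto intro!: exI[of _ bk']\<close>)
qed

text \<open>The buckets are disjoint, so the failed tests concern distinct earlier elements.\<close>

lemma fails_le:
  assumes hv: "hinv s X bk" and hm: "fst s 13 = hm"
  shows "length (takeWhile (\<lambda>x. (x, u) \<notin> r) ((if hm = 0 then [] else bk hm) @ low bk hm))
    \<le> card {x\<in>set X. (x, u) \<notin> r}"
proof -
  let ?zs = "(if hm = 0 then [] else bk hm) @ low bk hm"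
  have z: "?zs = low bk (Suc hm)" by (cases "hm = 0") (auto simp: low_simps)
  have "distinct ?zs" unfolding z using hv hm
    by (intro distinct_low[where ht = "snd s 17"]) (auto simp: hinv_def)
  then have "length (takeWhile (\<lambda>x. (x, u) \<notin> r) ?zs) = card (set (takeWhile (\<lambda>x. (x, u) \<notin> r) ?zs))"
    by (metis distinct_card distinct_takeWhile)
  also have "\<dots> \<le> card {x\<in>set X. (x, u) \<notin> r}"
  proof (rule card_mono)
    have "set ?zs \<subseteq> set X" unfolding z using hv hm
      by (force simp: set_low hinv_def less_Suc_eq_le)
    then show "set (takeWhile (\<lambda>x. (x, u) \<notin> r) ?zs) \<subseteq> {x\<in>set X. (x, u) \<notin> r}"
      using set_takeWhileD[of _ "\<lambda>x. (x, u) \<notin> r" ?zs] by blast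
  qed simp
  finally show ?thesis .
qed

lemma height_step_ok:
  assumes st: "static s" and cl: "clist (snd s 2) (snd s 3) b (fst s 14) (u # ys)" and b: "b \<le> M"
    and hv: "hinv s X bk" "ilist (snd s 19) (fst s 21) (rev X)"
    and X: "\<forall>x\<in>set X. x < u" "length X < n" and u: "u < n"
  shows "wp height_step s (\<lambda>l es t. es = [] \<and> l \<le> 40 + 20 * card {x\<in>set X. (x, u) \<notin> r} \<and>
    (static t \<and> (\<exists>bk'. hinv t (X @ [u]) bk') \<and> ilist (snd t 19) (fst t 21) (rev (X @ [u])) \<and> clist (snd t 2) (snd t 3) b (fst t 14) ys \<and>
     (\<forall>a. a \<notin> {15, 16, 17, 18, 19} \<longrightarrow> snd t a = snd s a) \<and>
     (\<forall>y. y \<notin> {13, 14, 15, 16, 17, 19, 21} \<longrightarrow> fst t y = fst s y)))"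
proof -
  obtain R A where s: "s = (R, A)" by force
  define hm where "hm = R 13"
  let ?f = "card {x\<in>set X. (x, u) \<notin> r}"
  have c: "0 < R 14" "R 14 - 1 < M" "A 2 (R 14 - 1) = u" "clist (A 2) (A 3) b (A 3 (R 14 - 1)) ys"
    using cl b by (auto simp: s)
  have "hm \<le> length X" using hv(1) by (simp add: hinv_def s hm_def)
  then have h0: "hm \<le> n" "hm < M" "u + 1 < W" "u < M" using X(2) u sizes by linarith+
  let ?s1 = "(R(15 := u, 14 := A 3 (R 14 - 1), 21 := u + 1, 16 := hm, 17 := A 15 hm, 19 := hm),
    A(19 := (A 19)(u := R 21)))"
  have pre: "wp height_pre s (\<lambda>l es t. es = [] \<and> l \<le> 7 \<and> t = ?s1)"
    using c h0 sizes by (simp add: s height_pre_def lim_def hm_def)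
  have st1: "static ?s1" using st by (simp add: static_def s)
  have uX: "u \<notin> set X" using X by auto
  have bkh: "\<And>h. 1 \<le> h \<Longrightarrow> h \<le> hm \<Longrightarrow> ilist (A 16) (A 15 h) (bk h) \<and> bk h \<noteq> [] \<and> set (bk h) \<subseteq> set X"
    using hv(1) unfolding hinv_def s fst_conv snd_conv hm_def by blast
  have Xn: "set X \<subseteq> {..<n}" using X(1) u by fastforce
  have pv: "ilist ((A 19)(u := R 21)) (Suc u) (rev (X @ [u]))"
    using hv(2) uX by (simp add: s ilist_upd)
  define ys' where "ys' = (if hm = 0 then [] else bk hm)"
  note sc = scan_ok[of ?s1 hm u ys' bk]
  have scan: "wp (Loop (V 19) scan) ?s1 (\<lambda>l es t. es = [] \<and> snd t = snd ?s1 \<and> (\<forall>y. y \<notin> {16, 17, 19} \<longrightarrow> fst t y = fst ?s1 y) \<and>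
    l \<le> 10 * (1 + 2 * length (takeWhile (\<lambda>x. (x, u) \<notin> r) (ys' @ low bk hm)) + (if ys' = [] \<and> hm \<noteq> 0 then 1 else 0)) \<and>
    (\<exists>h'. fst t 16 = h' \<and> h' \<le> hm \<and> (if h' = 0 then fst t 17 = 0 else \<exists>x. fst t 17 = Suc x \<and> (x, u) \<in> r \<and>
       x \<in> set (if h' = hm then ys' else bk h')) \<and>
     (h' < hm \<longrightarrow> (\<forall>y\<in>set ys'. (y, u) \<notin> r)) \<and> (\<forall>j. h' < j \<longrightarrow> j < hm \<longrightarrow> (\<forall>y\<in>set (bk j). (y, u) \<notin> r))))"
  proof (rule sc)
    show "ilist (snd ?s1 16) (fst ?s1 17) ys'" using bkh[of hm] st by (auto simp: ys'_def static_def s)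
    show "set ys' \<subseteq> {..<n}" using bkh[of hm] subset_trans[OF _ Xn] by (cases "hm = 0") (simp_all add: ys'_def)
    show "ilist (snd ?s1 16) (snd ?s1 15 j) (bk j) \<and> bk j \<noteq> [] \<and> set (bk j) \<subseteq> {..<n}" if "1 \<le> j" "j < hm" for j
      using bkh[of j] that subset_trans[OF _ Xn] by simp
  qed (use st1 h0 u in \<open>auto simp: ys'_def\<close>)
  have fl: "length (takeWhile (\<lambda>x. (x, u) \<notin> r) (ys' @ low bk hm)) \<le> ?f"
    unfolding ys'_def by (rule fails_le[OF hv(1)]) (simp add: s hm_def)
  let ?P2 = "\<lambda>t. snd t = snd ?s1 \<and> (\<forall>y. y \<notin> {16, 17, 19} \<longrightarrow> fst t y = fst ?s1 y) \<and>
    (\<exists>h'. fst t 16 = h' \<and> h' \<le> hm \<and> (if h' = 0 then fst t 17 = 0 else \<exists>x. fst t 17 = Suc x \<and> (x, u) \<in> r \<and>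
       x \<in> set (bk h')) \<and> (\<forall>j. h' < j \<longrightarrow> j \<le> hm \<longrightarrow> (\<forall>y\<in>set (bk j). (y, u) \<notin> r)))"
  have scan': "wp (Loop (V 19) scan) ?s1 (\<lambda>l es t. es = [] \<and> l \<le> 20 + 20 * ?f \<and> ?P2 t)"
  proof (rule wp_mono[OF scan], elim conjE exE, goal_cases)
    case (1 l es t h')
    note h' = 1(5-9)
    have "(y, u) \<notin> r" if "h' < j" "j \<le> hm" "y \<in> set (bk j)" for j y
    proof (cases "j = hm")
      case True
      then have "h' < hm" "hm \<noteq> 0" using that by auto
      then show ?thesis using h'(4) that(3) True by (simp add: ys'_def)
    next
      case False
      then show ?thesis using h'(5) that by simp
    qed
    moreover have "if h' = 0 then fst t 17 = 0 else \<exists>x. fst t 17 = Suc x \<and> (x, u) \<in> r \<and> x \<in> set (bk h')"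
      using h'(3) by (cases "h' = hm") (auto simp: ys'_def)
    moreover have "l \<le> 20 + 20 * ?f" using 1(4) fl by (simp split: if_splits)
    ultimately show ?case using 1(1,2,3) h'(1,2) by (intro conjI exI[of _ h']) blast+
  qed
  show ?thesis unfolding height_step_def
  proof (rule wp_Seq_silent[OF pre, where Q' = "\<lambda>l es t. es = [] \<and> l \<le> 33 + 20 * ?f \<and>
    (static t \<and> (\<exists>bk'. hinv t (X @ [u]) bk') \<and> ilist (snd t 19) (fst t 21) (rev (X @ [u])) \<and> clist (snd t 2) (snd t 3) b (fst t 14) ys \<and>
     (\<forall>a. a \<notin> {15, 16, 17, 18, 19} \<longrightarrow> snd t a = snd s a) \<and>
     (\<forall>y. y \<notin> {13, 14, 15, 16, 17, 19, 21} \<longrightarrow> fst t y = fst s y))"])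
    fix t assume t: "t = ?s1"
    show "wp (Loop (V 19) scan ;; height_post) t (\<lambda>l es t. es = [] \<and> l \<le> 33 + 20 * ?f \<and>
      (static t \<and> (\<exists>bk'. hinv t (X @ [u]) bk') \<and> ilist (snd t 19) (fst t 21) (rev (X @ [u])) \<and> clist (snd t 2) (snd t 3) b (fst t 14) ys \<and>
       (\<forall>a. a \<notin> {15, 16, 17, 18, 19} \<longrightarrow> snd t a = snd s a) \<and>
       (\<forall>y. y \<notin> {13, 14, 15, 16, 17, 19, 21} \<longrightarrow> fst t y = fst s y)))"
      unfolding t
    proof (rule wp_Seq_silent[OF scan', where Q' = "\<lambda>k es t. es = [] \<and> k \<le> 12 \<and>
      (static t \<and> (\<exists>bk'. hinv t (X @ [u]) bk') \<and> ilist (snd t 19) (fst t 21) (rev (X @ [u])) \<and>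
       clist (snd t 2) (snd t 3) b (fst t 14) ys \<and>
       (\<forall>a. a \<notin> {15, 16, 17, 18, 19} \<longrightarrow> snd t a = snd s a) \<and>
       (\<forall>y. y \<notin> {13, 14, 15, 16, 17, 19, 21} \<longrightarrow> fst t y = fst s y))"])
      fix t2 assume P2: "?P2 t2"
      then obtain h' where h': "fst t2 16 = h'" "h' \<le> hm"
        "if h' = 0 then fst t2 17 = 0 else \<exists>x. fst t2 17 = Suc x \<and> (x, u) \<in> r \<and> x \<in> set (bk h')"
        "\<forall>j. h' < j \<longrightarrow> j \<le> hm \<longrightarrow> (\<forall>y\<in>set (bk j). (y, u) \<notin> r)" by blast
      have s2: "snd t2 = snd ?s1" and f2: "\<And>y. y \<notin> {16, 17, 19} \<Longrightarrow> fst t2 y = fst ?s1 y" using P2 by blast+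
      have f2': "fst t2 0 = R 0" "fst t2 3 = R 3" "fst t2 13 = hm" "fst t2 15 = u" "fst t2 21 = u + 1"
        "fst t2 14 = A 3 (R 14 - 1)" using f2 by (simp_all add: hm_def)
      have st2: "static t2" using st1 f2' s2 by (simp add: static_def)
      have hv2: "hinv t2 X bk" using hv(1) f2'(3) s2 unfolding hinv_def by (simp add: s hm_def)
      have hp: "wp height_post t2 (\<lambda>k es t'. es = [] \<and> k \<le> 12 \<and> static t' \<and> (\<exists>bk'. hinv t' (X @ [u]) bk') \<and>
        (\<forall>a. a \<notin> {15, 16, 17, 18} \<longrightarrow> snd t' a = snd t2 a) \<and> (\<forall>y. y \<notin> {13, 16} \<longrightarrow> fst t' y = fst t2 y))"
        by (rule height_post_ok[OF st2 hv2 X f2'(4) u h'(1)]) (use h' f2'(3) in simp_all)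
      show "wp height_post t2 (\<lambda>k es t. es = [] \<and> k \<le> 12 \<and>
        (static t \<and> (\<exists>bk'. hinv t (X @ [u]) bk') \<and> ilist (snd t 19) (fst t 21) (rev (X @ [u])) \<and>
         clist (snd t 2) (snd t 3) b (fst t 14) ys \<and>
         (\<forall>a. a \<notin> {15, 16, 17, 18, 19} \<longrightarrow> snd t a = snd s a) \<and>
         (\<forall>y. y \<notin> {13, 14, 15, 16, 17, 19, 21} \<longrightarrow> fst t y = fst s y)))"
      proof (rule wp_mono[OF hp], goal_cases)
        case (1 k es t3)
        then have e: "\<And>a. a \<notin> {15, 16, 17, 18} \<Longrightarrow> snd t3 a = snd t2 a"
          "\<And>y. y \<notin> {13, 16} \<Longrightarrow> fst t3 y = fst t2 y" by blast+
        have "snd t3 19 = (A 19)(u := R 21)" "snd t3 2 = A 2" "snd t3 3 = A 3" "fst t3 21 = Suc u"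
          "fst t3 14 = A 3 (R 14 - 1)" using e s2 f2' by simp_all
        moreover have "snd t3 a = snd s a" if "a \<notin> {15, 16, 17, 18, 19}" for a
          using e(1)[of a] s2 that by (simp add: s)
        moreover have "fst t3 y = fst s y" if "y \<notin> {13, 14, 15, 16, 17, 19, 21}" for y
          using e(2)[of y] f2[of y] that by (simp add: s)
        ultimately show ?case using 1 pv c(4) by simp
      qed
    qed auto
  qed auto
qed

text \<open>An element with a smaller label that is not below \<open>u\<close> is incomparable to
  \<open>u\<close>. The failed tests of successive insertions are therefore charged to different
  pairs, which gives the time bound for the heights.\<close>

lemma incomparable_insert:
  assumes "\<forall>x\<in>X. x < u" "finite X"
  shows "card (incomparable r X) + card {x\<in>X. (x, u) \<notin> r} \<le> card (incomparable r (insert u X))"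
proof -
  let ?P = "(\<lambda>x. (x, u)) ` {x\<in>X. (x, u) \<notin> r}"
  have fin: "finite (incomparable r Y)" if "finite Y" for Y
    by (rule finite_subset[of _ "Y \<times> Y"]) (use that in \<open>auto simp: incomparable_def\<close>)
  have "card ?P = card {x\<in>X. (x, u) \<notin> r}" by (intro card_image inj_onI) auto
  moreover have "incomparable r X \<inter> ?P = {}" using assms(1) by (auto simp: incomparable_def)
  moreover have "incomparable r X \<union> ?P \<subseteq> incomparable r (insert u X)"
    using assms(1) label by (fastforce simp: incomparable_def)
  ultimately have "card (incomparable r X) + card {x\<in>X. (x, u) \<notin> r} = card (incomparable r X \<union> ?P)"
    using card_Un_disjoint[of "incomparable r X" ?P] fin[OF assms(2)] assms(2) by simp
  also have "\<dots> \<le> card (incomparable r (insert u X))"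
    by (rule card_mono[OF fin]) (use assms(2) \<open>incomparable r X \<union> ?P \<subseteq> _\<close> in simp_all)
  finally show ?thesis .
qed

lemma height_loop_ok:
  assumes "static s" "clist (snd s 2) (snd s 3) b (fst s 14) ys" "b \<le> M" "hinv s X bk"
    "ilist (snd s 19) (fst s 21) (rev X)" "sorted_wrt (<) (X @ ys)" "set (X @ ys) \<subseteq> {..<n}"
  shows "wp (Loop (V 14) height_step) s (\<lambda>l es t. es = [] \<and>
    l + 20 * card (incomparable r (set X)) \<le> 1 + 42 * length ys + 20 * card (incomparable r (set (X @ ys))) \<and>
    static t \<and> (\<exists>bk'. hinv t (X @ ys) bk') \<and> ilist (snd t 19) (fst t 21) (rev (X @ ys)) \<and>
    (\<forall>a. a \<notin> {15, 16, 17, 18, 19} \<longrightarrow> snd t a = snd s a) \<and>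
    (\<forall>y. y \<notin> {13, 14, 15, 16, 17, 19, 21} \<longrightarrow> fst t y = fst s y))"
  using assms
proof (induction ys arbitrary: s X bk)
  case Nil
  then show ?case by (subst wp_Loop) auto
next
  case (Cons u ys)
  have X: "\<forall>x\<in>set X. x < u" "u < n" using Cons.prems(6,7) by (auto simp: sorted_wrt_append)
  have len: "length X < n"
  proof -
    have "distinct (X @ u # ys)" using Cons.prems(6) strict_sorted_iff by blast
    then have "length (X @ u # ys) = card (set (X @ u # ys))" by (rule distinct_card[symmetric])
    also have "\<dots> \<le> card {..<n}" using Cons.prems(7) by (intro card_mono) auto
    finally show ?thesis by simp
  qed
  note st = height_step_ok[OF Cons.prems(1-5) X(1) len X(2)]
  have inc: "card (incomparable r (set X)) + card {x\<in>set X. (x, u) \<notin> r} \<le> card (incomparable r (set (X @ [u])))"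
    using incomparable_insert[OF X(1)] by simp
  have nz: "fst s 14 \<noteq> 0" using Cons.prems(2) by simp
  show ?case
  proof (rule wp_Loop_step[OF _ _ st, where Q' = "\<lambda>l es t. es = [] \<and>
    l + 20 * card (incomparable r (set (X @ [u]))) \<le> 1 + 42 * length ys + 20 * card (incomparable r (set ((X @ [u]) @ ys))) \<and>
    static t \<and> (\<exists>bk'. hinv t ((X @ [u]) @ ys) bk') \<and> ilist (snd t 19) (fst t 21) (rev ((X @ [u]) @ ys)) \<and>
    (\<forall>a. a \<notin> {15, 16, 17, 18, 19} \<longrightarrow> snd t a = snd s a) \<and>
    (\<forall>y. y \<notin> {13, 14, 15, 16, 17, 19, 21} \<longrightarrow> fst t y = fst s y)"], goal_cases)
    case (3 t)
    then obtain bk' where bk': "hinv t (X @ [u]) bk'" by blast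
    show ?case
      by (rule wp_mono[OF Cons.IH[of t "X @ [u]" bk']]) (use 3 bk' Cons.prems(3,6,7) in auto)
  next
    case (4 l l' es t)
    then show ?case using inc by auto
  qed (use nz in auto)
qed

lemma heights_ok:
  assumes "static s" "clist (snd s 2) (snd s 3) b (fst s 9) xs" "b \<le> M" "sorted_wrt (<) xs" "set xs \<subseteq> {..<n}"
  shows "wp heights s (\<lambda>l es t. es = [] \<and> l \<le> 50 * (1 + length xs + card (incomparable r (set xs))) \<and>
    static t \<and> (\<exists>bk. hinv t xs bk) \<and> ilist (snd t 19) (fst t 21) (rev xs) \<and>
    (\<forall>a. a \<notin> {15, 16, 17, 18, 19} \<longrightarrow> snd t a = snd s a) \<and>
    (\<forall>y. y \<notin> {13, 14, 15, 16, 17, 19, 21} \<longrightarrow> fst t y = fst s y))"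
proof -
  let ?s = "((fst s)(13 := 0, 21 := 0, 14 := fst s 9), snd s)"
  have "wp (Loop (V 14) height_step) ?s (\<lambda>l es t. es = [] \<and>
    l + 20 * card (incomparable r (set [])) \<le> 1 + 42 * length xs + 20 * card (incomparable r (set ([] @ xs))) \<and>
    static t \<and> (\<exists>bk'. hinv t ([] @ xs) bk') \<and> ilist (snd t 19) (fst t 21) (rev ([] @ xs)) \<and>
    (\<forall>a. a \<notin> {15, 16, 17, 18, 19} \<longrightarrow> snd t a = snd ?s a) \<and>
    (\<forall>y. y \<notin> {13, 14, 15, 16, 17, 19, 21} \<longrightarrow> fst t y = fst ?s y))"
    by (rule height_loop_ok) (use assms in \<open>auto simp: hinv_def hts_def static_def\<close>)
  then have "wp (Loop (V 14) height_step) ?s (\<lambda>l es t. es = [] \<and>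
    l + 10 \<le> 50 * (1 + length xs + card (incomparable r (set xs))) \<and>
    static t \<and> (\<exists>bk. hinv t xs bk) \<and> ilist (snd t 19) (fst t 21) (rev xs) \<and>
    (\<forall>a. a \<notin> {15, 16, 17, 18, 19} \<longrightarrow> snd t a = snd s a) \<and>
    (\<forall>y. y \<notin> {13, 14, 15, 16, 17, 19, 21} \<longrightarrow> fst t y = fst s y))"
    by (rule wp_mono) auto
  then show ?thesis using sizes unfolding heights_def
    by (simp, elim wp_mono) auto
qed

end

section \<open>The traversal program: chains and children\<close>

definition chain_step :: com where
  "chain_step = Write 4 (Plus (V 10) (V 18)) (Minus (V 17) (N 1)) ;; Write 5 (Plus (V 10) (V 18)) (N 0) ;;
     Assign 17 (At 18 (Minus (V 17) (N 1))) ;; Assign 18 (Minus (V 18) (N 1))"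

definition chain_code :: com where
  "chain_code = Assign 22 (V 13) ;; Assign 17 (At 15 (V 13)) ;; Assign 18 (V 13) ;;
     Loop (V 18) chain_step ;; Write 5 (V 10) (N 0)"

definition down_step :: com where
  "down_step = Cond (At 0 (Plus (Times (At 4 (Plus (V 10) (V 18))) (V 0)) (V 15))) (Assign 19 (N 0))
     (Assign 18 (Minus (V 18) (N 1)) ;; Assign 19 (V 18))"

definition up_step :: com where
  "up_step = Cond (V 18) (Assign 23 (At 0 (Plus (Times (V 15) (V 0)) (At 4 (Plus (V 10) (V 18)))))) (Assign 23 (N 0)) ;;
     Cond (V 23) (Assign 19 (N 0))
       (Write 2 (V 20) (V 15) ;; Write 3 (V 20) (At 5 (Plus (V 10) (V 18))) ;; Assign 20 (Plus (V 20) (N 1)) ;;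
        Write 5 (Plus (V 10) (V 18)) (V 20) ;; Assign 18 (Plus (V 18) (N 1)) ;;
        Assign 19 (Minus (Plus (V 22) (N 1)) (V 18)))"

definition child_pre :: com where
  "child_pre = Assign 15 (Minus (V 14) (N 1)) ;; Assign 14 (At 19 (V 15)) ;; Assign 18 (At 17 (V 15)) ;; Assign 19 (V 18)"

definition child_step :: com where
  "child_step = child_pre ;; Loop (V 19) down_step ;; Assign 19 (N 1) ;; Loop (V 19) up_step"

definition children_code :: com where
  "children_code = Assign 14 (V 21) ;; Assign 20 (V 10) ;; Loop (V 14) child_step"

context producer
begin

lemma chain_loop_ok:
  assumes "hts (snd s 17) (snd s 18) hm X" "X \<subseteq> {..<n}" "fst s 18 = i" "fst s 10 + i < M"
    "1 \<le> i \<Longrightarrow> fst s 17 = Suc x \<and> x \<in> X \<and> snd s 17 x = i"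
  shows "wp (Loop (V 18) chain_step) s (\<lambda>l es t. es = [] \<and> l \<le> 8 * i + 1 \<and>
    (\<forall>a. a \<notin> {4, 5} \<longrightarrow> snd t a = snd s a) \<and> (\<forall>y. y \<notin> {17, 18} \<longrightarrow> fst t y = fst s y) \<and>
    (\<forall>j. \<not> (fst s 10 < j \<and> j \<le> fst s 10 + i) \<longrightarrow> snd t 4 j = snd s 4 j \<and> snd t 5 j = snd s 5 j) \<and>
    (\<forall>j. 1 \<le> j \<longrightarrow> j \<le> i \<longrightarrow> snd t 5 (fst s 10 + j) = 0) \<and>
    (\<exists>ds. length ds = i \<and> chain_in r X ds \<and> (\<forall>j<i. snd s 17 (ds ! j) = Suc j \<and> snd t 4 (fst s 10 + Suc j) = ds ! j) \<and>
      (\<forall>u\<in>set ds. (u, x) \<in> r)))"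
  using assms
proof (induction i arbitrary: s x)
  case 0
  then show ?case by (subst wp_Loop) (simp add: chain_in_def)
next
  case (Suc i)
  obtain R A where s: "s = (R, A)" by force
  let ?b = "R 10"
  have x: "R 17 = Suc x" "x \<in> X" "A 17 x = Suc i" "x < n" using Suc.prems(2,5) by (auto simp: s)
  have i: "R 18 = Suc i" "?b + Suc i < M" using Suc.prems(3,4) by (auto simp: s)
  have W: "?b + Suc i < W" "x < M" "1 < W" "0 < W" using i x sizes by linarith+
  let ?t = "(R(17 := A 18 x, 18 := i), A(4 := (A 4)(?b + Suc i := x), 5 := (A 5)(?b + Suc i := 0)))"
  have body: "wp chain_step s (\<lambda>l es t. es = [] \<and> l \<le> 6 \<and> t = ?t)"
    using x(1) i W by (simp add: s chain_step_def lim_def)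
  have hx: "if A 17 x = 1 then A 18 x = 0 else \<exists>y\<in>X. A 18 x = Suc y \<and> (y, x) \<in> r \<and> y \<noteq> x \<and> A 17 y = A 17 x - 1"
    using Suc.prems(1) x(2) unfolding hts_def s by fastforce
  define y where "y = A 18 x - 1"
  have y: "A 18 x = Suc y \<and> y \<in> X \<and> (y, x) \<in> r \<and> A 17 y = i" if "1 \<le> i" using hx that x(3) by (auto simp: y_def)
  have ls: "length ds = i \<Longrightarrow> 1 \<le> i \<or> ds = []" for ds :: "nat list" by (cases i) auto
  have IH: "wp (Loop (V 18) chain_step) ?t (\<lambda>l es t. es = [] \<and> l \<le> 8 * i + 1 \<and>
    (\<forall>a. a \<notin> {4, 5} \<longrightarrow> snd t a = snd ?t a) \<and> (\<forall>y. y \<notin> {17, 18} \<longrightarrow> fst t y = fst ?t y) \<and>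
    (\<forall>j. \<not> (fst ?t 10 < j \<and> j \<le> fst ?t 10 + i) \<longrightarrow> snd t 4 j = snd ?t 4 j \<and> snd t 5 j = snd ?t 5 j) \<and>
    (\<forall>j. 1 \<le> j \<longrightarrow> j \<le> i \<longrightarrow> snd t 5 (fst ?t 10 + j) = 0) \<and>
    (\<exists>ds. length ds = i \<and> chain_in r X ds \<and> (\<forall>j<i. snd ?t 17 (ds ! j) = Suc j \<and> snd t 4 (fst ?t 10 + Suc j) = ds ! j) \<and>
      (\<forall>u\<in>set ds. (u, y) \<in> r)))" (is "wp _ _ ?Q'")
    by (rule Suc.IH) (use Suc.prems(1,2) y i in \<open>auto simp: s\<close>)
  show ?case
  proof (rule wp_Loop_step[OF _ _ body, where Q' = ?Q'], goal_cases)
    case (3 t) then show ?case using IH by simp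
  next
    case (4 l l' es t)
    note q = 4(2)[THEN conjunct1] 4(2)[THEN conjunct2, THEN conjunct1]
      4(2)[THEN conjunct2, THEN conjunct2, THEN conjunct1]
      4(2)[THEN conjunct2, THEN conjunct2, THEN conjunct2, THEN conjunct1]
      4(2)[THEN conjunct2, THEN conjunct2, THEN conjunct2, THEN conjunct2, THEN conjunct1]
      4(2)[THEN conjunct2, THEN conjunct2, THEN conjunct2, THEN conjunct2, THEN conjunct2, THEN conjunct1]
      4(2)[THEN conjunct2, THEN conjunct2, THEN conjunct2, THEN conjunct2, THEN conjunct2, THEN conjunct2]
    from q(7) obtain ds where ds: "length ds = i" "chain_in r X ds"
      "\<forall>j<i. A 17 (ds ! j) = Suc j \<and> snd t 4 (?b + Suc j) = ds ! j" "\<forall>u\<in>set ds. (u, y) \<in> r" by (auto simp: s)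
    have below: "(u, x) \<in> r \<and> u \<noteq> x" if u: "u \<in> set ds" for u
    proof -
      have "1 \<le> i" using ls[OF ds(1)] u by auto
      then have "(u, x) \<in> r" using y ds(4) u partial_orderD(2)[OF po, of u y x] by blast
      moreover obtain j where "j < i" "u = ds ! j" using u ds(1) by (auto simp: in_set_conv_nth)
      then have "A 17 u = Suc j" using ds(3) by blast
      then have "u \<noteq> x" using x(3) \<open>j < i\<close> by auto
      ultimately show ?thesis by blast
    qed
    have "chain_in r X (ds @ [x])" using ds(2) below x(2) by (auto simp: chain_in_def sorted_wrt_append)
    moreover have "A 17 ((ds @ [x]) ! j) = Suc j \<and> snd t 4 (?b + Suc j) = (ds @ [x]) ! j" if j: "j < Suc i" for j
    proof (cases "j = i")
      case True
      have "snd t 4 (?b + Suc i) = x" using q(5) by simp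
      then show ?thesis using True ds(1) x(3) by (simp add: nth_append)
    next
      case False
      then show ?thesis using ds(1,3) j by (simp add: nth_append)
    qed
    moreover have "(u, x) \<in> r" if "u \<in> set (ds @ [x])" for u
      using that below partial_orderD(1)[OF po, of x] x(4) by auto
    moreover have "length (ds @ [x]) = Suc i" using ds(1) by simp
    ultimately have ex: "\<exists>ds. length ds = Suc i \<and> chain_in r X ds \<and>
      (\<forall>j<Suc i. A 17 (ds ! j) = Suc j \<and> snd t 4 (?b + Suc j) = ds ! j) \<and> (\<forall>u\<in>set ds. (u, x) \<in> r)" by blast
    have z: "snd t 5 (?b + j) = 0" if "1 \<le> j" "j \<le> Suc i" for j
    proof (cases "j = Suc i")
      case True then show ?thesis using q(5) by simp
    next
      case False then show ?thesis using q(6) that by simp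
    qed
    show ?case unfolding s fst_conv snd_conv
    proof (intro conjI allI impI)
      show "es = []" "Suc (Suc (l + l')) \<le> 8 * Suc i + 1" using q(1,2) 4(1) by auto
      show "snd t a = A a" if "a \<notin> {4, 5}" for a using q(3) that by simp
      show "fst t y = R y" if "y \<notin> {17, 18}" for y using q(4) that by simp
      fix j assume "\<not> (R 10 < j \<and> j \<le> R 10 + Suc i)"
      then show "snd t 4 j = A 4 j" "snd t 5 j = A 5 j" using q(5) by auto
    qed (use z ex in auto)
  qed (use i in \<open>auto simp: s\<close>)
qed

text \<open>Along a chain the heights are distinct numbers between 1 and
  \<open>length ds\<close>.\<close>

lemma hts_longest:
  assumes h: "hts ht pr (length ds) X" and ds: "chain_in r X ds"
  shows "longest_chain_in r X ds"
  unfolding longest_chain_in_def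
proof (intro conjI allI impI ds)
  fix es assume es: "chain_in r X es"
  have "sorted_wrt (<) (map ht es)"
    unfolding sorted_wrt_map
  proof (rule sorted_wrt_mono_rel[OF _ conjunct2[OF es[unfolded chain_in_def]]])
    fix u v assume "u \<in> set es" "v \<in> set es" "(u, v) \<in> r \<and> u \<noteq> v"
    moreover have "u \<in> X" "v \<in> X" using es calculation by (auto simp: chain_in_def)
    ultimately show "ht u < ht v" using h unfolding hts_def by blast
  qed
  then have "distinct (map ht es)" using strict_sorted_iff by blast
  then have "length es = card (set (map ht es))" using distinct_card[of "map ht es"] by simp
  also have "\<dots> \<le> card {1..length ds}"
  proof (rule card_mono)
    show "set (map ht es) \<subseteq> {1..length ds}"
      using es h unfolding hts_def chain_in_def by fastforce
  qed simp
  finally show "length es \<le> length ds" by simp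
qed

lemma chain_ok:
  assumes hv: "hinv s xs bk" and xs: "xs \<noteq> []" "set xs \<subseteq> {..<n}" "length xs \<le> n" and st: "static s"
    and b: "fst s 10 + wd \<le> M"
  shows "wp chain_code s (\<lambda>l es t. es = [] \<and> l \<le> 8 * length xs + 10 \<and> static t \<and>
    (\<forall>a. a \<notin> {4, 5} \<longrightarrow> snd t a = snd s a) \<and> (\<forall>y. y \<notin> {17, 18, 22} \<longrightarrow> fst t y = fst s y) \<and>
    (\<forall>j. j < fst s 10 \<longrightarrow> snd t 4 j = snd s 4 j \<and> snd t 5 j = snd s 5 j) \<and>
    (\<exists>ds. longest_chain_in r (set xs) ds \<and> fst t 22 = length ds \<and> length ds = fst s 13 \<and>
      (\<forall>j\<le>length ds. snd t 5 (fst s 10 + j) = 0) \<and>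
      (\<forall>j<length ds. snd t 4 (fst s 10 + Suc j) = ds ! j \<and> snd s 17 (ds ! j) = Suc j)))"
proof -
  obtain R A where s: "s = (R, A)" by force
  define hm where "hm = R 13"
  have hm: "hm \<le> length xs" "hts (A 17) (A 18) hm (set xs)" using hv by (simp_all add: hinv_def s hm_def)
  have mem: "\<And>x. x \<in> set xs \<longleftrightarrow> (\<exists>h. 1 \<le> h \<and> h \<le> hm \<and> x \<in> set (bk h))"
    using hv unfolding hinv_def s hm_def fst_conv snd_conv by blast
  have bk: "\<And>h. 1 \<le> h \<Longrightarrow> h \<le> hm \<Longrightarrow> ilist (A 16) (A 15 h) (bk h) \<and> bk h \<noteq> [] \<and> (\<forall>x\<in>set (bk h). A 17 x = h)"
    using hv unfolding hinv_def s hm_def fst_conv snd_conv by blast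
  have "hd xs \<in> set xs" using xs by simp
  then have h1: "1 \<le> hm" using mem[of "hd xs"] by auto
  obtain x zs where z: "bk hm = x # zs" using bk[OF h1 order_refl] by (cases "bk hm") auto
  have x: "A 15 hm = Suc x" "x \<in> set xs" "A 17 x = hm"
    using bk[OF h1 order_refl] z mem[of x] h1 by auto
  have W: "hm < M" "R 10 + hm < M" "R 10 < M" "0 < W" using hm xs(3) b sizes by (auto simp: s)
  let ?s = "(R(22 := hm, 17 := Suc x, 18 := hm), A)"
  have loop: "wp (Loop (V 18) chain_step) ?s (\<lambda>l es t. es = [] \<and> l \<le> 8 * hm + 1 \<and>
    (\<forall>a. a \<notin> {4, 5} \<longrightarrow> snd t a = snd ?s a) \<and> (\<forall>y. y \<notin> {17, 18} \<longrightarrow> fst t y = fst ?s y) \<and>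
    (\<forall>j. \<not> (fst ?s 10 < j \<and> j \<le> fst ?s 10 + hm) \<longrightarrow> snd t 4 j = snd ?s 4 j \<and> snd t 5 j = snd ?s 5 j) \<and>
    (\<forall>j. 1 \<le> j \<longrightarrow> j \<le> hm \<longrightarrow> snd t 5 (fst ?s 10 + j) = 0) \<and>
    (\<exists>ds. length ds = hm \<and> chain_in r (set xs) ds \<and> (\<forall>j<hm. snd ?s 17 (ds ! j) = Suc j \<and> snd t 4 (fst ?s 10 + Suc j) = ds ! j) \<and>
      (\<forall>u\<in>set ds. (u, x) \<in> r)))" (is "wp _ _ ?Q")
    by (rule chain_loop_ok[where hm = hm]) (use hm xs(2) W x in auto)
  have fin: "wp (Loop (V 18) chain_step ;; Write 5 (V 10) (N 0)) ?s (\<lambda>l es t. es = [] \<and> l \<le> 8 * length xs + 2 \<and> static t \<and>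
    (\<forall>a. a \<notin> {4, 5} \<longrightarrow> snd t a = snd s a) \<and> (\<forall>y. y \<notin> {17, 18, 22} \<longrightarrow> fst t y = fst s y) \<and>
    (\<forall>j. j < fst s 10 \<longrightarrow> snd t 4 j = snd s 4 j \<and> snd t 5 j = snd s 5 j) \<and>
    (\<exists>ds. longest_chain_in r (set xs) ds \<and> fst t 22 = length ds \<and> length ds = fst s 13 \<and>
      (\<forall>j\<le>length ds. snd t 5 (fst s 10 + j) = 0) \<and>
      (\<forall>j<length ds. snd t 4 (fst s 10 + Suc j) = ds ! j \<and> snd s 17 (ds ! j) = Suc j)))"
    unfolding wp_simps(5)
  proof (rule wp_mono[OF loop], elim conjE exE, goal_cases)
    case (1 l es t ds)
    have f: "fst t 10 = R 10" "fst t 22 = hm" "fst t 0 = R 0" "fst t 3 = R 3" "snd t 0 = A 0" "snd t 15 = A 15"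
      using 1(3,4) by simp_all
    have lg: "longest_chain_in r (set xs) ds" using hts_longest[of "A 17" "A 18" ds "set xs"] hm(2) 1(7,8) by simp
    have z: "((snd t 5)(R 10 := 0)) (R 10 + j) = 0" if "j \<le> hm" for j using 1(6) that by (cases j) auto
    have stt: "static (fst t, (snd t)(5 := (snd t 5)(R 10 := 0)))"
      using st f by (simp add: static_def s)
    show ?case unfolding wp_simps(3)
      by (intro conjI allI impI exI[of _ ds]) (use 1 f lg z stt W hm(1) in \<open>simp_all add: s lim_def hm_def\<close>)
  qed
  show ?thesis unfolding chain_code_def
    using W x(1) by (simp add: s hm_def[symmetric] lim_def wp_Assign_Seq del: wp_simps(5))
      (rule wp_mono[OF fin[unfolded s fst_conv snd_conv]], simp add: hm_def)
qed

definition deg :: "nat set \<Rightarrow> nat \<Rightarrow> nat" where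
  "deg P u = card {v\<in>P. (u, v) \<notin> r \<and> (v, u) \<notin> r}"

lemma sum_deg: "finite P \<Longrightarrow> (\<Sum>u\<in>P. deg P u) = card (incomparable r P)"
proof -
  assume P: "finite P"
  have "incomparable r P = Sigma P (\<lambda>u. {v\<in>P. (u, v) \<notin> r \<and> (v, u) \<notin> r})"
    by (auto simp: incomparable_def)
  then show ?thesis using P by (simp add: deg_def)
qed

end

section \<open>Distributing the elements to the blocks\<close>

locale producer_node = producer n M W r wd + ns: chain_split r "{..<n}" P cs
  for n M W r wd P cs +
  fixes base :: nat
  assumes base: "base + wd \<le> M"
begin

abbreviation "k \<equiv> length cs"
abbreviation "c i \<equiv> cs ! (i - Suc 0)"
abbreviation "B i \<equiv> sub_poset r P cs i"

lemma sizes': "P \<subseteq> {..<n}" "k \<le> card P" "card P \<le> n" "k < wd" "card P + card (incomparable r P) + 2 \<le> wd"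
proof -
  show P: "P \<subseteq> {..<n}" by (rule ns.sub)
  show k: "k \<le> card P" using distinct_card[OF ns.distinct_cs] card_mono[OF ns.fin ns.C_sub] by simp
  show p: "card P \<le> n" using card_mono[OF _ P] by simp
  show "k < wd" using k p sizes by linarith
  have "finite (incomparable r {..<n})"
    by (rule finite_subset[of _ "{..<n} \<times> {..<n}"]) (auto simp: incomparable_def)
  then have "card (incomparable r P) \<le> card (incomparable r {..<n})"
    using P by (intro card_mono) (auto simp: incomparable_def)
  then show "card P + card (incomparable r P) + 2 \<le> wd" using p by (simp add: wd)
qed

definition frame_chain :: "state \<Rightarrow> bool" where
  "frame_chain s \<longleftrightarrow> fst s 10 = base \<and> fst s 22 = k \<and> (\<forall>j. 1 \<le> j \<longrightarrow> j \<le> k \<longrightarrow> snd s 4 (base + j) = c j)"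

text \<open>\<open>c d\<close> is the last chain element below \<open>u\<close>, with
  \<open>d = 0\<close> if there is none; block \<open>d\<close> is the first block that contains
  \<open>u\<close>.\<close>

definition bot :: "nat \<Rightarrow> nat \<Rightarrow> bool" where
  "bot u d \<longleftrightarrow> d \<le> k \<and> (1 \<le> d \<longrightarrow> (c d, u) \<in> r) \<and> (\<forall>j. d < j \<longrightarrow> j \<le> k \<longrightarrow> (c j, u) \<notin> r)"

lemma down_ok:
  assumes "static s" "frame_chain s" "fst s 15 = u" "u \<in> P" "fst s 18 = i" "fst s 19 = i" "i \<le> k"
    "\<forall>j. i < j \<longrightarrow> j \<le> k \<longrightarrow> (c j, u) \<notin> r"
  shows "wp (Loop (V 19) down_step) s (\<lambda>l es t. es = [] \<and> snd t = snd s \<and>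
    (\<forall>y. y \<notin> {18, 19} \<longrightarrow> fst t y = fst s y) \<and> bot u (fst t 18) \<and> fst t 18 \<le> i \<and>
    l \<le> 10 * (i - fst t 18) + 10)"
  using assms
proof (induction i arbitrary: s)
  case 0
  then show ?case by (subst wp_Loop) (simp add: bot_def)
next
  case (Suc i)
  obtain R A where s: "s = (R, A)" by force
  have f: "R 10 = base" "A 4 (base + Suc i) = cs ! i" "R 18 = Suc i" "R 15 = u"
    using Suc.prems(2,3,5,7) by (auto simp: frame_chain_def s)
  have cu: "cs ! i < n" "u < n" using ns.c_in[of "Suc i"] Suc.prems(4,7) sizes' by auto
  have mt: "A 0 (cs ! i * n + u) = (if (cs ! i, u) \<in> r then 1 else 0)" "R 0 = n"
    using Suc.prems(1) cu by (auto simp: static_def s)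
  have W: "base + Suc i < M" "base + Suc i < W" "cs ! i * n + u < n * n" "cs ! i * n + u < W" "cs ! i * n < W"
    "0 < W" "1 < W"
    using base sizes' sizes Suc.prems(7) cell[OF cu] by linarith+
  show ?case
  proof (cases "(cs ! i, u) \<in> r")
    case True
    have body: "wp down_step s (\<lambda>l es t. es = [] \<and> l \<le> 5 \<and> t = (R(19 := 0), A))"
      using f mt W True by (simp add: s down_step_def lim_def)
    show ?thesis
    proof (rule wp_Loop_step[OF _ _ body, where Q' = "\<lambda>l es t. es = [] \<and> l = 1 \<and> t = (R(19 := 0), A)"], goal_cases)
      case (3 t) then show ?case by (subst wp_Loop) simp
    next
      case (4 l l' es t)
      have "bot u (Suc i)" using True Suc.prems(7,8) by (simp add: bot_def)
      then show ?case using 4 f(3) by (simp add: s)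
    qed (use Suc.prems(6) in auto)
  next
    case False
    let ?t = "(R(18 := i, 19 := i), A)"
    have body: "wp down_step s (\<lambda>l es t. es = [] \<and> l \<le> 6 \<and> t = ?t)"
      using f mt W False by (simp add: s down_step_def lim_def)
    have up: "\<forall>j. i < j \<longrightarrow> j \<le> k \<longrightarrow> (c j, u) \<notin> r"
    proof (intro allI impI)
      fix j assume "i < j" "j \<le> k"
      then show "(c j, u) \<notin> r" using False Suc.prems(8) by (cases "j = Suc i") auto
    qed
    have IH: "wp (Loop (V 19) down_step) ?t (\<lambda>l es t. es = [] \<and> snd t = snd ?t \<and>
      (\<forall>y. y \<notin> {18, 19} \<longrightarrow> fst t y = fst ?t y) \<and> bot u (fst t 18) \<and> fst t 18 \<le> i \<and>
      l \<le> 10 * (i - fst t 18) + 10)" (is "wp _ _ ?Q'")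
      by (rule Suc.IH) (use Suc.prems(1-4,7) up in \<open>auto simp: s static_def frame_chain_def\<close>)
    show ?thesis
    proof (rule wp_Loop_step[OF _ _ body, where Q' = ?Q'], goal_cases)
      case (3 t) then show ?case using IH by simp
    next
      case (4 l l' es t)
      then have "10 * (Suc i - fst t 18) = 10 * (i - fst t 18) + 10" by (simp add: Suc_diff_le)
      then show ?case using 4 by (simp add: s)
    qed (use Suc.prems(6) in auto)
  qed
qed

text \<open>Elements below \<open>c j\<close> drop out as \<open>j\<close> grows, so the blocks
  containing \<open>u\<close> form an interval that starts at \<open>d\<close>. This is why a
  downward search for \<open>d\<close> and an upward scan find exactly these blocks.\<close>

lemma in_B_iff: "bot u d \<Longrightarrow> u \<in> P \<Longrightarrow> j \<le> k \<Longrightarrow> u \<in> B j \<longleftrightarrow> d \<le> j \<and> (j = 0 \<or> (u, c j) \<notin> r)"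
proof -
  assume b: "bot u d" and u: "u \<in> P" and j: "j \<le> k"
  have "(c (Suc j), u) \<in> r" if "j < d"
  proof -
    have "d \<le> k" "(c d, u) \<in> r" using b that by (auto simp: bot_def)
    moreover have "(c (Suc j), c d) \<in> r" using ns.c_le_iff[of "Suc j" d] that \<open>d \<le> k\<close> by simp
    ultimately show ?thesis using ns.trans by blast
  qed
  moreover have "j < d \<Longrightarrow> j < k" using b by (simp add: bot_def)
  moreover have "(c (Suc j), u) \<notin> r" if "d \<le> j" "j < k"
    using b that unfolding bot_def by (auto dest!: spec[of _ "Suc j"])
  ultimately show ?thesis using ns.in_B[OF j, of u] u by (cases "d \<le> j") auto
qed

text \<open>In every block of \<open>u\<close> after the first, \<open>c j\<close> is incomparable
  to \<open>u\<close>. Summed over \<open>u\<close>, this bounds the total size of the blocks by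
  \<open>card P + card (incomparable r P)\<close>.\<close>

lemma card_B: "u \<in> P \<Longrightarrow> card {j. j \<le> k \<and> u \<in> B j} \<le> 1 + deg P u"
proof -
  assume u: "u \<in> P"
  obtain d where d: "d \<le> k" "1 \<le> d \<Longrightarrow> (c d, u) \<in> r" "\<And>j. d < j \<Longrightarrow> j \<le> k \<Longrightarrow> (c j, u) \<notin> r"
    by (rule ns.cut[of "{v. (v, u) \<in> r}", unfolded mem_Collect_eq]) blast
  have bot: "bot u d" using d by (simp add: bot_def)
  let ?I = "{j. 1 \<le> j \<and> j \<le> k \<and> (u, c j) \<notin> r \<and> (c j, u) \<notin> r}"
  have "{j. j \<le> k \<and> u \<in> B j} \<subseteq> insert d ?I"
  proof
    fix j assume "j \<in> {j. j \<le> k \<and> u \<in> B j}"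
    then have j: "j \<le> k" "d \<le> j" "j = 0 \<or> (u, c j) \<notin> r" using in_B_iff[OF bot u] by auto
    then show "j \<in> insert d ?I" using d(3)[of j] by (cases "j = d") auto
  qed
  then have "card {j. j \<le> k \<and> u \<in> B j} \<le> card (insert d ?I)" by (intro card_mono) auto
  also have "\<dots> \<le> 1 + card ?I" by (simp add: card_insert_if)
  also have "card ?I \<le> deg P u" unfolding deg_def
  proof (rule card_inj_on_le[of c])
    show "inj_on c ?I" by (intro inj_onI) (simp add: ns.c_inj)
    show "c ` ?I \<subseteq> {v\<in>P. (u, v) \<notin> r \<and> (v, u) \<notin> r}" using ns.c_in by auto
    show "finite {v\<in>P. (u, v) \<notin> r \<and> (v, u) \<notin> r}" using ns.fin by simp
  qed
  finally show ?thesis by simp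
qed

definition ranked :: "state \<Rightarrow> bool" where
  "ranked s \<longleftrightarrow> frame_chain s \<and> hts (snd s 17) (snd s 18) k P \<and> (\<forall>j. 1 \<le> j \<longrightarrow> j \<le> k \<longrightarrow> snd s 17 (c j) = j)"

definition over :: "nat \<Rightarrow> nat \<Rightarrow> bool" where
  "over u j \<longleftrightarrow> j = 0 \<or> (u, c j) \<notin> r"

text \<open>The number of iterations that insert \<open>u\<close> from block \<open>i\<close> on,
  and hence the number of list cells allocated for them.\<close>

definition cnt :: "nat \<Rightarrow> nat \<Rightarrow> nat" where
  "cnt u i = card {j. i \<le> j \<and> j \<le> k \<and> over u j}"

lemma over_antimono: "i \<le> j \<Longrightarrow> j \<le> k \<Longrightarrow> over u j \<Longrightarrow> over u i"
  using ns.c_le_iff[of i j] ns.trans[of u "c i" "c j"] by (auto simp: over_def)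

lemma cnt_over: "i \<le> k \<Longrightarrow> over u i \<Longrightarrow> cnt u i = Suc (cnt u (Suc i))"
proof -
  assume i: "i \<le> k" "over u i"
  have "{j. i \<le> j \<and> j \<le> k \<and> over u j} = insert i {j. Suc i \<le> j \<and> j \<le> k \<and> over u j}"
    using i by (auto simp: Suc_le_eq intro: le_neq_implies_less)
  then show ?thesis by (simp add: cnt_def)
qed

lemma cnt_under: "\<not> over u i \<Longrightarrow> cnt u i = 0"
proof -
  assume i: "\<not> over u i"
  then have "{j. i \<le> j \<and> j \<le> k \<and> over u j} = {}" using over_antimono by blast
  then show ?thesis by (simp add: cnt_def)
qed

lemma up_ok:
  assumes "static s" "frame_chain s" "fst s 15 = u" "u \<in> P" "fst s 18 = i" "i \<le> Suc k"
    "fst s 19 = 0 \<longleftrightarrow> i = Suc k" "fst s 20 = f" "f + cnt u i \<le> M" "base \<le> f"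
    "\<forall>j\<le>k. clist (snd s 2) (snd s 3) f (snd s 5 (base + j)) (L j)"
  shows "wp (Loop (V 19) up_step) s (\<lambda>l es t. es = [] \<and> l \<le> 20 * (1 + cnt u i) \<and> fst t 20 = f + cnt u i \<and>
    (\<forall>a. a \<notin> {2, 3, 5} \<longrightarrow> snd t a = snd s a) \<and> (\<forall>y. y \<notin> {18, 19, 20, 23} \<longrightarrow> fst t y = fst s y) \<and>
    (\<forall>j<base. snd t 2 j = snd s 2 j \<and> snd t 3 j = snd s 3 j \<and> snd t 5 j = snd s 5 j) \<and>
    (\<forall>j\<le>k. clist (snd t 2) (snd t 3) (f + cnt u i) (snd t 5 (base + j)) (if i \<le> j \<and> over u j then u # L j else L j)))"
  using assms
proof (induction "Suc k - i" arbitrary: s i f L)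
  case 0
  then have i: "i = Suc k" by simp
  then have "cnt u i = 0" by (auto simp: cnt_def)
  then show ?case using 0 i by (subst wp_Loop) simp
next
  case (Suc q)
  obtain R A where s: "s = (R, A)" by force
  have i: "i \<le> k" using Suc.hyps(2) by simp
  have f: "R 10 = base" "R 22 = k" "1 \<le> i \<Longrightarrow> A 4 (base + i) = c i" "R 18 = i" "R 15 = u" "R 20 = f"
    using Suc.prems(2,3,5,8) i by (auto simp: frame_chain_def s)
  have r19: "R 19 \<noteq> 0" using Suc.prems(7) i by (simp add: s)
  have cu: "1 \<le> i \<Longrightarrow> c i < n" "u < n" using ns.c_in[of i] i Suc.prems(4) sizes' by auto
  have mt: "1 \<le> i \<Longrightarrow> A 0 (u * n + c i) = (if (u, c i) \<in> r then 1 else 0)" "R 0 = n"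
    using Suc.prems(1) cu by (auto simp: static_def s)
  have W: "base + i < M" "base + i < W" "1 \<le> i \<Longrightarrow> u * n + c i < n * n" "1 \<le> i \<Longrightarrow> u * n + c i < W"
    "u * n < W" "0 < W" "1 < W" "u < M" "u < W"
  proof -
    show a: "1 \<le> i \<Longrightarrow> u * n + c i < n * n" using cell[OF cu(2,1)] by simp
    then show "1 \<le> i \<Longrightarrow> u * n + c i < W" using sizes by (meson less_trans)
    have "u * n \<le> n * n" using cu(2) by simp
    then show "u * n < W" using sizes by linarith
  qed (use base sizes' sizes i cu in linarith)+
  have ov: "over u i \<longleftrightarrow> i = 0 \<or> (u, c i) \<notin> r" by (simp add: over_def)
  show ?case
  proof (cases "over u i")
    case False
    then have i1: "1 \<le> i" "(u, c i) \<in> r" using ov by auto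
    have body: "wp up_step s (\<lambda>l es t. es = [] \<and> l \<le> 8 \<and> t = (R(23 := 1, 19 := 0), A))"
      using f mt W i1 by (simp add: s up_step_def lim_def)
    have none: "\<not> (i \<le> j \<and> over u j)" if "j \<le> k" for j using over_antimono that False by blast
    show ?thesis
    proof (rule wp_Loop_step[OF _ _ body, where Q' = "\<lambda>l es t. es = [] \<and> l = 1 \<and> t = (R(23 := 1, 19 := 0), A)"], goal_cases)
      case (3 t) then show ?case by (subst wp_Loop) simp
    next
      case (4 l l' es t)
      then show ?case using cnt_under[OF False] f none Suc.prems(11) by (auto simp: s)
    qed (use r19 in \<open>auto simp: s\<close>)
  next
    case True
    have ct: "cnt u i = Suc (cnt u (Suc i))" using cnt_over[OF i True] .
    have fM: "f < M" "f < W" "Suc f < W" using Suc.prems(9) ct sizes by linarith+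
    have kW: "Suc k < W" "Suc i < W" using sizes' sizes i by linarith+
    let ?t = "(R(23 := 0, 20 := Suc f, 18 := Suc i, 19 := k - i),
      A(2 := (A 2)(f := u), 3 := (A 3)(f := A 5 (base + i)), 5 := (A 5)(base + i := Suc f)))"
    have body: "wp up_step s (\<lambda>l es t. es = [] \<and> l \<le> 14 \<and> t = ?t)"
    proof (cases "i = 0")
      case True
      then show ?thesis using f mt(2) W fM kW by (simp add: s up_step_def lim_def)
    next
      case False
      then show ?thesis using f mt W fM kW ov \<open>over u i\<close> by (simp add: s up_step_def lim_def)
    qed
    have IH: "wp (Loop (V 19) up_step) ?t (\<lambda>l es t. es = [] \<and> l \<le> 20 * (1 + cnt u (Suc i)) \<and> fst t 20 = Suc f + cnt u (Suc i) \<and>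
      (\<forall>a. a \<notin> {2, 3, 5} \<longrightarrow> snd t a = snd ?t a) \<and> (\<forall>y. y \<notin> {18, 19, 20, 23} \<longrightarrow> fst t y = fst ?t y) \<and>
      (\<forall>j<base. snd t 2 j = snd ?t 2 j \<and> snd t 3 j = snd ?t 3 j \<and> snd t 5 j = snd ?t 5 j) \<and>
      (\<forall>j\<le>k. clist (snd t 2) (snd t 3) (Suc f + cnt u (Suc i)) (snd t 5 (base + j))
         (if Suc i \<le> j \<and> over u j then u # (L(i := u # L i)) j else (L(i := u # L i)) j)))" (is "wp _ _ ?Q'")
    proof (rule Suc.hyps(1))
      show "q = Suc k - Suc i" using Suc.hyps(2) by simp
      show "\<forall>j\<le>k. clist (snd ?t 2) (snd ?t 3) (Suc f) (snd ?t 5 (base + j)) ((L(i := u # L i)) j)"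
      proof (intro allI impI)
        fix j assume j: "j \<le> k"
        have o: "clist (A 2) (A 3) f (A 5 (base + j)) (L j)" using Suc.prems(11) j by (simp add: s)
        have "clist ((A 2)(f := u)) ((A 3)(f := A 5 (base + i))) f (A 5 (base + j)) (L j)"
          by (rule clist_cong[OF o]) simp
        then have "clist ((A 2)(f := u)) ((A 3)(f := A 5 (base + i))) (Suc f) (A 5 (base + j)) (L j)"
          by (rule clist_mono) simp
        then show "clist (snd ?t 2) (snd ?t 3) (Suc f) (snd ?t 5 (base + j)) ((L(i := u # L i)) j)"
          by (cases "j = i") auto
      qed
    qed (use Suc.prems(1-4,9,10) i ct in \<open>auto simp: s static_def frame_chain_def\<close>)
    show ?thesis
    proof (rule wp_Loop_step[OF _ _ body, where Q' = ?Q'], goal_cases)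
      case (3 t) then show ?case using IH by simp
    next
      case (4 l l' es t)
      note q = 4(2)[THEN conjunct2, THEN conjunct2, THEN conjunct2, THEN conjunct2, THEN conjunct2, THEN conjunct2]
      have cl: "clist (snd t 2) (snd t 3) (f + cnt u i) (snd t 5 (base + j)) (if i \<le> j \<and> over u j then u # L j else L j)"
        if "j \<le> k" for j
      proof (cases "j = i")
        case True
        then show ?thesis using q that ct \<open>over u i\<close> by (auto dest!: spec[of _ i])
      next
        case False
        then have "Suc i \<le> j \<longleftrightarrow> i \<le> j" by auto
        then show ?thesis using q that ct False by (auto dest!: spec[of _ j])
      qed
      show ?case using 4(1) 4(2) ct cl Suc.prems(10) by (auto simp: s)
    qed (use r19 in \<open>auto simp: s\<close>)
  qed
qed

lemma cnt_bot: "bot u d \<Longrightarrow> u \<in> P \<Longrightarrow> cnt u d \<le> 1 + deg P u"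
proof -
  assume a: "bot u d" "u \<in> P"
  have "{j. d \<le> j \<and> j \<le> k \<and> over u j} = {j. j \<le> k \<and> u \<in> B j}"
    using in_B_iff[OF a] by (auto simp: over_def)
  then show ?thesis using card_B[OF a(2)] by (simp add: cnt_def)
qed

text \<open>Since \<open>c j\<close> has height \<open>j\<close>, the search for \<open>d\<close>
  may start at the height of \<open>u\<close>. A chain element passed on the way down is not below
  \<open>u\<close> and, its height being at most that of \<open>u\<close>, not above
  \<open>u\<close> either, so each step is paid for by an incomparable pair.\<close>

lemma height_bot:
  assumes h: "hts ht pr k P" "\<forall>j. 1 \<le> j \<longrightarrow> j \<le> k \<longrightarrow> ht (c j) = j" and u: "u \<in> P" and b: "bot u d"
  shows "ht u \<le> k" "ht u < j \<Longrightarrow> j \<le> k \<Longrightarrow> (c j, u) \<notin> r" "ht u - d \<le> deg P u"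
proof -
  have hu: "ht u \<le> k" "1 \<le> ht u" using h(1) u by (auto simp: hts_def)
  then show "ht u \<le> k" by simp
  have lt: "(y, x) \<in> r \<Longrightarrow> y \<noteq> x \<Longrightarrow> x \<in> P \<Longrightarrow> y \<in> P \<Longrightarrow> ht y < ht x" for x y
    using h(1) unfolding hts_def by blast
  show "(c j, u) \<notin> r" if "ht u < j" "j \<le> k" for j
  proof
    assume "(c j, u) \<in> r"
    moreover have "ht (c j) = j" "c j \<in> P" using h(2) that ns.c_in by auto
    ultimately show False using lt[of "c j" u] u that by (cases "c j = u") auto
  qed
  have "card {d<..ht u} \<le> deg P u" unfolding deg_def
  proof (rule card_inj_on_le[of c])
    show "inj_on c {d<..ht u}" using hu by (intro inj_onI) (simp add: ns.c_inj)
    show "c ` {d<..ht u} \<subseteq> {v\<in>P. (u, v) \<notin> r \<and> (v, u) \<notin> r}"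
    proof (safe)
      fix j assume j: "j \<in> {d<..ht u}"
      then have j': "1 \<le> j" "j \<le> k" using hu by auto
      show m: "c j \<in> P" using ns.c_in j' by simp
      show "(c j, u) \<in> r \<Longrightarrow> False" using b j j' by (auto simp: bot_def)
      assume uc: "(u, c j) \<in> r"
      have "u \<noteq> c j" using b j j' ns.refl[OF u] by (auto simp: bot_def)
      then show False using lt[OF uc _ m u] h(2)[rule_format, OF j'] j by simp
    qed
    show "finite {v\<in>P. (u, v) \<notin> r \<and> (v, u) \<notin> r}" using ns.fin by simp
  qed
  then show "ht u - d \<le> deg P u" by simp
qed

lemma child_step_ok:
  assumes st: "static s" and rk: "ranked s" and p: "fst s 14 = Suc u" and u: "u \<in> P" and f: "fst s 20 = f"
    and fM: "f + (1 + deg P u) \<le> M" and bf: "base \<le> f"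
    and L: "\<forall>j\<le>k. clist (snd s 2) (snd s 3) f (snd s 5 (base + j)) (L j)"
  shows "wp child_step s (\<lambda>l es t. es = [] \<and> l \<le> 60 * (1 + deg P u) \<and> fst t 14 = snd s 19 u \<and>
    (\<forall>a. a \<notin> {2, 3, 5} \<longrightarrow> snd t a = snd s a) \<and> (\<forall>y. y \<notin> {14, 15, 18, 19, 20, 23} \<longrightarrow> fst t y = fst s y) \<and>
    (\<forall>j<base. snd t 2 j = snd s 2 j \<and> snd t 3 j = snd s 3 j \<and> snd t 5 j = snd s 5 j) \<and>
    base \<le> fst t 20 \<and> fst t 20 \<le> f + (1 + deg P u) \<and>
    (\<forall>j\<le>k. clist (snd t 2) (snd t 3) (fst t 20) (snd t 5 (base + j)) (if u \<in> B j then u # L j else L j)))"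
proof -
  obtain R A where s: "s = (R, A)" by force
  have un: "u < n" "u < M" "1 < W" using u sizes' sizes by auto
  note rk' = rk[unfolded ranked_def s fst_conv snd_conv]
  have h: "hts (A 17) (A 18) k P" "\<forall>j. 1 \<le> j \<longrightarrow> j \<le> k \<longrightarrow> A 17 (c j) = j" using rk' by blast+
  let ?s1 = "(R(15 := u, 14 := A 19 u, 18 := A 17 u, 19 := A 17 u), A)"
  have pre: "wp child_pre s (\<lambda>l es t. es = [] \<and> l \<le> 4 \<and> t = ?s1)"
    using p un by (simp add: s child_pre_def lim_def)
  have stc: "static ?s1" "frame_chain ?s1" using st rk by (auto simp: s static_def ranked_def frame_chain_def)
  obtain d0 where "d0 \<le> k" "1 \<le> d0 \<Longrightarrow> (c d0, u) \<in> r" "\<And>j. d0 < j \<Longrightarrow> j \<le> k \<Longrightarrow> (c j, u) \<notin> r"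
    by (rule ns.cut[of "{v. (v, u) \<in> r}", unfolded mem_Collect_eq]) blast
  then have d0: "bot u d0" by (simp add: bot_def)
  note hb = height_bot[OF h u]
  have down: "wp (Loop (V 19) down_step) ?s1 (\<lambda>l es t. es = [] \<and> snd t = snd ?s1 \<and>
    (\<forall>y. y \<notin> {18, 19} \<longrightarrow> fst t y = fst ?s1 y) \<and> bot u (fst t 18) \<and> fst t 18 \<le> A 17 u \<and>
    l \<le> 10 * (A 17 u - fst t 18) + 10)"
    by (rule down_ok) (use stc u hb(1,2)[OF d0] in auto)
  have down': "wp (Loop (V 19) down_step) ?s1 (\<lambda>l es t. es = [] \<and> l \<le> 10 * deg P u + 10 \<and> (snd t = A \<and>
    (\<forall>y. y \<notin> {18, 19} \<longrightarrow> fst t y = fst ?s1 y) \<and> bot u (fst t 18)))"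
    by (rule wp_mono[OF down]) (use hb(3) in force)
  let ?Q = "\<lambda>m l es t. es = [] \<and> l \<le> m \<and> fst t 14 = A 19 u \<and>
    (\<forall>a. a \<notin> {2, 3, 5} \<longrightarrow> snd t a = A a) \<and> (\<forall>y. y \<notin> {14, 15, 18, 19, 20, 23} \<longrightarrow> fst t y = R y) \<and>
    (\<forall>j<base. snd t 2 j = A 2 j \<and> snd t 3 j = A 3 j \<and> snd t 5 j = A 5 j) \<and>
    base \<le> fst t 20 \<and> fst t 20 \<le> f + (1 + deg P u) \<and>
    (\<forall>j\<le>k. clist (snd t 2) (snd t 3) (fst t 20) (snd t 5 (base + j)) (if u \<in> B j then u # L j else L j))"
  have up: "wp (Assign 19 (N 1) ;; Loop (V 19) up_step) t (?Q (1 + 20 * (2 + deg P u)))"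
    if t: "snd t = A \<and> (\<forall>y. y \<notin> {18, 19} \<longrightarrow> fst t y = fst ?s1 y) \<and> bot u (fst t 18)" for t
  proof -
    obtain d where d: "fst t 18 = d" by blast
    have bd: "bot u d" using t d by simp
    have dk: "d \<le> k" using bd by (simp add: bot_def)
    note ct = cnt_bot[OF bd u]
    have eq: "snd t = A" "\<And>y. y \<notin> {18, 19} \<Longrightarrow> fst t y = fst ?s1 y" using t by auto
    let ?t = "((fst t)(19 := 1), snd t)"
    have loop: "wp (Loop (V 19) up_step) ?t (\<lambda>l es t'. es = [] \<and> l \<le> 20 * (1 + cnt u d) \<and> fst t' 20 = f + cnt u d \<and>
    (\<forall>a. a \<notin> {2, 3, 5} \<longrightarrow> snd t' a = snd ?t a) \<and> (\<forall>y. y \<notin> {18, 19, 20, 23} \<longrightarrow> fst t' y = fst ?t y) \<and>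
    (\<forall>j<base. snd t' 2 j = snd ?t 2 j \<and> snd t' 3 j = snd ?t 3 j \<and> snd t' 5 j = snd ?t 5 j) \<and>
    (\<forall>j\<le>k. clist (snd t' 2) (snd t' 3) (f + cnt u d) (snd t' 5 (base + j)) (if d \<le> j \<and> over u j then u # L j else L j)))"
    proof (rule up_ok)
      show "static ?t" "frame_chain ?t" using stc eq by (auto simp: static_def frame_chain_def)
    qed (use u d dk eq f fM ct bf L s in auto)
    have mB: "(d \<le> j \<and> over u j) = (u \<in> B j)" if "j \<le> k" for j using in_B_iff[OF bd u that] by (auto simp: over_def)
    have ct': "cnt u d \<le> Suc (deg P u)" using ct by simp
    have "wp (Loop (V 19) up_step) ?t (\<lambda>l es. ?Q (1 + 20 * (2 + deg P u)) (Suc l) es)"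
    proof (rule wp_mono[OF loop], elim conjE, goal_cases)
      case (1 l es t')
      show ?case
      proof (intro conjI)
        show "Suc l \<le> 1 + 20 * (2 + deg P u)" using 1(2) ct' by simp
        show "\<forall>j\<le>k. clist (snd t' 2) (snd t' 3) (fst t' 20) (snd t' 5 (base + j)) (if u \<in> B j then u # L j else L j)"
          using 1(3,7) mB by simp
      qed (use 1(1,3-6) eq ct' bf in auto)
    qed
    then show ?thesis unfolding wp_Assign_Seq ev.simps using un by simp
  qed
  show ?thesis unfolding child_step_def
  proof (rule wp_Seq_silent[OF pre, where Q' = "?Q (60 * (1 + deg P u) - 4)"], goal_cases)
    case (1 t)
    then have t: "t = ?s1" .
    show ?case unfolding t
    proof (rule wp_Seq_silent[OF down' up], assumption, goal_cases)
      case (1 l l' es t)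
      then show ?case by auto
    qed
  next
    case (2 l l' es t)
    then show ?case by (auto simp: s)
  qed
qed

lemma children_loop_ok:
  assumes "static s" "ranked s" "ilist (snd s 19) (fst s 14) zs" "set zs \<subseteq> P" "fst s 20 = f" "base \<le> f"
    "f + sum_list (map (\<lambda>u. 1 + deg P u) zs) \<le> base + wd"
    "\<forall>j\<le>k. clist (snd s 2) (snd s 3) f (snd s 5 (base + j)) (L j)"
  shows "wp (Loop (V 14) child_step) s (\<lambda>l es t. es = [] \<and> l \<le> 1 + 62 * sum_list (map (\<lambda>u. 1 + deg P u) zs) \<and> static t \<and>
    (\<forall>a. a \<notin> {2, 3, 5} \<longrightarrow> snd t a = snd s a) \<and> (\<forall>y. y \<notin> {14, 15, 18, 19, 20, 23} \<longrightarrow> fst t y = fst s y) \<and>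
    (\<forall>j<base. snd t 2 j = snd s 2 j \<and> snd t 3 j = snd s 3 j \<and> snd t 5 j = snd s 5 j) \<and>
    (\<forall>j\<le>k. clist (snd t 2) (snd t 3) (base + wd) (snd t 5 (base + j)) (filter (\<lambda>u. u \<in> B j) (rev zs) @ L j)))"
  using assms
proof (induction zs arbitrary: s f L)
  case Nil
  have "clist (snd s 2) (snd s 3) (base + wd) (snd s 5 (base + j)) (L j)" if "j \<le> k" for j
    by (rule clist_mono[of _ _ f]) (use Nil.prems(7,8) that in auto)
  then show ?case using Nil.prems by (subst wp_Loop) auto
next
  case (Cons u zs)
  have p: "fst s 14 = Suc u" "ilist (snd s 19) (snd s 19 u) zs" using Cons.prems(3) by auto
  have fM: "f + (1 + deg P u) \<le> M" using Cons.prems(7) base by simp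
  note cs = child_step_ok[OF Cons.prems(1,2) p(1) _ Cons.prems(5) fM Cons.prems(6,8)]
  let ?S = "sum_list (map (\<lambda>u. 1 + deg P u) zs)"
  let ?L = "\<lambda>j. if u \<in> B j then u # L j else L j"
  let ?P = "\<lambda>t. fst t 14 = snd s 19 u \<and>
    (\<forall>a. a \<notin> {2, 3, 5} \<longrightarrow> snd t a = snd s a) \<and> (\<forall>y. y \<notin> {14, 15, 18, 19, 20, 23} \<longrightarrow> fst t y = fst s y) \<and>
    (\<forall>j<base. snd t 2 j = snd s 2 j \<and> snd t 3 j = snd s 3 j \<and> snd t 5 j = snd s 5 j) \<and>
    base \<le> fst t 20 \<and> fst t 20 \<le> f + (1 + deg P u) \<and>
    (\<forall>j\<le>k. clist (snd t 2) (snd t 3) (fst t 20) (snd t 5 (base + j)) (?L j))"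
  let ?Q' = "\<lambda>l es t. es = [] \<and> l \<le> 1 + 62 * ?S \<and> static t \<and>
    (\<forall>a. a \<notin> {2, 3, 5} \<longrightarrow> snd t a = snd s a) \<and> (\<forall>y. y \<notin> {14, 15, 18, 19, 20, 23} \<longrightarrow> fst t y = fst s y) \<and>
    (\<forall>j<base. snd t 2 j = snd s 2 j \<and> snd t 3 j = snd s 3 j \<and> snd t 5 j = snd s 5 j) \<and>
    (\<forall>j\<le>k. clist (snd t 2) (snd t 3) (base + wd) (snd t 5 (base + j)) (filter (\<lambda>u. u \<in> B j) (rev zs) @ ?L j))"
  show ?case
  proof (rule wp_Loop_step[where P = ?P and Q' = ?Q' and k = "60 * (1 + deg P u)"], goal_cases)
    case 3
    show ?case using cs Cons.prems(4) by simp
  next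
    case (4 t)
    then show ?case
    proof (elim conjE, goal_cases)
      case 1
      have "static t" by (rule static_upd[OF Cons.prems(1)]) (use 1(2,3) Cons.prems(1) in \<open>auto simp: static_def\<close>)
      moreover have "ranked t" using Cons.prems(2) 1(2,3) by (simp add: ranked_def frame_chain_def)
      ultimately have "wp (Loop (V 14) child_step) t (\<lambda>l es t'. es = [] \<and> l \<le> 1 + 62 * ?S \<and> static t' \<and>
    (\<forall>a. a \<notin> {2, 3, 5} \<longrightarrow> snd t' a = snd t a) \<and> (\<forall>y. y \<notin> {14, 15, 18, 19, 20, 23} \<longrightarrow> fst t' y = fst t y) \<and>
    (\<forall>j<base. snd t' 2 j = snd t 2 j \<and> snd t' 3 j = snd t 3 j \<and> snd t' 5 j = snd t 5 j) \<and>
    (\<forall>j\<le>k. clist (snd t' 2) (snd t' 3) (base + wd) (snd t' 5 (base + j)) (filter (\<lambda>u. u \<in> B j) (rev zs) @ ?L j)))"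
        by (rule Cons.IH) (use 1 p(2) Cons.prems(4,7) in auto)
      then show ?case
        by (rule wp_mono) (use 1(2-4) in simp)
    qed
  next
    case (5 l l' es t)
    have e: "filter (\<lambda>u. u \<in> B j) (rev (u # zs)) @ L j = filter (\<lambda>u. u \<in> B j) (rev zs) @ ?L j" for j by simp
    show ?case unfolding e using 5 by (elim conjE) (intro conjI, (assumption | simp)+)
  qed (use p in auto)
qed

text \<open>The elements come from the reversed list left by the heights, in decreasing order of
  labels. Prepending therefore yields increasing lists for the blocks, as required of the input of a
  call.\<close>

lemma children_ok:
  assumes "static s" "ranked s" "ilist (snd s 19) (fst s 21) (rev xs)" "set xs = P" "distinct xs"
    "\<forall>j\<le>k. snd s 5 (base + j) = 0"
  shows "wp children_code s (\<lambda>l es t. es = [] \<and> l \<le> 3 + 62 * (card P + card (incomparable r P)) \<and> static t \<and>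
    (\<forall>a. a \<notin> {2, 3, 5} \<longrightarrow> snd t a = snd s a) \<and> (\<forall>y. y \<notin> {14, 15, 18, 19, 20, 23} \<longrightarrow> fst t y = fst s y) \<and>
    (\<forall>j<base. snd t 2 j = snd s 2 j \<and> snd t 3 j = snd s 3 j \<and> snd t 5 j = snd s 5 j) \<and>
    (\<forall>j\<le>k. clist (snd t 2) (snd t 3) (base + wd) (snd t 5 (base + j)) (filter (\<lambda>u. u \<in> B j) xs)))"
proof -
  have "sum_list (map (\<lambda>u. 1 + deg P u) (rev xs)) = (\<Sum>u\<in>P. 1 + deg P u)"
    using sum_list_distinct_conv_sum_set[of "rev xs" "\<lambda>u. 1 + deg P u"] assms(4,5) by simp
  also have "\<dots> = card P + card (incomparable r P)" unfolding sum.distrib sum_deg[OF ns.fin] by simp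
  finally have S: "sum_list (map (\<lambda>u. 1 + deg P u) (rev xs)) = card P + card (incomparable r P)" .
  have b: "fst s 10 = base" using assms(2) by (simp add: ranked_def frame_chain_def)
  let ?s = "((fst s)(14 := fst s 21, 20 := base), snd s)"
  have "wp (Loop (V 14) child_step) ?s (\<lambda>l es t. es = [] \<and> l \<le> 1 + 62 * sum_list (map (\<lambda>u. 1 + deg P u) (rev xs)) \<and> static t \<and>
    (\<forall>a. a \<notin> {2, 3, 5} \<longrightarrow> snd t a = snd ?s a) \<and> (\<forall>y. y \<notin> {14, 15, 18, 19, 20, 23} \<longrightarrow> fst t y = fst ?s y) \<and>
    (\<forall>j<base. snd t 2 j = snd ?s 2 j \<and> snd t 3 j = snd ?s 3 j \<and> snd t 5 j = snd ?s 5 j) \<and>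
    (\<forall>j\<le>k. clist (snd t 2) (snd t 3) (base + wd) (snd t 5 (base + j)) (filter (\<lambda>u. u \<in> B j) (rev (rev xs)) @ (\<lambda>j. []) j)))"
    by (rule children_loop_ok)
      (use assms S sizes'(5) in \<open>auto simp: static_def ranked_def frame_chain_def\<close>)
  then have "wp (Loop (V 14) child_step) ?s (\<lambda>l es t. es = [] \<and> Suc (Suc l) \<le> 3 + 62 * (card P + card (incomparable r P)) \<and> static t \<and>
    (\<forall>a. a \<notin> {2, 3, 5} \<longrightarrow> snd t a = snd s a) \<and> (\<forall>y. y \<notin> {14, 15, 18, 19, 20, 23} \<longrightarrow> fst t y = fst s y) \<and>
    (\<forall>j<base. snd t 2 j = snd s 2 j \<and> snd t 3 j = snd s 3 j \<and> snd t 5 j = snd s 5 j) \<and>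
    (\<forall>j\<le>k. clist (snd t 2) (snd t 3) (base + wd) (snd t 5 (base + j)) (filter (\<lambda>u. u \<in> B j) xs)))"
    unfolding S by (rule wp_mono) simp
  then show ?thesis unfolding children_code_def wp_Assign_Seq using b by simp
qed

end

section \<open>The traversal program: moving along the chain\<close>

text \<open>For a reversed order the chain and the blocks are indexed backwards, \<open>ix\<close> translates.\<close>

definition ix :: "exp \<Rightarrow> exp" where
  "ix j = Plus (Times (V 5) (Minus (Plus (V 22) (N 1)) j)) (Times (Minus (N 1) (V 5)) j)"

definition celem :: "exp \<Rightarrow> exp" where
  "celem j = At 4 (Plus (V 10) (ix j))"

text \<open>The minimum of the old and the new position, by truncated subtraction.\<close>

definition least :: exp where
  "least = Minus (V 26) (Minus (V 26) (V 24))"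

definition nxt_code :: com where
  "nxt_code = Cond (V 25) (Assign 26 (Minus (V 24) (N 2)) ;; Assign 27 (N 1))
     (Cond (Minus (V 28) (V 24)) (Assign 26 (Plus (V 24) (N 1)) ;; Assign 27 (N 0))
       (Cond (Minus (V 22) (V 24)) (Assign 26 (Plus (V 24) (N 2)) ;; Assign 27 (N 0))
         (Assign 26 (Minus (Plus (Plus (V 22) (V 22)) (N 1)) (V 24)) ;; Assign 27 (N 1))))"

definition togs_code :: com where
  "togs_code = Cond least (Emt (Plus (celem least) (N 1))) Skip ;;
     Cond (Minus (Plus (Minus (V 24) (V 26)) (Minus (V 26) (V 24))) (N 1))
       (Emt (Plus (celem (Plus least (N 1))) (N 1))) Skip"

text \<open>It vanishes exactly when the tour is on its way down and has reached position
  \<open>b + 1\<close>; on the way down \<open>p\<close> is never smaller.\<close>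

definition more :: exp where
  "more = Plus (Minus (N 1) (V 25)) (Minus (V 24) (Plus (V 28) (N 1)))"

text \<open>The move after the coming block is computed ahead, since it determines the last ideal of
  that block. The kind is stored with respect to \<open>r\<close>, hence the exclusive or with the
  orientation in variable 5; the final block inherits the description of its parent.\<close>

definition exit_code :: com where
  "exit_code = Cond more
     (nxt_code ;; Assign 7 (Plus (Times (V 27) (Minus (N 1) (V 5))) (Times (Minus (N 1) (V 27)) (V 5))) ;;
       Cond (V 27) (Assign 8 (celem least)) (Assign 8 (celem (Minus (V 26) (N 1)))))
     (Assign 7 (At 10 (V 10)) ;; Assign 8 (At 11 (V 10)))"

text \<open>Position \<open>p\<close> is block \<open>p - 1\<close>. In the reversed order this is
  block \<open>k - (p - 1)\<close>, which equals the translated index \<open>k + 1 - p\<close>, so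
  the subtraction of 1 applies to the forward order only.\<close>

definition child_code :: com where
  "child_code = Assign 9 (At 5 (Plus (V 10) (Minus (ix (V 24)) (Minus (N 1) (V 5))))) ;; Assign 6 (V 25) ;;
     Assign 5 (Plus (Times (V 25) (Minus (N 1) (V 5))) (Times (Minus (N 1) (V 25)) (V 5))) ;;
     Assign 10 (Plus (V 10) (V 3)) ;; Assign 11 (N 1)"

definition return_code :: com where
  "return_code = Assign 10 (Minus (V 10) (V 3)) ;; Assign 11 (N 0)"

definition load_code :: com where
  "load_code = Assign 22 (At 6 (V 10)) ;; Assign 28 (At 7 (V 10)) ;; Assign 5 (At 9 (V 10)) ;;
     Assign 24 (At 12 (V 10)) ;; Assign 25 (At 13 (V 10))"

definition descend_code :: com where
  "descend_code = nxt_code ;; togs_code ;; Write 12 (V 10) (V 26) ;; Write 13 (V 10) (V 27) ;;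
     Assign 24 (V 26) ;; Assign 25 (V 27) ;; exit_code ;; child_code"

definition finish_code :: com where
  "finish_code = Cond (At 8 (V 10)) (Emt (At 8 (V 10))) Skip ;; return_code"

definition adv_code :: com where
  "adv_code = load_code ;; Cond more descend_code finish_code"

text \<open>\<open>b\<close> is found by walking up the chain as long as its elements are in
  \<open>Jst\<close>. Membership in \<open>J\<close> is one matrix entry, negated according to the
  kind and once more according to the orientation. If \<open>c 1\<close> is missing and
  \<open>m\<close> does not hold, it is counted nevertheless and recorded as the final
  toggle.\<close>

definition setup_code :: com where
  "setup_code = Assign 28 (N 0) ;; Assign 29 (N 0) ;; Assign 19 (N 1) ;;
     Loop (V 19) (Assign 23 (celem (Plus (V 28) (N 1))) ;;
       Cond (V 7) (Assign 24 (Minus (N 1) (At 0 (Plus (Times (V 8) (V 0)) (V 23)))))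
         (Assign 24 (At 0 (Plus (Times (V 23) (V 0)) (V 8)))) ;;
       Assign 24 (Plus (Times (V 5) (Minus (N 1) (V 24))) (Times (Minus (N 1) (V 5)) (V 24))) ;;
       Cond (V 24) Skip (Cond (Plus (V 6) (V 28)) Skip (Assign 24 (N 1) ;; Assign 29 (Plus (V 23) (N 1)))) ;;
       Cond (V 24) (Assign 28 (Plus (V 28) (N 1)) ;; Assign 19 (Minus (V 22) (V 28))) (Assign 19 (N 0))) ;;
     Write 6 (V 10) (V 22) ;; Write 7 (V 10) (V 28) ;; Write 8 (V 10) (V 29) ;; Write 9 (V 10) (V 5) ;;
     Write 10 (V 10) (V 7) ;; Write 11 (V 10) (V 8) ;; Write 12 (V 10) (N 0) ;; Write 13 (V 10) (N 0) ;;
     Assign 11 (N 0)"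

definition new_code :: com where
  "new_code = Cond (V 9) (heights ;; chain_code ;; children_code ;; setup_code) (Emt (N 0) ;; return_code)"

definition main_code :: com where
  "main_code = Loop (V 10) (Cond (V 11) new_code adv_code)"

lemma pure_main: "pure main_code"
  by (simp add: main_code_def new_code_def adv_code_def setup_code_def load_code_def descend_code_def finish_code_def
    return_code_def child_code_def exit_code_def togs_code_def nxt_code_def more_def least_def celem_def ix_def
    children_code_def child_step_def child_pre_def down_step_def up_step_def chain_code_def chain_step_def
    heights_def height_step_def height_pre_def height_post_def scan_def)

definition bit :: "bool \<Rightarrow> nat" where
  "bit d = (if d then 1 else 0)"

text \<open>The prescribed last ideal \<open>J\<close> of a call is not stored but described by an element \<open>x\<close> of a chain of an
  ancestor; \<open>dir\<close> holds for a call in the dual order.\<close>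

definition Jof :: "(nat \<times> nat) set \<Rightarrow> bool \<Rightarrow> bool \<Rightarrow> nat \<Rightarrow> nat set \<Rightarrow> nat set" where
  "Jof r dir kind x P = {u \<in> P. dir \<noteq> (if kind then (x, u) \<notin> r else (u, x) \<in> r)}"

abbreviation turn :: "bool \<Rightarrow> (nat \<times> nat) set \<Rightarrow> (nat \<times> nat) set" where
  "turn dir r \<equiv> (if dir then r\<inverse> else r)"

lemma Jof_ideal:
  assumes "partial_order_on E r" "P \<subseteq> E"
  shows "Jof r dir kind x P \<in> order_ideals (turn dir r) P"
  using partial_orderD(2)[OF assms(1)] by (auto simp: Jof_def order_ideals_def split: if_splits)

context producer
begin

text \<open>The stack discipline: a call at base \<open>d\<close> leaves the index range below
  \<open>d\<close> alone, where the frames of its ancestors and the list of its own elements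
  live.\<close>

definition keep :: "nat \<Rightarrow> state \<Rightarrow> state \<Rightarrow> bool" where
  "keep d s t \<longleftrightarrow> (\<forall>a j. 2 \<le> a \<longrightarrow> a \<le> 13 \<longrightarrow> j < d \<longrightarrow> snd t a j = snd s a j)"

lemma keep_trans: "keep d s t \<Longrightarrow> keep d' t u \<Longrightarrow> d \<le> d' \<Longrightarrow> keep d s u"
  by (simp add: keep_def)

text \<open>The calling convention. The argument list lies below \<open>d\<close>, in the frame of
  the caller.\<close>

definition entry :: "nat \<Rightarrow> bool \<Rightarrow> bool \<Rightarrow> bool \<Rightarrow> nat \<Rightarrow> nat list \<Rightarrow> state \<Rightarrow> bool" where
  "entry d dir m kind x ys t \<longleftrightarrow> fst t 11 = 1 \<and> fst t 10 = d \<and> fst t 5 = bit dir \<and> fst t 6 = bit m \<and>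
     fst t 7 = bit kind \<and> fst t 8 = x \<and> (ys = [] \<or> x < n) \<and> static t \<and> clist (snd t 2) (snd t 3) d (fst t 9) ys"

end

text \<open>The chain \<open>ds\<close> and its blocks are stored with respect to \<open>r\<close>
  in either orientation; the tour of a dual call runs along \<open>rev ds\<close>.\<close>

locale node = producer_node n M W r wd P ds base + tr: tour "turn dir r" "{..<n}" P "if dir then rev ds else ds" J Jst b m K Y
  for n M W r wd P ds base dir J Jst b m K Y +
  fixes kind :: bool and x :: nat
  assumes x_less: "x < n" and J_def: "J = Jof r dir kind x P"
begin

definition link :: "state \<Rightarrow> bool" where
  "link s \<longleftrightarrow> fst s 10 = base \<and> fst s 22 = k \<and> fst s 5 = bit dir \<and> (\<forall>j. 1 \<le> j \<longrightarrow> j \<le> k \<longrightarrow> snd s 4 (base + j) = ds ! (j - 1))"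

lemma len [simp]: "length (if dir then rev ds else ds) = k"
  by simp

lemma c_real: "1 \<le> j \<Longrightarrow> j \<le> k \<Longrightarrow> tr.c j = ds ! ((if dir then k + 1 - j else j) - 1)"
  by (auto simp: rev_nth)

lemma c_n: "1 \<le> j \<Longrightarrow> j \<le> k \<Longrightarrow> tr.c j < n"
  using tr.c_in[of j] sizes'(1) by auto

lemma B_real: "j \<le> k \<Longrightarrow> tr.B j = B (if dir then k - j else j)"
  by (simp add: sub_poset_rev)

lemma big_W: "base + k < M" "n + 3 * k + 10 < W" "base < M" "base + k + 10 < W" "base + wd < W"
proof -
  show a: "base + k < M" "base < M" using base sizes'(4) by linarith+
  have "k \<le> n" using sizes'(2,3) by linarith
  moreover have "n \<le> M" using sizes(5) by simp
  ultimately show "n + 3 * k + 10 < W" using wide by linarith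
  show "base + k + 10 < W" "base + wd < W" using a base wide by linarith+
qed

lemma ix_ev:
  assumes "link s" "eok e s" "ev e s \<le> Suc k"
  shows "ev (ix e) s = (if dir then k + 1 - ev e s else ev e s)" "eok (ix e) s"
  using assms big_W by (auto simp: link_def ix_def bit_def)

lemma celem_ev:
  assumes "link s" "eok e s" "1 \<le> ev e s" "ev e s \<le> k"
  shows "ev (celem e) s = tr.c (ev e s)" "eok (celem e) s"
proof -
  have i: "1 \<le> ev (ix e) s \<and> ev (ix e) s \<le> k" using ix_ev[OF assms(1,2)] assms(3,4) by auto
  have cell: "snd s 4 (base + ev (ix e) s) = ds ! (ev (ix e) s - 1)" using assms(1) i unfolding link_def by blast
  have s10: "fst s 10 = base" using assms(1) by (simp add: link_def)
  show "ev (celem e) s = tr.c (ev e s)"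
    using cell s10 ix_ev(1)[OF assms(1,2)] assms(3,4) c_real[OF assms(3,4)] by (simp add: celem_def)
  show "eok (celem e) s" using ix_ev(2)[OF assms(1,2)] assms(4) i s10 big_W by (simp add: celem_def lim_def)
qed

lemma nxt_ok:
  assumes "link s" "fst s 24 = p" "fst s 25 = bit d" "fst s 28 = b" "p \<le> k + 1" "nxt b k (p, d) = (p2, d2)"
  shows "wp nxt_code s (\<lambda>l es t. es = [] \<and> l \<le> 8 \<and> t = ((fst s)(26 := p2, 27 := bit d2), snd s))"
proof -
  have W: "p + 2 < W" "k + k + 1 < W" "k + k < W" "1 < W" "0 < W" "2 < W" using big_W assms(5) by linarith+
  have "fst s 22 = k" using assms(1) by (simp add: link_def)
  then show ?thesis using assms(2-) W unfolding nxt_code_def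
    by (cases d) (auto simp: bit_def mult_2 split: if_splits)
qed

lemma least_ev: "fst s 24 = p \<Longrightarrow> fst s 26 = p2 \<Longrightarrow> ev least s = min p p2" "eok least s"
  by (auto simp: least_def min_def)

lemma togs_near:
  assumes "tr.valid p d" "\<not> (d \<and> p = b + 1)" "nxt b k (p, d) = (p2, d2)"
  shows "p \<le> k + 1" "p2 \<le> k + 1" "max p p2 \<le> min p p2 + 2" "p \<noteq> p2" "min p p2 \<le> k" "min p p2 + 2 = max p p2 \<Longrightarrow> min p p2 + 1 \<le> k"
proof -
  have n: "nxt b (length (if dir then rev ds else ds)) (p, d) = (p2, d2)" using assms(3) by simp
  note v = tr.valid_nxt(1,2,3)[OF assms(1,2) n]
  have p: "p \<le> k + 1" using assms(1) by (auto simp: tr.valid_def)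
  have cs: "p2 = p + 1 \<or> p2 = p + 2 \<or> p = k \<and> p2 = k + 1 \<or> p = k + 1 \<and> p2 = k \<or> p2 = p - 2 \<and> 2 \<le> p"
  proof (cases d)
    case True
    then have "b < p" "odd (p + b)" "p \<noteq> b + 1" "p2 = p - 2" using assms by (auto simp: tr.valid_def)
    then show ?thesis by presburger
  next
    case False
    then show ?thesis using assms(3) p by (simp split: if_splits) linarith
  qed
  have near: "max p p2 \<le> min p p2 + 2" "p \<noteq> p2" using cs by (elim disjE; linarith)+
  have mk: "min p p2 \<le> k" "min p p2 + 2 = max p p2 \<Longrightarrow> min p p2 + 1 \<le> k" using near p v(3) by (auto simp: min_def max_def split: if_splits)
  show "p \<le> k + 1" "p2 \<le> k + 1" "max p p2 \<le> min p p2 + 2" "p \<noteq> p2" using p v(3) near by simp_all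
  show "min p p2 \<le> k" "min p p2 + 2 = max p p2 \<Longrightarrow> min p p2 + 1 \<le> k" using mk by simp_all
qed

lemma togs_ok:
  assumes "link s" "fst s 24 = p" "fst s 26 = p2" "tr.valid p d" "\<not> (d \<and> p = b + 1)" "nxt b k (p, d) = (p2, d2)"
  shows "wp togs_code s (\<lambda>l es t. es = map Suc (tr.togs p p2) \<and> l \<le> 6 \<and> t = s)"
proof -
  note near = togs_near(1-4)[OF assms(4-6)] and mk = togs_near(5,6)[OF assms(4-6)]
  let ?m = "min p p2"
  have e: "ev least s = ?m" "eok least s" using least_ev assms(2,3) by auto
  have e1: "ev (celem least) s = tr.c ?m \<and> eok (celem least) s \<and> tr.c ?m + 1 < W" if "?m \<noteq> 0"
    using celem_ev[OF assms(1) e(2)] c_n[of ?m] mk(1) that big_W by (simp add: e(1))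
  have m1: "eok (Plus least (N 1)) s" "ev (Plus least (N 1)) s = ?m + 1" using e mk(1) big_W by auto
  have e2: "ev (celem (Plus least (N 1))) s = tr.c (?m + 1) \<and> eok (celem (Plus least (N 1))) s \<and> tr.c (?m + 1) + 1 < W"
    if "?m + 2 = max p p2"
    using celem_ev[OF assms(1) m1(1)] c_n[of "?m + 1"] mk(2)[OF that] that big_W unfolding m1(2) by simp
  have diff: "p - p2 + (p2 - p) - Suc 0 \<noteq> 0 \<longleftrightarrow> ?m + 2 = max p p2" "p - p2 + (p2 - p) < W"
    using near big_W by (auto simp: min_def max_def)
  have w: "1 < W" using big_W by linarith
  have t1: "wp (Cond least (Emt (Plus (celem least) (N 1))) Skip) s
    (\<lambda>l es t. es = map Suc (if ?m = 0 then [] else [tr.c ?m]) \<and> l \<le> 3 \<and> t = s)"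
    using e e1 w by (cases "?m = 0") simp_all
  have t2: "wp (Cond (Minus (Plus (Minus (V 24) (V 26)) (Minus (V 26) (V 24))) (N 1))
       (Emt (Plus (celem (Plus least (N 1))) (N 1))) Skip) s
    (\<lambda>l es t. es = map Suc (if ?m + 2 = max p p2 then [tr.c (?m + 1)] else []) \<and> l \<le> 3 \<and> t = s)"
  proof (cases "?m + 2 = max p p2")
    case True
    note e2[OF this]
    then show ?thesis using True diff w assms(2,3) by simp
  next
    case False
    then show ?thesis using diff w assms(2,3) by simp
  qed
  show ?thesis unfolding togs_code_def wp_simps(5)
    by (rule wp_mono[OF t1], elim conjE, hypsubst, rule wp_mono[OF t2]) (auto simp: tr.togs_def)
qed

definition frame :: "nat list \<Rightarrow> nat \<Rightarrow> nat \<Rightarrow> bool \<Rightarrow> state \<Rightarrow> bool" where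
  "frame xs post p d s \<longleftrightarrow> static s \<and> snd s 6 base = k \<and> snd s 7 base = b \<and> snd s 8 base = post \<and>
     snd s 9 base = bit dir \<and> snd s 10 base = bit kind \<and> snd s 11 base = x \<and> snd s 12 base = p \<and>
     snd s 13 base = bit d \<and> (\<forall>j. 1 \<le> j \<longrightarrow> j \<le> k \<longrightarrow> snd s 4 (base + j) = ds ! (j - 1)) \<and>
     (\<forall>j\<le>k. clist (snd s 2) (snd s 3) (base + wd) (snd s 5 (base + j)) (filter (\<lambda>u. u \<in> B j) xs))"

lemma frame_keep:
  assumes f: "frame xs post p d s" and kp: "keep (base + wd) s t" and st: "static t"
  shows "frame xs post p d t"
proof -
  have kw: "k < wd" by (rule sizes'(4))
  have same: "snd t a (base + j) = snd s a (base + j)" if "2 \<le> a" "a \<le> 13" "j \<le> k" for a j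
    using kp that kw by (simp add: keep_def)
  have cl: "clist (snd t 2) (snd t 3) (base + wd) q ys" if "clist (snd s 2) (snd s 3) (base + wd) q ys" for q ys
    using clist_cong[OF that, of "snd t 2" "snd t 3"] kp by (simp add: keep_def)
  have same0: "snd t a base = snd s a base" if "2 \<le> a" "a \<le> 13" for a
    using same[OF that, of 0] by simp
  show ?thesis
    using f st cl by (simp add: frame_def same same0)
qed

text \<open>The last ideal of the final block is the restriction of \<open>J\<close>, so the
  parent's description remains valid; the complement is absorbed by the change of orientation.
  \<open>Jst\<close> and \<open>J\<close> differ at most in \<open>c 1\<close>, which is in no
  block.\<close>

lemma exit_done: "Jof r (dir \<noteq> True) kind x (tr.B b) = tr.B b - tr.exit (b + 1) True"
proof -
  have "tr.c 1 \<notin> tr.B b" using tr.B_C[OF tr.b_le] tr.c_mem[of 1] tr.k_pos by auto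
  moreover have "tr.B b \<subseteq> P" by (rule tr.B_sub)
  moreover have "tr.exit (b + 1) True = tr.B b \<inter> Jst" unfolding tr.exit_def by simp
  moreover have "Jof r (dir \<noteq> True) kind x Q = Q - Q \<inter> Jst" if "tr.c 1 \<notin> Q" "Q \<subseteq> P" for Q
  proof -
    have "Q \<inter> Jst = Q \<inter> J" using that(1) unfolding tr.Jst by auto
    then show ?thesis using that(2) unfolding J_def Jof_def by auto
  qed
  ultimately show ?thesis by simp
qed

text \<open>Dualising replaces an ideal by its complement and exchanges the two kinds of cuts. Both
  effects are exclusive ors, and a finite case distinction on the three bits shows that the stored
  bits agree.\<close>

lemma exit_nxt:
  assumes "\<not> (d2 \<and> p2 = b + 1)" "nxt b k (p2, d2) = (p3, d3)"
  shows "Jof r (dir \<noteq> d2) (d3 \<noteq> dir) (if d3 then tr.c (min p2 p3) else tr.c (p3 - 1)) (tr.B (p2 - 1)) =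
    (if d2 then tr.B (p2 - 1) - tr.exit p2 d2 else tr.exit p2 d2)"
proof -
  have "d3" if "d2" using assms(2) that by auto
  moreover have "tr.exit p2 d2 = (if d3 then {u \<in> tr.B (p2 - 1). (tr.c (min p2 p3), u) \<notin> turn dir r}
     else {u \<in> tr.B (p2 - 1). (u, tr.c (p3 - 1)) \<in> turn dir r})"
    unfolding tr.exit_def len assms(2) fst_conv snd_conv using assms(1) by (simp only: if_False)
  ultimately show ?thesis unfolding Jof_def by (cases dir; cases d2; cases d3) (simp_all, blast+)
qed

lemma more_ok:
  assumes "fst s 24 = p" "fst s 25 = bit d" "fst s 28 = b" "p \<le> k + 1"
  shows "eok more s" "d \<longrightarrow> b < p \<Longrightarrow> ev more s \<noteq> 0 \<longleftrightarrow> \<not> (d \<and> p = b + 1)"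
  using assms big_W tr.b_le by (auto simp: more_def bit_def)

lemma exit_ok:
  assumes l: "link s" and r: "fst s 24 = p2" "fst s 25 = bit d2" "fst s 28 = b"
    and mem: "snd s 10 base = bit kind" "snd s 11 base = x" and v: "tr.valid p2 d2" "1 \<le> p2"
  shows "wp exit_code s (\<lambda>l es t. es = [] \<and> l \<le> 16 \<and> snd t = snd s \<and>
    (\<forall>y. y \<notin> {7, 8, 26, 27} \<longrightarrow> fst t y = fst s y) \<and> (\<exists>kind' x'. fst t 7 = bit kind' \<and> fst t 8 = x' \<and> x' < n \<and>
      Jof r (dir \<noteq> d2) kind' x' (tr.B (p2 - 1)) = (if d2 then tr.B (p2 - 1) - tr.exit p2 d2 else tr.exit p2 d2)))"
proof -
  have p: "p2 \<le> k + 1" and dp: "d2 \<longrightarrow> b < p2" using v(1) by (auto simp: tr.valid_def)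
  note mo = more_ok[OF r p] 
  have W: "base < W" "base < M" "1 < W" "0 < W" using big_W by linarith+
  have s10: "fst s 10 = base" "fst s 5 = bit dir" using l by (auto simp: link_def)
  define Ok where "Ok = (\<lambda>kd y. Jof r (dir \<noteq> d2) kd y (tr.B (p2 - 1)) =
    (if d2 then tr.B (p2 - 1) - tr.exit p2 d2 else tr.exit p2 d2))"
  have "wp exit_code s (\<lambda>l es t. es = [] \<and> l \<le> 16 \<and> snd t = snd s \<and>
    (\<forall>y. y \<notin> {7, 8, 26, 27} \<longrightarrow> fst t y = fst s y) \<and>
    (\<exists>kind' x'. fst t 7 = bit kind' \<and> fst t 8 = x' \<and> x' < n \<and> Ok kind' x'))"
  proof (cases "d2 \<and> p2 = b + 1")
    case True
    have "Ok kind x" using exit_done True by (simp only: Ok_def if_True simp_thms diff_add_inverse2)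
    then have "\<exists>kind' x'. bit kind = bit kind' \<and> x = x' \<and> x' < n \<and> Ok kind' x'"
      using x_less by blast
    moreover have "ev more s = 0" using mo(2)[OF dp] True by blast
    ultimately show ?thesis unfolding exit_code_def wp_simps(6) using mo(1) W s10(1) mem
      by (simp add: lim_def)
  next
    case False
    obtain p3 d3 where n: "nxt b k (p2, d2) = (p3, d3)" by force
    have n': "nxt b (length (if dir then rev ds else ds)) (p2, d2) = (p3, d3)" using n by simp
    note v3 = tr.valid_nxt[OF v(1) False n']
    have p3: "1 \<le> p3" "p3 \<le> k + 1" using v3(2,3) by simp_all
    have ne: "p3 \<noteq> p2"
    proof
      assume "p3 = p2"
      then have "p2 \<in> tr.todo p2 d2" using v3(4) by simp
      then show False using v(1) by (cases d2) (simp_all add: tr.todo_def tr.valid_def)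
    qed
    have asc: "\<not> d3 \<Longrightarrow> 2 \<le> p3" using n v(2) by (cases d2) (auto split: if_splits)
    define y where "y = (if d3 then tr.c (min p2 p3) else tr.c (p3 - 1))"
    let ?s = "((fst s)(26 := p3, 27 := bit d3, 7 := bit (d3 \<noteq> dir)), snd s)"
    have nx: "wp nxt_code s (\<lambda>l es t. es = [] \<and> l \<le> 8 \<and> t = ((fst s)(26 := p3, 27 := bit d3), snd s))"
      by (rule nxt_ok[OF l r p n])
    have l': "link ?s" using l by (simp add: link_def)
    have mk: "1 \<le> min p2 p3" "min p2 p3 \<le> k" using p3 ne v(2) p by linarith+
    have le: "ev least ?s = min p2 p3" "eok least ?s" using least_ev(1)[of ?s p2 p3] least_ev(2) r(1) by simp_all
    have okx: "Ok (d3 \<noteq> dir) y" unfolding Ok_def y_def by (rule exit_nxt[OF False n])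
    have xn: "y < n"
    proof (cases d3)
      case True
      show ?thesis unfolding y_def if_P[OF True] by (rule c_n[OF mk])
    next
      case False
      show ?thesis unfolding y_def if_not_P[OF False] by (rule c_n) (use asc[OF False] p3 in linarith)+
    qed
    have "wp (Cond (V 27) (Assign 8 (celem least)) (Assign 8 (celem (Minus (V 26) (N 1))))) ?s
      (\<lambda>l es t. es = [] \<and> l \<le> 3 \<and> t = ((fst ?s)(8 := y), snd s))"
    proof (cases d3)
      case True
      have "ev (celem least) ?s = y" "eok (celem least) ?s"
        using celem_ev[OF l' le(2), unfolded le(1), OF mk] True by (simp_all only: y_def if_True)
      then show ?thesis using True W by (simp add: bit_def)
    next
      case False
      have e: "eok (Minus (V 26) (N 1)) ?s" "ev (Minus (V 26) (N 1)) ?s = p3 - 1" using W by auto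
      have "1 \<le> p3 - 1" "p3 - 1 \<le> k" using asc[OF False] p3 by linarith+
      from celem_ev[OF l' e(1), unfolded e(2), OF this]
      have "ev (celem (Minus (V 26) (N 1))) ?s = y" "eok (celem (Minus (V 26) (N 1))) ?s"
        using False by (simp_all only: y_def if_False)
      then show ?thesis using False W by (simp add: bit_def)
    qed
    then have c: "wp (Cond (V 27) (Assign 8 (celem least)) (Assign 8 (celem (Minus (V 26) (N 1))))) ?s
      (\<lambda>l es t. es = [] \<and> l \<le> 3 \<and> t = ((fst ?s)(8 := y), snd s))" .
    have kd: "bit d3 * (1 - bit dir) + (1 - bit d3) * bit dir = bit (d3 \<noteq> dir)" by (simp add: bit_def)
    have ek: "eok (Plus (Times (V 27) (Minus (N 1) (V 5))) (Times (Minus (N 1) (V 27)) (V 5))) ((fst s)(26 := p3, 27 := bit d3), snd s)"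
      using W s10 by (auto simp: bit_def)
    have "wp (Assign 7 (Plus (Times (V 27) (Minus (N 1) (V 5))) (Times (Minus (N 1) (V 27)) (V 5))) ;;
       Cond (V 27) (Assign 8 (celem least)) (Assign 8 (celem (Minus (V 26) (N 1))))) ((fst s)(26 := p3, 27 := bit d3), snd s)
      (\<lambda>l es t. es = [] \<and> l \<le> 4 \<and> t = ((fst ?s)(8 := y), snd s))"
    proof -
      have "ev (Plus (Times (V 27) (Minus (N 1) (V 5))) (Times (Minus (N 1) (V 27)) (V 5)))
        ((fst s)(26 := p3, 27 := bit d3), snd s) = bit (d3 \<noteq> dir)" using kd s10(2) by simp
      then have e: "((fst s)(26 := p3, 27 := bit d3))(7 := ev (Plus (Times (V 27) (Minus (N 1) (V 5))) (Times (Minus (N 1) (V 27)) (V 5)))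
        ((fst s)(26 := p3, 27 := bit d3), snd s)) = fst ?s" by simp
      show ?thesis unfolding wp_Assign_Seq
        by (intro conjI ek, simp, unfold fst_conv snd_conv, unfold e[unfolded fst_conv], rule wp_mono[OF c]) simp
    qed
    note w2 = this
    have w: "wp (nxt_code ;; Assign 7 (Plus (Times (V 27) (Minus (N 1) (V 5))) (Times (Minus (N 1) (V 27)) (V 5))) ;;
       Cond (V 27) (Assign 8 (celem least)) (Assign 8 (celem (Minus (V 26) (N 1))))) s
       (\<lambda>l es t. es = [] \<and> l \<le> 12 \<and> t = ((fst ?s)(8 := y), snd s))"
      by (rule wp_Seq_silent[OF nx, where Q' = "\<lambda>l es t. es = [] \<and> l \<le> 4 \<and> t = ((fst ?s)(8 := y), snd s)"])
        (hypsubst, rule w2, simp)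
    show ?thesis unfolding exit_code_def wp_simps(6)
      apply (intro conjI mo(1))
      apply (subst if_P)
       apply (use mo(2)[OF dp] False in blast)
      apply (rule wp_mono[OF w])
      using xn okx by (intro conjI exI[of _ "d3 \<noteq> dir"] exI[of _ y]) simp_all
  qed
  then show ?thesis unfolding Ok_def .
qed

end

context node
begin

lemma child_ok:
  assumes l: "link s" and s: "fst s 24 = p2" "fst s 25 = bit d2" "fst s 3 = wd" "1 \<le> p2" "p2 \<le> k + 1"
  shows "wp child_code s (\<lambda>l es t. es = [] \<and> l \<le> 5 \<and>
    t = ((fst s)(9 := snd s 5 (base + (if dir then k - (p2 - 1) else p2 - 1)), 6 := bit d2, 5 := bit (dir \<noteq> d2),
      10 := base + wd, 11 := 1), snd s))"
proof -
  have e: "eok (V 24) s" "ev (V 24) s \<le> Suc k" using s by simp_all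
  note i = ix_ev[OF l e]
  have s': "fst s 10 = base" "fst s 5 = bit dir" using l by (auto simp: link_def)
  let ?i = "if dir then k - (p2 - 1) else p2 - 1"
  have "ev (ix (V 24)) s - (1 - bit dir) = ?i" using i(1) s by (auto simp: bit_def)
  moreover have "?i \<le> k" using s by auto
  moreover have "bit d2 * (1 - bit dir) + (1 - bit d2) * bit dir = bit (dir \<noteq> d2)" by (auto simp: bit_def)
  moreover have "1 < W" "base + ?i < W" "base + ?i < M" using big_W \<open>?i \<le> k\<close> by linarith+
  moreover have "bit d2 * (1 - bit dir) \<le> 1" "(1 - bit d2) * bit dir \<le> 1" "bit (dir \<noteq> d2) \<le> 1" by (auto simp: bit_def)
  moreover have "base + wd < W" using big_W by simp
  ultimately show ?thesis using i(2) s s' unfolding child_code_def wp_Assign_Seq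
    by (simp add: lim_def)
qed

definition moved :: "nat list \<Rightarrow> nat \<Rightarrow> nat \<Rightarrow> bool \<Rightarrow> state \<Rightarrow> state \<Rightarrow> bool" where
  "moved xs post p d s t \<longleftrightarrow> keep base s t \<and> frame xs post p d t \<and>
    (\<exists>kind' x'. entry (base + wd) (dir \<noteq> d) d kind' x' (filter (\<lambda>u. u \<in> tr.B (p - 1)) xs) t \<and>
      Jof r (dir \<noteq> d) kind' x' (tr.B (p - 1)) = (if d then tr.B (p - 1) - tr.exit p d else tr.exit p d))"

lemma move_ok:
  assumes l: "link s" and r: "fst s 26 = p2" "fst s 27 = bit d2" "fst s 28 = b"
    and f: "frame xs post p d s" and v: "tr.valid p2 d2" "1 \<le> p2"
  shows "wp (Write 12 (V 10) (V 26) ;; Write 13 (V 10) (V 27) ;; Assign 24 (V 26) ;; Assign 25 (V 27) ;; exit_code ;; child_code) s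
    (\<lambda>l es t. es = [] \<and> l \<le> 30 \<and> moved xs post p2 d2 s t)"
proof -
  let ?A = "(snd s)(12 := (snd s 12)(base := p2), 13 := (snd s 13)(base := bit d2))"
  let ?s = "((fst s)(24 := p2, 25 := bit d2), ?A)"
  have p: "p2 \<le> k + 1" using v by (simp add: tr.valid_def)
  have l': "link ?s" using l by (simp add: link_def)
  have f': "frame xs post p2 d2 ?s" using f by (simp add: frame_def static_def)
  have kp: "keep base s ?s" by (simp add: keep_def)
  define Ok where "Ok = (\<lambda>kd y. Jof r (dir \<noteq> d2) kd y (tr.B (p2 - 1)) =
    (if d2 then tr.B (p2 - 1) - tr.exit p2 d2 else tr.exit p2 d2))"
  define bi where "bi = (if dir then k - (p2 - 1) else p2 - 1)"
  have bi: "bi \<le> k" "tr.B (p2 - 1) = B bi" using B_real[of "p2 - 1"] p unfolding bi_def by auto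
  have ex: "wp exit_code ?s (\<lambda>l es t. es = [] \<and> l \<le> 16 \<and> (snd t = ?A \<and>
    (\<forall>y. y \<notin> {7, 8, 26, 27} \<longrightarrow> fst t y = fst ?s y) \<and>
    (\<exists>kind' x'. fst t 7 = bit kind' \<and> fst t 8 = x' \<and> x' < n \<and> Ok kind' x')))"
    using exit_ok[OF l', of p2 d2] r(3) f v unfolding Ok_def by (simp add: frame_def)
  have fin: "wp (exit_code ;; child_code) ?s (\<lambda>l es t. es = [] \<and> l \<le> 21 \<and> keep base s t \<and> frame xs post p2 d2 t \<and>
      (\<exists>kind' x'. entry (base + wd) (dir \<noteq> d2) d2 kind' x' (filter (\<lambda>u. u \<in> B bi) xs) t \<and> Ok kind' x'))"
  proof (rule wp_Seq_silent[OF ex, where Q' = "\<lambda>l es t. es = [] \<and> l \<le> 5 \<and> keep base s t \<and> frame xs post p2 d2 t \<and>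
      (\<exists>kind' x'. entry (base + wd) (dir \<noteq> d2) d2 kind' x' (filter (\<lambda>u. u \<in> B bi) xs) t \<and> Ok kind' x')"], goal_cases)
    case (1 t)
    then obtain kd y where t: "snd t = ?A" "\<And>z. z \<notin> {7, 8, 26, 27} \<Longrightarrow> fst t z = fst ?s z"
      "fst t 7 = bit kd" "fst t 8 = y" "y < n" "Ok kd y" by blast
    have lt: "link t" using l' t(1,2) by (simp add: link_def)
    have t3: "fst t 3 = wd" "fst t 0 = n" using t(2) f by (simp_all add: frame_def static_def)
    have w: "wp child_code t (\<lambda>l es u. es = [] \<and> l \<le> 5 \<and>
      u = ((fst t)(9 := snd t 5 (base + bi), 6 := bit d2, 5 := bit (dir \<noteq> d2), 10 := base + wd, 11 := 1), snd t))"
      unfolding bi_def by (rule child_ok[OF lt]) (use t(2) t3 v(2) p in simp_all)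
    show ?case
    proof (rule wp_mono[OF w], elim conjE, goal_cases)
      case (1 l es u)
      have su: "snd u = ?A" and fu: "fst u 0 = n" "fst u 3 = wd" using 1(3) t(1) t3 by simp_all
      have stu: "static u" using f' su fu by (simp add: frame_def static_def)
      have "frame xs post p2 d2 u" using frame_keep[OF f' _ stu] su by (simp add: keep_def)
      moreover have "keep base s u" using kp su by (simp add: keep_def)
      moreover have "entry (base + wd) (dir \<noteq> d2) d2 kd y (filter (\<lambda>u. u \<in> B bi) xs) u"
        using stu 1(3) t f' bi(1) by (simp add: entry_def frame_def)
      ultimately show ?case using 1 t(6) by blast
    qed
  qed auto
  have W: "base < M" "0 < M" using big_W by linarith+
  have s10: "fst s 10 = base" using l by (simp add: link_def)
  define Q where "Q = (\<lambda>t. keep base s t \<and> frame xs post p2 d2 t \<and>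
      (\<exists>kind' x'. entry (base + wd) (dir \<noteq> d2) d2 kind' x' (filter (\<lambda>u. u \<in> B bi) xs) t \<and> Ok kind' x'))"
  have fin: "wp (exit_code ;; child_code) ?s (\<lambda>l es t. es = [] \<and> l \<le> 26 \<and> Q t)"
    by (rule wp_mono[OF fin]) (simp add: Q_def)
  have "wp (Write 12 (V 10) (V 26) ;; Write 13 (V 10) (V 27) ;; Assign 24 (V 26) ;; Assign 25 (V 27) ;; exit_code ;; child_code) s
    (\<lambda>l es t. es = [] \<and> l \<le> 30 \<and> Q t)"
    using W s10 r fin
    by (simp add: lim_def del: wp_simps(5) add: wp_Assign_Seq wp_simps(5)[of "Write _ _ _"])
  then show ?thesis unfolding moved_def Q_def Ok_def bi(2) .
qed

lemma descend_ok:
  assumes l: "link s" and r: "fst s 24 = p" "fst s 25 = bit d" "fst s 28 = b"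
    and f: "frame xs post p d s" and v: "tr.valid p d" "\<not> (d \<and> p = b + 1)" "nxt b k (p, d) = (p2, d2)"
  shows "wp descend_code s (\<lambda>l es t. es = map Suc (tr.togs p p2) \<and> l \<le> 50 \<and> moved xs post p2 d2 s t)"
proof -
  have n: "nxt b (length (if dir then rev ds else ds)) (p, d) = (p2, d2)" using v(3) by simp
  note v2 = tr.valid_nxt(1,2)[OF v(1,2) n]
  have p: "p \<le> k + 1" using v(1) by (simp add: tr.valid_def)
  let ?s = "((fst s)(26 := p2, 27 := bit d2), snd s)"
  have l': "link ?s" and f': "frame xs post p d ?s" using l f by (simp_all add: link_def frame_def static_def)
  have m: "wp (Write 12 (V 10) (V 26) ;; Write 13 (V 10) (V 27) ;; Assign 24 (V 26) ;; Assign 25 (V 27) ;; exit_code ;; child_code) ?s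
    (\<lambda>l es t. es = [] \<and> l \<le> 30 \<and> moved xs post p2 d2 ?s t)"
    by (rule move_ok[OF l' _ _ _ f' v2]) (use r in simp_all)
  have tg: "wp togs_code ?s (\<lambda>l es t. es = map Suc (tr.togs p p2) \<and> l \<le> 6 \<and> t = ?s)"
    by (rule togs_ok[OF l' _ _ v]) (use r in simp_all)
  have m': "wp (togs_code ;; Write 12 (V 10) (V 26) ;; Write 13 (V 10) (V 27) ;; Assign 24 (V 26) ;; Assign 25 (V 27) ;; exit_code ;; child_code) ?s
    (\<lambda>l es t. es = map Suc (tr.togs p p2) \<and> l \<le> 36 \<and> moved xs post p2 d2 s t)"
    unfolding wp_simps(5)[of togs_code]
    by (rule wp_mono[OF tg], elim conjE, hypsubst, rule wp_mono[OF m]) (simp add: moved_def keep_def)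
  show ?thesis unfolding descend_code_def
    by (rule wp_Seq_silent[OF nxt_ok[OF l r p v(3)], where Q' = "\<lambda>l es t. es = map Suc (tr.togs p p2) \<and> l \<le> 36 \<and> moved xs post p2 d2 s t"])
      (hypsubst, rule m', simp)
qed

lemma adv_ok:
  assumes f: "frame xs post p d s" and s: "fst s 10 = base" and p: "p \<le> k + 1" "d \<longrightarrow> b < p"
    and W: "post < W"
    and step: "\<And>t. link t \<Longrightarrow> fst t 24 = p \<Longrightarrow> fst t 25 = bit d \<Longrightarrow> fst t 28 = b \<Longrightarrow> frame xs post p d t \<Longrightarrow>
      keep M s t \<Longrightarrow> wp (if d \<and> p = b + 1 then finish_code else descend_code) t Q"
    and Q: "\<And>l l' es t. l' \<le> 10 \<Longrightarrow> Q l es t \<Longrightarrow> Q' (l' + l) es t"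
  shows "wp adv_code s Q'"
proof -
  let ?t = "((fst s)(22 := k, 28 := b, 5 := bit dir, 24 := p, 25 := bit d), snd s)"
  have W: "base < M" "base < W" "1 < W" "0 < W" using big_W by linarith+
  have load: "wp load_code s (\<lambda>l es t. es = [] \<and> l \<le> 5 \<and> t = ?t)"
    using f s W unfolding load_code_def by (simp add: frame_def lim_def)
  have t: "link ?t" "fst ?t 24 = p" "fst ?t 25 = bit d" "fst ?t 28 = b" "frame xs post p d ?t" "keep M s ?t"
    using f s by (auto simp: frame_def link_def static_def keep_def)
  note mo = more_ok[OF t(2,3,4) p(1)]
  have w: "wp (if d \<and> p = b + 1 then finish_code else descend_code) ?t Q" by (rule step[OF t])
  have "wp (Cond more descend_code finish_code) ?t (\<lambda>l es t. \<exists>l'. l = Suc (Suc l') \<and> Q l' es t)"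
    unfolding wp_simps(6)
  proof (intro conjI mo(1))
    have sel: "if \<not> e then wp c s Q else wp c' s Q" if "wp (if e then c' else c) s Q" for e c c' s
      using that by (cases e) simp_all
    have ex: "(\<exists>l'. Suc (Suc l) = Suc (Suc l') \<and> Q l' es t) = Q l es t" for l es t by simp
    show "if ev more ?t \<noteq> 0 then wp descend_code ?t (\<lambda>l es t. \<exists>l'. Suc (Suc l) = Suc (Suc l') \<and> Q l' es t)
      else wp finish_code ?t (\<lambda>l es t. \<exists>l'. Suc (Suc l) = Suc (Suc l') \<and> Q l' es t)"
      unfolding mo(2)[OF p(2)] ex by (rule sel[OF w])
  qed
  then have w2: "wp (Cond more descend_code finish_code) t (\<lambda>l es t. \<exists>l'. l = Suc (Suc l') \<and> Q l' es t)"
    if "t = ?t" for t unfolding that .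
  show ?thesis unfolding adv_code_def
  proof (rule wp_Seq_silent[OF load w2], goal_cases)
    case (2 l l' es t)
    then obtain i where "l' = Suc (Suc i)" "Q i es t" by blast
    then show ?case using Q[of "l + 2" i es t] 2(1) by simp
  qed
qed

lemma adv_step_ok:
  assumes f: "frame xs post p d s" and s: "fst s 10 = base" and W: "post < W"
    and v: "tr.valid p d" "\<not> (d \<and> p = b + 1)" "nxt b k (p, d) = (p2, d2)"
  shows "wp adv_code s (\<lambda>l es t. es = map Suc (tr.togs p p2) \<and> l \<le> 60 \<and> moved xs post p2 d2 s t)"
proof (rule adv_ok[OF f s _ _ W])
  show "p \<le> k + 1" "d \<longrightarrow> b < p" using v(1) by (auto simp: tr.valid_def)
next
  fix t assume t: "link t" "fst t 24 = p" "fst t 25 = bit d" "fst t 28 = b" "frame xs post p d t" "keep M s t"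
  show "wp (if d \<and> p = b + 1 then finish_code else descend_code) t
    (\<lambda>l es u. es = map Suc (tr.togs p p2) \<and> l \<le> 50 \<and> moved xs post p2 d2 s u)"
    unfolding if_not_P[OF v(2)]
  proof (rule wp_mono[OF descend_ok[OF t(1-5) v]])
    fix l es u assume a: "es = map Suc (tr.togs p p2) \<and> l \<le> 50 \<and> moved xs post p2 d2 t u"
    have "keep base s u" if "keep base t u" using that t(6) big_W(3) by (simp add: keep_def)
    then show "es = map Suc (tr.togs p p2) \<and> l \<le> 50 \<and> moved xs post p2 d2 s u"
      using a unfolding moved_def by blast
  qed
qed auto

lemma adv_done_ok:
  assumes f: "frame xs post (b + 1) True s" and s: "fst s 10 = base" and W: "post < W"
  shows "wp adv_code s (\<lambda>l es t. es = (if post = 0 then [] else [post]) \<and> l \<le> 20 \<and> static t \<and> keep base s t \<and>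
    fst t 10 = base - wd \<and> fst t 11 = 0)"
proof (rule adv_ok[OF f s _ _ W])
  show "b + 1 \<le> k + 1" "True \<longrightarrow> b < b + 1" using tr.b_le by auto
next
  fix t assume t: "link t" "fst t 24 = b + 1" "fst t 25 = bit True" "fst t 28 = b" "frame xs post (b + 1) True t" "keep M s t"
  have w: "base < M" "0 < W" using big_W by linarith+
  have "keep base s t" using t(6) big_W(3) by (simp add: keep_def)
  moreover have "static t" "snd t 8 base = post" "fst t 3 = wd" "fst t 10 = base"
    using t(1,5) by (simp_all add: frame_def static_def link_def)
  ultimately show "wp (if True \<and> b + 1 = b + 1 then finish_code else descend_code) t
    (\<lambda>l es u. es = (if post = 0 then [] else [post]) \<and> l \<le> 10 \<and> static u \<and> keep base s u \<and> fst u 10 = base - wd \<and> fst u 11 = 0)"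
    using W w by (simp add: finish_code_def return_code_def static_def keep_def lim_def)
qed auto

end

context ram
begin

lemma wp_Seq_state:
  assumes "wp c s (\<lambda>l es t. es = [] \<and> l \<le> i \<and> t = s')" "wp d s' (\<lambda>l es t. es = [] \<and> l \<le> j \<and> R t)"
  shows "wp (c ;; d) s (\<lambda>l es t. es = [] \<and> l \<le> i + j \<and> R t)"
  by (rule wp_Seq_silent[OF assms(1), where Q' = "\<lambda>l es t. es = [] \<and> l \<le> j \<and> R t"]) (use assms(2) in auto)

end

context node
begin

definition post :: nat where
  "post = (if m \<or> tr.c 1 \<in> J then 0 else Suc (tr.c 1))"

section \<open>Setting up the frame of a call\<close>

abbreviation setup_body :: com where
  "setup_body \<equiv> Assign 23 (celem (Plus (V 28) (N 1))) ;;
       Cond (V 7) (Assign 24 (Minus (N 1) (At 0 (Plus (Times (V 8) (V 0)) (V 23)))))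
         (Assign 24 (At 0 (Plus (Times (V 23) (V 0)) (V 8)))) ;;
       Assign 24 (Plus (Times (V 5) (Minus (N 1) (V 24))) (Times (Minus (N 1) (V 5)) (V 24))) ;;
       Cond (V 24) Skip (Cond (Plus (V 6) (V 28)) Skip (Assign 24 (N 1) ;; Assign 29 (Plus (V 23) (N 1)))) ;;
       Cond (V 24) (Assign 28 (Plus (V 28) (N 1)) ;; Assign 19 (Minus (V 22) (V 28))) (Assign 19 (N 0))"

definition ready :: "state \<Rightarrow> bool" where
  "ready s \<longleftrightarrow> static s \<and> link s \<and> fst s 6 = bit m \<and> fst s 7 = bit kind \<and> fst s 8 = x"

lemma setup_body_ok:
  assumes rd: "ready s" and i: "fst s 28 = i" "i < k"
  shows "wp setup_body s (\<lambda>l es t. es = [] \<and> l \<le> 18 \<and> snd t = snd s \<and> ready t \<and>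
    (\<forall>y. y \<notin> {19, 23, 24, 28, 29} \<longrightarrow> fst t y = fst s y) \<and>
    fst t 28 = (if i < b then Suc i else i) \<and> fst t 19 = (if i < b then k - Suc i else 0) \<and>
    fst t 29 = (if \<not> m \<and> i = 0 \<and> tr.c 1 \<notin> J then Suc (tr.c 1) else fst s 29))"
proof -
  define y where "y = tr.c (Suc i)"
  have st: "static s" "link s" and R: "fst s 6 = bit m" "fst s 7 = bit kind" "fst s 8 = x" using rd by (simp_all add: ready_def)
  have R0: "fst s 0 = n" "fst s 5 = bit dir" "fst s 22 = k" using st by (simp_all add: static_def link_def)
  have mat: "\<And>u v. u < n \<Longrightarrow> v < n \<Longrightarrow> snd s 0 (u * n + v) = (if (u, v) \<in> r then 1 else 0)" using st by (simp add: static_def)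
  have W: "1 < W" "0 < W" "i + 1 < W" "n < W" "n * n < W" "n + 1 < W" using big_W i sizes by linarith+
  have e: "eok (Plus (V 28) (N 1)) s" "ev (Plus (V 28) (N 1)) s = Suc i" using i W by simp_all
  have ce: "ev (celem (Plus (V 28) (N 1))) s = y" "eok (celem (Plus (V 28) (N 1))) s"
    using celem_ev[OF st(2) e(1)] i(2) unfolding e(2) y_def by simp_all
  have y: "y < n" "y \<in> P" using c_n[of "Suc i"] tr.c_in[of "Suc i"] i(2) unfolding y_def by simp_all
  have cells: "x * n + y < n * n" "y * n + x < n * n" using cell x_less y by auto
  then have cells': "x * n < W" "y * n < W" "x * n + y < W" "y * n + x < W" using W by linarith+
  have yJ: "y \<in> J \<longleftrightarrow> dir \<noteq> (if kind then (x, y) \<notin> r else (y, x) \<in> r)" using y(2) by (simp add: J_def Jof_def)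
  have y1: "y = tr.c 1 \<longleftrightarrow> i = 0" using tr.c_inj[of "Suc i" 1] i(2) by (simp add: y_def)
  have yb: "i < b \<longleftrightarrow> y \<in> J \<or> (\<not> m \<and> i = 0)" 
  proof -
    have "y \<in> Jst \<longleftrightarrow> Suc i \<le> b" unfolding y_def by (rule tr.b_iff) (use i(2) in simp_all)
    moreover have "y \<in> Jst \<longleftrightarrow> y \<in> J \<or> (\<not> m \<and> y = tr.c 1)" unfolding tr.Jst by (cases m) (simp_all only: if_True if_False insert_iff simp_thms, blast)
    ultimately show ?thesis unfolding y1 by auto
  qed
  define v where "v = (if kind then (x, y) \<notin> r else (y, x) \<in> r)"
  let ?R1 = "(fst s)(23 := y)" let ?R2 = "?R1(24 := bit v)" let ?R3 = "?R2(24 := bit (y \<in> J))"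
  have c2: "wp (Cond (V 7) (Assign 24 (Minus (N 1) (At 0 (Plus (Times (V 8) (V 0)) (V 23)))))
         (Assign 24 (At 0 (Plus (Times (V 23) (V 0)) (V 8))))) (?R1, snd s)
     (\<lambda>l es t. es = [] \<and> l \<le> 3 \<and> t = (?R2, snd s))"
    using R R0 W cells cells' x_less y(1) mat by (simp add: bit_def v_def lim_def)
  have b3: "bit dir * (1 - bit v) + (1 - bit dir) * bit v = bit (y \<in> J)"
    "bit dir \<le> 1" "bit v \<le> 1" "bit dir * (1 - bit v) \<le> 1" "(1 - bit dir) * bit v \<le> 1" "bit (y \<in> J) \<le> 1"
    unfolding yJ v_def[symmetric] by (auto simp: bit_def)
  have c3: "wp (Assign 24 (Plus (Times (V 5) (Minus (N 1) (V 24))) (Times (Minus (N 1) (V 5)) (V 24)))) (?R2, snd s)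
     (\<lambda>l es t. es = [] \<and> l \<le> 1 \<and> t = (?R3, snd s))"
    using R R0 W b3 by simp
  define o1 where "o1 \<longleftrightarrow> y \<notin> J \<and> \<not> m \<and> i = 0"
  let ?R4 = "if o1 then ?R3(24 := 1, 29 := Suc y) else ?R3"
  have c4: "wp (Cond (V 24) Skip (Cond (Plus (V 6) (V 28)) Skip (Assign 24 (N 1) ;; Assign 29 (Plus (V 23) (N 1))))) (?R3, snd s)
     (\<lambda>l es t. es = [] \<and> l \<le> 6 \<and> t = (?R4, snd s))"
    using R i W y by (auto simp: bit_def o1_def)
  have v4: "?R4 24 = bit (i < b)" "?R4 28 = i" "?R4 22 = k" unfolding yb o1_def using i R0 by (auto simp: bit_def)
  let ?R5 = "if i < b then ?R4(28 := Suc i, 19 := k - Suc i) else ?R4(19 := 0)"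
  have c5: "wp (Cond (V 24) (Assign 28 (Plus (V 28) (N 1)) ;; Assign 19 (Minus (V 22) (V 28))) (Assign 19 (N 0))) (?R4, snd s)
     (\<lambda>l es t. es = [] \<and> l \<le> 4 \<and> t = (?R5, snd s))"
    using v4 W by (simp add: bit_def)
  have c1: "wp (Assign 23 (celem (Plus (V 28) (N 1)))) s (\<lambda>l es t. es = [] \<and> l \<le> 1 \<and> t = (?R1, snd s))"
    using ce by simp
  note wp_Seq_state[OF c1 wp_Seq_state[OF c2 wp_Seq_state[OF c3 wp_Seq_state[OF c4 c5]]]]
  then have "wp setup_body s (\<lambda>l es t. es = [] \<and> l \<le> 18 \<and> t = (?R5, snd s))"
    by (rule wp_mono) simp
  then show ?thesis
  proof (rule wp_mono, goal_cases)
    case (1 l es t)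
    have nb: "o1 \<Longrightarrow> i < b" using yb by (simp add: o1_def)
    have "ready t" using rd 1 by (auto simp: ready_def static_def link_def)
    moreover have "fst t 29 = (if \<not> m \<and> i = 0 \<and> tr.c 1 \<notin> J then Suc (tr.c 1) else fst s 29)"
      using 1 y1 by (auto simp: o1_def)
    moreover have "\<forall>y. y \<notin> {19, 23, 24, 28, 29} \<longrightarrow> fst t y = fst s y" using 1 by simp
    moreover have "fst t 28 = (if i < b then Suc i else i)" "fst t 19 = (if i < b then k - Suc i else 0)"
      using 1 i by auto
    ultimately show ?case using 1 by (intro conjI) simp_all
  qed
qed

text \<open>If \<open>m\<close> fails, \<open>c 1\<close> belongs to \<open>Jst\<close> and
  \<open>b\<close> is positive. Hence the loop need not have seen the chain element
  \<open>c 1\<close> for the recorded toggle to be right.\<close>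

lemma post_zero: "b = 0 \<Longrightarrow> post = 0"
proof -
  assume b: "b = 0"
  have "m"
  proof (rule ccontr)
    assume "\<not> m"
    then have "tr.c 1 \<in> Jst" unfolding tr.Jst by (simp only: if_False insertI1)
    then show False using tr.b_iff[of 1] tr.k_pos b by simp
  qed
  then show "post = 0" unfolding post_def by (simp only: simp_thms if_True)
qed

lemma post_less: "post < W"
proof -
  have "tr.c 1 < n" using c_n[of 1] tr.k_pos by simp
  then show ?thesis using big_W unfolding post_def by simp
qed

lemma setup_loop_ok:
  assumes "ready s" "fst s 28 = i" "i \<le> b" "fst s 19 \<noteq> 0 \<Longrightarrow> i < k" "fst s 19 = 0 \<Longrightarrow> i = b"
    "fst s 29 = (if i = 0 then 0 else post)"
  shows "wp (Loop (V 19) setup_body) s (\<lambda>l es t. es = [] \<and> l \<le> 20 * (b - i + (if fst s 19 = 0 then 0 else 1)) + 1 \<and>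
    snd t = snd s \<and> ready t \<and> fst t 28 = b \<and> fst t 29 = post)"
  using assms
proof (induction "b - i + (if fst s 19 = 0 then 0 else 1)" arbitrary: s i rule: less_induct)
  case less
  show ?case
  proof (cases "fst s 19 = 0")
    case True
    then show ?thesis using less.prems post_zero by (subst wp_Loop) auto
  next
    case False
    have ik: "i < k" using less.prems(4) False by simp
    define R where "R = (\<lambda>t. snd t = snd s \<and> ready t \<and>
      fst t 28 = (if i < b then Suc i else i) \<and> fst t 19 = (if i < b then k - Suc i else 0) \<and>
      fst t 29 = (if \<not> m \<and> i = 0 \<and> tr.c 1 \<notin> J then Suc (tr.c 1) else fst s 29))"
    have body: "wp setup_body s (\<lambda>l es t. es = [] \<and> l \<le> 18 \<and> R t)"
      by (rule wp_mono[OF setup_body_ok[OF less.prems(1,2) ik]]) (simp add: R_def)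
    let ?i = "if i < b then Suc i else i"
    show ?thesis
    proof (rule wp_Loop_step[OF _ _ body, where Q' = "\<lambda>l es t. es = [] \<and> l \<le> 20 * (b - i) + 1 \<and>
        snd t = snd s \<and> ready t \<and> fst t 28 = b \<and> fst t 29 = post"], goal_cases)
      case (3 t)
      then have t: "snd t = snd s" "ready t" "fst t 28 = ?i" "fst t 19 = (if i < b then k - Suc i else 0)"
        "fst t 29 = (if \<not> m \<and> i = 0 \<and> tr.c 1 \<notin> J then Suc (tr.c 1) else fst s 29)" unfolding R_def by simp_all
      have kb: "b \<le> k" using tr.b_le by simp
      have p: "fst t 29 = (if ?i = 0 then 0 else post)"

      proof -
        have "fst t 29 = post"
        proof (cases "i = 0")
          case True
          then have "fst s 29 = 0" using less.prems(6) by simp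
          then show ?thesis unfolding t(5) post_def using True by (cases m; cases "tr.c 1 \<in> J") (simp_all only: simp_thms if_True if_False)
        next
          case False
          then show ?thesis unfolding t(5) less.prems(6) by (simp only: simp_thms if_False)
        qed
        then show ?thesis using post_zero less.prems(3) by (cases "i < b") auto
      qed
      have dec: "b - ?i + (if fst t 19 = 0 then 0 else 1) \<le> b - i" using t(4) less.prems(3) by auto
      show ?case
      proof (rule wp_mono[OF less.hyps[OF _ t(2,3)]], goal_cases)
        case 1 show ?case using dec False by simp
      next
        case 2 show ?case using less.prems(3) by simp
      next
        case 3 then show ?case using t(4) ik by (auto split: if_splits)
      next
        case 4 then show ?case using t(4) less.prems(3) kb by (auto split: if_splits)
      next
        case 5 show ?case by (rule p)
      next
        case (6 l es u)
        then show ?case using dec t(1) by (elim conjE) (intro conjI, simp_all)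
      qed
    qed (use False in \<open>auto\<close>)
  qed
qed

lemma setup_ok:
  assumes rd: "ready s" and cl: "\<forall>j\<le>k. clist (snd s 2) (snd s 3) (base + wd) (snd s 5 (base + j)) (filter (\<lambda>u. u \<in> B j) xs)"
    and ch: "\<forall>j. 1 \<le> j \<longrightarrow> j \<le> k \<longrightarrow> snd s 4 (base + j) = ds ! (j - 1)"
  shows "wp setup_code s (\<lambda>l es t. es = [] \<and> l \<le> 20 * k + 40 \<and> keep base s t \<and> frame xs post 0 False t \<and>
    fst t 10 = base \<and> fst t 11 = 0)"
proof -
  have W: "base < M" "1 < W" "0 < W" using big_W by linarith+
  let ?s = "((fst s)(28 := 0, 29 := 0, 19 := 1), snd s)"
  have rs: "ready ?s" using rd by (simp add: ready_def static_def link_def)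
  have kp: "0 < k" using tr.k_pos unfolding len by linarith
  have loop: "wp (Loop (V 19) setup_body) ?s (\<lambda>l es t. es = [] \<and> l \<le> 20 * k + 21 \<and>
    (snd t = snd s \<and> ready t \<and> fst t 28 = b \<and> fst t 29 = post))"
    by (rule wp_mono[OF setup_loop_ok[OF rs, of 0]]) (use kp tr.b_le in auto)
  have "wp (Write 6 (V 10) (V 22) ;; Write 7 (V 10) (V 28) ;; Write 8 (V 10) (V 29) ;; Write 9 (V 10) (V 5) ;;
     Write 10 (V 10) (V 7) ;; Write 11 (V 10) (V 8) ;; Write 12 (V 10) (N 0) ;; Write 13 (V 10) (N 0) ;; Assign 11 (N 0)) t
     (\<lambda>l es u. es = [] \<and> l \<le> 9 \<and> (keep base s u \<and> frame xs post 0 False u \<and> fst u 10 = base \<and> fst u 11 = 0))"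
    if t: "snd t = snd s" "ready t" "fst t 28 = b" "fst t 29 = post" for t
    using t W cl ch by (simp add: lim_def ready_def link_def frame_def keep_def static_def bit_def)
  then have "wp (Loop (V 19) setup_body ;; Write 6 (V 10) (V 22) ;; Write 7 (V 10) (V 28) ;; Write 8 (V 10) (V 29) ;; Write 9 (V 10) (V 5) ;;
     Write 10 (V 10) (V 7) ;; Write 11 (V 10) (V 8) ;; Write 12 (V 10) (N 0) ;; Write 13 (V 10) (N 0) ;; Assign 11 (N 0)) ?s
     (\<lambda>l es u. es = [] \<and> l \<le> 20 * k + 30 \<and> (keep base s u \<and> frame xs post 0 False u \<and> fst u 10 = base \<and> fst u 11 = 0))"
    by (rule wp_Seq_silent[OF loop]) auto
  from wp_mono[OF this, where Q' = "\<lambda>l es u. es = [] \<and> Suc (Suc (Suc l)) \<le> 20 * k + 40 \<and>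
    (keep base s u \<and> frame xs post 0 False u \<and> fst u 10 = base \<and> fst u 11 = 0)"]
  show ?thesis unfolding setup_code_def wp_Assign_Seq using W by simp
qed

end

lemma (in chain_split) cut_initial:
  assumes "T \<in> order_ideals rho P"
  obtains b where "b \<le> k" "\<And>j. 1 \<le> j \<Longrightarrow> j \<le> k \<Longrightarrow> c j \<in> T \<longleftrightarrow> j \<le> b"
proof -
  obtain b where b: "b \<le> k" "1 \<le> b \<Longrightarrow> c b \<in> T" "\<And>j. b < j \<Longrightarrow> j \<le> k \<Longrightarrow> c j \<notin> T"
    using cut[of T] by metis
  have "c j \<in> T" if j: "1 \<le> j" "j \<le> b" for j
  proof -
    have "c b \<in> T" "(c j, c b) \<in> rho" "c j \<in> P" using b j c_le_iff[of j b] c_in[of j] by auto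
    then show ?thesis using assms unfolding order_ideals_def by blast
  qed
  then show thesis using that[of b] b(1,3) not_le by blast
qed

context producer
begin

definition node_state :: "nat \<Rightarrow> bool \<Rightarrow> bool \<Rightarrow> bool \<Rightarrow> nat \<Rightarrow> nat list \<Rightarrow> state \<Rightarrow> bool" where
  "node_state base dir m kind x xs t \<longleftrightarrow> fst t 10 = base \<and> fst t 11 = 0 \<and>
    (\<exists>ds Jst b. node n M W r wd (set xs) ds base dir (Jof r dir kind x (set xs)) Jst b m kind x \<and>
      node.frame n r wd (set xs) ds base dir b kind x xs (node.post ds dir (Jof r dir kind x (set xs)) m) 0 False t)"

text \<open>The four phases take at most 50, 8, 62 and 20 steps per element or incomparable pair,
  plus constants. The existential quantifiers of \<open>node_state\<close> hide the chain that was
  found and the cut \<open>b\<close> it makes in \<open>Jst\<close>.\<close>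

lemma new_ok:
  assumes e: "entry base dir m kind x xs s" and b: "base + wd \<le> M" and xs: "sorted_wrt (<) xs" "set xs \<subseteq> {..<n}" "xs \<noteq> []"
  shows "wp (heights ;; chain_code ;; children_code ;; setup_code) s (\<lambda>l es t. es = [] \<and>
    l \<le> 200 * (1 + card (set xs) + card (incomparable r (set xs))) \<and> (keep base s t \<and> node_state base dir m kind x xs t))"
    (is "wp _ s (\<lambda>l es t. es = [] \<and> l \<le> _ \<and> ?F t)")
proof -
  let ?P = "set xs" let ?J = "Jof r dir kind x ?P"
  let ?i = "card (incomparable r ?P)"
  have dist: "distinct xs" using xs(1) strict_sorted_iff by blast
  have len: "length xs = card ?P" by (rule distinct_card[OF dist, symmetric])
  have lenn: "length xs \<le> n" using card_mono[OF _ xs(2)] len by simp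
  have e': "fst s 10 = base" "fst s 5 = bit dir" "fst s 6 = bit m" "fst s 7 = bit kind" "fst s 8 = x" "x < n" "static s"
    "clist (snd s 2) (snd s 3) base (fst s 9) xs" using e xs(3) by (auto simp: entry_def)
  have bM: "base \<le> M" using b by simp
  have Jid: "?J \<in> order_ideals (turn dir r) ?P" by (rule Jof_ideal[OF po xs(2)])
  have H: "wp heights s (\<lambda>l es t. es = [] \<and> l \<le> 50 * (1 + card ?P + ?i) \<and> (static t \<and> (\<exists>bk. hinv t xs bk) \<and>
    ilist (snd t 19) (fst t 21) (rev xs) \<and> (\<forall>a. a \<notin> {15, 16, 17, 18, 19} \<longrightarrow> snd t a = snd s a) \<and>
    (\<forall>y. y \<notin> {13, 14, 15, 16, 17, 19, 21} \<longrightarrow> fst t y = fst s y)))"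
    by (rule wp_mono[OF heights_ok[OF e'(7,8) bM xs(1,2)]]) (auto simp: len)
  show ?thesis
  proof (rule wp_Seq_silent[OF H, where Q' = "\<lambda>l es t. es = [] \<and> l \<le> 100 * (1 + card ?P + ?i) + 50 \<and> ?F t"], elim conjE exE, goal_cases)
    case (1 t bk)
    then have t: "hinv t xs bk" "static t" "ilist (snd t 19) (fst t 21) (rev xs)"
      "\<And>a. a \<notin> {15, 16, 17, 18, 19} \<Longrightarrow> snd t a = snd s a"
      "\<And>y. y \<notin> {13, 14, 15, 16, 17, 19, 21} \<Longrightarrow> fst t y = fst s y" by blast+
    have C: "wp chain_code t (\<lambda>l es u. es = [] \<and> l \<le> 8 * card ?P + 10 \<and> (static u \<and>
    (\<forall>a. a \<notin> {4, 5} \<longrightarrow> snd u a = snd t a) \<and> (\<forall>y. y \<notin> {17, 18, 22} \<longrightarrow> fst u y = fst t y) \<and>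
    (\<forall>j. j < fst t 10 \<longrightarrow> snd u 4 j = snd t 4 j \<and> snd u 5 j = snd t 5 j) \<and>
    (\<exists>ds. longest_chain_in r ?P ds \<and> fst u 22 = length ds \<and> length ds = fst t 13 \<and>
      (\<forall>j\<le>length ds. snd u 5 (fst t 10 + j) = 0) \<and>
      (\<forall>j<length ds. snd u 4 (fst t 10 + Suc j) = ds ! j \<and> snd t 17 (ds ! j) = Suc j))))"
      using chain_ok[OF t(1) xs(3,2) lenn t(2)] t(5) e'(1) b len by simp
    show ?case
    proof (rule wp_Seq_silent[OF C, where Q' = "\<lambda>l es t. es = [] \<and> l \<le> 90 * (1 + card ?P + ?i) + 40 \<and> ?F t"], elim conjE exE, goal_cases)
      case (1 u ds)
      then have u: "static u" "\<And>a. a \<notin> {4, 5} \<Longrightarrow> snd u a = snd t a" "\<And>y. y \<notin> {17, 18, 22} \<Longrightarrow> fst u y = fst t y"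
        "\<And>j. j < base \<Longrightarrow> snd u 4 j = snd t 4 j \<and> snd u 5 j = snd t 5 j"
        "longest_chain_in r ?P ds" "fst u 22 = length ds" "length ds = fst t 13"
        "\<And>j. j \<le> length ds \<Longrightarrow> snd u 5 (base + j) = 0"
        "\<And>j. j < length ds \<Longrightarrow> snd u 4 (base + Suc j) = ds ! j \<and> snd t 17 (ds ! j) = Suc j"
        using t(5) e'(1) by simp_all
      have reg: "fst u y = fst s y" if "y \<notin> {13, 14, 15, 16, 17, 18, 19, 21, 22}" for y
        using u(3)[of y] t(5)[of y] that by simp
      have arr: "snd u a = snd s a" if "a \<notin> {4, 5, 15, 16, 17, 18, 19}" for a
        using u(2)[of a] t(4)[of a] that by simp
      interpret cp: chain_split r "{..<n}" ?P ds
        using po xs u(5) by unfold_locales auto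
      interpret pn: producer_node n M W r wd ?P ds base
        by unfold_locales (rule b)
      have cells: "snd u 4 (base + j) = ds ! (j - 1) \<and> snd t 17 (ds ! (j - 1)) = j" if "1 \<le> j" "j \<le> length ds" for j
        using u(9)[of "j - 1"] that by simp
      have fc: "pn.frame_chain u" using cells reg[of 10] e'(1) u(6) by (simp add: pn.frame_chain_def)
      have "hts (snd t 17) (snd t 18) (length ds) ?P" using t(1) u(7) by (simp add: hinv_def)
      then have rk: "pn.ranked u" unfolding pn.ranked_def using fc cells u(2)[of 17] u(2)[of 18] by simp
      have il: "ilist (snd u 19) (fst u 21) (rev xs)" using t(3) u(2)[of 19] u(3)[of 21] by simp
      note K = pn.children_ok[OF u(1) rk il HOL.refl dist]
      let ?cs = "if dir then rev ds else ds"
      let ?Jst = "if m then ?J else insert (?cs ! (1 - Suc 0)) ?J"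
      have cs: "chain_split (turn dir r) {..<n} ?P ?cs"
        using cp.chain_split_dual cp.chain_split_axioms by simp
      have "?Jst \<in> order_ideals (turn dir r) ?P"
      proof (cases m)
        case True
        show ?thesis unfolding if_P[OF True] by (rule Jid)
      next
        case False
        have "insert (?cs ! (1 - Suc 0)) ?J \<in> order_ideals (turn dir r) ?P"
          using Jid chain_split.below_first[OF cs] chain_split.c_in[OF cs order_refl chain_split.k_pos[OF cs]]
          unfolding order_ideals_def by blast
        then show ?thesis unfolding if_not_P[OF False] .
      qed
      then obtain b where b': "b \<le> length ?cs" "\<And>j. 1 \<le> j \<Longrightarrow> j \<le> length ?cs \<Longrightarrow> ?cs ! (j - Suc 0) \<in> ?Jst \<longleftrightarrow> j \<le> b"
        by (rule chain_split.cut_initial[OF cs]) blast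
      have N: "node n M W r wd ?P ds base dir ?J ?Jst b m kind x"
        unfolding node_def node_axioms_def tour_def tour_axioms_def
        by (intro conjI pn.producer_node_axioms cs Jid HOL.refl b' allI impI e'(6))
      have z: "\<forall>j\<le>length ds. snd u 5 (base + j) = 0" using u(8) by simp
      have G: "keep base s v' \<and> node_state base dir m kind x xs v'"
        if "keep base v v' \<and> node.frame n r wd ?P ds base dir b kind x xs (node.post ds dir ?J m) 0 False v' \<and> fst v' 10 = base \<and> fst v' 11 = 0"
          "\<And>a. a \<notin> {2, 3, 5} \<Longrightarrow> snd v a = snd u a"
          "\<And>j. j < base \<Longrightarrow> snd v 2 j = snd u 2 j \<and> snd v 3 j = snd u 3 j \<and> snd v 5 j = snd u 5 j" for v v'
      proof -
        have "snd v a j = snd s a j" if j: "j < base" and a: "2 \<le> a" "a \<le> 13" for a j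
        proof -
          have "snd v a j = snd u a j" using \<open>\<And>a. a \<notin> {2, 3, 5} \<Longrightarrow> snd v a = snd u a\<close>[of a]
            \<open>\<And>j. j < base \<Longrightarrow> snd v 2 j = snd u 2 j \<and> snd v 3 j = snd u 3 j \<and> snd v 5 j = snd u 5 j\<close>[OF j] by fastforce
          also have "\<dots> = snd t a j" using u(2)[of a] u(4)[OF j] by fastforce
          also have "\<dots> = snd s a j" using t(4)[of a] a by simp
          finally show ?thesis .
        qed
        then have "keep base s v" by (simp add: keep_def)
        then show ?thesis using that(1) N keep_trans[of base s v base v'] unfolding node_state_def by blast
      qed
      show ?case
      proof (rule wp_Seq_silent[OF wp_mono[OF K[OF z]], where Q' = "\<lambda>l es t. es = [] \<and> l \<le> 20 * card ?P + 40 \<and> ?F t"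
          and P = "\<lambda>v. static v \<and> (\<forall>a. a \<notin> {2, 3, 5} \<longrightarrow> snd v a = snd u a) \<and>
            (\<forall>y. y \<notin> {14, 15, 18, 19, 20, 23} \<longrightarrow> fst v y = fst u y) \<and>
            (\<forall>j<base. snd v 2 j = snd u 2 j \<and> snd v 3 j = snd u 3 j \<and> snd v 5 j = snd u 5 j) \<and>
            (\<forall>j\<le>length ds. clist (snd v 2) (snd v 3) (base + wd) (snd v 5 (base + j)) (filter (\<lambda>u. u \<in> sub_poset r ?P ds j) xs))"
          and k = "3 + 62 * (card ?P + ?i)"], goal_cases)
        case (1 l es t) then show ?case by simp
      next
        case (2 v)
        then have v: "static v" "\<And>a. a \<notin> {2, 3, 5} \<Longrightarrow> snd v a = snd u a"
          "\<And>y. y \<notin> {14, 15, 18, 19, 20, 23} \<Longrightarrow> fst v y = fst u y"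
          "\<And>j. j < base \<Longrightarrow> snd v 2 j = snd u 2 j \<and> snd v 3 j = snd u 3 j \<and> snd v 5 j = snd u 5 j"
          and cl: "\<forall>j\<le>length ds. clist (snd v 2) (snd v 3) (base + wd) (snd v 5 (base + j)) (filter (\<lambda>u. u \<in> sub_poset r ?P ds j) xs)"
          by blast+
        have rv: "fst v y = fst s y" if "y \<notin> {13, 14, 15, 16, 17, 18, 19, 20, 21, 22, 23}" for y
          using v(3)[of y] reg[of y] that by simp
        have ch: "\<forall>j. 1 \<le> j \<longrightarrow> j \<le> length ds \<longrightarrow> snd v 4 (base + j) = ds ! (j - 1)" using cells v(2)[of 4] by simp
        have "node.ready n r wd ds base dir m kind x v"
          unfolding node.ready_def[OF N] node.link_def[OF N] using ch v(1) v(3)[of 22] u(6) rv e' by simp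
        from node.setup_ok[OF N this cl ch] show ?case
        proof (rule wp_mono, goal_cases)
          case (1 l es v')
          have "l \<le> 20 * card ?P + 40" using 1 pn.sizes'(2) by linarith
          then show ?case using 1 G[of v v'] v(2,4) by blast
        qed
      next
        case (3 l l' es t)
        then show ?case by simp
      qed
    qed auto
  qed auto
qed

end

section \<open>The traversal program: recursion\<close>

context ram
begin

text \<open>A number of iterations of the main loop without its exit. A call of the recursion is
  such a segment, so nested calls can be composed although the machine has no procedures.\<close>

inductive runs :: "state \<Rightarrow> event list \<Rightarrow> state \<Rightarrow> bool" where
  runs_refl: "runs s [] s"
| runs_step: "fst s 10 \<noteq> 0 \<Longrightarrow> big (Cond (V 11) new_code adv_code) s w t \<Longrightarrow> runs t v u \<Longrightarrow>
    runs s (Tick # w @ Tick # v) u"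

lemma runs_trans: "runs s v t \<Longrightarrow> runs t w u \<Longrightarrow> runs s (v @ w) u"
proof (induction rule: runs.induct)
  case (runs_step s v t v' u')
  then show ?case using runs.runs_step[of s v t "v' @ w" u] by simp
qed simp

lemma runs_loop: "runs s w t \<Longrightarrow> fst t 10 = 0 \<Longrightarrow> big main_code s (w @ [Tick]) t"
proof (induction rule: runs.induct)
  case (runs_refl s)
  then show ?case unfolding main_code_def using LoopF[of "V 10" s] by simp
next
  case (runs_step s w t v u)
  then show ?case unfolding main_code_def using LoopT[of "V 10" s "Cond (V 11) new_code adv_code" w t "v @ [Tick]" u] by simp
qed

lemma runs_wp:
  assumes "fst s 10 \<noteq> 0" "wp (if fst s 11 = 0 then adv_code else new_code) s Q"
  shows "\<exists>w t l. runs s w t \<and> length w = l + 4 \<and> Q l (emits w) t"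
proof -
  have "wp (Cond (V 11) new_code adv_code) s (\<lambda>l es t. \<exists>i. l = i + 2 \<and> Q i es t)"
    using assms(2) by (cases "fst s 11 = 0") simp_all
  then obtain w t i where w: "big (Cond (V 11) new_code adv_code) s w t" "length w = i + 2" "Q i (emits w) t"
    unfolding wp_def wpw_def by blast
  have "runs s (Tick # w @ [Tick]) t" using runs_step[OF assms(1) w(1) runs_refl] by simp
  then show ?thesis using w by (intro exI[of _ "Tick # w @ [Tick]"] exI[of _ t] exI[of _ i]) simp
qed

definition in_range :: "event list \<Rightarrow> bool" where
  "in_range w \<longleftrightarrow> (\<forall>u. Suc u \<in> set (emits w) \<longrightarrow> u < n)"

lemma in_range_append [simp]: "in_range (v @ w) \<longleftrightarrow> in_range v \<and> in_range w"
  by (auto simp: in_range_def)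

end

context producer
begin

definition solves :: "nat \<Rightarrow> nat \<Rightarrow> nat \<Rightarrow> bool \<Rightarrow> bool \<Rightarrow> bool \<Rightarrow> nat \<Rightarrow> nat list \<Rightarrow> state \<Rightarrow> bool" where
  "solves K Y base dir m kind x xs s \<longleftrightarrow> (\<exists>w t. runs s w t \<and>
    good K Y (turn dir r) (set xs) (Jof r dir kind x (set xs)) m w \<and> in_range w \<and> static t \<and>
    keep base s t \<and> fst t 10 = base - wd \<and> fst t 11 = 0)"

end

context node
begin

text \<open>Each round consists of one iteration that advances the tour and the complete run of the
  child, which is supplied by \<open>IH\<close>. The bound 64 is 60 steps for advancing plus the
  four ticks of an iteration and its conditional.\<close>

lemma tour_run:
  assumes IH: "\<And>kind' x' m' dir' ys s. entry (base + wd) dir' m' kind' x' ys s \<Longrightarrow> set ys \<subset> P \<Longrightarrow>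
      sorted_wrt (<) ys \<Longrightarrow> solves K Y (base + wd) dir' m' kind' x' ys s"
    and K: "64 \<le> K" and base0: "0 < base" and xs: "set xs = P" "sorted_wrt (<) xs"
    and s: "frame xs post p d s" "fst s 10 = base" "fst s 11 = 0" "tr.valid p d"
  shows "\<exists>w t. runs s w t \<and> tr.tgood p d w \<and> frame xs post (b + 1) True t \<and> keep base s t \<and>
    fst t 10 = base \<and> fst t 11 = 0 \<and> in_range w"
  using s
proof (induction "card (tr.todo p d)" arbitrary: p d s rule: less_induct)
  case less
  show ?case
  proof (cases "d \<and> p = b + 1")
    case True
    then show ?thesis using less.prems tr.tgood_done runs_refl[of s]
      by (intro exI[of _ "[]"] exI[of _ s]) (simp add: keep_def in_range_def)
  next
    case False
    obtain p2 d2 where n: "nxt b k (p, d) = (p2, d2)" by force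
    have n': "nxt b (length (if dir then rev ds else ds)) (p, d) = (p2, d2)" using n by simp
    note v2 = tr.valid_nxt[OF less.prems(4) False n']
    have nz: "fst s 10 \<noteq> 0" using less.prems(2) base0 by simp
    have "wp (if fst s 11 = 0 then adv_code else new_code) s
      (\<lambda>l es t. es = map Suc (tr.togs p p2) \<and> l \<le> 60 \<and> moved xs post p2 d2 s t)"
      using adv_step_ok[OF less.prems(1,2) post_less less.prems(4) False n] less.prems(3) by simp
    from runs_wp[OF nz this] obtain seg t1 l where seg: "runs s seg t1" "length seg = l + 4" "emits seg = map Suc (tr.togs p p2)" "l \<le> 60"
      and mv: "moved xs post p2 d2 s t1" by blast
    let ?Q = "tr.B (p2 - 1)"
    let ?ys = "filter (\<lambda>u. u \<in> ?Q) xs"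
    obtain kind' x' where e: "entry (base + wd) (dir \<noteq> d2) d2 kind' x' ?ys t1"
      and J': "Jof r (dir \<noteq> d2) kind' x' ?Q = (if d2 then ?Q - tr.exit p2 d2 else tr.exit p2 d2)"
      and k1: "keep base s t1" and f1: "frame xs post p2 d2 t1" using mv unfolding moved_def by blast
    have pk: "p2 - 1 \<le> length (if dir then rev ds else ds)" using v2(3) by simp
    have sys: "set ?ys = ?Q" unfolding set_filter xs(1) using tr.B_sub[of "p2 - 1"] by blast
    have sorted: "sorted_wrt (<) ?ys" by (rule sorted_wrt_filter[OF xs(2)])
    have "solves K Y (base + wd) (dir \<noteq> d2) d2 kind' x' ?ys t1"
      by (rule IH[OF e _ sorted], unfold sys, rule tr.B_psub[OF pk])
    then obtain wc t2 where wc: "runs t1 wc t2" "good K Y (turn (dir \<noteq> d2) r) ?Q (Jof r (dir \<noteq> d2) kind' x' ?Q) d2 wc"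
      "in_range wc" "static t2" "keep (base + wd) t1 t2" "fst t2 10 = base" "fst t2 11 = 0"
      unfolding solves_def sys by auto
    have f2: "frame xs post p2 d2 t2" by (rule frame_keep[OF f1 wc(5,4)])
    have "card (tr.todo p2 d2) < card (tr.todo p d)"
      unfolding v2(5) by (rule card_Diff1_less[OF tr.finite_todo v2(4)])
    from less.hyps[OF this f2 wc(6,7) v2(1)] obtain w t3 where w: "runs t2 w t3" "tr.tgood p2 d2 w"
      "frame xs post (b + 1) True t3" "keep base t2 t3" "fst t3 10 = base" "fst t3 11 = 0" "in_range w" by blast
    have tt: "turn (dir \<noteq> d2) r = (if d2 then (turn dir r)\<inverse> else turn dir r)" by (cases dir; cases d2) simp_all
    have tg: "tr.tgood p d (seg @ wc @ w)"
      by (rule tr.tgood_step[OF less.prems(4) False n' seg(3) _ wc(2)[unfolded J' tt] w(2)]) (use seg K in simp)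
    note near = togs_near[OF less.prems(4) False n]
    have "in_range seg"
      unfolding in_range_def seg(3) tr.togs_def using near(5,6) c_n[of "min p p2"] c_n[of "min p p2 + 1"]
      by (auto simp del: min_def split: if_splits)
    moreover have "keep base s t3"
      using keep_trans[OF keep_trans[OF k1 wc(5)] w(4)] by simp
    ultimately show ?thesis
      using runs_trans[OF seg(1) runs_trans[OF wc(1) w(1)]] tg w wc(3)
      by (intro exI[of _ "seg @ wc @ w"] exI[of _ t3]) simp
  qed
qed

end

lemma incomparable_turn: "incomparable (turn dir r) P = incomparable r P"
  by (auto simp: incomparable_def)

context producer
begin

text \<open>The unit 300 covers the 200 steps of \<open>new_ok\<close> and small constants.
  \<open>900 * wd\<close> is three such units for each of the at most \<open>wd\<close> elements and
  pairs of a node. Each level of nesting uses up one \<open>wd\<close> and at least one element,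
  which preserves the condition on \<open>M\<close>.\<close>

lemma node_run:
  assumes "entry base dir m kind x xs s" "wd \<le> base" "base + (card (set xs) + 2) * wd \<le> M"
    "sorted_wrt (<) xs" "set xs \<subseteq> {..<n}"
  shows "solves 300 (900 * wd) base dir m kind x xs s"
  using assms
proof (induction "card (set xs)" arbitrary: base dir m kind x xs s rule: less_induct)
  case less
  let ?P = "set xs" let ?J = "Jof r dir kind x ?P" let ?inc = "card (incomparable r ?P)"
  have wd0: "0 < wd" by (simp add: wd)
  have b0: "fst s 10 \<noteq> 0" and s11: "fst s 11 = 1" using less.prems(1,2) wd0 by (simp_all add: entry_def)
  have bM: "base + wd \<le> M" using less.prems(3) by simp
  have Wb: "1 < W" "0 < W" using sizes by simp_all
  show ?case
  proof (cases "xs = []")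
    case True
    have "fst s 9 = 0" using less.prems(1) True by (simp add: entry_def)
    then have "wp (if fst s 11 = 0 then adv_code else new_code) s
      (\<lambda>l es t. es = [0] \<and> l \<le> 5 \<and> t = ((fst s)(10 := base - wd, 11 := 0), snd s))"
      using s11 less.prems(1) Wb by (simp add: new_code_def return_code_def entry_def static_def)
    from runs_wp[OF b0 this] obtain w t l where w: "runs s w t" "length w = l + 4" "emits w = [0]" "l \<le> 5"
      "t = ((fst s)(10 := base - wd, 11 := 0), snd s)" by blast
    have "good 300 (900 * wd) (turn dir r) {} {} m w"
      by (rule good_leaf[OF w(3)]) (use w(2,4) wd0 in simp_all)
    then show ?thesis unfolding solves_def using w less.prems(1) True
      by (intro exI[of _ w] exI[of _ t]) (simp add: Jof_def in_range_def keep_def entry_def static_def)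
  next
    case False
    have "fst s 9 \<noteq> 0" using less.prems(1) False by (cases xs) (simp_all add: entry_def)
    then have "wp (if fst s 11 = 0 then adv_code else new_code) s
      (\<lambda>l es t. es = [] \<and> l \<le> 200 * (1 + card ?P + ?inc) + 2 \<and> keep base s t \<and> node_state base dir m kind x xs t)"
      using s11 wp_mono[OF new_ok[OF less.prems(1) bM less.prems(4,5) False],
        of "\<lambda>l es t. es = [] \<and> l \<le> 200 * (1 + card ?P + ?inc) \<and> keep base s t \<and> node_state base dir m kind x xs t"]
      by (simp add: new_code_def del: wp_simps(5))
    from runs_wp[OF b0 this] obtain pre t0 l0 where pre: "runs s pre t0" "length pre = l0 + 4" "emits pre = []"
      "l0 \<le> 200 * (1 + card ?P + ?inc) + 2" "keep base s t0" and ns: "node_state base dir m kind x xs t0" by blast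
    from ns obtain ds Jst b where N: "node n M W r wd ?P ds base dir ?J Jst b m kind x"
      and f: "node.frame n r wd ?P ds base dir b kind x xs (node.post ds dir ?J m) 0 False t0"
      and t0: "fst t0 10 = base" "fst t0 11 = 0" unfolding node_state_def by blast
    interpret nd: node n M W r wd ?P ds base dir ?J Jst b m 300 "900 * wd" kind x by (rule N)
    have base0: "0 < base" using wd0 less.prems(2) by simp
    have IH: "solves 300 (900 * wd) (base + wd) dir' m' kind' x' ys s'"
      if e: "entry (base + wd) dir' m' kind' x' ys s'" "set ys \<subset> ?P" "sorted_wrt (<) ys" for kind' x' m' dir' ys s'
    proof -
      have c: "card (set ys) < card ?P" using e(2) by (intro psubset_card_mono) simp
      then have "(card (set ys) + 3) * wd \<le> (card ?P + 2) * wd" by (intro mult_le_mono1) simp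
      then have "base + wd + (card (set ys) + 2) * wd \<le> M" using less.prems(3) by (simp add: algebra_simps)
      moreover have "wd \<le> base + wd" "set ys \<subseteq> {..<n}" using e(2) less.prems(5) by auto
      ultimately show ?thesis using less.hyps[OF c e(1) _ _ e(3)] by blast
    qed
    have v0: "nd.tr.valid 0 False" by (simp add: nd.tr.valid_def)
    from nd.tour_run[OF IH _ base0 HOL.refl less.prems(4) f t0 v0] obtain w t1 where w: "runs t0 w t1" "nd.tr.tgood 0 False w"
      "nd.frame xs nd.post (b + 1) True t1" "keep base t0 t1" "fst t1 10 = base" "fst t1 11 = 0" "in_range w" by auto
    have "wp (if fst t1 11 = 0 then adv_code else new_code) t1 (\<lambda>l es t. es = (if nd.post = 0 then [] else [nd.post]) \<and> l \<le> 20 \<and>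
      static t \<and> keep base t1 t \<and> fst t 10 = base - wd \<and> fst t 11 = 0)"
      using nd.adv_done_ok[OF w(3,5) nd.post_less] w(6) by simp
    from runs_wp[OF _ this] w(5) base0 obtain fin t2 l2 where fin: "runs t1 fin t2" "length fin = l2 + 4" "l2 \<le> 20"
      "emits fin = (if nd.post = 0 then [] else [nd.post])" "static t2" "keep base t1 t2" "fst t2 10 = base - wd" "fst t2 11 = 0"
      by blast
    have ef: "emits fin = (if m \<or> nd.tr.c 1 \<in> ?J then [] else [Suc (nd.tr.c 1)])"
      unfolding fin(4) nd.post_def by (cases m; cases "nd.tr.c 1 \<in> ?J") (simp_all only: simp_thms if_True if_False nat.distinct)
    have "good 300 (900 * wd) (turn dir r) ?P ?J m (pre @ w @ fin)"
      by (rule nd.tr.tgood_root[OF w(2) pre(3) _ ef])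
        (use pre(2,4) fin(2,3) nd.sizes'(5) in \<open>simp_all add: incomparable_turn\<close>)
    moreover have "in_range (pre @ w @ fin)"
    proof -
      have "nd.tr.c 1 < n" using nd.c_n[of 1] nd.tr.k_pos nd.len by (metis order_refl)
      then show ?thesis using w(7) pre(3) ef by (simp add: in_range_def)
    qed
    moreover have "keep base s t2" using keep_trans[OF keep_trans[OF pre(5) w(4)] fin(6)] by simp
    ultimately show ?thesis unfolding solves_def
      using runs_trans[OF pre(1) runs_trans[OF w(1) fin(1)]] fin(5,7,8) by blast
  qed
qed

end

section \<open>Initialisation\<close>

definition count_step :: com where
  "count_step = Assign 15 (Minus (V 15) (N 1)) ;;
     Cond (Plus (At 0 (Plus (Times (V 14) (V 0)) (V 15))) (At 0 (Plus (Times (V 15) (V 0)) (V 14))))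
       Skip (Assign 3 (Plus (V 3) (N 1)))"

definition row_step :: com where
  "row_step = Assign 14 (Minus (V 14) (N 1)) ;; Assign 15 (V 0) ;; Loop (V 15) count_step ;;
     Write 2 (V 14) (V 14) ;; Write 3 (V 14) (V 9) ;; Assign 9 (Plus (V 14) (N 1))"

definition root_code :: com where
  "root_code = Assign 3 (Plus (V 0) (N 2)) ;; Assign 14 (V 0) ;; Loop (V 14) row_step ;;
     Assign 10 (V 3) ;; Assign 6 (N 1) ;; Assign 11 (N 1)"

text \<open>The initial countdown exceeds the largest lag by one, and the capacity is
  \<open>4 * lag + 8\<close>, the condition of \<open>qrep\<close>; 7204 is 4 times 1801.\<close>

definition queue_code :: com where
  "queue_code = Assign 40 (Plus (Times (N 1801) (Times (Plus (V 0) (N 1)) (V 3))) (N 1)) ;;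
     Assign 44 (Plus (Times (N 7204) (Times (Plus (V 0) (N 1)) (V 3))) (N 8))"

lemma clist_upto:
  assumes "\<And>u. u < n \<Longrightarrow> cv u = u \<and> cn u = (if Suc u < n then u + 2 else 0)" "n \<le> b" "i \<le> n"
  shows "clist cv cn b (if i < n then Suc i else 0) [i..<n]"
  using assms(3)
proof (induction rule: inc_induct)
  case (step i)
  then show ?case using assms(1)[of i] assms(2) by (simp add: upt_conv_Cons split: if_splits)
qed simp

context producer
begin

definition matrix :: "state \<Rightarrow> bool" where
  "matrix s \<longleftrightarrow> fst s 0 = n \<and> snd s 15 0 = 0 \<and> (\<forall>x<n. \<forall>u<n. snd s 0 (x * n + u) = (if (x, u) \<in> r then 1 else 0))"

lemma count_loop_ok:
  assumes "matrix s" "fst s 15 = j" "j \<le> n" "fst s 14 = u" "u < n"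
    "fst s 3 + card {v. v < j \<and> (u, v) \<notin> r \<and> (v, u) \<notin> r} < W"
  shows "wp (Loop (V 15) count_step) s (\<lambda>l es t. es = [] \<and> l \<le> 6 * j + 1 \<and>
    t = ((fst s)(15 := 0, 3 := fst s 3 + card {v. v < j \<and> (u, v) \<notin> r \<and> (v, u) \<notin> r}), snd s))"
  using assms
proof (induction j arbitrary: s)
  case 0
  then show ?case by (subst wp_Loop) (auto simp: fun_upd_idem)
next
  case (Suc j)
  obtain R A where s: "s = (R, A)" by force
  define e where "e = (if (u, j) \<notin> r \<and> (j, u) \<notin> r then 1 else 0 :: nat)"
  have "{v. v < Suc j \<and> (u, v) \<notin> r \<and> (v, u) \<notin> r} =
    (if (u, j) \<notin> r \<and> (j, u) \<notin> r then {j} else {}) \<union> {v. v < j \<and> (u, v) \<notin> r \<and> (v, u) \<notin> r}"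
    by (auto simp: less_Suc_eq)
  then have cd: "card {v. v < Suc j \<and> (u, v) \<notin> r \<and> (v, u) \<notin> r} = e + card {v. v < j \<and> (u, v) \<notin> r \<and> (v, u) \<notin> r}"
    by (auto simp: e_def)
  have j: "j < n" using Suc.prems(3) by simp
  have c: "u * n + j < n * n" "j * n + u < n * n" using cell j Suc.prems(5) by auto
  then have W: "u * n < W" "j * n < W" "u * n + j < W" "j * n + u < W" "1 < W" "2 < W" "R 3 + e < W"
    using sizes Suc.prems(6) cd unfolding s by simp_all
  have m: "A 0 (u * n + j) = (if (u, j) \<in> r then 1 else 0)" "A 0 (j * n + u) = (if (j, u) \<in> r then 1 else 0)" "R 0 = n"
    using Suc.prems(1,5) j by (auto simp: matrix_def s)
  let ?t = "(R(15 := j, 3 := R 3 + e), A)"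
  have body: "wp count_step s (\<lambda>l es t. es = [] \<and> l \<le> 4 \<and> t = ?t)"
    using Suc.prems(2,4) W m c by (auto simp: s count_step_def e_def lim_def numeral_2_eq_2 fun_upd_idem)
  have IH: "wp (Loop (V 15) count_step) ?t (\<lambda>l es t. es = [] \<and> l \<le> 6 * j + 1 \<and>
    t = ((fst ?t)(15 := 0, 3 := fst ?t 3 + card {v. v < j \<and> (u, v) \<notin> r \<and> (v, u) \<notin> r}), snd ?t))" (is "wp _ _ ?Q'")
    by (rule Suc.IH) (use Suc.prems cd in \<open>auto simp: matrix_def s\<close>)
  show ?case
  proof (rule wp_Loop_step[OF _ _ body, where Q' = ?Q'], goal_cases)
    case (3 t)
    show ?case unfolding 3 by (rule IH)
  next
    case (4 l l' es t)
    then show ?case by (auto simp: s cd fun_upd_twist)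
  qed (use Suc.prems(2) in auto)
qed

definition cells_from :: "nat \<Rightarrow> state \<Rightarrow> bool" where
  "cells_from i s \<longleftrightarrow> fst s 9 = (if i < n then Suc i else 0) \<and>
    (\<forall>u. i \<le> u \<longrightarrow> u < n \<longrightarrow> snd s 2 u = u \<and> snd s 3 u = (if Suc u < n then u + 2 else 0))"

lemma row_loop_ok:
  assumes "matrix s" "fst s 14 = i" "i \<le> n" "fst s 3 + (\<Sum>u<i. deg {..<n} u) \<le> wd" "cells_from i s"
  shows "wp (Loop (V 14) row_step) s (\<lambda>l es t. es = [] \<and> l \<le> i * (6 * n + 10) + 1 \<and>
    matrix t \<and> fst t 3 = fst s 3 + (\<Sum>u<i. deg {..<n} u) \<and> cells_from 0 t \<and>
    (\<forall>y. y \<notin> {3, 9, 14, 15} \<longrightarrow> fst t y = fst s y) \<and> (\<forall>a. a \<notin> {2, 3} \<longrightarrow> snd t a = snd s a))"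
  using assms
proof (induction i arbitrary: s)
  case 0
  then show ?case by (subst wp_Loop) auto
next
  case (Suc u)
  obtain R A where s: "s = (R, A)" by force
  have u: "u < n" "R 14 = Suc u" "R 0 = n" using Suc.prems(1-3) by (simp_all add: s matrix_def)
  have dg: "card {v. v < n \<and> (u, v) \<notin> r \<and> (v, u) \<notin> r} = deg {..<n} u" by (simp add: deg_def)
  have W: "1 < W" "n < W" "u < M" "u + 1 < W" "wd < W" using sizes u(1) by linarith+
  have R3: "R 3 + deg {..<n} u < W" using Suc.prems(4) W(5) by (simp add: s)
  let ?s = "(R(14 := u, 15 := n), A)"
  let ?t = "(R(14 := u, 15 := 0, 3 := R 3 + deg {..<n} u), A)"
  let ?t' = "(R(14 := u, 15 := 0, 3 := R 3 + deg {..<n} u, 9 := Suc u), A(2 := (A 2)(u := u), 3 := (A 3)(u := R 9)))"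
  have L: "wp (Loop (V 15) count_step) ?s (\<lambda>l es t. es = [] \<and> l \<le> 6 * n + 1 \<and> t = ?t)"
    by (rule wp_mono[OF count_loop_ok[of ?s n u]])
      (use Suc.prems(1) u R3 in \<open>auto simp: matrix_def s dg\<close>)
  have "wp (Write 2 (V 14) (V 14) ;; Write 3 (V 14) (V 9) ;; Assign 9 (Plus (V 14) (N 1))) ?t
    (\<lambda>l es t. es = [] \<and> l \<le> 3 \<and> t = ?t')" using W by (simp add: lim_def)
  from wp_Seq_state[OF L this]
  have body: "wp row_step s (\<lambda>l es t. es = [] \<and> l \<le> 6 * n + 8 \<and> t = ?t')"
    unfolding row_step_def using u W by (simp add: s del: wp_simps(5) add: wp_Assign_Seq) (elim wp_mono; simp)
  have R9: "R 9 = (if Suc u < n then u + 2 else 0)" using Suc.prems(5) by (simp add: cells_from_def s)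
  have cf: "cells_from u ?t'"

  proof -
    have old: "\<And>v. Suc u \<le> v \<Longrightarrow> v < n \<Longrightarrow> A 2 v = v \<and> A 3 v = (if Suc v < n then v + 2 else 0)"
      using Suc.prems(5) unfolding cells_from_def s snd_conv by blast
    have "((A 2)(u := u)) v = v \<and> ((A 3)(u := R 9)) v = (if Suc v < n then v + 2 else 0)" if "u \<le> v" "v < n" for v
      using old[of v] that R9 by (cases "v = u") simp_all
    then show ?thesis using u(1) by (simp add: cells_from_def)
  qed
  have IH: "wp (Loop (V 14) row_step) ?t' (\<lambda>l es t. es = [] \<and> l \<le> u * (6 * n + 10) + 1 \<and>
    matrix t \<and> fst t 3 = fst ?t' 3 + (\<Sum>u<u. deg {..<n} u) \<and> cells_from 0 t \<and>
    (\<forall>y. y \<notin> {3, 9, 14, 15} \<longrightarrow> fst t y = fst ?t' y) \<and> (\<forall>a. a \<notin> {2, 3} \<longrightarrow> snd t a = snd ?t' a))" (is "wp _ _ ?Q'")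
    by (rule Suc.IH) (use Suc.prems cf in \<open>auto simp: matrix_def s\<close>)
  show ?case
  proof (rule wp_Loop_step[OF _ _ body, where Q' = ?Q'], goal_cases)
    case (3 t)
    show ?case unfolding 3 by (rule IH)
  next
    case (4 l l' es t)
    then show ?case by (elim conjE) (intro conjI; simp add: s)
  qed (use u s in auto)
qed

text \<open>Width counting starts at \<open>n + 2\<close> and adds one for every ordered
  incomparable pair. The root call has \<open>m\<close> set so that no toggle is pending at the end;
  its last ideal, cut out by element 0, is the set of elements below 0. Its base is
  \<open>wd\<close>, since base 0 ends the main loop.\<close>

lemma root_ok:
  assumes s: "s = ram_program.start_state n r"
  shows "wp root_code s (\<lambda>l es t. es = [] \<and> l \<le> n * (6 * n + 10) + 10 \<and>
    entry wd False True False 0 [0..<n] t \<and> fst t 0 = n \<and> fst t 3 = wd \<and>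
    (\<forall>y. 40 \<le> y \<longrightarrow> fst t y = 0) \<and> snd t 1 = (\<lambda>_. 0))"
proof -
  have sum: "n + 2 + (\<Sum>u<n. deg {..<n} u) = wd" using sum_deg[of "{..<n}"] by (simp add: wd)
  have "ram_program n M W" by unfold_locales
  note ss = ram_program.start_state_def[OF this]
  have mat: "matrix s"
  proof -
    have "(x * n + u) div n = x" "(x * n + u) mod n = u" "x * n + u < n * n" if "x < n" "u < n" for x u
      using that cell by simp_all
    then show ?thesis by (simp add: matrix_def s ss)
  qed
  let ?s = "((fst s)(3 := n + 2, 14 := n), snd s)"
  have L: "wp (Loop (V 14) row_step) ?s (\<lambda>l es t. es = [] \<and> l \<le> n * (6 * n + 10) + 1 \<and>
    matrix t \<and> fst t 3 = wd \<and> cells_from 0 t \<and>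
    (\<forall>y. y \<notin> {3, 9, 14, 15} \<longrightarrow> fst t y = fst ?s y) \<and> (\<forall>a. a \<notin> {2, 3} \<longrightarrow> snd t a = snd ?s a))"
    by (rule wp_mono[OF row_loop_ok[of ?s n]]) (use mat sum in \<open>auto simp: matrix_def cells_from_def s ss\<close>)
  have W: "n + 2 < W" "1 < W" "2 < W" "n \<le> wd" using sizes by simp_all
  have E: "wp (Assign 10 (V 3) ;; Assign 6 (N 1) ;; Assign 11 (N 1)) t
    (\<lambda>l es t. es = [] \<and> l \<le> 3 \<and> entry wd False True False 0 [0..<n] t \<and> fst t 0 = n \<and> fst t 3 = wd \<and>
      (\<forall>y. 40 \<le> y \<longrightarrow> fst t y = 0) \<and> snd t 1 = (\<lambda>_. 0))"
    if t: "matrix t" "fst t 3 = wd" "cells_from 0 t" "\<And>y. y \<notin> {3, 9, 14, 15} \<Longrightarrow> fst t y = fst ?s y"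
      "\<And>a. a \<notin> {2, 3} \<Longrightarrow> snd t a = snd ?s a" for t
  proof -
    have "clist (snd t 2) (snd t 3) wd (fst t 9) [0..<n]"
      using clist_upto[of n "snd t 2" "snd t 3" wd 0] t(3) W by (simp add: cells_from_def)
    moreover have "fst t 5 = 0" "fst t 7 = 0" "fst t 8 = 0" "snd t 1 = (\<lambda>_. 0)" "\<And>y. 40 \<le> y \<Longrightarrow> fst t y = 0"
      using t(4)[of 5] t(4)[of 7] t(4)[of 8] t(5)[of 1] t(4) by (auto simp: s ss)
    ultimately show ?thesis using t(1,2) W by (simp add: entry_def static_def matrix_def bit_def) blast
  qed
  have "wp (Loop (V 14) row_step ;; Assign 10 (V 3) ;; Assign 6 (N 1) ;; Assign 11 (N 1)) ?s
    (\<lambda>l es t. es = [] \<and> l \<le> n * (6 * n + 10) + 4 \<and> entry wd False True False 0 [0..<n] t \<and> fst t 0 = n \<and> fst t 3 = wd \<and>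
      (\<forall>y. 40 \<le> y \<longrightarrow> fst t y = 0) \<and> snd t 1 = (\<lambda>_. 0))"
    by (rule wp_Seq_silent[OF L E]) auto
  from wp_mono[OF this, where Q' = "\<lambda>l es t. es = [] \<and> Suc (Suc l) \<le> n * (6 * n + 10) + 10 \<and>
      entry wd False True False 0 [0..<n] t \<and> fst t 0 = n \<and> fst t 3 = wd \<and>
      (\<forall>y. 40 \<le> y \<longrightarrow> fst t y = 0) \<and> snd t 1 = (\<lambda>_. 0)"]
  show ?thesis unfolding root_code_def wp_Assign_Seq using W by (simp add: s ss)
qed

end

section \<open>The algorithm\<close>

text \<open>The interval between outputs is the amortised cost per visit,
  \<open>18000300 = 60001 * 300\<close>.\<close>

definition enumerator :: com where
  "enumerator = root_code ;; queue_code ;; deam 18000300 main_code ;; drain"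

lemma silent_enumerator: "silent enumerator"
  by (simp add: enumerator_def silent_deam root_code_def row_step_def count_step_def queue_code_def drain_def pop_def fetch_def flip_def)

lemma (in ram) pure_outs: "big c s w t \<Longrightarrow> pure c \<Longrightarrow> outs w = []"
  by (induction rule: big.induct) auto

locale solver = producer +
  assumes capacity: "7204 * ((n + 1) * wd) + 8 \<le> M" and C_less: "18000300 < W"
begin

lemma enumerator_trace:
  "\<exists>w t es. big enumerator (ram_program.start_state n r) w t \<and> visits r {..<n} (walk {} es) \<and> gray 0 es 0 \<and>
    list_all2 (\<lambda>f T. T \<subseteq> {..<n} \<and> (\<forall>u<n. f u = (if u \<in> T then 1 else 0))) (outs w) (walk {} es) \<and>
    due (100 * 18000302) (n * (6 * n + 10) + 12 + 100 * (1801 * ((n + 1) * wd) + 2)) w 0"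
proof -
  define lg where "lg = 1801 * ((n + 1) * wd)"
  interpret d: deamortizer n M W 18000300 lg
    by unfold_locales (use C_less in simp_all)
  let ?s0 = "ram_program.start_state n r"
  have "wp root_code ?s0 (\<lambda>l es t. es = [] \<and> l \<le> n * (6 * n + 10) + 10 \<and>
    entry wd False True False 0 [0..<n] t \<and> fst t 0 = n \<and> fst t 3 = wd \<and>
    (\<forall>y. 40 \<le> y \<longrightarrow> fst t y = 0) \<and> snd t 1 = (\<lambda>_. 0))" by (rule root_ok[OF HOL.refl])
  then obtain w0 t0 where t0: "big root_code ?s0 w0 t0" "length w0 \<le> n * (6 * n + 10) + 10"
    "entry wd False True False 0 [0..<n] t0" "fst t0 0 = n" "fst t0 3 = wd" "\<And>y. 40 \<le> y \<Longrightarrow> fst t0 y = 0" "snd t0 1 = (\<lambda>_. 0)"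
    unfolding wp_def wpw_def by blast
  have "pure root_code" by (simp add: root_code_def row_step_def count_step_def)
  then have o0: "outs w0 = []" using pure_outs t0(1) by blast
  have cap: "4 * lg + 8 \<le> M" using capacity by (simp add: lg_def)
  define t1 where "t1 = ((fst t0)(40 := lg + 1, 44 := 4 * lg + 8), snd t0)"
  have W: "4 * lg + 8 < W" "7204 < W" "(n + 1) * wd < W" "n + 1 < W" "1801 * ((n + 1) * wd) + 1 < W" "7204 * ((n + 1) * wd) + 8 < W"
    using cap capacity sizes C_less by (simp_all add: lg_def)
  have "wpw queue_code t0 (\<lambda>w t. w = [Tick, Tick] \<and> t = t1)"
    using W t0(4,5) by (simp add: queue_code_def t1_def lg_def)
  then have t1: "big queue_code t0 [Tick, Tick] t1" unfolding wpw_def by blast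
  have e1: "entry wd False True False 0 [0..<n] t1" using t0(3) by (simp add: entry_def t1_def static_def)
  have "solves 300 (900 * wd) wd False True False 0 [0..<n] t1"
  proof (rule node_run[OF e1 order_refl])
    show "wd + (card (set [0..<n]) + 2) * wd \<le> M" using M by (simp add: algebra_simps)
  qed auto
  then obtain w t2 where w: "runs t1 w t2" "good 300 (900 * wd) r {..<n} (Jof r False False 0 {..<n}) True w" "in_range w"
    "fst t2 10 = 0" unfolding solves_def by (auto simp: atLeast0LessThan)
  let ?w = "w @ [Tick]"
  have main: "big main_code t1 ?w t2" by (rule runs_loop[OF w(1,4)])
  have vw: "visits r {..<n} (walk {} (emits w))" and gw: "gray 0 (emits w) 0"
    and lw: "lag 18000300 0 ((n + 1) * (900 * wd)) (2 * (n + 1) * (900 * wd)) w"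
    using w(2) by (auto simp: good_def)
  have lw': "lag 18000300 (0 + 1) ((n + 1) * (900 * wd)) (2 * (n + 1) * (900 * wd)) ?w"
    by (rule lag_append[OF lw lag_short]) simp_all
  have wd1: "1 \<le> (n + 1) * wd" by (simp add: wd)
  \<comment> \<open>The factor bound of \<open>good\<close> amounts to
    \<open>1800 * ((n + 1) * wd)\<close>. The tick that leaves the main loop is absorbed by raising
    1800 to 1801.\<close>
  have fac: "length u \<le> 18000300 * vis u + lg" if "?w = x @ u @ v" for x u v
  proof -
    have "length u \<le> 18000300 * vis u + (0 + 1) + 2 * (n + 1) * (900 * wd)" using lw' that unfolding lag_def by blast
    then show ?thesis using wd1 by (simp add: lg_def algebra_simps)
  qed
  have core: "d.core [] {} (?w @ []) t1"
    unfolding d.core_def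
  proof (intro conjI)
    show "d.qrep [] t1" using t0(6) cap by (simp add: d.qrep_def t1_def)
    show "d.out_rep {} t1" using t0(7) by (simp add: d.out_rep_def t1_def)
    show "\<forall>u. Suc u \<in> set ([] @ emits (?w @ [])) \<longrightarrow> u < n" using w(3) by (simp add: in_range_def)
    show "gray 0 ([] @ emits (?w @ [])) 0" using gw by simp
    show "1 \<le> fst t1 40" "fst t1 40 \<le> 18000300 + lg + 1" by (simp_all add: t1_def)
    show "\<forall>u v. ?w @ [] = u @ v \<longrightarrow> length u < 18000300 * (zeros [] + vis u) + fst t1 40"
      using fac[of "[]"] by (auto simp: t1_def less_Suc_eq_le)
  qed
  have "d.fac (?w @ [])" unfolding d.fac_def using fac by simp
  with d.deam_ok[OF main pure_main] core obtain v q' S' t3 where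
    v: "big (deam 18000300 main_code) t1 v t3" "d.core q' S' [] t3"
    "d.link [] {} (emits ?w @ emits []) v q' S' (emits [])" "due d.budget (d.E * (fst t1 40 + 1)) v (d.E * (fst t3 40 + 1))"
    unfolding d.sim_def by (metis agree_refl)
  have q': "d.qrep q' t3" "d.out_rep S' t3" "\<forall>u. Suc u \<in> set q' \<longrightarrow> u < n" "gray 0 q' 0" "1 \<le> fst t3 40"
    using v(2) by (simp_all add: d.core_def)
  obtain z t4 where z: "big drain t3 z t4" "list_all2 d.depicts (outs z) (walk S' q')" "due d.budget 100 z 0"
    using d.drain_ok[OF q'(1-4)] by blast
  obtain Ts where Ts: "list_all2 d.depicts (outs v) Ts" "walk {} (emits w) = Ts @ walk S' q'"
    using v(3) by (auto simp: d.link_def)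
  have "big enumerator ?s0 (w0 @ [Tick, Tick] @ v @ z) t4"
    unfolding enumerator_def by (rule big.Seq[OF t0(1) big.Seq[OF t1 big.Seq[OF v(1) z(1)]]])
  moreover have "list_all2 d.depicts (outs (w0 @ [Tick, Tick] @ v @ z)) (walk {} (emits w))"
    unfolding Ts(2) using o0 list_all2_appendI[OF Ts(1) z(2)] by simp
  moreover have "due d.budget (n * (6 * n + 10) + 12 + 100 * (lg + 2)) (w0 @ [Tick, Tick] @ v @ z) 0"
  proof (rule due_append[OF due_silent[OF o0]])
    show "length w0 + (100 * (lg + 2) + 2) \<le> n * (6 * n + 10) + 12 + 100 * (lg + 2)" using t0(2) by simp
    have "due d.budget (100 * (lg + 2)) (v @ z) 0"
    proof (rule due_append)
      show "due d.budget (100 * (lg + 2)) v (d.E * (fst t3 40 + 1))" using v(4) by (simp add: t1_def)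
      show "due d.budget (d.E * (fst t3 40 + 1)) z 0" by (rule due_mono[OF z(3)]) (use q'(5) in simp_all)
    qed
    then show "due d.budget (100 * (lg + 2) + 2) ([Tick, Tick] @ v @ z) 0" by simp
  qed
  ultimately show ?thesis using vw gw unfolding lg_def d.depicts_def by (intro exI[of _ "w0 @ [Tick, Tick] @ v @ z"] exI[of _ t4] exI[of _ "emits w"]) simp
qed

end

section \<open>From the trace to the stated bounds\<close>

lemma card_incomparable: "card (incomparable r {..<n}) \<le> 2 * card (incomparable_pairs n r)"
proof (rule card_le_fibers[where f = "\<lambda>(u, v). {u, v}"])
  show "finite (incomparable r {..<n})"
    by (rule finite_subset[of _ "{..<n} \<times> {..<n}"]) (auto simp: incomparable_def)
  show "finite (incomparable_pairs n r)"
    by (rule finite_subset[of _ "Pow {..<n}"]) (auto simp: incomparable_pairs_def)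
  show "(\<lambda>(u, v). {u, v}) x \<in> incomparable_pairs n r" if "x \<in> incomparable r {..<n}" for x
  proof (cases x)
    case (Pair u v)
    then have "u < n" "v < n" "(u, v) \<notin> r" "(v, u) \<notin> r" using that by (simp_all add: incomparable_def)
    then show ?thesis unfolding Pair prod.case incomparable_pairs_def by blast
  qed
next
  fix A assume "A \<in> incomparable_pairs n r"
  then obtain u v where "A = {u, v}" by (auto simp: incomparable_pairs_def)
  have "{x \<in> incomparable r {..<n}. (\<lambda>(u, v). {u, v}) x = A} \<subseteq> {(u, v), (v, u)}"
  proof
    fix x assume "x \<in> {x \<in> incomparable r {..<n}. (\<lambda>(u, v). {u, v}) x = A}"
    then have "{fst x, snd x} = {u, v}" using \<open>A = {u, v}\<close> by (cases x) simp
    then show "x \<in> {(u, v), (v, u)}" by (cases x) (auto simp: doubleton_eq_iff)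
  qed
  then have "card {x \<in> incomparable r {..<n}. (\<lambda>(u, v). {u, v}) x = A} \<le> card {(u, v), (v, u)}" by (intro card_mono) simp_all
  also have "\<dots> \<le> 2" using card_insert_le_m1[of 2 "{(v, u)}" "(u, v)"] by simp
  finally show "card {x \<in> incomparable r {..<n}. (\<lambda>(u, v). {u, v}) x = A} \<le> 2" .
qed

lemma order_ideals_eq_ideals: "labelled_poset n r \<Longrightarrow> order_ideals r {..<n} = ideals n r"
  unfolding order_ideals_def ideals_def labelled_poset_def by fastforce

theorem theorem3p15:
  shows "\<exists>(prog :: instr list) (c :: nat) (d :: nat).
    \<forall>(n :: nat) (r :: (nat \<times> nat) set). labelled_poset n r \<longrightarrow>
      (let q = card (incomparable_pairs n r);
           bound = c * (n * (n + q) + 1)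
       in \<exists>(Is :: nat set list) (ts :: nat list) (t0 :: nat).
            distinct Is \<and> set Is = ideals n r \<and>
            enumerate_visits r {..<n} {} Is \<and>
            (\<forall>j. Suc j < length Is \<longrightarrow>
               card ((Is ! j - Is ! Suc j) \<union> (Is ! Suc j - Is ! j)) \<le> 3) \<and>
            sorted_wrt (<) ts \<and> set ts = output_times prog n r \<and>
            length ts = length Is \<and>
            (\<forall>j < length Is. outputs_set prog n (config_at prog n r (ts ! j)) (Is ! j)) \<and>
            halts prog n r \<and>
            t0 \<le> bound \<and>
            t0 \<le> ts ! 0 \<and> ts ! 0 \<le> t0 + c \<and>
            (\<forall>j. Suc j < length ts \<longrightarrow> ts ! Suc j \<le> ts ! j + c) \<and>
            space_within prog n r bound \<and>
            words_within prog n r d)"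
proof -
  define L where "L = clen enumerator"
  \<comment> \<open>The \<open>budget\<close> of the deamortised program,
    \<open>E * (C + 2)\<close>.\<close>
  define D :: nat where "D = 100 * 18000302"
  \<comment> \<open>The first summand dominates space and initialisation, the rest is the delay:
    \<open>D\<close> ticks of at most \<open>L\<close> steps and the output itself.\<close>
  define c where "c = 10000000 * (L + 1) + L * D + 1"
  define prog where "prog = program enumerator"
  have "\<exists>Is ts t0. distinct Is \<and> set Is = ideals n r \<and> enumerate_visits r {..<n} {} Is \<and>
      (\<forall>j. Suc j < length Is \<longrightarrow> card ((Is ! j - Is ! Suc j) \<union> (Is ! Suc j - Is ! j)) \<le> 3) \<and>
      sorted_wrt (<) ts \<and> set ts = output_times prog n r \<and> length ts = length Is \<and>
      (\<forall>j < length Is. outputs_set prog n (config_at prog n r (ts ! j)) (Is ! j)) \<and> halts prog n r \<and>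
      t0 \<le> c * (n * (n + q) + 1) \<and> t0 \<le> ts ! 0 \<and> ts ! 0 \<le> t0 + c \<and>
      (\<forall>j. Suc j < length ts \<longrightarrow> ts ! Suc j \<le> ts ! j + c) \<and>
      space_within prog n r (c * (n * (n + q) + 1)) \<and> words_within prog n r 30"
    if poset: "labelled_poset n r" and q: "q = card (incomparable_pairs n r)" for n r q
  proof -
    define wd where "wd = n + card (incomparable r {..<n}) + 2"
    define X where "X = (n + 3) * wd"
    \<comment> \<open>8000 leaves room for the capacity \<open>7204 * ((n + 1) * wd) + 8\<close> of
      the queue as well as for the frames.\<close>
    define M where "M = 8000 * X"
    define W where "W = (n + 2) ^ 30"
    define T where "T = n * (n + q) + 1"
    define S where "S = n * n"
    define R where "R = n * q"
    have Te: "T = S + R + 1" by (simp add: T_def S_def R_def algebra_simps)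
    have nn: "n \<le> S" by (cases n) (simp_all add: S_def)
    have nq: "q \<le> R"
    proof (cases n)
      case 0
      then have "incomparable_pairs n r = {}" by (auto simp: incomparable_pairs_def)
      then show ?thesis by (simp add: q)
    qed (simp add: R_def)
    have "wd \<le> n + 2 * q + 2" using card_incomparable[of r n] by (simp add: wd_def q)
    then have "X \<le> (n + 3) * (n + 2 * q + 2)" unfolding X_def by (rule mult_le_mono2)
    also have "\<dots> = S + 2 * R + 5 * n + 6 * q + 6" by (simp add: S_def R_def algebra_simps)
    also have "\<dots> \<le> 8 * T" unfolding Te using nn nq by simp
    finally have X: "X \<le> 8 * T" .
    have n1: "(n + 1) * wd \<le> X" unfolding X_def by (rule mult_le_mono1) simp
    have "3 * 2 \<le> X" unfolding X_def by (rule mult_le_mono) (simp_all add: wd_def)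
    note n1 = n1 this
    have card_le: "card (incomparable r {..<n}) \<le> n * n"
      using card_mono[of "{..<n} \<times> {..<n}" "incomparable r {..<n}"] by (auto simp: incomparable_def)
    \<comment> \<open>\<open>X\<close> is at most the fourth power of \<open>n + 2\<close>. The
      numerical factors stay below \<open>2 ^ 26\<close>, hence below the 26th power of
      \<open>n + 2\<close>, which explains the exponent 30.\<close>
    have small: "n * n + n + 30 * M + 100 < W" "18000300 < W"
    proof -
      let ?m = "n + 2"
      have pw: "2 ^ k \<le> ?m ^ k" for k by (rule power_mono) simp_all
      have "wd \<le> ?m ^ 2" using card_le by (simp add: wd_def power2_eq_square algebra_simps)
      moreover have "n + 3 \<le> ?m ^ 2" by (simp add: power2_eq_square algebra_simps)
      ultimately have "X \<le> ?m ^ 2 * ?m ^ 2" unfolding X_def by (intro mult_le_mono)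
      then have X4: "X \<le> ?m ^ 4" by (simp flip: power_add)
      have "n * n + n \<le> ?m ^ 2" by (simp add: power2_eq_square algebra_simps)
      also have "\<dots> \<le> ?m ^ 4" by (rule power_increasing) simp_all
      finally have "n * n + n + 30 * M + 100 < 2 ^ 26 * ?m ^ 4" using X4 pw[of 4] by (simp add: M_def)
      also have "\<dots> \<le> ?m ^ 26 * ?m ^ 4" by (intro mult_le_mono1 pw)
      also have "\<dots> = W" by (simp add: W_def flip: power_add)
      finally show "n * n + n + 30 * M + 100 < W" .
      show "18000300 < W" using pw[of 30] by (simp add: W_def)
    qed
    interpret solver n M W r wd
    proof unfold_locales
      show "n * n + n + 30 * M + 100 < W" "18000300 < W" by (fact small)+
      show "labelled_poset n r" by (rule poset)
      show "wd = n + card (incomparable r {..<n}) + 2" by (rule wd_def)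
      show "(n + 3) * wd \<le> M" by (simp add: M_def X_def)
      show "7204 * ((n + 1) * wd) + 8 \<le> M" using n1 unfolding M_def by linarith
    qed
    interpret rp: ram_program n M W prog L by unfold_locales
    define b where "b = n * (6 * n + 10) + 12 + 100 * (1801 * ((n + 1) * wd) + 2)"
    obtain w t es where tr: "big enumerator (rp.start_state r) w t" "visits r {..<n} (walk {} es)" "gray 0 es 0"
      "list_all2 (\<lambda>f T. T \<subseteq> {..<n} \<and> (\<forall>u<n. f u = (if u \<in> T then 1 else 0))) (outs w) (walk {} es)"
      "due D b w 0" using enumerator_trace unfolding D_def b_def by blast
    define Is where "Is = walk {} es"
    obtain ts where ts: "sorted_wrt (<) ts" "set ts = output_times prog n r" "length ts = length (outs w)"
      "\<forall>j<length ts. rp.shows_at (config_at prog n r (ts ! j)) (outs w ! j)" "halts prog n r"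
      "ts \<noteq> [] \<longrightarrow> hd ts \<le> 2 + L * b" "\<forall>j. Suc j < length ts \<longrightarrow> ts ! Suc j \<le> ts ! j + (L * D + 1)"
      "\<And>t. rp.safe_at r t"
      using rp.program_run[OF tr(1) silent_enumerator tr(5) prog_def] L_def by blast
    have Is: "distinct Is" "set Is = ideals n r"
      using visits_ideals[OF tr(2) po] order_ideals_eq_ideals[OF poset] by (simp_all add: Is_def)
    have tr': "trans r" using partial_order_onD(2)[OF po] .
    have "u \<in> {..<n} \<union> {}" if "(u, v) \<in> r" "v \<in> {..<n}" for u v using label[OF that(1)] that(2) by simp
    from visits_enumerate[OF tr(2) tr' this] have ev: "enumerate_visits r {..<n} {} Is"
      by (simp add: Is_def map_idI)
    have gray: "card ((Is ! j - Is ! Suc j) \<union> (Is ! Suc j - Is ! j)) \<le> 3" if "Suc j < length Is" for j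
    proof -
      have "xor A B = (A - B) \<union> (B - A)" for A B by (auto simp: xor_def)
      then show ?thesis using gray_differ[OF tr(3), of "{}" "{}" "Suc j"] that by (simp add: Is_def)
    qed
    have len: "length ts = length Is" using list_all2_lengthD[OF tr(4)] ts(3) by (simp add: Is_def)
    have out: "outputs_set prog n (config_at prog n r (ts ! j)) (Is ! j)" if "j < length Is" for j
      using ts(4)[rule_format, of j] list_all2_nthD[OF tr(4), of j] that len ts(3)
      by (auto simp: outputs_set_def rp.shows_at_def Is_def)
    have "{} \<in> ideals n r" by (simp add: ideals_def)
    then have ne: "ts \<noteq> []" using Is(2) len by auto
    have b: "b \<le> 2000000 * T"
    proof -
      obtain y where y: "y = (n + 1) * wd" by simp
      have "b = 6 * S + 10 * n + 12 + 100 * (1801 * y + 2)" unfolding b_def y by (simp add: S_def algebra_simps)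
      moreover have "S \<le> T" "1 \<le> T" by (simp_all add: Te)
      ultimately show ?thesis using X n1(1)[folded y] nn by simp
    qed
    have t0: "ts ! 0 \<le> c * T"
    proof -
      have "ts ! 0 \<le> 2 + L * b" using ts(6) ne by (simp add: hd_conv_nth)
      also have "\<dots> \<le> 2 * T + L * (2000000 * T)"
        by (rule add_mono[OF _ mult_le_mono2[OF b]]) (simp add: Te)
      also have "\<dots> = (2 + L * 2000000) * T" by (simp add: algebra_simps)
      also have "\<dots> \<le> c * T" by (intro mult_le_mono1) (simp add: c_def)
      finally show ?thesis .
    qed
    have sp: "rp.space \<le> c * T"
    proof -
      have "S + n \<le> 2 * T" "1 \<le> T" using nn unfolding Te by simp_all
      moreover have "rp.space = S + n + 30 * M + 30" unfolding rp.space_def S_def by simp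
      moreover have "M \<le> 64000 * T" using X by (simp add: M_def)
      ultimately have "rp.space \<le> 10000000 * T" by simp
      also have "\<dots> \<le> c * T" by (intro mult_le_mono1) (simp add: c_def)
      finally show ?thesis .
    qed
    have "space_within prog n r (c * T)"
      unfolding space_within_def Let_def
    proof (intro conjI allI)
      show "{..<n * n} \<subseteq> {..<c * T}" using sp unfolding rp.space_def by auto
      show "accessed n (current prog (config_at prog n r t)) (config_at prog n r t) \<subseteq> {..<c * T}" for t
        using ts(8)[of t] sp by fastforce
    qed
    moreover have "words_within prog n r 30"
      using ts(8) unfolding rp.bounded_def unfolding words_within_def W_def by blast
    moreover have "\<forall>j. Suc j < length ts \<longrightarrow> ts ! Suc j \<le> ts ! j + c"
      using ts(7) by (fastforce simp: c_def)
    \<comment> \<open>Initialisation is taken to last until the first output, so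
      \<open>ts ! 0\<close> is the witness for \<open>t0\<close>; it is bounded by the initial
      budget \<open>b\<close>.\<close>
    ultimately show ?thesis
      using Is ev gray ts(1,2,5) len out t0 unfolding T_def
      by (intro exI[of _ Is] exI[of _ ts] exI[of _ "ts ! 0"]) simp
  qed
  then show ?thesis unfolding Let_def by blast
qed

end
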